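(* Let $\varphi\in C^2_b(H)$, i.e. $\varphi:H\to\mathbb{R}$ is a twice (continuously) differentiable functional whose first and second derivatives are bounded on $H$. Let $\alpha>0$ and $0\le\beta\le\alpha$ be such that $$\mathrm{Tr}(A^{-\alpha})=\sum_{n\ge1}\lambda_n^{-\alpha}<+\infty,\qquad A^{\beta}Q\in\mathcal{L}(H),\qquad 1-\alpha+\beta>0 .$$ Let $T\ge 1$, $x\in H$, and let $\{X_t\}_{t\in[0,T]}$ be the $H$-valued process $$X_t=e^{-tA}x+\int_0^t e^{-(t-s)A}Q^{1/2}\,dW_s,$$ the weak solution of $dX_t+AX_t\,dt=Q^{1/2}dW_t$, $X_0=x$. Let $1/2<\theta\le 1$. For $h>0$ and any integer $N\ge 1$, with $\Delta t=T/N$, let $\{X_h^n\}_{0\le n\le N}$ be the $V_h$-valued sequence defined by $X_h^0=P_hx$ and $$X_h^{n+1}-X_h^n+\Delta t\,A_h\big(\theta X_h^{n+1}+(1-\theta)X_h^n\big)=P_hQ^{1/2}\big(W_{(n+1)\Delta t}-W_{n\Delta t}\big),\qquad 0\le n\le N-1.$$ Then there exists a constant $C=C(T,\varphi)>0$, which does not depend on $h$ and $N$, such that for any $\gamma<1-\alpha+\beta\le 1$ the following inequality holds: $$\left|\mathbb{E}\,\varphi(X_h^N)-\mathbb{E}\,\varphi(X_T)\right|\le C\left(h^{2\gamma}+\Delta t^{\gamma}\right),$$ where $\Delta t=T/N\le1$.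
   Context: Setting. $H$ is a Hilbert space with inner product $(\cdot,\cdot)$ and norm $|\cdot|$; $\mathcal{L}(H)$ is the space of bounded linear operators on $H$. $A$ is a non-negative self-adjoint unbounded operator on $H$ with domain $D(A)$ dense and compactly embedded in $H$; there is an orthonormal basis $\{e_n\}_{n\ge1}$ of $H$ with $Ae_n=\lambda_ne_n$, where $0<\lambda_1\le\lambda_2\le\cdots$ and $\lambda_n\to+\infty$. Powers $A^s$ are defined spectrally, and $e^{-tA}$ is the semigroup generated by $-A$. $Q$ is a non-negative symmetric bounded linear operator on $H$ (not assumed nuclear, nor to commute with $A$). The condition $A^\beta Q\in\mathcal{L}(H)$ implies that $Q$ is bounded from $H$ into $D(A^\beta)$. $\{W_t\}_{t\in[0,T]}$ is a cylindrical Wiener process on $H$ adapted to a normal filtration on a probability space $(\Omega,\mathcal{F},\mathbb{P})$: formally $W_t=\sum_{i\ge1}\beta_i(t)e_i$ with independent real standard Brownian motions $\beta_i$. For $\Phi$ with values in the Hilbert–Schmidt operators, $\int\Phi(s)\,dW_s=\sum_i\int\Phi(s)e_i\,d\beta_i(s)$. The quantity $P_hQ^{1/2}(W_t-W_s)=\sum_i(\beta_i(t)-\beta_i(s))P_hQ^{1/2}e_i$ is well defined because $P_hQ^{1/2}$ has finite rank. Spatial discretization. $V=D(A^{1/2})$ with inner product $((u,v))=(A^{1/2}u,A^{1/2}v)$. $\{V_h\}_{h>0}$ is a family of finite-dimensional subspaces of $V$. $P_h:H\to V_h$ is the orthogonal projector for $(\cdot,\cdot)$, and $\Pi_h:V\to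 V_h$ is the orthogonal projector for $((\cdot,\cdot))$. $A_h:V_h\to V_h$ is the linear operator defined by $(A_hu_h,v_h)=((u_h,v_h))$ for all $u_h,v_h\in V_h$. It is assumed that there are $r\ge2$ and a constant $\kappa_0>0$ (independent of $h$) such that for all $h>0$: $$|\Pi_hv-v|\le\kappa_0h^s|A^{s/2}v|\quad\text{for } 1\le s\le r,\ v\in D(A^{s/2}),$$ $$|A^{1/2}(\Pi_hw-w)|\le\kappa_0h^{s'-1}|A^{s'/2}w|\quad\text{for } 1\le s'\le r-1,\ w\in D(A^{s'/2}).$$ *)

theory Defs
  imports "HOL-Probability.Probability"
begin

text \<open>
  The Hilbert space is a real type of class \<open>real_inner\<close> and \<open>banach\<close>. The class
  \<open>second_countable_topology\<close> costs no generality, since the space has a countable orthonormal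
  basis. Sequences indexed by \<open>n \<ge> 1\<close> in the mathematics are indexed here by all of \<open>nat\<close>.
\<close>

section \<open>Unbounded operators\<close>

definition orthonormal_basis :: "(nat \<Rightarrow> 'h::real_inner) \<Rightarrow> bool" where
  "orthonormal_basis e \<longleftrightarrow>
     (\<forall>m n. e m \<bullet> e n = (if m = n then 1 else 0)) \<and> closure (span (range e)) = UNIV"

text \<open>
  An unbounded operator is a domain \<open>D\<close> together with a total function \<open>A\<close> whose values outside
  \<open>D\<close> are irrelevant.
\<close>

definition linear_on_dom :: "'h::real_vector set \<Rightarrow> ('h \<Rightarrow> 'h) \<Rightarrow> bool" where
  "linear_on_dom D A \<longleftrightarrow> subspace D \<and>
     (\<forall>u\<in>D. \<forall>v\<in>D. A (u + v) = A u + A v) \<and> (\<forall>c. \<forall>u\<in>D. A (c *\<^sub>R u) = c *\<^sub>R A u)"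

definition adjoint_graph :: "'h::real_inner set \<Rightarrow> ('h \<Rightarrow> 'h) \<Rightarrow> ('h \<times> 'h) set" where
  "adjoint_graph D A = {(y, z). \<forall>u\<in>D. A u \<bullet> y = u \<bullet> z}"

definition self_adjoint_op :: "'h::real_inner set \<Rightarrow> ('h \<Rightarrow> 'h) \<Rightarrow> bool" where
  "self_adjoint_op D A \<longleftrightarrow> linear_on_dom D A \<and> closure D = UNIV \<and>
     adjoint_graph D A = {(y, A y) | y. y \<in> D}"

definition nonneg_op :: "'h::real_inner set \<Rightarrow> ('h \<Rightarrow> 'h) \<Rightarrow> bool" where
  "nonneg_op D A \<longleftrightarrow> (\<forall>v\<in>D. 0 \<le> A v \<bullet> v)"

text \<open>The unit ball of the graph norm is relatively compact.\<close>

definition compactly_embedded :: "'h::real_inner set \<Rightarrow> ('h \<Rightarrow> 'h) \<Rightarrow> bool" where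
  "compactly_embedded D A \<longleftrightarrow>
     compact (closure {v \<in> D. (norm v)\<^sup>2 + (norm (A v))\<^sup>2 \<le> 1})"

text \<open>Spectral powers, for the eigenpairs \<open>(lam n, e n)\<close> and any real exponent \<open>s\<close>.\<close>

definition pow_dom :: "(nat \<Rightarrow> 'h::real_inner) \<Rightarrow> (nat \<Rightarrow> real) \<Rightarrow> real \<Rightarrow> 'h set" where
  "pow_dom e lam s = {v. summable (\<lambda>n. (lam n powr s * (v \<bullet> e n))\<^sup>2)}"

definition pow_op :: "(nat \<Rightarrow> 'h::real_inner) \<Rightarrow> (nat \<Rightarrow> real) \<Rightarrow> real \<Rightarrow> 'h \<Rightarrow> 'h" where
  "pow_op e lam s v = (\<Sum>n. (lam n powr s * (v \<bullet> e n)) *\<^sub>R e n)"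

definition C0_semigroup :: "(real \<Rightarrow> 'h::real_normed_vector \<Rightarrow> 'h) \<Rightarrow> bool" where
  "C0_semigroup S \<longleftrightarrow>
     (\<forall>t\<ge>0. bounded_linear (S t)) \<and> (\<forall>v. S 0 v = v) \<and>
     (\<forall>s\<ge>0. \<forall>t\<ge>0. \<forall>v. S (s + t) v = S s (S t v)) \<and>
     (\<forall>v. ((\<lambda>t. S t v) \<longlongrightarrow> v) (at_right 0))"

definition generates :: "'h::real_normed_vector set \<Rightarrow> ('h \<Rightarrow> 'h) \<Rightarrow> (real \<Rightarrow> 'h \<Rightarrow> 'h) \<Rightarrow> bool" where
  "generates D G S \<longleftrightarrow> C0_semigroup S \<and>
     (\<forall>v w. (v \<in> D \<and> w = G v) \<longleftrightarrow> ((\<lambda>t. (S t v - v) /\<^sub>R t) \<longlongrightarrow> w) (at_right 0))"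

section \<open>Bounded operators and test functions\<close>

definition nonneg_sym_bounded :: "('h::real_inner \<Rightarrow> 'h) \<Rightarrow> bool" where
  "nonneg_sym_bounded Q \<longleftrightarrow>
     bounded_linear Q \<and> (\<forall>u v. Q u \<bullet> v = u \<bullet> Q v) \<and> (\<forall>v. 0 \<le> Q v \<bullet> v)"

text \<open>Every operator \<open>Q\<close> of this kind has exactly one square root of this kind.\<close>

definition is_sqrt_op :: "('h::real_inner \<Rightarrow> 'h) \<Rightarrow> ('h \<Rightarrow> 'h) \<Rightarrow> bool" where
  "is_sqrt_op R Q \<longleftrightarrow> nonneg_sym_bounded R \<and> (\<forall>v. R (R v) = Q v)"

text \<open>Only the two derivatives are required to be bounded, not the function itself.\<close>

definition C2b :: "('h::real_normed_vector \<Rightarrow> real) \<Rightarrow> bool" where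
  "C2b \<phi> \<longleftrightarrow> (\<exists>(D1 :: 'h \<Rightarrow> 'h \<Rightarrow>\<^sub>L real) (D2 :: 'h \<Rightarrow> 'h \<Rightarrow>\<^sub>L 'h \<Rightarrow>\<^sub>L real).
     (\<forall>x. (\<phi> has_derivative blinfun_apply (D1 x)) (at x)) \<and>
     (\<forall>x. (D1 has_derivative blinfun_apply (D2 x)) (at x)) \<and>
     continuous_on UNIV D2 \<and> bounded (range D1) \<and> bounded (range D2))"

section \<open>Cylindrical Wiener process and stochastic integral\<close>

definition normal_filtration :: "'w measure \<Rightarrow> real \<Rightarrow> (real \<Rightarrow> 'w measure) \<Rightarrow> bool" where
  "normal_filtration M T F \<longleftrightarrow>
     (\<forall>t\<in>{0..T}. subalgebra M (F t)) \<and>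
     (\<forall>s t. 0 \<le> s \<and> s \<le> t \<and> t \<le> T \<longrightarrow> sets (F s) \<subseteq> sets (F t)) \<and>
     null_sets M \<subseteq> sets (F 0) \<and>
     (\<forall>t\<in>{0..<T}. sets (F t) = (\<Inter>s\<in>{t<..T}. sets (F s)))"

definition brownian_motion :: "'w measure \<Rightarrow> real \<Rightarrow> (real \<Rightarrow> 'w \<Rightarrow> real) \<Rightarrow> bool" where
  "brownian_motion M T b \<longleftrightarrow>
     (\<forall>t\<in>{0..T}. b t \<in> borel_measurable M) \<and>
     (AE \<omega> in M. b 0 \<omega> = 0) \<and>
     (AE \<omega> in M. continuous_on {0..T} (\<lambda>t. b t \<omega>)) \<and>
     (\<forall>s t. 0 \<le> s \<and> s < t \<and> t \<le> T \<longrightarrow>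
        distributed M lborel (\<lambda>\<omega>. b t \<omega> - b s \<omega>)
          (\<lambda>y. ennreal (normal_density 0 (sqrt (t - s)) y))) \<and>
     (\<forall>m p. (\<forall>j\<le>m. p j \<in> {0..T}) \<and> (\<forall>j<m. p j \<le> p (Suc j)) \<longrightarrow>
        prob_space.indep_vars M (\<lambda>_. borel) (\<lambda>j \<omega>. b (p (Suc j)) \<omega> - b (p j) \<omega>) {..<m::nat})"

text \<open>
  The process \<open>\<Sum>i. b i t *\<^sub>R e i\<close> does not converge in the Hilbert space, so it is represented by
  its coordinates \<open>b i\<close>, which are independent Brownian motions. They are adapted, and the
  increments of all coordinates after time \<open>s\<close> are jointly independent of \<open>F s\<close>.
\<close>

definition cylindrical_wiener ::
    "'w measure \<Rightarrow> real \<Rightarrow> (real \<Rightarrow> 'w measure) \<Rightarrow> (nat \<Rightarrow> real \<Rightarrow> 'w \<Rightarrow> real) \<Rightarrow> bool" where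
  "cylindrical_wiener M T F b \<longleftrightarrow>
     (\<forall>i. brownian_motion M T (b i)) \<and>
     prob_space.indep_vars M (\<lambda>_. PiM {0..T} (\<lambda>_. borel))
       (\<lambda>i \<omega>. restrict (\<lambda>t. b i t \<omega>) {0..T}) UNIV \<and>
     (\<forall>i. \<forall>t\<in>{0..T}. b i t \<in> borel_measurable (F t)) \<and>
     (\<forall>s t. 0 \<le> s \<and> s \<le> t \<and> t \<le> T \<longrightarrow>
        prob_space.indep_set M (sets (F s))
          (sets (vimage_algebra (space M) (\<lambda>\<omega> i. b i t \<omega> - b i s \<omega>)
             (PiM UNIV (\<lambda>_. borel)))))"

definition tendsto_L2 ::
    "'a measure \<Rightarrow> (nat \<Rightarrow> 'a \<Rightarrow> 'h::real_normed_vector) \<Rightarrow> ('a \<Rightarrow> 'h) \<Rightarrow> bool" where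
  "tendsto_L2 M Y Z \<longleftrightarrow>
     (\<forall>k. Y k \<in> borel_measurable M) \<and> Z \<in> borel_measurable M \<and>
     (\<lambda>k. \<integral>\<^sup>+ \<omega>. ennreal ((norm (Y k \<omega> - Z \<omega>))\<^sup>2) \<partial>M) \<longlonglongrightarrow> 0"

definition sums_L2 ::
    "'a measure \<Rightarrow> (nat \<Rightarrow> 'a \<Rightarrow> 'h::real_normed_vector) \<Rightarrow> ('a \<Rightarrow> 'h) \<Rightarrow> bool" where
  "sums_L2 M Y Z \<longleftrightarrow> tendsto_L2 M (\<lambda>n \<omega>. \<Sum>i<n. Y i \<omega>) Z"

text \<open>
  Integral over \<open>[0, t]\<close> of a deterministic function \<open>f\<close> against a real Brownian motion \<open>b\<close>: the
  limit in mean square of the integrals of step functions (with \<open>n k\<close> steps, nodes \<open>p k\<close> and values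
  \<open>c k\<close>) that converge to \<open>f\<close> in \<open>L\<^sup>2(0, t)\<close>. By the isometry property the value \<open>Z\<close> is determined
  almost surely and does not depend on the approximating sequence.
\<close>

definition step_fun :: "nat \<Rightarrow> (nat \<Rightarrow> real) \<Rightarrow> (nat \<Rightarrow> 'h::real_normed_vector) \<Rightarrow> real \<Rightarrow> 'h" where
  "step_fun n p c s = (\<Sum>j<n. indicator {p j<..p (Suc j)} s *\<^sub>R c j)"

definition step_integral ::
    "(real \<Rightarrow> 'w \<Rightarrow> real) \<Rightarrow> nat \<Rightarrow> (nat \<Rightarrow> real) \<Rightarrow> (nat \<Rightarrow> 'h::real_normed_vector) \<Rightarrow> 'w \<Rightarrow> 'h" where
  "step_integral b n p c \<omega> = (\<Sum>j<n. (b (p (Suc j)) \<omega> - b (p j) \<omega>) *\<^sub>R c j)"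

definition has_wiener_integral ::
    "'w measure \<Rightarrow> (real \<Rightarrow> 'w \<Rightarrow> real) \<Rightarrow> real \<Rightarrow> (real \<Rightarrow> 'h::real_normed_vector) \<Rightarrow> ('w \<Rightarrow> 'h) \<Rightarrow> bool"
    where
  "has_wiener_integral M b t f Z \<longleftrightarrow> (\<exists>n p c.
     (\<forall>k. \<forall>j<n k. 0 \<le> p k j \<and> p k j \<le> p k (Suc j) \<and> p k (Suc j) \<le> t) \<and>
     tendsto_L2 (restrict_space lborel {0..t}) (\<lambda>k. step_fun (n k) (p k) (c k)) f \<and>
     tendsto_L2 M (\<lambda>k. step_integral b (n k) (p k) (c k)) Z)"

text \<open>
  \<open>Z\<close> is (a version of) the integral over \<open>[0, t]\<close> of the deterministic operator-valued function
  \<open>\<Phi>\<close> against the cylindrical process with coordinates \<open>b i\<close> in the basis \<open>e\<close>, that is the sum over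
  \<open>i\<close>, in mean square, of the integrals of \<open>\<Phi> s (e i)\<close> against \<open>b i\<close>.
\<close>

definition has_stoch_integral ::
    "'w measure \<Rightarrow> (nat \<Rightarrow> 'h::real_normed_vector) \<Rightarrow> (nat \<Rightarrow> real \<Rightarrow> 'w \<Rightarrow> real) \<Rightarrow> real \<Rightarrow>
     (real \<Rightarrow> 'h \<Rightarrow> 'h) \<Rightarrow> ('w \<Rightarrow> 'h) \<Rightarrow> bool" where
  "has_stoch_integral M e b t \<Phi> Z \<longleftrightarrow> (\<exists>J.
     (\<forall>i. has_wiener_integral M (b i) t (\<lambda>s. \<Phi> s (e i)) (J i)) \<and> sums_L2 M J Z)"

section \<open>Discretization\<close>

definition finite_dim_subspace :: "'h::real_vector set \<Rightarrow> bool" where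
  "finite_dim_subspace U \<longleftrightarrow> (\<exists>B. finite B \<and> U = span B)"

definition energy_inner :: "(nat \<Rightarrow> 'h::real_inner) \<Rightarrow> (nat \<Rightarrow> real) \<Rightarrow> 'h \<Rightarrow> 'h \<Rightarrow> real" where
  "energy_inner e lam u v = pow_op e lam (1/2) u \<bullet> pow_op e lam (1/2) v"

text \<open>Orthogonal projector onto \<open>U\<close> for the inner product \<open>ip\<close>.\<close>

definition orth_proj :: "('h::real_vector \<Rightarrow> 'h \<Rightarrow> real) \<Rightarrow> 'h set \<Rightarrow> 'h \<Rightarrow> 'h" where
  "orth_proj ip U v = (THE p. p \<in> U \<and> (\<forall>w\<in>U. ip (v - p) w = 0))"

definition discrete_op ::
    "(nat \<Rightarrow> 'h::real_inner) \<Rightarrow> (nat \<Rightarrow> real) \<Rightarrow> 'h set \<Rightarrow> 'h \<Rightarrow> 'h" where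
  "discrete_op e lam U u = (THE w. w \<in> U \<and> (\<forall>v\<in>U. w \<bullet> v = energy_inner e lam u v))"

text \<open>
  \<open>Y\<close> is the sequence produced by the \<open>\<theta>\<close>-scheme in the space \<open>U\<close> with \<open>N\<close> steps. The last
  conjunct states the recursion: its left-hand side is almost surely equal to the noise increment,
  which is a series converging in mean square. The operator \<open>R\<close> is the square root of the
  covariance.
\<close>

definition theta_scheme ::
    "'w measure \<Rightarrow> (nat \<Rightarrow> 'h::real_inner) \<Rightarrow> (nat \<Rightarrow> real) \<Rightarrow> (nat \<Rightarrow> real \<Rightarrow> 'w \<Rightarrow> real) \<Rightarrow> ('h \<Rightarrow> 'h) \<Rightarrow>
     'h set \<Rightarrow> real \<Rightarrow> real \<Rightarrow> 'h \<Rightarrow> nat \<Rightarrow> (nat \<Rightarrow> 'w \<Rightarrow> 'h) \<Rightarrow> bool" where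
  "theta_scheme M e lam b R U \<theta> T x N Y \<longleftrightarrow> (let dt = T / real N; P = orth_proj inner U in
     (\<forall>n\<le>N. Y n \<in> borel_measurable M \<and> (\<forall>\<omega>\<in>space M. Y n \<omega> \<in> U)) \<and>
     (\<forall>\<omega>\<in>space M. Y 0 \<omega> = P x) \<and>
     (\<forall>n<N. sums_L2 M
        (\<lambda>i \<omega>. (b i (real (Suc n) * dt) \<omega> - b i (real n * dt) \<omega>) *\<^sub>R P (R (e i)))
        (\<lambda>\<omega>. Y (Suc n) \<omega> - Y n \<omega> +
              dt *\<^sub>R discrete_op e lam U (\<theta> *\<^sub>R Y (Suc n) \<omega> + (1 - \<theta>) *\<^sub>R Y n \<omega>))))"

end

theory Submission
  imports Defs
begin

text \<open>
  Both \<open>X\<^sub>T\<close> and \<open>X\<^sub>h\<^sup>N\<close> are Gaussian, so the error of \<open>E \<phi>\<close> is controlled by the difference of the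
  means and, through an interpolation of the two laws and Stein's identity, by the trace norm of the
  difference of the covariances. Both covariances have the form \<open>K - E K E\<^sup>*\<close>, with the stationary
  covariance \<open>K\<close> and the propagator \<open>E\<close> over \<open>[0, T]\<close>. The propagators differ in operator norm by
  \<open>O(h\<^sup>2\<^sup>\<gamma> + \<Delta>t\<^sup>\<gamma>)\<close>, since \<open>T \<ge> 1\<close> is bounded away from \<open>0\<close>. The stationary covariances are integrals
  over time, so that in the eigenbasis their difference is a sum of differences of resolvents applied
  to \<open>Q e\<^sub>n\<close>. These are estimated by elliptic duality, and summed with \<open>Tr A\<^sup>-\<^sup>\<alpha> < \<infinity>\<close> and the decay
  \<open>\<bar>Q e\<^sub>n\<bar> = O(\<lambda>\<^sub>n\<^sup>-\<^sup>\<beta>)\<close>. This yields the rate even at the endpoint \<open>\<gamma> = 1 - \<alpha> + \<beta>\<close>, with a constant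
  that serves all smaller \<open>\<gamma>\<close>.
\<close>

section \<open>Orthonormal bases\<close>

text \<open>As \<open>Q\<close> need not commute with \<open>A\<close>, no covariance here is
  diagonal: its kernel has entries like
  \<open>(R (e j) \<bullet> R (e k)) / (lam j + lam k)\<close>. Trace norms are therefore measured
  by duality, as pairings with bilinear forms \<open>b\<close> of bound \<open>K\<close>, and the
  workhorse is that a kernel of positive type pairs with \<open>b\<close> to at most
  \<open>K\<close> times its trace. A difference of covariances has no sign, so each one is
  rearranged until only positive-type remainders and resolvent errors are left; the traces of these
  remainders are then compared with traces of the exact operator, which is what makes the bounds
  uniform in \<open>h\<close>. The endpoint exponent survives because the two resolvent bounds, of
  size \<open>h^2\<close> and \<open>1 / lam n\<close>, are interpolated separately for each
  eigenvector. Integrating a norm of the semigroup error over times near 0 would lose an arbitrarily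
  small power instead. Second derivatives of \<open>\<phi>\<close> are known only to be bounded, so
  every approximation of a covariance has to be uniform over all \<open>b\<close> of given
  bound.\<close>

locale hilbert_basis =
  fixes e :: "nat \<Rightarrow> 'h::{real_inner, banach, second_countable_topology}"
  assumes basis: "orthonormal_basis e"
begin

lemma ortho: "e m \<bullet> e n = (if m = n then 1 else 0)"
  using basis by (auto simp: orthonormal_basis_def)

lemma norm_e [simp]: "norm (e n) = 1"
  by (simp add: norm_eq_sqrt_inner ortho)

lemma inner_sum_e: "finite J \<Longrightarrow> (\<Sum>i\<in>J. c i *\<^sub>R e i) \<bullet> e k = (if k \<in> J then c k else 0)"
  by (simp add: inner_sum_left ortho if_distrib[of "\<lambda>x. _ * x"] cong: if_cong)

lemma norm_sum_e: "finite J \<Longrightarrow> (norm (\<Sum>i\<in>J. c i *\<^sub>R e i))\<^sup>2 = (\<Sum>i\<in>J. (c i)\<^sup>2)"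
  unfolding power2_norm_eq_inner
  by (subst inner_sum_right) (simp add: inner_sum_e power2_eq_square)

lemma residual_orth:
  assumes "finite J" "k \<in> J"
  shows "(v - (\<Sum>i\<in>J. (v \<bullet> e i) *\<^sub>R e i)) \<bullet> e k = 0"
  using assms by (simp add: inner_diff_left inner_sum_e)

lemma best_approx:
  assumes "finite J"
  shows "norm (v - (\<Sum>i\<in>J. (v \<bullet> e i) *\<^sub>R e i)) \<le> norm (v - (\<Sum>i\<in>J. c i *\<^sub>R e i))"
proof -
  let ?r = "v - (\<Sum>i\<in>J. (v \<bullet> e i) *\<^sub>R e i)" and ?q = "\<Sum>i\<in>J. (v \<bullet> e i - c i) *\<^sub>R e i"
  have "orthogonal ?r ?q"
    unfolding orthogonal_def inner_sum_right
    by (intro sum.neutral ballI) (simp add: residual_orth[OF assms] del: inner_diff_left)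
  then have "(norm (?r + ?q))\<^sup>2 = (norm ?r)\<^sup>2 + (norm ?q)\<^sup>2" by (rule norm_add_Pythagorean)
  moreover have "?r + ?q = v - (\<Sum>i\<in>J. c i *\<^sub>R e i)"
    by (simp add: scaleR_diff_left sum_subtractf)
  ultimately have "(norm ?r)\<^sup>2 \<le> (norm (v - (\<Sum>i\<in>J. c i *\<^sub>R e i)))\<^sup>2" by simp
  then show ?thesis by (rule power2_le_imp_le) simp
qed

lemma bessel:
  assumes "finite J"
  shows "(\<Sum>i\<in>J. (v \<bullet> e i)\<^sup>2) \<le> (norm v)\<^sup>2"
proof -
  let ?r = "v - (\<Sum>i\<in>J. (v \<bullet> e i) *\<^sub>R e i)" and ?q = "\<Sum>i\<in>J. (v \<bullet> e i) *\<^sub>R e i"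
  have "orthogonal ?r ?q"
    unfolding orthogonal_def inner_sum_right
    by (intro sum.neutral ballI) (simp add: residual_orth[OF assms] del: inner_diff_left)
  then have "(norm (?r + ?q))\<^sup>2 = (norm ?r)\<^sup>2 + (norm ?q)\<^sup>2" by (rule norm_add_Pythagorean)
  then show ?thesis by (simp add: norm_sum_e[OF assms])
qed

lemma summable_coeff_sq: "summable (\<lambda>i. (v \<bullet> e i)\<^sup>2)"
  by (rule summableI_nonneg_bounded[where x="(norm v)\<^sup>2"]) (auto intro: bessel)

lemma span_range_repr:
  assumes "w \<in> span (range e)"
  shows "\<exists>m c. \<forall>n\<ge>m. w = (\<Sum>i<n. c i *\<^sub>R e i)"
  using assms
proof (induction rule: span_induct_alt)
  case base
  show ?case by (intro exI[of _ 0] exI[of _ "\<lambda>_. 0"]) simp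
next
  case (step a x y)
  then obtain k m c where x: "x = e k" and y: "\<And>n. n \<ge> m \<Longrightarrow> y = (\<Sum>i<n. c i *\<^sub>R e i)" by blast
  show ?case
  proof (intro exI[of _ "max m (Suc k)"] exI[of _ "\<lambda>i. c i + (if i = k then a else 0)"] allI impI)
    fix n assume n: "max m (Suc k) \<le> n"
    have "(\<Sum>i<n. (if i = k then a else 0) *\<^sub>R e i) = a *\<^sub>R e k"
      using n by (simp add: if_distrib[of "\<lambda>x. x *\<^sub>R _"] cong: if_cong)
    then show "a *\<^sub>R x + y = (\<Sum>i<n. (c i + (if i = k then a else 0)) *\<^sub>R e i)"
      using y[of n] n x by (simp add: scaleR_add_left sum.distrib)
  qed
qed

text \<open>Density gives some \<open>w\<close> in the span near \<open>v\<close>. From an index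
  \<open>m\<close> on, \<open>w\<close> is a competitor for the partial sums of \<open>v\<close>,
  and orthogonal projections are at least as close to \<open>v\<close> as any competitor.\<close>

lemma expansion: "(\<lambda>i. (v \<bullet> e i) *\<^sub>R e i) sums v"
proof -
  have "(\<lambda>n. \<Sum>i<n. (v \<bullet> e i) *\<^sub>R e i) \<longlonglongrightarrow> v"
  proof (rule LIMSEQ_I)
    fix r :: real assume r: "r > 0"
    have "v \<in> closure (span (range e))" using basis by (simp add: orthonormal_basis_def)
    then obtain w where w: "w \<in> span (range e)" "dist w v < r"
      using r closure_approachable by blast
    obtain m c where wt: "\<And>n. n \<ge> m \<Longrightarrow> w = (\<Sum>i<n. c i *\<^sub>R e i)"
      using span_range_repr[OF w(1)] by blast
    show "\<exists>no. \<forall>n\<ge>no. norm ((\<Sum>i<n. (v \<bullet> e i) *\<^sub>R e i) - v) < r"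
    proof (intro exI[of _ m] allI impI)
      fix n assume n: "n \<ge> m"
      have "norm (v - (\<Sum>i<n. (v \<bullet> e i) *\<^sub>R e i)) \<le> norm (v - w)"
        unfolding wt[OF n] by (rule best_approx) simp
      also have "\<dots> < r" using w(2) by (simp add: dist_norm norm_minus_commute)
      finally show "norm ((\<Sum>i<n. (v \<bullet> e i) *\<^sub>R e i) - v) < r" by (simp add: norm_minus_commute)
    qed
  qed
  then show ?thesis by (simp add: sums_def)
qed

lemma parseval_inner: "(\<lambda>i. (u \<bullet> e i) * (v \<bullet> e i)) sums (u \<bullet> v)"
  using bounded_linear.sums[OF bounded_linear_inner_right expansion[of v], of u]
  by (simp add: mult.commute)

lemma parseval: "(\<lambda>i. (v \<bullet> e i)\<^sup>2) sums (norm v)\<^sup>2"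
  using parseval_inner[of v v] unfolding power2_norm_eq_inner by (simp add: power2_eq_square)

lemma eq_of_coeff: "(\<And>i. u \<bullet> e i = v \<bullet> e i) \<Longrightarrow> u = v"
  using expansion[of u] expansion[of v] sums_unique2 by auto

text \<open>Riesz-Fischer: by orthonormality the Cauchy criterion for the vectors is the one for the
  squared coefficients, and completeness of the space does the rest.\<close>

lemma series_coeff:
  assumes "summable (\<lambda>i. (c i)\<^sup>2)"
  shows "summable (\<lambda>i. c i *\<^sub>R e i)" "(\<Sum>i. c i *\<^sub>R e i) \<bullet> e k = c k"
proof -
  show s: "summable (\<lambda>i. c i *\<^sub>R e i)"
  proof (subst summable_Cauchy, intro allI impI)
    fix r :: real assume r: "r > 0"
    then obtain N where N: "\<And>m n. m \<ge> N \<Longrightarrow> norm (\<Sum>i\<in>{m..<n}. (c i)\<^sup>2) < r\<^sup>2"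
      using assms[unfolded summable_Cauchy, rule_format, of "r\<^sup>2"] by auto
    show "\<exists>N. \<forall>m\<ge>N. \<forall>n. norm (\<Sum>i\<in>{m..<n}. c i *\<^sub>R e i) < r"
    proof (intro exI[of _ N] allI impI)
      fix m n assume "m \<ge> N"
      then have "(norm (\<Sum>i\<in>{m..<n}. c i *\<^sub>R e i))\<^sup>2 < r\<^sup>2"
        using N[of m n] by (simp add: norm_sum_e)
      then show "norm (\<Sum>i\<in>{m..<n}. c i *\<^sub>R e i) < r"
        using r by (simp add: power_less_imp_less_base)
    qed
  qed
  have "(\<lambda>i. (c i *\<^sub>R e i) \<bullet> e k) sums ((\<Sum>i. c i *\<^sub>R e i) \<bullet> e k)"
    by (rule bounded_linear.sums[OF bounded_linear_inner_left summable_sums[OF s]])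
  moreover have "(\<lambda>i. (c i *\<^sub>R e i) \<bullet> e k) = (\<lambda>i. if i = k then c i else 0)"
    by (auto simp: ortho)
  ultimately show "(\<Sum>i. c i *\<^sub>R e i) \<bullet> e k = c k"
    using sums_single[of k c] sums_unique2 by force
qed

lemma norm_le_of_coeff:
  assumes "\<And>i. \<bar>u \<bullet> e i\<bar> \<le> K * \<bar>v \<bullet> e i\<bar>" "0 \<le> K"
  shows "norm u \<le> K * norm v"
proof -
  have "(norm u)\<^sup>2 \<le> K\<^sup>2 * (norm v)\<^sup>2"
  proof (rule sums_le[OF _ parseval sums_mult[OF parseval]])
    fix i have "\<bar>u \<bullet> e i\<bar>\<^sup>2 \<le> (K * \<bar>v \<bullet> e i\<bar>)\<^sup>2" by (rule power_mono[OF assms(1)]) simp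
    then show "(u \<bullet> e i)\<^sup>2 \<le> K\<^sup>2 * (v \<bullet> e i)\<^sup>2" by (simp add: power_mult_distrib)
  qed
  then have "(norm u)\<^sup>2 \<le> (K * norm v)\<^sup>2" by (simp add: power_mult_distrib)
  then show ?thesis by (rule power2_le_imp_le) (simp add: assms(2))
qed

lemma diag_coeff:
  assumes "\<And>i. \<bar>c i\<bar> \<le> K"
  shows "(\<Sum>i. (c i * (v \<bullet> e i)) *\<^sub>R e i) \<bullet> e k = c k * (v \<bullet> e k)"
proof (rule series_coeff(2), rule summable_comparison_test)
  show "\<exists>N. \<forall>n\<ge>N. norm ((c n * (v \<bullet> e n))\<^sup>2) \<le> K\<^sup>2 * (v \<bullet> e n)\<^sup>2"
  proof (intro exI[of _ 0] allI impI)
    fix n have "(c n)\<^sup>2 \<le> K\<^sup>2" using assms[of n] by (rule abs_le_square_iff[THEN iffD1, OF order_trans]) simp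
    then show "norm ((c n * (v \<bullet> e n))\<^sup>2) \<le> K\<^sup>2 * (v \<bullet> e n)\<^sup>2"
      by (simp add: power_mult_distrib mult_right_mono)
  qed
  show "summable (\<lambda>n. K\<^sup>2 * (v \<bullet> e n)\<^sup>2)" by (intro summable_mult summable_coeff_sq)
qed

end

section \<open>Diagonalization of a symmetric form on a finite-dimensional space\<close>

text \<open>First-order optimality in scalar form: once \<open>y > 0\<close>, the choice
  \<open>t = x / y\<close> turns the bound into \<open>x^2 <= 0\<close>. It extracts the eigenvalue
  equation from the maximality of a Rayleigh quotient.\<close>

lemma zero_of_quadratic_bound:
  fixes x y :: real
  assumes "\<And>t. 2 * t * x \<le> t\<^sup>2 * y"
  shows "x = 0"
proof (rule ccontr)
  assume x: "x \<noteq> 0"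
  have y: "y > 0" using assms[of x] x
    by (simp add: power2_eq_square) (smt (verit) mult_le_0_iff not_square_less_zero zero_less_mult_iff)
  have "2 * (x / y) * x \<le> (x / y)\<^sup>2 * y" by (rule assms)
  then have "x * x \<le> 0" using y by (simp add: power2_eq_square field_simps)
  then show False using x not_real_square_gt_zero[of x] by linarith
qed

text \<open>Makes the coordinates in a finite-dimensional subspace inner products, hence continuous
  functions of the vector. Continuity of the form and closedness of the subspace both follow from
  this formula.\<close>

lemma orthogonal_span_coeff:
  fixes C :: "'h::real_inner set"
  assumes "finite C" "pairwise orthogonal C" "0 \<notin> C" "u \<in> span C"
  shows "u = (\<Sum>c\<in>C. (u \<bullet> c / (c \<bullet> c)) *\<^sub>R c)"
proof -
  obtain t where t: "u = (\<Sum>c\<in>C. t c *\<^sub>R c)"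
    using assms(1,4) by (auto simp: span_finite)
  have "u \<bullet> c / (c \<bullet> c) = t c" if "c \<in> C" for c
  proof -
    have "u \<bullet> c = (\<Sum>d\<in>C. if d = c then t c * (c \<bullet> c) else 0)"
      unfolding t inner_sum_left using assms(2) that
      by (intro sum.cong refl) (auto simp: pairwise_def orthogonal_def)
    then show ?thesis using assms(1,3) that by auto
  qed
  then have "(\<Sum>c\<in>C. (u \<bullet> c / (c \<bullet> c)) *\<^sub>R c) = (\<Sum>c\<in>C. t c *\<^sub>R c)" by (intro sum.cong) auto
  then show ?thesis using t by simp
qed

text \<open>The box is a Minkowski sum of finitely many segments. It supplies the compactness for
  the Rayleigh argument, because the ambient unit sphere is not compact.\<close>

lemma compact_box_combination:
  fixes C :: "'h::real_normed_vector set"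
  assumes "finite C"
  shows "compact {\<Sum>c\<in>C. t c *\<^sub>R c | t. \<forall>c\<in>C. \<bar>t c\<bar> \<le> r c}"
  using assms
proof (induction C)
  case empty
  then show ?case by simp
next
  case (insert d C)
  have "{\<Sum>c\<in>insert d C. t c *\<^sub>R c | t. \<forall>c\<in>insert d C. \<bar>t c\<bar> \<le> r c} =
     {x + y | x y. x \<in> (\<lambda>s. s *\<^sub>R d) ` {- r d .. r d} \<and>
        y \<in> {\<Sum>c\<in>C. t c *\<^sub>R c | t. \<forall>c\<in>C. \<bar>t c\<bar> \<le> r c}}" (is "?L = ?R")
  proof (intro equalityI subsetI)
    fix z assume "z \<in> ?L"
    then obtain t where t: "z = (\<Sum>c\<in>insert d C. t c *\<^sub>R c)" "\<forall>c\<in>insert d C. \<bar>t c\<bar> \<le> r c" by blast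
    have "z = t d *\<^sub>R d + (\<Sum>c\<in>C. t c *\<^sub>R c)" using t insert by simp
    moreover have "t d *\<^sub>R d \<in> (\<lambda>s. s *\<^sub>R d) ` {- r d .. r d}" using t(2) by (intro imageI) auto
    ultimately show "z \<in> ?R" using t(2) by blast
  next
    fix z assume "z \<in> ?R"
    then obtain s t where s: "s \<in> {- r d .. r d}" and t: "\<forall>c\<in>C. \<bar>t c\<bar> \<le> r c"
      and z: "z = s *\<^sub>R d + (\<Sum>c\<in>C. t c *\<^sub>R c)" by blast
    have "z = (\<Sum>c\<in>insert d C. (t(d := s)) c *\<^sub>R c)"
    proof -
      have "(\<Sum>c\<in>C. (t(d := s)) c *\<^sub>R c) = (\<Sum>c\<in>C. t c *\<^sub>R c)"
        using insert(2) by (intro sum.cong) auto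
      then show ?thesis using z insert by simp
    qed
    moreover have "\<forall>c\<in>insert d C. \<bar>(t(d := s)) c\<bar> \<le> r c" using s t by auto
    ultimately show "z \<in> ?L" by blast
  qed
  moreover have "compact ((\<lambda>s. s *\<^sub>R d) ` {- r d .. r d})"
    by (intro compact_continuous_image continuous_intros) simp
  ultimately show ?case using compact_sums[OF _ insert.IH] by simp
qed

text \<open>The maximizer of the Rayleigh quotient on the orthogonal complement of the eigenvectors found
  so far is a further eigenvector.\<close>

lemma rayleigh_eigenvector:
  fixes U :: "'h::real_inner set" and a :: "'h \<Rightarrow> 'h \<Rightarrow> real"
  assumes U: "finite_dim_subspace U"
    and sym: "\<And>u v. u \<in> U \<Longrightarrow> v \<in> U \<Longrightarrow> a u v = a v u"
    and add: "\<And>u v w. u \<in> U \<Longrightarrow> v \<in> U \<Longrightarrow> w \<in> U \<Longrightarrow> a (u + v) w = a u w + a v w"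
    and scale: "\<And>c u w. u \<in> U \<Longrightarrow> w \<in> U \<Longrightarrow> a (c *\<^sub>R u) w = c * a u w"
    and W: "subspace W" "W \<subseteq> U" "closed W" "W \<noteq> {0}"
  shows "\<exists>v\<in>W. norm v = 1 \<and> (\<forall>w\<in>W. a v w = a v v * (v \<bullet> w))"
proof -
  obtain B where B: "finite B" "U = span B" using U by (auto simp: finite_dim_subspace_def)
  obtain C0 where C0: "finite C0" "span C0 = span B" "pairwise orthogonal C0"
    using basis_orthogonal[OF B(1)] by blast
  define C where "C = C0 - {0}"
  have C: "finite C" "pairwise orthogonal C" "0 \<notin> C" "U = span C"
    using C0 B(2) pairwise_subset[OF C0(3), of C] by (auto simp: C_def span_delete_0)
  have CU: "C \<subseteq> U" by (simp add: C(4) span_superset)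
  have subU: "subspace U" by (simp add: C(4))
  have addr: "a w (u + v) = a w u + a w v" if "u \<in> U" "v \<in> U" "w \<in> U" for u v w
    using add[of u v w] sym[of w u] sym[of w v] sym[of w "u + v"] that subspace_add[OF subU] by simp
  have scaler: "a w (c *\<^sub>R u) = c * a w u" if "u \<in> U" "w \<in> U" for u w c
    using scale[of u w c] sym[of w u] sym[of w "c *\<^sub>R u"] that subspace_scale[OF subU] by simp
  define t :: "'h \<Rightarrow> 'h \<Rightarrow> real" where "t = (\<lambda>u c. u \<bullet> c / (c \<bullet> c))"
  have rep: "u = (\<Sum>c\<in>C. t u c *\<^sub>R c)" if "u \<in> U" for u
    unfolding t_def using orthogonal_span_coeff[OF C(1-3)] that C(4) by blast
  have sumU: "(\<Sum>c\<in>J. s c *\<^sub>R c) \<in> U" if "J \<subseteq> C" for J s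
    using that CU by (intro subspace_sum subspace_scale subU) auto
  have a0: "a 0 w = 0" if "w \<in> U" for w using scale[of w w 0] that by simp
  have asum: "a (\<Sum>c\<in>J. s c *\<^sub>R c) w = (\<Sum>c\<in>J. s c * a c w)" if "J \<subseteq> C" "w \<in> U" for J s w
    using finite_subset[OF that(1) C(1)] that
  proof (induction J)
    case (insert c J)
    have "a (s c *\<^sub>R c + (\<Sum>c\<in>J. s c *\<^sub>R c)) w = s c * a c w + a (\<Sum>c\<in>J. s c *\<^sub>R c) w"
      using insert.prems CU sumU[of J s]
      by (subst add) (auto simp: scale intro: subspace_scale[OF subU])
    then show ?case using insert by simp
  qed (simp add: a0)
  have aform: "a u w = (\<Sum>c\<in>C. \<Sum>d\<in>C. t u c * (t w d * a d c))" if "u \<in> U" "w \<in> U" for u w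
  proof -
    have "a u w = (\<Sum>c\<in>C. t u c * a c w)" using asum[of C w "t u"] rep[OF that(1)] that by simp
    also have "\<dots> = (\<Sum>c\<in>C. t u c * a (\<Sum>d\<in>C. t w d *\<^sub>R d) c)"
      using rep[OF that(2)] that CU sym by (intro sum.cong) auto
    also have "\<dots> = (\<Sum>c\<in>C. t u c * (\<Sum>d\<in>C. t w d * a d c))"
      using CU by (intro sum.cong) (auto simp: asum)
    finally show ?thesis by (simp add: sum_distrib_left)
  qed
  \<comment> \<open>By Cauchy-Schwarz the coordinate of a unit vector along \<open>c\<close> is at
    most \<open>1 / norm c\<close>, so this compact box contains the unit sphere of
    \<open>U\<close>.\<close>
  define K where "K = {\<Sum>c\<in>C. s c *\<^sub>R c | s. \<forall>c\<in>C. \<bar>s c\<bar> \<le> 1 / norm c}"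
  have K: "compact K" unfolding K_def by (rule compact_box_combination[OF C(1)])
  have KU: "K \<subseteq> U" by (auto simp: K_def sumU)
  have inK: "u \<in> K" if "u \<in> U" "norm u = 1" for u
  proof -
    have "\<bar>t u c\<bar> \<le> 1 / norm c" if c: "c \<in> C" for c
    proof -
      have "\<bar>u \<bullet> c\<bar> \<le> norm c" using Cauchy_Schwarz_ineq2[of u c] \<open>norm u = 1\<close> by simp
      then show ?thesis using c C(3)
        by (auto simp: t_def abs_divide dot_square_norm power2_eq_square divide_simps)
    qed
    then show ?thesis using rep[OF \<open>u \<in> U\<close>] unfolding K_def by blast
  qed
  define S where "S = K \<inter> (W \<inter> sphere 0 1)"
  have Seq: "S = W \<inter> sphere 0 1" using inK W(2) by (auto simp: S_def)
  have "closed {u::'h. norm u = 1}" by (intro closed_Collect_eq continuous_intros)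
  then have "closed (sphere (0::'h) 1)" by (simp add: sphere_def)
  then have "compact S" unfolding S_def using K W(3) by (intro compact_Int_closed closed_Int)
  moreover have "S \<noteq> {}"
  proof -
    obtain w where "w \<in> W" "w \<noteq> 0" using W(1,4) subspace_0 by blast
    then have "w /\<^sub>R norm w \<in> S" using W(1) by (simp add: Seq subspace_scale)
    then show ?thesis by auto
  qed
  moreover have "continuous_on S (\<lambda>u. a u u)"
  proof -
    have "continuous_on S (\<lambda>u. t u c)" for c
      unfolding t_def divide_inverse by (intro continuous_intros)
    then have cont: "continuous_on S (\<lambda>u. \<Sum>c\<in>C. \<Sum>d\<in>C. t u c * (t u d * a d c))"
      by (intro continuous_on_sum continuous_on_mult continuous_on_const)
    have "(\<Sum>c\<in>C. \<Sum>d\<in>C. t u c * (t u d * a d c)) = a u u" if "u \<in> S" for u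
    proof -
      have "u \<in> U" using that W(2) unfolding Seq by blast
      then show ?thesis using aform[of u u] by simp
    qed
    then show ?thesis by (rule continuous_on_eq[OF cont])
  qed
  ultimately obtain v where v: "v \<in> S" and vmax: "\<And>w. w \<in> S \<Longrightarrow> a w w \<le> a v v"
    using continuous_attains_sup[of S "\<lambda>u. a u u"] by auto
  have vW: "v \<in> W" "norm v = 1" "v \<in> U" using v W(2) by (auto simp: Seq)
  have bound: "a w w \<le> a v v * (norm w)\<^sup>2" if w: "w \<in> W" for w
  proof (cases "w = 0")
    case True
    then show ?thesis using a0 subspace_0[OF subU] by simp
  next
    case False
    have wU: "w \<in> U" using w W(2) by auto
    have "w /\<^sub>R norm w \<in> S" using w W(1) False by (simp add: Seq subspace_scale)
    then have "a (w /\<^sub>R norm w) (w /\<^sub>R norm w) \<le> a v v" by (rule vmax)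
    then have "inverse (norm w) * (inverse (norm w) * a w w) \<le> a v v"
      using wU by (simp add: scale scaler subspace_scale[OF subU])
    then show ?thesis using False by (simp add: field_simps power2_eq_square)
  qed
  have "a v w = a v v * (v \<bullet> w)" if w: "w \<in> W" for w
  proof -
    have wU: "w \<in> U" using w W(2) by auto
    \<comment> \<open>Perturb the maximizer to \<open>v + s *\<^sub>R w\<close>: the terms of order
      0 in \<open>s\<close> cancel, and the term linear in \<open>s\<close> must vanish because it
      is dominated by a quadratic one.\<close>
    have "2 * s * (a v w - a v v * (v \<bullet> w)) \<le> s\<^sup>2 * (a v v * (norm w)\<^sup>2 - a w w)" for s
    proof -
      have "v + s *\<^sub>R w \<in> W" using vW w W(1) by (simp add: subspace_add subspace_scale)
      then have "a (v + s *\<^sub>R w) (v + s *\<^sub>R w) \<le> a v v * (norm (v + s *\<^sub>R w))\<^sup>2" by (rule bound)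
      moreover have "a (v + s *\<^sub>R w) (v + s *\<^sub>R w) = a v v + 2 * s * a v w + s\<^sup>2 * a w w"
        using vW wU sym[of w v]
        by (simp add: add addr scale scaler subspace_add[OF subU] subspace_scale[OF subU]
            power2_eq_square algebra_simps)
      moreover have "(norm (v + s *\<^sub>R w))\<^sup>2 = 1 + 2 * s * (v \<bullet> w) + s\<^sup>2 * (norm w)\<^sup>2"
        using vW(2) unfolding power2_norm_eq_inner
        by (simp add: inner_add_left inner_add_right inner_commute[of w v] norm_eq_1
            power2_eq_square algebra_simps)
      ultimately show ?thesis by (simp add: algebra_simps)
    qed
    then have "a v w - a v v * (v \<bullet> w) = 0" by (rule zero_of_quadratic_bound)
    then show ?thesis by simp
  qed
  then show ?thesis using vW by blast
qed

text \<open>Take an orthonormal family of eigenvectors of maximal length \<open>d\<close>; lengths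
  are bounded because orthonormal vectors are independent in a space spanned by \<open>B\<close>. If
  its orthogonal complement in \<open>U\<close> were nonzero, a Rayleigh maximizer there would
  lengthen the family.\<close>

lemma simultaneous_diagonalization:
  fixes U :: "'h::real_inner set" and a :: "'h \<Rightarrow> 'h \<Rightarrow> real"
  assumes U: "finite_dim_subspace U"
    and sym: "\<And>u v. u \<in> U \<Longrightarrow> v \<in> U \<Longrightarrow> a u v = a v u"
    and add: "\<And>u v w. u \<in> U \<Longrightarrow> v \<in> U \<Longrightarrow> w \<in> U \<Longrightarrow> a (u + v) w = a u w + a v w"
    and scale: "\<And>c u w. u \<in> U \<Longrightarrow> w \<in> U \<Longrightarrow> a (c *\<^sub>R u) w = c * a u w"
  shows "\<exists>(d::nat) f mu. (\<forall>m<d. \<forall>l<d. f m \<bullet> f l = (if m = l then 1 else 0)) \<and>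
      U = span (f ` {..<d}) \<and> (\<forall>m<d. \<forall>v\<in>U. a (f m) v = mu m * (f m \<bullet> v))"
proof -
  obtain B where B: "finite B" "U = span B" using U by (auto simp: finite_dim_subspace_def)
  have subU: "subspace U" by (simp add: B(2))
  define P :: "nat \<Rightarrow> bool" where "P = (\<lambda>d. \<exists>f mu. (\<forall>m<d. f m \<in> U) \<and>
      (\<forall>m<d. \<forall>l<d. f m \<bullet> f l = (if m = l then 1 else (0::real))) \<and>
      (\<forall>m<d. \<forall>v\<in>U. a (f m) v = mu m * (f m \<bullet> v)))"
  have bnd: "d \<le> card B" if Pd: "P d" for d
  proof -
    obtain f where f: "\<forall>m<d. f m \<in> U" "\<forall>m<d. \<forall>l<d. f m \<bullet> f l = (if m = l then 1 else (0::real))"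
      using Pd unfolding P_def by blast
    have inj: "inj_on f {..<d}"
    proof (rule inj_onI)
      fix m l assume "m \<in> {..<d}" "l \<in> {..<d}" "f m = f l"
      then have "f m \<bullet> f l = 1" using f(2) by simp
      then show "m = l" using f(2) \<open>m \<in> {..<d}\<close> \<open>l \<in> {..<d}\<close> by (auto split: if_splits)
    qed
    have "independent (f ` {..<d})"
    proof (rule pairwise_orthogonal_independent)
      show "pairwise orthogonal (f ` {..<d})"
        using f(2) by (auto simp: pairwise_def orthogonal_def)
      show "0 \<notin> f ` {..<d}"
      proof
        assume "0 \<in> f ` {..<d}"
        then obtain m where "m < d" "f m = 0" by auto
        then show False using f(2)[rule_format, of m m] by simp
      qed
    qed
    then have "card (f ` {..<d}) \<le> card B"
      using independent_span_bound[OF B(1)] f(1) B(2) by blast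
    then show ?thesis using inj by (simp add: card_image)
  qed
  have "P 0" by (simp add: P_def)
  then have "P (Greatest P)" "\<And>k. P k \<Longrightarrow> k \<le> Greatest P"
    using GreatestI_nat[of P 0 "card B"] Greatest_le_nat[of P _ "card B"] bnd by blast+
  then obtain d where d: "P d" and dmax: "\<And>k. P k \<Longrightarrow> k \<le> d" by blast
  obtain f mu where fU: "\<And>m. m < d \<Longrightarrow> f m \<in> U"
    and on: "\<And>m l. m < d \<Longrightarrow> l < d \<Longrightarrow> f m \<bullet> f l = (if m = l then 1 else (0::real))"
    and eig: "\<And>m v. m < d \<Longrightarrow> v \<in> U \<Longrightarrow> a (f m) v = mu m * (f m \<bullet> v)"
    using d unfolding P_def by blast
  define W where "W = U \<inter> {v. \<forall>m<d. f m \<bullet> v = 0}"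
  have "closed U"
  proof -
    obtain C0 where C0: "finite C0" "span C0 = span B" "pairwise orthogonal C0"
      using basis_orthogonal[OF B(1)] by blast
    define C where "C = C0 - {0}"
    have C: "finite C" "pairwise orthogonal C" "0 \<notin> C" "U = span C"
      using C0 B(2) pairwise_subset[OF C0(3), of C] by (auto simp: C_def span_delete_0)
    have "U = {u. u = (\<Sum>c\<in>C. (u \<bullet> c / (c \<bullet> c)) *\<^sub>R c)}"
    proof (intro equalityI subsetI CollectI)
      fix u assume "u \<in> {u. u = (\<Sum>c\<in>C. (u \<bullet> c / (c \<bullet> c)) *\<^sub>R c)}"
      then have "u = (\<Sum>c\<in>C. (u \<bullet> c / (c \<bullet> c)) *\<^sub>R c)" by simp
      also have "\<dots> \<in> U" unfolding C(4) by (intro span_sum span_scale span_base)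
      finally show "u \<in> U" .
    qed (use orthogonal_span_coeff[OF C(1-3)] C(4) in blast)
    moreover have "closed {u. u = (\<Sum>c\<in>C. (u \<bullet> c / (c \<bullet> c)) *\<^sub>R c)}"
      unfolding divide_inverse by (intro closed_Collect_eq continuous_intros)
    ultimately show ?thesis by simp
  qed
  moreover have "{v. \<forall>m<d. f m \<bullet> v = 0} = (\<Inter>m\<in>{..<d}. {v. f m \<bullet> v = 0})" by auto
  moreover have "closed {v. f m \<bullet> v = 0}" for m by (intro closed_Collect_eq continuous_intros)
  ultimately have Wc: "closed W" unfolding W_def by (simp add: closed_INT closed_Int)
  have Ws: "subspace W" using subU
    by (auto simp: W_def subspace_def inner_add_right)
  have proj: "v - (\<Sum>m<d. (f m \<bullet> v) *\<^sub>R f m) \<in> W" if "v \<in> U" for v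
  proof -
    have "f l \<bullet> (\<Sum>m<d. (f m \<bullet> v) *\<^sub>R f m) = f l \<bullet> v" if "l < d" for l
    proof -
      have "f l \<bullet> (\<Sum>m<d. (f m \<bullet> v) *\<^sub>R f m) = (\<Sum>m<d. if m = l then f l \<bullet> v else 0)"
        unfolding inner_sum_right using that by (intro sum.cong) (auto simp: on)
      then show ?thesis using that by simp
    qed
    moreover have "v - (\<Sum>m<d. (f m \<bullet> v) *\<^sub>R f m) \<in> U"
      using that fU by (intro subspace_diff[OF subU] subspace_sum[OF subU] subspace_scale[OF subU]) auto
    ultimately show ?thesis unfolding W_def by (simp add: inner_diff_right)
  qed
  have W0: "W = {0}"
  proof (rule ccontr)
    assume "W \<noteq> {0}"
    moreover have "W \<subseteq> U" unfolding W_def by blast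
    ultimately have "\<exists>v\<in>W. norm v = 1 \<and> (\<forall>w\<in>W. a v w = a v v * (v \<bullet> w))"
      using rayleigh_eigenvector[where a=a, OF U sym add scale Ws _ Wc] by blast
    then obtain w where w: "w \<in> W" "norm w = 1" "\<And>v. v \<in> W \<Longrightarrow> a w v = a w w * (w \<bullet> v)"
      by auto
    have wU: "w \<in> U" and wo: "\<And>m. m < d \<Longrightarrow> f m \<bullet> w = 0" using w(1) by (auto simp: W_def)
    \<comment> \<open>The maximizer satisfies the eigenvalue equation only against \<open>W\<close>.
      It extends to \<open>U\<close> since \<open>a (f k) w\<close> equals
      \<open>mu k * (f k \<bullet> w)\<close>, which is zero.\<close>
    have aw: "a w v = a w w * (w \<bullet> v)" if v: "v \<in> U" for v
    proof -
      let ?p = "\<Sum>m<d. (f m \<bullet> v) *\<^sub>R f m"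
      have pU: "(\<Sum>m\<in>J. (f m \<bullet> v) *\<^sub>R f m) \<in> U" if "J \<subseteq> {..<d}" for J
        using that fU by (auto intro!: subspace_sum subspace_scale subU)
      have 0: "a (\<Sum>m\<in>J. (f m \<bullet> v) *\<^sub>R f m) w = 0" if "J \<subseteq> {..<d}" for J
        using finite_subset[OF that finite_lessThan] that
      proof (induction J)
        case empty
        show ?case using scale[of w w 0] wU by simp
      next
        case (insert k J)
        have "a ((f k \<bullet> v) *\<^sub>R f k + (\<Sum>m\<in>J. (f m \<bullet> v) *\<^sub>R f m)) w = 0"
          using insert pU[of J] wU fU[of k]
          by (subst add) (auto simp: scale eig wo intro: subspace_scale[OF subU])
        then show ?case using insert by simp
      qed
      have "a v w = a ((v - ?p) + ?p) w" by simp
      also have "\<dots> = a (v - ?p) w + a ?p w"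
        using proj[OF v] pU wU by (intro add) (auto simp: W_def)
      also have "a (v - ?p) w = a w (v - ?p)" using proj[OF v] wU by (intro sym) (auto simp: W_def)
      also have "\<dots> = a w w * (w \<bullet> (v - ?p))" using proj[OF v] by (rule w(3))
      also have "w \<bullet> (v - ?p) = w \<bullet> v"
        using wo by (simp add: inner_diff_right inner_sum_right inner_commute[of w "f _"])
      finally show ?thesis using 0[of "{..<d}"] sym[OF wU v] by simp
    qed
    have "P (Suc d)"
      unfolding P_def
    proof (rule exI[of _ "f(d := w)"], rule exI[of _ "mu(d := a w w)"], intro conjI allI impI ballI)
      fix m assume m: "m < Suc d"
      have m': "m < d" if "m \<noteq> d" using m that by simp
      show "(f(d := w)) m \<in> U" using m' fU[of m] wU by (cases "m = d") simp_all
      show "(f(d := w)) m \<bullet> (f(d := w)) l = (if m = l then 1 else 0)" if l: "l < Suc d" for l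
      proof -
        have l': "l < d" if "l \<noteq> d" using l that by simp
        show ?thesis
          using m' l' wo[of l] wo[of m] on[of m l] w(2)
          by (cases "m = d"; cases "l = d") (simp_all add: norm_eq_1 inner_commute[of w "f l"])
      qed
      show "a ((f(d := w)) m) v = (mu(d := a w w)) m * ((f(d := w)) m \<bullet> v)" if v: "v \<in> U" for v
        using m' aw[OF v] eig[of m v] v by (cases "m = d") simp_all
    qed
    from dmax[OF this] show False by simp
  qed
  have "U = span (f ` {..<d})"
  proof (intro equalityI subsetI)
    fix v assume "v \<in> U"
    then have "v - (\<Sum>m<d. (f m \<bullet> v) *\<^sub>R f m) \<in> {0}" using proj W0 by metis
    then have "v = (\<Sum>m<d. (f m \<bullet> v) *\<^sub>R f m)" by simp
    also have "\<dots> \<in> span (f ` {..<d})" by (intro span_sum span_scale span_base) auto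
    finally show "v \<in> span (f ` {..<d})" .
  next
    fix v assume "v \<in> span (f ` {..<d})"
    moreover have "span (f ` {..<d}) \<subseteq> U" using fU subU by (intro span_minimal) auto
    ultimately show "v \<in> U" by blast
  qed
  then show ?thesis using on eig by blast
qed

section \<open>Covariance kernels and the trace norm\<close>

text \<open>The form \<open>D2 x\<close> of a test function is the intended instance. Keeping the
  bound \<open>K\<close> explicit lets estimates that are linear in \<open>K\<close>, for all such
  forms at once, stand in for trace norm estimates.\<close>

definition bform :: "real \<Rightarrow> ('h::real_inner \<Rightarrow> 'h \<Rightarrow> real) \<Rightarrow> bool" where
  "bform K b \<longleftrightarrow> bounded_bilinear b \<and> (\<forall>u v. \<bar>b u v\<bar> \<le> K * norm u * norm v)"

lemma bform_inner: "bform 1 inner"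
  unfolding bform_def using Cauchy_Schwarz_ineq2 by (auto simp: bounded_bilinear_inner)

lemma bformD:
  assumes "bform K b"
  shows "bounded_bilinear b" "\<bar>b u v\<bar> \<le> K * norm u * norm v"
  using assms by (auto simp: bform_def)

lemma bform_comp:
  assumes b: "bform K b" and f: "bounded_linear f" "\<And>v. norm (f v) \<le> F * norm v" "0 \<le> F"
    and g: "bounded_linear g" "\<And>v. norm (g v) \<le> G * norm v" and K: "0 \<le> K"
  shows "bform (K * F * G) (\<lambda>u v. b (f u) (g v))"
  unfolding bform_def
proof (intro conjI allI)
  show "bounded_bilinear (\<lambda>u v. b (f u) (g v))"
    by (rule bounded_bilinear.comp[OF bformD(1)[OF b] f(1) g(1)])
  fix u v
  have "\<bar>b (f u) (g v)\<bar> \<le> K * norm (f u) * norm (g v)" by (rule bformD(2)[OF b])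
  also have "\<dots> \<le> K * (F * norm u) * (G * norm v)"
    using K f(2)[of u] g(2)[of v] f(3) by (intro mult_mono mult_nonneg_nonneg) auto
  finally show "\<bar>b (f u) (g v)\<bar> \<le> K * F * G * norm u * norm v" by (simp add: mult_ac)
qed

lemma bform_add:
  assumes "bform K b" "bform L c"
  shows "bform (K + L) (\<lambda>u v. b u v + c u v)"
  unfolding bform_def
proof (intro conjI allI)
  interpret b: bounded_bilinear b by (rule bformD(1)[OF assms(1)])
  interpret c: bounded_bilinear c by (rule bformD(1)[OF assms(2)])
  show bound: "\<bar>b u v + c u v\<bar> \<le> (K + L) * norm u * norm v" for u v
    using bformD(2)[OF assms(1), of u v] bformD(2)[OF assms(2), of u v]
    by (simp add: algebra_simps)
  show "bounded_bilinear (\<lambda>u v. b u v + c u v)"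
  proof
    show "\<exists>K. \<forall>u v. norm (b u v + c u v) \<le> norm u * norm v * K"
      using bound by (intro exI[of _ "K + L"]) (simp add: mult_ac)
  qed (simp_all add: b.add_left b.add_right c.add_left c.add_right b.scaleR_left b.scaleR_right
      c.scaleR_left c.scaleR_right algebra_simps)
qed

text \<open>The pairing of \<open>b\<close> with the finite rank operator whose matrix is
  \<open>p\<close> in the vectors \<open>g\<close>; for \<open>b = inner\<close> it is the trace of
  that operator.\<close>

definition kernel_form :: "'i set \<Rightarrow> ('i \<Rightarrow> 'i \<Rightarrow> real) \<Rightarrow> ('i \<Rightarrow> 'h) \<Rightarrow> ('h \<Rightarrow> 'h \<Rightarrow> real) \<Rightarrow> real" where
  "kernel_form J p g b = (\<Sum>j\<in>J. \<Sum>k\<in>J. p j k * b (g j) (g k))"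

text \<open>A positive semidefinite kernel satisfies this for every \<open>b\<close> with \<open>bform K b\<close>: the trace
  controls the trace norm.\<close>

definition dominated :: "real \<Rightarrow> ('h::real_inner \<Rightarrow> 'h \<Rightarrow> real) \<Rightarrow> 'i set \<Rightarrow> ('i \<Rightarrow> 'i \<Rightarrow> real) \<Rightarrow> bool" where
  "dominated K b J p \<longleftrightarrow> (\<forall>g. \<bar>kernel_form J p g b\<bar> \<le> K * kernel_form J p g inner)"

lemma dominated_mult_pos:
  fixes b :: "'h::real_inner \<Rightarrow> 'h \<Rightarrow> real" and J :: "'i set"
  assumes "dominated K b J p" "0 \<le> c"
  shows "dominated K b J (\<lambda>j k. c * p j k)"
proof -
  have "kernel_form J (\<lambda>j k. c * p j k) g b' = c * kernel_form J p g b'" for g and b' :: "'h \<Rightarrow> 'h \<Rightarrow> real"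
    by (simp add: kernel_form_def sum_distrib_left mult.assoc)
  then show ?thesis using assms
    by (auto simp: dominated_def abs_mult mult.left_commute[of K] intro!: mult_left_mono)
qed

text \<open>\<open>1 / (x j + x k)\<close> is the integral of the rank one kernels \<open>exp (- s x j) exp (- s x k)\<close>.\<close>

lemma dominated_divide_add:
  fixes b :: "'h::real_inner \<Rightarrow> 'h \<Rightarrow> real" and J :: "'i set"
  assumes p: "dominated K b J p" and b: "bounded_bilinear b" and J: "finite J"
    and x: "\<And>j. j \<in> J \<Longrightarrow> 0 < x j"
  shows "dominated K b J (\<lambda>j k. p j k / (x j + x k))"
  unfolding dominated_def
proof
  fix g :: "'i \<Rightarrow> 'h"
  interpret b: bounded_bilinear b by (rule b)
  define G where "G = (\<lambda>s j. exp (- (x j * s)) *\<^sub>R g j)"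
  have int: "((\<lambda>s. kernel_form J p (G s) c) has_integral
      kernel_form J (\<lambda>j k. p j k / (x j + x k)) g c) {0..}"
    if c: "bounded_bilinear c" for c :: "'h \<Rightarrow> 'h \<Rightarrow> real"
    unfolding kernel_form_def
  proof (intro has_integral_sum J)
    fix j k assume jk: "j \<in> J" "k \<in> J"
    interpret c: bounded_bilinear c by (rule c)
    have "((\<lambda>s. exp (- (x j + x k) * s)) has_integral exp (- (x j + x k) * 0) / (x j + x k)) {0..}"
      using jk x by (intro has_integral_exp_minus_to_infinity add_pos_pos) auto
    then have "((\<lambda>s. (p j k * c (g j) (g k)) * exp (- (x j + x k) * s)) has_integral
        (p j k * c (g j) (g k)) * (1 / (x j + x k))) {0..}"
      by (intro has_integral_mult_right) simp
    moreover have "(p j k * c (g j) (g k)) * exp (- (x j + x k) * s) = p j k * c (G s j) (G s k)" for s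
      by (simp add: G_def c.scaleR_left c.scaleR_right exp_add[symmetric] algebra_simps)
    ultimately show "((\<lambda>s. p j k * c (G s j) (G s k)) has_integral
        p j k / (x j + x k) * c (g j) (g k)) {0..}"
      by (simp only: times_divide_eq_right times_divide_eq_left mult_1_right)
  qed
  let ?I = "kernel_form J (\<lambda>j k. p j k / (x j + x k)) g"
  have le: "\<bar>kernel_form J p (G s) b\<bar> \<le> K * kernel_form J p (G s) inner" for s
    using p by (auto simp: dominated_def)
  have 1: "((\<lambda>s. K * kernel_form J p (G s) inner) has_integral K * ?I inner) {0..}"
    by (intro has_integral_mult_right int bounded_bilinear_inner)
  have "?I b \<le> K * ?I inner"
    by (rule has_integral_le[OF int[OF b] 1]) (use le abs_le_D1 in blast)
  moreover have "- ?I b \<le> K * ?I inner"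
    by (rule has_integral_le[OF has_integral_neg[OF int[OF b]] 1]) (use le abs_le_D2 in blast)
  ultimately show "\<bar>?I b\<bar> \<le> K * ?I inner" by simp
qed

context hilbert_basis
begin

lemma bform_nonneg:
  fixes b :: "'h \<Rightarrow> 'h \<Rightarrow> real"
  assumes "bform K b"
  shows "0 \<le> K"
  using bformD(2)[OF assms, of "e 0" "e 0"] by simp

text \<open>Parseval writes each Gram entry as a sum over \<open>i\<close> of products, so the Gram
  kernel is a sum of rank one kernels, and each of these pairs with \<open>b\<close> as a value
  \<open>b w w\<close> on the diagonal.\<close>

lemma gram_expansion:
  assumes b: "bounded_bilinear b" and J: "finite J"
  shows "(\<lambda>i. b (\<Sum>j\<in>J. (u j \<bullet> e i) *\<^sub>R g j) (\<Sum>j\<in>J. (u j \<bullet> e i) *\<^sub>R g j)) sums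
     kernel_form J (\<lambda>j k. u j \<bullet> u k) g (b :: 'h \<Rightarrow> 'h \<Rightarrow> real)"
proof -
  interpret b: bounded_bilinear b by (rule b)
  have "(\<lambda>i. \<Sum>j\<in>J. \<Sum>k\<in>J. ((u j \<bullet> e i) * (u k \<bullet> e i)) * b (g j) (g k)) sums
      kernel_form J (\<lambda>j k. u j \<bullet> u k) g b"
    unfolding kernel_form_def by (intro sums_sum sums_mult2 parseval_inner)
  moreover have "b (\<Sum>j\<in>J. (u j \<bullet> e i) *\<^sub>R g j) (\<Sum>j\<in>J. (u j \<bullet> e i) *\<^sub>R g j) =
      (\<Sum>j\<in>J. \<Sum>k\<in>J. ((u j \<bullet> e i) * (u k \<bullet> e i)) * b (g j) (g k))" for i
    by (subst b.sum_left, intro sum.cong refl, subst b.sum_right)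
      (simp add: b.scaleR_left b.scaleR_right sum_distrib_left mult_ac)
  ultimately show ?thesis by simp
qed

text \<open>A rank one kernel contributes \<open>b w w\<close>, at most
  \<open>K * (w \<bullet> w)\<close> in absolute value; the claim is the sum of these inequalities.
  Dividing by sums of positive numbers later keeps the property, which produces all kernels in
  use.\<close>

lemma dominated_gram:
  fixes J :: "'i set" and u :: "'i \<Rightarrow> 'h" and b :: "'h \<Rightarrow> 'h \<Rightarrow> real"
  assumes b: "bform K b" and J: "finite J"
  shows "dominated K b J (\<lambda>j k. u j \<bullet> u k)"
  unfolding dominated_def
proof
  fix g :: "'i \<Rightarrow> 'h"
  let ?w = "\<lambda>i. \<Sum>j\<in>J. (u j \<bullet> e i) *\<^sub>R g j" and ?I = "kernel_form J (\<lambda>j k. u j \<bullet> u k) g"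
  have 1: "(\<lambda>i. b (?w i) (?w i)) sums ?I b"
    by (rule gram_expansion[OF bformD(1)[OF b] J])
  have 2: "(\<lambda>i. K * (?w i \<bullet> ?w i)) sums (K * ?I inner)"
    by (intro sums_mult gram_expansion bounded_bilinear_inner J)
  have le: "\<bar>b (?w i) (?w i)\<bar> \<le> K * (?w i \<bullet> ?w i)" for i
    using bformD(2)[OF b, of "?w i" "?w i"] by (simp only: dot_square_norm power2_eq_square mult.assoc)
  have "?I b \<le> K * ?I inner"
    by (rule sums_le[OF _ 1 2]) (use le abs_le_D1 in blast)
  moreover have "- ?I b \<le> K * ?I inner"
    by (rule sums_le[OF _ sums_minus[OF 1] 2]) (use le abs_le_D2 in blast)
  ultimately show "\<bar>?I b\<bar> \<le> K * ?I inner" by simp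
qed

end

section \<open>Resolvents and the Galerkin approximation\<close>

text \<open>The operator \<open>A\<close> has eigenvalues \<open>lam\<close> in the basis \<open>e\<close>; \<open>f\<close> is an orthonormal basis of the
  discrete space in which the discrete operator is diagonal, with eigenvalues \<open>mu\<close>. The two
  approximation properties bound \<open>A\<inverse> - A\<^sub>h\<inverse> P\<^sub>h = (1 - \<Pi>\<^sub>h) A\<inverse>\<close>.\<close>

locale spectral_basis = hilbert_basis e for e :: "nat \<Rightarrow> 'h::{real_inner, banach, second_countable_topology}" +
  fixes lam :: "nat \<Rightarrow> real"
  assumes lam0: "0 < lam 0" and mono_lam: "mono lam"
begin

lemma lam_pos: "0 < lam n"
  using lam0 monoD[OF mono_lam, of 0 n] by simp

definition resolv :: "real \<Rightarrow> 'h \<Rightarrow> 'h" where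
  "resolv x w = (\<Sum>n. (1 / (x + lam n) * (w \<bullet> e n)) *\<^sub>R e n)"

lemma resolv_coeff:
  assumes "0 \<le> x"
  shows "resolv x w \<bullet> e n = 1 / (x + lam n) * (w \<bullet> e n)"
  unfolding resolv_def
proof (rule diag_coeff[where K="1 / lam 0"])
  fix n
  have "lam 0 \<le> x + lam n" using assms monoD[OF mono_lam, of 0 n] by simp
  then show "\<bar>1 / (x + lam n)\<bar> \<le> 1 / lam 0"
    using lam0 by (simp add: frac_le)
qed

lemma norm_resolv:
  assumes "0 < x"
  shows "norm (resolv x w) \<le> 1 / x * norm w"
proof (rule norm_le_of_coeff)
  fix n
  have "1 / (x + lam n) \<le> 1 / x" using assms lam_pos[of n] by (simp add: frac_le)
  then show "\<bar>resolv x w \<bullet> e n\<bar> \<le> 1 / x * \<bar>w \<bullet> e n\<bar>"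
    using assms lam_pos[of n] by (simp add: resolv_coeff abs_mult mult_right_mono del: times_divide_eq_left)
qed (use assms in simp)

text \<open>The form domain of \<open>A\<close>, written without real powers; it agrees with
  \<open>pow_dom e lam (1/2)\<close>.\<close>

definition energy_dom :: "'h set" where
  "energy_dom = {v. summable (\<lambda>n. lam n * (v \<bullet> e n)\<^sup>2)}"

text \<open>\<open>rt x v\<close> is \<open>(x + A)\<^sup>1\<^sup>/\<^sup>2 v\<close>, so that \<open>rt x u \<bullet> rt x v\<close> is the energy form of \<open>x + A\<close>.\<close>

definition rt :: "real \<Rightarrow> 'h \<Rightarrow> 'h" where
  "rt x v = (\<Sum>n. (sqrt (x + lam n) * (v \<bullet> e n)) *\<^sub>R e n)"

lemma rt_summable:
  assumes "0 \<le> x" "v \<in> energy_dom"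
  shows "summable (\<lambda>n. (sqrt (x + lam n) * (v \<bullet> e n))\<^sup>2)"
proof -
  have "(sqrt (x + lam n) * (v \<bullet> e n))\<^sup>2 = x * (v \<bullet> e n)\<^sup>2 + lam n * (v \<bullet> e n)\<^sup>2" for n
    using assms(1) lam_pos[of n] by (simp add: power_mult_distrib algebra_simps)
  then show ?thesis
    using assms(2) summable_coeff_sq[of v] by (simp add: energy_dom_def summable_add summable_mult)
qed

lemma rt_coeff:
  assumes "0 \<le> x" "v \<in> energy_dom"
  shows "rt x v \<bullet> e n = sqrt (x + lam n) * (v \<bullet> e n)"
  unfolding rt_def by (rule series_coeff(2)[OF rt_summable[OF assms]])

lemma energy_dom_subspace: "subspace energy_dom"
  unfolding subspace_def
proof (intro conjI allI ballI)
  show "0 \<in> energy_dom" by (simp add: energy_dom_def)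
next
  fix u v assume "u \<in> energy_dom" "v \<in> energy_dom"
  then have s: "summable (\<lambda>n. 2 * (lam n * (u \<bullet> e n)\<^sup>2) + 2 * (lam n * (v \<bullet> e n)\<^sup>2))"
    by (intro summable_add summable_mult) (auto simp: energy_dom_def)
  have le: "norm (lam n * ((u + v) \<bullet> e n)\<^sup>2) \<le> 2 * (lam n * (u \<bullet> e n)\<^sup>2) + 2 * (lam n * (v \<bullet> e n)\<^sup>2)" for n
  proof -
    have "((u + v) \<bullet> e n)\<^sup>2 \<le> 2 * (u \<bullet> e n)\<^sup>2 + 2 * (v \<bullet> e n)\<^sup>2"
      using sum_squares_bound[of "u \<bullet> e n" "v \<bullet> e n"] by (simp add: inner_add_left power2_sum)
    then have "lam n * ((u + v) \<bullet> e n)\<^sup>2 \<le> lam n * (2 * (u \<bullet> e n)\<^sup>2 + 2 * (v \<bullet> e n)\<^sup>2)"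
      using lam_pos[of n] by (intro mult_left_mono) auto
    then show ?thesis using lam_pos[of n] by (simp add: abs_mult algebra_simps)
  qed
  have "summable (\<lambda>n. lam n * ((u + v) \<bullet> e n)\<^sup>2)"
    by (rule summable_comparison_test[OF _ s]) (use le in blast)
  then show "u + v \<in> energy_dom" by (simp add: energy_dom_def)
next
  fix c v assume "v \<in> energy_dom"
  then have "summable (\<lambda>n. c\<^sup>2 * (lam n * (v \<bullet> e n)\<^sup>2))"
    by (intro summable_mult) (simp add: energy_dom_def)
  then show "c *\<^sub>R v \<in> energy_dom" by (simp add: energy_dom_def power_mult_distrib mult_ac)
qed

lemma resolv_dom:
  assumes "0 \<le> x" shows "resolv x w \<in> energy_dom"
proof -
  have le: "norm (lam n * (resolv x w \<bullet> e n)\<^sup>2) \<le> 1 / lam 0 * (w \<bullet> e n)\<^sup>2" for n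
  proof -
    have l: "0 < lam n" "lam 0 \<le> lam n" "lam n \<le> x + lam n"
      using lam_pos assms monoD[OF mono_lam, of 0 n] by auto
    have "lam n * (1 / (x + lam n))\<^sup>2 \<le> lam n * (1 / lam n)\<^sup>2"
      using l by (intro mult_left_mono power_mono frac_le) auto
    also have "\<dots> \<le> 1 / lam 0"
      using l lam0 by (simp add: power2_eq_square frac_le)
    finally have "lam n * (1 / (x + lam n))\<^sup>2 * (w \<bullet> e n)\<^sup>2 \<le> 1 / lam 0 * (w \<bullet> e n)\<^sup>2"
      by (rule mult_right_mono) simp
    then show ?thesis
      unfolding resolv_coeff[OF assms] using l by (simp add: abs_mult power_mult_distrib power_divide mult_ac)
  qed
  have "summable (\<lambda>n. lam n * (resolv x w \<bullet> e n)\<^sup>2)"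
    by (rule summable_comparison_test[OF _ summable_mult[OF summable_coeff_sq]]) (use le in blast)
  then show ?thesis by (simp add: energy_dom_def)
qed

text \<open>The variational form of \<open>(x + A) y = w\<close>: in each mode the two square roots
  cancel the denominator of the resolvent.\<close>

lemma rt_resolv:
  assumes "0 \<le> x" "v \<in> energy_dom"
  shows "rt x (resolv x w) \<bullet> rt x v = w \<bullet> v"
proof -
  have "(rt x (resolv x w) \<bullet> e n) * (rt x v \<bullet> e n) = (w \<bullet> e n) * (v \<bullet> e n)" for n
  proof -
    have p: "0 < x + lam n" using assms(1) lam_pos[of n] by simp
    have "(rt x (resolv x w) \<bullet> e n) * (rt x v \<bullet> e n)
        = (sqrt (x + lam n) * sqrt (x + lam n)) * (1 / (x + lam n)) * ((w \<bullet> e n) * (v \<bullet> e n))"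
      by (simp only: rt_coeff[OF assms(1) resolv_dom[OF assms(1)]] rt_coeff[OF assms]
          resolv_coeff[OF assms(1)] mult_ac)
    then show ?thesis using p by simp
  qed
  then show ?thesis
    using parseval_inner[of "rt x (resolv x w)" "rt x v"] parseval_inner[of w v]
    by (simp add: sums_unique2)
qed

lemma rt_linear:
  assumes "0 \<le> x"
  shows "u \<in> energy_dom \<Longrightarrow> v \<in> energy_dom \<Longrightarrow> rt x (u + v) = rt x u + rt x v"
    and "u \<in> energy_dom \<Longrightarrow> rt x (c *\<^sub>R u) = c *\<^sub>R rt x u"
    and "u \<in> energy_dom \<Longrightarrow> v \<in> energy_dom \<Longrightarrow> rt x (u - v) = rt x u - rt x v"
    and "finite J \<Longrightarrow> (\<And>j. j \<in> J \<Longrightarrow> g j \<in> energy_dom) \<Longrightarrow> rt x (\<Sum>j\<in>J. c' j *\<^sub>R g j) = (\<Sum>j\<in>J. c' j *\<^sub>R rt x (g j))"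
proof -
  note sub = energy_dom_subspace
  show 1: "rt x (u + v) = rt x u + rt x v" if "u \<in> energy_dom" "v \<in> energy_dom" for u v
    using that by (intro eq_of_coeff)
      (simp add: rt_coeff assms inner_add_left subspace_add[OF sub] distrib_left)
  show 2: "rt x (c *\<^sub>R u) = c *\<^sub>R rt x u" if "u \<in> energy_dom" for u c
    using that by (intro eq_of_coeff)
      (simp add: rt_coeff assms subspace_scale[OF sub])
  show "rt x (u - v) = rt x u - rt x v" if "u \<in> energy_dom" "v \<in> energy_dom" for u v
    using that by (intro eq_of_coeff)
      (simp add: rt_coeff assms inner_diff_left subspace_diff[OF sub] right_diff_distrib)
  show "rt x (\<Sum>j\<in>J. c' j *\<^sub>R g j) = (\<Sum>j\<in>J. c' j *\<^sub>R rt x (g j))"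
    if "finite J" "\<And>j. j \<in> J \<Longrightarrow> g j \<in> energy_dom" for J g c'
    using that
  proof (induction J)
    case empty
    then show ?case using 2[of 0 0] subspace_0[OF sub] by simp
  next
    case (insert k J)
    then show ?case
      using insert.prems by (simp add: 1 2 subspace_scale[OF sub] subspace_sum[OF sub])
  qed
qed

lemma rt_norm:
  assumes "0 \<le> x" "v \<in> energy_dom"
  shows "(norm (rt x v))\<^sup>2 = x * (norm v)\<^sup>2 + (norm (rt 0 v))\<^sup>2"
proof -
  have "(\<lambda>n. x * (v \<bullet> e n)\<^sup>2 + (rt 0 v \<bullet> e n)\<^sup>2) sums (x * (norm v)\<^sup>2 + (norm (rt 0 v))\<^sup>2)"
    by (intro sums_add sums_mult parseval)
  moreover have "x * (v \<bullet> e n)\<^sup>2 + (rt 0 v \<bullet> e n)\<^sup>2 = (rt x v \<bullet> e n)\<^sup>2" for n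
    using assms lam_pos[of n] by (simp add: rt_coeff power_mult_distrib algebra_simps)
  ultimately show ?thesis using parseval[of "rt x v"] sums_unique2 by simp
qed

end

locale galerkin = spectral_basis e lam for e :: "nat \<Rightarrow> 'h::{real_inner, banach, second_countable_topology}" and lam +
  fixes d :: nat and f :: "nat \<Rightarrow> 'h" and mu :: "nat \<Rightarrow> real" and \<kappa> h :: real
  assumes f_ortho: "\<And>m l. m < d \<Longrightarrow> l < d \<Longrightarrow> f m \<bullet> f l = (if m = l then 1 else 0)"
    and f_dom: "\<And>m. m < d \<Longrightarrow> f m \<in> energy_dom"
    and f_energy: "\<And>m l. m < d \<Longrightarrow> l < d \<Longrightarrow> rt 0 (f m) \<bullet> rt 0 (f l) = (if m = l then mu m else 0)"
    and \<kappa>: "0 < \<kappa>" and h: "0 < h"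
    and approx2: "\<And>w. norm (resolv 0 w - (\<Sum>m<d. (w \<bullet> f m / mu m) *\<^sub>R f m)) \<le> \<kappa> * h\<^sup>2 * norm w"
    and approx1: "\<And>w. norm (resolv 0 w - (\<Sum>m<d. (w \<bullet> f m / mu m) *\<^sub>R f m)) \<le> \<kappa> * h * norm (rt 0 (resolv 0 w))"
begin

lemma norm_f: "m < d \<Longrightarrow> norm (f m) = 1"
  using f_ortho[of m m] by (simp add: norm_eq_1)

lemma f_inner_sum:
  assumes "l < d"
  shows "f l \<bullet> (\<Sum>m<d. c m *\<^sub>R f m) = c l" "(\<Sum>m<d. c m *\<^sub>R f m) \<bullet> f l = c l"
proof -
  have "f l \<bullet> (\<Sum>m<d. c m *\<^sub>R f m) = (\<Sum>m<d. if m = l then c l else 0)"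
    unfolding inner_sum_right using assms by (intro sum.cong) (auto simp: f_ortho)
  then show "f l \<bullet> (\<Sum>m<d. c m *\<^sub>R f m) = c l" using assms by simp
  then show "(\<Sum>m<d. c m *\<^sub>R f m) \<bullet> f l = c l" by (simp add: inner_commute)
qed

lemma norm_sum_f: "(norm (\<Sum>m<d. c m *\<^sub>R f m))\<^sup>2 = (\<Sum>m<d. (c m)\<^sup>2)"
  unfolding power2_norm_eq_inner
  by (subst inner_sum_left) (simp add: f_inner_sum power2_eq_square)

lemma bessel_f: "(\<Sum>m<d. (v \<bullet> f m)\<^sup>2) \<le> (norm v)\<^sup>2"
proof -
  let ?q = "\<Sum>m<d. (v \<bullet> f m) *\<^sub>R f m"
  have "?q \<bullet> v = (\<Sum>m<d. (v \<bullet> f m)\<^sup>2)"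
    by (simp add: inner_sum_left power2_eq_square inner_commute[of "f _" v])
  then have "(norm ?q)\<^sup>2 \<le> norm ?q * norm v"
    using norm_sum_f[of "\<lambda>m. v \<bullet> f m"] norm_cauchy_schwarz[of ?q v] by simp
  then have "norm ?q \<le> norm v"
    by (cases "norm ?q = 0") (auto simp: power2_eq_square)
  then have "(norm ?q)\<^sup>2 \<le> (norm v)\<^sup>2" by (rule power_mono) simp
  then show ?thesis by (simp add: norm_sum_f)
qed

lemma norm_sum_f_mult_le:
  assumes "\<And>m. m < d \<Longrightarrow> \<bar>c m\<bar> \<le> C" "0 \<le> C"
  shows "norm (\<Sum>m<d. (c m * (v \<bullet> f m)) *\<^sub>R f m) \<le> C * norm v"
proof -
  have "(\<Sum>m<d. (c m * (v \<bullet> f m))\<^sup>2) \<le> (\<Sum>m<d. C\<^sup>2 * (v \<bullet> f m)\<^sup>2)"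
  proof (rule sum_mono)
    fix m assume "m \<in> {..<d}"
    then have "\<bar>c m * (v \<bullet> f m)\<bar> \<le> \<bar>C * (v \<bullet> f m)\<bar>"
      using assms by (simp add: abs_mult mult_right_mono)
    then show "(c m * (v \<bullet> f m))\<^sup>2 \<le> C\<^sup>2 * (v \<bullet> f m)\<^sup>2"
      by (simp add: abs_le_square_iff power_mult_distrib[symmetric])
  qed
  also have "\<dots> \<le> (C * norm v)\<^sup>2"
    using bessel_f[of v] by (simp add: sum_distrib_left[symmetric] power_mult_distrib mult_left_mono)
  finally show ?thesis
    unfolding norm_sum_f[symmetric] by (rule power2_le_imp_le) (simp_all add: norm_sum_f assms(2) del: power_mult_distrib)
qed

lemma mu_pos:
  assumes "m < d" shows "0 < mu m"
proof -
  have "f m \<noteq> 0" using norm_f[OF assms] by auto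
  then obtain n where n: "f m \<bullet> e n \<noteq> 0" using eq_of_coeff[of "f m" 0] by auto
  have "rt 0 (f m) \<bullet> e n \<noteq> 0"
    using n lam_pos[of n] by (simp add: rt_coeff f_dom[OF assms])
  then have "rt 0 (f m) \<noteq> 0" by auto
  then show ?thesis using f_energy[OF assms assms] by (metis inner_gt_zero_iff)
qed

lemma span_dom: "(\<Sum>m<d. c m *\<^sub>R f m) \<in> energy_dom"
  using f_dom by (intro subspace_sum subspace_scale energy_dom_subspace) auto

lemma rt_f_energy:
  assumes "0 \<le> x" "m < d" "l < d"
  shows "rt x (f m) \<bullet> rt x (f l) = (if m = l then x + mu m else 0)"
proof -
  have "(\<lambda>n. x * ((f m \<bullet> e n) * (f l \<bullet> e n)) + (rt 0 (f m) \<bullet> e n) * (rt 0 (f l) \<bullet> e n)) sums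
     (x * (f m \<bullet> f l) + rt 0 (f m) \<bullet> rt 0 (f l))"
    by (intro sums_add sums_mult parseval_inner)
  moreover have "x * ((f m \<bullet> e n) * (f l \<bullet> e n)) + (rt 0 (f m) \<bullet> e n) * (rt 0 (f l) \<bullet> e n) =
      (rt x (f m) \<bullet> e n) * (rt x (f l) \<bullet> e n)" for n
  proof -
    have "sqrt (x + lam n) * sqrt (x + lam n) = x + lam n" "sqrt (lam n) * sqrt (lam n) = lam n"
      using assms(1) lam_pos[of n] by simp_all
    moreover have "(sqrt a * P) * (sqrt a * Q) = (sqrt a * sqrt a) * (P * Q)" for a P Q :: real
      by simp
    ultimately show ?thesis
      using assms by (simp only: rt_coeff f_dom order_refl distrib_right add_0)
  qed
  ultimately show ?thesis
    using parseval_inner[of "rt x (f m)" "rt x (f l)"] sums_unique2 f_ortho[OF assms(2,3)]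
      f_energy[OF assms(2,3)] by (auto split: if_splits)
qed

text \<open>This is \<open>(x + A_h)^-1 P_h w\<close>, the Galerkin solution of
  \<open>(x + A) y = w\<close>.\<close>

definition gal :: "real \<Rightarrow> 'h \<Rightarrow> 'h" where
  "gal x w = (\<Sum>m<d. (w \<bullet> f m / (x + mu m)) *\<^sub>R f m)"

lemma gal_dom: "gal x w \<in> energy_dom"
  unfolding gal_def by (rule span_dom)

lemma galerkin_orth:
  assumes "0 \<le> x"
  shows "rt x (resolv x w - gal x w) \<bullet> rt x (\<Sum>m<d. c m *\<^sub>R f m) = 0"
proof -
  have "rt x (resolv x w - gal x w) \<bullet> rt x (f l) = 0" if l: "l < d" for l
  proof -
    have "rt x (gal x w) \<bullet> rt x (f l) = (\<Sum>m<d. (w \<bullet> f m / (x + mu m)) * (rt x (f m) \<bullet> rt x (f l)))"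
      unfolding gal_def by (subst rt_linear(4)[OF assms]) (use f_dom in \<open>auto simp: inner_sum_left\<close>)
    also have "\<dots> = (\<Sum>m<d. if m = l then w \<bullet> f l else 0)"
      using l assms mu_pos[OF l] by (intro sum.cong refl) (auto simp: rt_f_energy)
    also have "\<dots> = w \<bullet> f l" using l by simp
    finally show ?thesis
      by (simp add: rt_linear(3)[OF assms resolv_dom[OF assms] gal_dom] inner_diff_left
          rt_resolv[OF assms f_dom[OF l]])
  qed
  then show ?thesis
    by (subst rt_linear(4)[OF assms]) (use f_dom in \<open>auto simp: inner_sum_right\<close>)
qed

text \<open>Cea's argument: Galerkin orthogonality and Pythagoras in the energy norm of
  \<open>x + A\<close>.\<close>

lemma gal_best:
  assumes "0 \<le> x"
  shows "norm (rt x (resolv x w - gal x w)) \<le> norm (rt x (resolv x w - (\<Sum>m<d. c m *\<^sub>R f m)))"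
proof -
  let ?v = "\<Sum>m<d. c m *\<^sub>R f m" and ?y = "resolv x w"
  have "gal x w - ?v = (\<Sum>m<d. (w \<bullet> f m / (x + mu m) - c m) *\<^sub>R f m)"
    by (simp add: gal_def scaleR_diff_left sum_subtractf)
  then have "orthogonal (rt x (?y - gal x w)) (rt x (gal x w - ?v))"
    using galerkin_orth[OF assms] by (simp add: orthogonal_def)
  then have "(norm (rt x (?y - gal x w) + rt x (gal x w - ?v)))\<^sup>2 =
      (norm (rt x (?y - gal x w)))\<^sup>2 + (norm (rt x (gal x w - ?v)))\<^sup>2"
    by (rule norm_add_Pythagorean)
  moreover have "rt x (?y - gal x w) + rt x (gal x w - ?v) = rt x (?y - ?v)"
    by (simp add: rt_linear(3) assms resolv_dom gal_dom span_dom)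
  ultimately have "(norm (rt x (?y - gal x w)))\<^sup>2 \<le> (norm (rt x (?y - ?v)))\<^sup>2" by simp
  then show ?thesis by (rule power2_le_imp_le) simp
qed

text \<open>The approximation properties concern \<open>A^-1\<close> only, whereas a bound uniform
  in the shift \<open>x\<close> is needed. Since \<open>(x + A)^-1 w = A^-1 z\<close> with
  \<open>z = A (x + A)^-1 w\<close> and \<open>norm z \<le> norm w\<close>, the unshifted elliptic
  projection of \<open>A^-1 z\<close> is an admissible competitor, and its energy error splits into
  a part weighted by \<open>x\<close> and the pure energy of \<open>A\<close>.\<close>

lemma energy_error:
  assumes "0 \<le> x"
  shows "(norm (rt x (resolv x w - gal x w)))\<^sup>2 \<le> (\<kappa>\<^sup>2 + \<kappa>) * h\<^sup>2 * (norm w)\<^sup>2"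
proof -
  define z where "z = w - x *\<^sub>R resolv x w"
  have zc: "z \<bullet> e n = lam n / (x + lam n) * (w \<bullet> e n)" for n
    using assms lam_pos[of n] by (simp add: z_def inner_diff_left resolv_coeff field_simps)
  have y: "resolv x w = resolv 0 z"
    using assms lam_pos by (intro eq_of_coeff) (simp add: resolv_coeff zc less_imp_neq[symmetric])
  define F where "F = resolv 0 z - gal 0 z"
  have Fd: "F \<in> energy_dom"
    unfolding F_def by (intro subspace_diff energy_dom_subspace resolv_dom gal_dom) simp
  have nz: "norm z \<le> norm w"
  proof -
    have "norm z \<le> 1 * norm w"
    proof (rule norm_le_of_coeff)
      fix n
      have "lam n / (x + lam n) \<le> 1" "0 \<le> lam n / (x + lam n)" using assms lam_pos[of n] by auto
      then show "\<bar>z \<bullet> e n\<bar> \<le> 1 * \<bar>w \<bullet> e n\<bar>"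
        by (simp only: zc abs_mult abs_of_nonneg mult_right_mono abs_ge_zero)
    qed simp
    then show ?thesis by simp
  qed
  \<comment> \<open>Self-duality: by Galerkin orthogonality the energy of the elliptic error
    \<open>F\<close> equals \<open>z \<bullet> F\<close>, and the \<open>h\<^sup>2\<close> bound for
    \<open>F\<close> gives the summand \<open>\<kappa>\<close> of the constant.\<close>
  have 1: "(norm (rt 0 F))\<^sup>2 \<le> \<kappa> * h\<^sup>2 * (norm w)\<^sup>2"
  proof -
    have "rt 0 F \<bullet> rt 0 (gal 0 z) = 0"
      unfolding F_def gal_def[of 0 z] using galerkin_orth[of 0 z] by (simp add: gal_def)
    then have "(norm (rt 0 F))\<^sup>2 = rt 0 F \<bullet> rt 0 (resolv 0 z)"
      unfolding power2_norm_eq_inner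
      by (subst (2) F_def) (simp add: rt_linear(3) resolv_dom gal_dom inner_diff_right)
    also have "\<dots> = z \<bullet> F" using rt_resolv[of 0 F z] Fd by (simp add: inner_commute)
    also have "\<dots> \<le> norm z * norm F" by (rule norm_cauchy_schwarz)
    also have "\<dots> \<le> norm w * (\<kappa> * h\<^sup>2 * norm w)"
    proof (rule mult_mono[OF nz])
      have "norm F \<le> \<kappa> * h\<^sup>2 * norm z" using approx2[of z] by (simp add: F_def gal_def)
      also have "\<dots> \<le> \<kappa> * h\<^sup>2 * norm w" using nz \<kappa> by (intro mult_left_mono) auto
      finally show "norm F \<le> \<kappa> * h\<^sup>2 * norm w" .
    qed auto
    finally show ?thesis by (simp add: power2_eq_square mult_ac)
  qed
  \<comment> \<open>The weight \<open>x\<close> is paid for by the first-order estimate: the squared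
    coefficients of \<open>A^(1/2) A^-1 z\<close>, multiplied by \<open>x\<close>, carry the factor
    \<open>x * lam n / (x + lam n)\<^sup>2\<close>, which is at most 1. This gives the summand
    \<open>\<kappa>\<^sup>2\<close>.\<close>
  have 2: "x * (norm F)\<^sup>2 \<le> \<kappa>\<^sup>2 * h\<^sup>2 * (norm w)\<^sup>2"
  proof -
    have "norm F \<le> \<kappa> * h * norm (rt 0 (resolv 0 z))" using approx1[of z] by (simp add: F_def gal_def)
    then have "(norm F)\<^sup>2 \<le> (\<kappa> * h * norm (rt 0 (resolv 0 z)))\<^sup>2" by (rule power_mono) simp
    then have "x * (norm F)\<^sup>2 \<le> x * (\<kappa>\<^sup>2 * h\<^sup>2 * (norm (rt 0 (resolv 0 z)))\<^sup>2)"
      using assms by (intro mult_left_mono) (simp_all add: power_mult_distrib)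
    also have "\<dots> = \<kappa>\<^sup>2 * h\<^sup>2 * (x * (norm (rt 0 (resolv 0 z)))\<^sup>2)" by simp
    also have "x * (norm (rt 0 (resolv 0 z)))\<^sup>2 \<le> (norm w)\<^sup>2"
    proof (rule sums_le[OF _ sums_mult[OF parseval] parseval])
      fix n
      have l: "0 < lam n" "0 < x + lam n" using lam_pos assms by (auto simp: add_nonneg_pos)
      have "x * (rt 0 (resolv 0 z) \<bullet> e n)\<^sup>2 = (x * lam n / (x + lam n)\<^sup>2) * (w \<bullet> e n)\<^sup>2"
        using l by (simp add: rt_coeff resolv_dom resolv_coeff zc power_mult_distrib power_divide)
      also have "\<dots> \<le> 1 * (w \<bullet> e n)\<^sup>2"
      proof (rule mult_right_mono)
        have "x * lam n \<le> (x + lam n)\<^sup>2"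
          using mult_nonneg_nonneg[of x "lam n"] zero_le_power2[of x] zero_le_power2[of "lam n"] assms l
          unfolding power2_sum by linarith
        then show "x * lam n / (x + lam n)\<^sup>2 \<le> 1" using l by simp
      qed simp
      finally show "x * (rt 0 (resolv 0 z) \<bullet> e n)\<^sup>2 \<le> (w \<bullet> e n)\<^sup>2" by simp
    qed
    finally show ?thesis using \<kappa> by (simp add: mult_left_mono)
  qed
  have "norm (rt x (resolv x w - gal x w)) \<le> norm (rt x F)"
    using gal_best[OF assms, of w "\<lambda>m. z \<bullet> f m / (0 + mu m)"]
    by (simp only: F_def y[symmetric] gal_def[of 0 z])
  then have "(norm (rt x (resolv x w - gal x w)))\<^sup>2 \<le> (norm (rt x F))\<^sup>2" by (rule power_mono) simp
  also have "\<dots> = x * (norm F)\<^sup>2 + (norm (rt 0 F))\<^sup>2" by (rule rt_norm[OF assms Fd])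
  finally show ?thesis using 1 2 by (simp add: algebra_simps)
qed

text \<open>Aubin--Nitsche duality.\<close>

lemma resolvent_error:
  assumes "0 \<le> x"
  shows "norm (resolv x w - gal x w) \<le> (\<kappa>\<^sup>2 + \<kappa>) * h\<^sup>2 * norm w"
proof -
  define c where "c = sqrt ((\<kappa>\<^sup>2 + \<kappa>) * h\<^sup>2)"
  have c2: "c\<^sup>2 = (\<kappa>\<^sup>2 + \<kappa>) * h\<^sup>2" and c0: "0 \<le> c" using \<kappa> by (simp_all add: c_def)
  have en: "norm (rt x (resolv x v - gal x v)) \<le> c * norm v" for v
  proof (rule power2_le_imp_le)
    show "(norm (rt x (resolv x v - gal x v)))\<^sup>2 \<le> (c * norm v)\<^sup>2"
      using energy_error[OF assms, of v] by (simp add: c2 power_mult_distrib)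
  qed (simp add: c0)
  define E where "E = resolv x w - gal x w"
  have Ed: "E \<in> energy_dom"
    unfolding E_def by (intro subspace_diff energy_dom_subspace resolv_dom gal_dom assms)
  have "rt x E \<bullet> rt x (gal x E) = 0"
    unfolding E_def[symmetric] gal_def[of x E]
    using galerkin_orth[OF assms, of w] by (simp add: E_def)
  then have "(norm E)\<^sup>2 = rt x (resolv x E - gal x E) \<bullet> rt x E"
    using rt_resolv[OF assms Ed, of E]
    by (simp add: rt_linear(3) assms resolv_dom gal_dom inner_diff_left power2_norm_eq_inner
        inner_commute[of "rt x (gal x E)"])
  also have "\<dots> \<le> norm (rt x (resolv x E - gal x E)) * norm (rt x E)" by (rule norm_cauchy_schwarz)
  also have "\<dots> \<le> (c * norm E) * (c * norm w)"
    using en[of E] en[of w] c0 by (intro mult_mono) (auto simp: E_def)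
  finally have "norm E * norm E \<le> norm E * (c\<^sup>2 * norm w)" by (simp add: power2_eq_square mult_ac)
  then have "norm E \<le> c\<^sup>2 * norm w"
    by (cases "norm E = 0") (auto simp: c0)
  then show ?thesis by (simp add: c2 E_def)
qed

lemma norm_gal:
  assumes "0 < x"
  shows "norm (gal x w) \<le> 1 / x * norm w"
proof -
  have "norm (\<Sum>m<d. (1 / (x + mu m) * (w \<bullet> f m)) *\<^sub>R f m) \<le> 1 / x * norm w"
  proof (rule norm_sum_f_mult_le)
    fix m assume "m < d"
    then have "0 < mu m" by (rule mu_pos)
    then show "\<bar>1 / (x + mu m)\<bar> \<le> 1 / x" using assms by (simp add: frac_le)
  qed (use assms in simp)
  then show ?thesis by (simp add: gal_def)
qed

lemma resolvent_error_trivial: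
  assumes "0 < x"
  shows "norm (resolv x w - gal x w) \<le> 2 / x * norm w"
  using norm_triangle_ineq4[of "resolv x w" "gal x w"] norm_resolv[OF assms, of w] norm_gal[OF assms, of w]
  by simp

text \<open>In other words \<open>(x + A_h)^-1 P_h\<close> is below \<open>(x + A)^-1\<close> as a
  quadratic form. The Galerkin solution is the energy-orthogonal projection of the exact one, and
  the squared energy of either solution is its inner product with \<open>w\<close>.\<close>

lemma resolvent_monotone:
  assumes "0 \<le> x"
  shows "(\<Sum>m<d. (w \<bullet> f m)\<^sup>2 / (x + mu m)) \<le> w \<bullet> resolv x w"
proof -
  let ?y = "resolv x w" and ?g = "gal x w"
  have "rt x (?y - ?g) \<bullet> rt x ?g = 0"
    using galerkin_orth[OF assms, of w "\<lambda>m. w \<bullet> f m / (x + mu m)"] by (simp add: gal_def)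
  then have eq: "rt x ?y \<bullet> rt x ?g = (norm (rt x ?g))\<^sup>2"
    by (simp add: rt_linear(3) assms resolv_dom gal_dom inner_diff_left power2_norm_eq_inner)
  have "(norm (rt x ?g))\<^sup>2 \<le> norm (rt x ?y) * norm (rt x ?g)"
    unfolding eq[symmetric] by (rule norm_cauchy_schwarz)
  then have "norm (rt x ?g) \<le> norm (rt x ?y)"
    by (cases "norm (rt x ?g) = 0") (auto simp: power2_eq_square)
  then have "(norm (rt x ?g))\<^sup>2 \<le> (norm (rt x ?y))\<^sup>2" by (rule power_mono) simp
  moreover have "(norm (rt x ?g))\<^sup>2 = w \<bullet> ?g"
    using eq rt_resolv[OF assms gal_dom, of w x w] by simp
  moreover have "(norm (rt x ?y))\<^sup>2 = w \<bullet> ?y"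
    using rt_resolv[OF assms resolv_dom[OF assms], of w w] by (simp add: power2_norm_eq_inner)
  moreover have "w \<bullet> ?g = (\<Sum>m<d. (w \<bullet> f m)\<^sup>2 / (x + mu m))"
    by (simp add: gal_def inner_sum_right power2_eq_square)
  ultimately show ?thesis by simp
qed

end

section \<open>Trace estimates for the stationary covariances\<close>

text \<open>Each of \<open>a\<close> and \<open>b\<close> is at most \<open>a + b\<close>, and the
  exponents add up to 1. It divides the decay of a resolvent between \<open>lam n\<close>, where it
  makes the trace finite, and the shift, where it becomes a rate.\<close>

lemma inverse_add_le_powr:
  fixes a b g :: real
  assumes "0 < a" "0 < b" "0 \<le> g" "g \<le> 1"
  shows "1 / (a + b) \<le> a powr - (1 - g) * b powr - g"
proof -
  have "a powr (1 - g) * b powr g \<le> (a + b) powr (1 - g) * (a + b) powr g"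
    using assms by (intro mult_mono powr_mono2) auto
  also have "\<dots> = a + b" using assms by (simp add: powr_add[symmetric])
  finally have "1 / (a + b) \<le> 1 / (a powr (1 - g) * b powr g)"
    using assms by (intro frac_le) auto
  also have "\<dots> = a powr - (1 - g) * b powr - g"
    by (simp only: powr_minus inverse_eq_divide mult_1 times_divide_times_eq)
  finally show ?thesis .
qed

lemma min_le_powr:
  fixes a b g :: real
  assumes "0 < a" "0 < b" "0 \<le> g" "g \<le> 1"
  shows "min a b \<le> a powr g * b powr (1 - g)"
proof -
  have "min a b = min a b powr g * min a b powr (1 - g)"
    using assms by (simp add: powr_add[symmetric])
  also have "\<dots> \<le> a powr g * b powr (1 - g)"
    using assms by (intro mult_mono powr_mono2) auto
  finally show ?thesis .
qed

text \<open>\<open>R\<close> stands for \<open>Q^(1/2)\<close>. The bound on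
  \<open>A^\<beta> Q\<close> enters as the decay of \<open>R (R (e n))\<close>, that is of
  \<open>Q\<close> on eigenvectors.\<close>

locale noise = spectral_basis e lam for e :: "nat \<Rightarrow> 'h::{real_inner, banach, second_countable_topology}" and lam +
  fixes R :: "'h \<Rightarrow> 'h" and cq \<alpha> \<beta> :: real
  assumes R_linear: "bounded_linear R"
    and R_sym: "R u \<bullet> v = u \<bullet> R v"
    and cq: "0 \<le> cq"
    and Q_decay: "norm (R (R (e n))) \<le> cq * lam n powr - \<beta>"
    and trace: "summable (\<lambda>n. lam n powr - \<alpha>)"
    and \<beta>0: "0 \<le> \<beta>" and \<beta>\<alpha>: "\<beta> \<le> \<alpha>" and \<gamma>0: "0 < 1 - \<alpha> + \<beta>"
    and lam_lim: "filterlim lam at_top sequentially"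
begin

text \<open>From here on \<open>\<gamma>\<close> is the endpoint exponent itself; smaller exponents
  return only through \<open>rate_at_endpoint\<close>.\<close>

abbreviation "\<gamma> \<equiv> 1 - \<alpha> + \<beta>"

lemma \<gamma>1: "\<gamma> \<le> 1" using \<beta>\<alpha> by simp

definition trA :: real where "trA = (\<Sum>n. lam n powr - \<alpha>)"
text \<open>By symmetry of \<open>R\<close> this is the diagonal entry of \<open>Q\<close> at
  \<open>e n\<close>, so that the sum of \<open>q n / (2 * lam n)\<close> is the trace of the
  stationary covariance.\<close>

definition q :: "nat \<Rightarrow> real" where "q n = (norm (R (e n)))\<^sup>2"

lemma trA_nonneg: "0 \<le> trA"
  unfolding trA_def by (intro suminf_nonneg trace) simp

lemma sum_trace_le: "(\<Sum>n<N. lam n powr - \<alpha>) \<le> trA"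
  unfolding trA_def by (intro sum_le_suminf trace) auto

lemma q_nonneg: "0 \<le> q n" by (simp add: q_def)

lemma q_decay: "q n \<le> cq * lam n powr - \<beta>"
proof -
  have "q n = R (R (e n)) \<bullet> e n" by (simp add: q_def power2_norm_eq_inner R_sym)
  also have "\<dots> \<le> norm (R (R (e n))) * norm (e n)" by (rule norm_cauchy_schwarz)
  finally show ?thesis using Q_decay[of n] by simp
qed

text \<open>The factor \<open>lam n powr - \<beta>\<close> from \<open>Q\<close> and
  \<open>lam n powr - (1 - \<gamma>)\<close> from the resolvent combine to exactly
  \<open>lam n powr - \<alpha>\<close>, as \<open>\<beta> + 1 - \<gamma> = \<alpha>\<close>. Summed
  over \<open>n\<close>, the trace of \<open>Q (x + A)^-1\<close> decays like
  \<open>x powr - \<gamma>\<close>.\<close>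

lemma q_resolvent:
  assumes "0 < x"
  shows "q n / (x + lam n) \<le> cq * x powr - \<gamma> * lam n powr - \<alpha>"
proof -
  have "q n / (x + lam n) = q n * (1 / (lam n + x))" by (simp add: add.commute)
  also have "\<dots> \<le> (cq * lam n powr - \<beta>) * (lam n powr - (1 - \<gamma>) * x powr - \<gamma>)"
    using assms lam_pos[of n] \<gamma>0 \<gamma>1 cq
    by (intro mult_mono q_decay inverse_add_le_powr) auto
  also have "\<dots> = cq * x powr - \<gamma> * (lam n powr - \<beta> * lam n powr - (1 - \<gamma>))" by (simp only: mult_ac)
  also have "lam n powr - \<beta> * lam n powr - (1 - \<gamma>) = lam n powr - \<alpha>"
    by (simp add: powr_add[symmetric])
  finally show ?thesis .
qed

lemma lam_powr_split: "lam n powr - \<beta> * lam n powr - 1 = lam n powr - \<gamma> * lam n powr - \<alpha>"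
  unfolding powr_add[symmetric] by (rule arg_cong[where f="(powr) (lam n)"]) simp

lemma lam_powr_\<gamma>: "lam n powr - \<gamma> \<le> lam 0 powr - \<gamma>"
  using lam0 lam_pos[of n] monoD[OF mono_lam, of 0 n] \<gamma>0
  by (intro powr_mono2') auto

lemma q_div_lam: "q n / lam n \<le> cq * lam 0 powr - \<gamma> * lam n powr - \<alpha>"
proof -
  have inv: "lam n powr - 1 = inverse (lam n)" using lam_pos[of n] by (simp add: powr_minus)
  have "q n / lam n \<le> (cq * lam n powr - \<beta>) * lam n powr - 1"
    unfolding divide_inverse inv using lam_pos[of n] by (intro mult_right_mono q_decay) simp
  also have "\<dots> = cq * (lam n powr - \<gamma> * lam n powr - \<alpha>)"
    by (simp only: mult.assoc lam_powr_split)
  also have "\<dots> \<le> cq * (lam 0 powr - \<gamma> * lam n powr - \<alpha>)"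
    by (intro mult_left_mono mult_right_mono lam_powr_\<gamma> cq) auto
  finally show ?thesis by (simp add: mult_ac)
qed

lemma summable_q: "summable (\<lambda>n. q n / lam n)"
proof (rule summable_comparison_test[OF _ summable_mult[OF trace]])
  show "\<exists>N. \<forall>n\<ge>N. norm (q n / lam n) \<le> (cq * lam 0 powr - \<gamma>) * lam n powr - \<alpha>"
    using q_div_lam q_nonneg lam_pos by (intro exI[of _ 0]) (simp add: less_imp_le)
qed

lemma summable_q_resolvent:
  assumes "0 \<le> x" shows "summable (\<lambda>n. q n / (x + lam n))"
proof (rule summable_comparison_test[OF _ summable_q])
  have "norm (q n / (x + lam n)) \<le> q n / lam n" for n
    using q_nonneg[of n] lam_pos[of n] assms by (simp add: frac_le)
  then show "\<exists>N. \<forall>n\<ge>N. norm (q n / (x + lam n)) \<le> q n / lam n" by blast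
qed

definition trK :: real where "trK = (\<Sum>n. q n / lam n) / 2"

lemma trK_nonneg: "0 \<le> trK"
  unfolding trK_def using q_nonneg lam_pos
  by (intro divide_nonneg_nonneg suminf_nonneg summable_q) (auto simp: less_imp_le)

text \<open>The pairing of \<open>b\<close> with the stationary covariance, compressed to the first
  \<open>N\<close> modes; \<open>1 / (lam j + lam k)\<close> is the integral of
  \<open>exp (- s * (lam j + lam k))\<close> over positive \<open>s\<close>.\<close>

definition TN :: "nat \<Rightarrow> ('h \<Rightarrow> 'h \<Rightarrow> real) \<Rightarrow> real" where
  "TN N b = kernel_form {..<N} (\<lambda>j k. (R (e j) \<bullet> R (e k)) / (lam j + lam k)) e b"

lemma TN_dominated:
  assumes "bform K b"
  shows "\<bar>TN N b\<bar> \<le> K * TN N inner"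
proof -
  have "dominated K b {..<N} (\<lambda>j k. (R (e j) \<bullet> R (e k)) / (lam j + lam k))"
    by (intro dominated_divide_add dominated_gram assms bformD(1)[OF assms] lam_pos) auto
  then show ?thesis by (simp add: dominated_def TN_def)
qed

lemma TN_inner: "TN N inner = (\<Sum>n<N. q n / lam n) / 2"
proof -
  have "TN N inner = (\<Sum>j<N. \<Sum>k<N. if j = k then q j / lam j / 2 else 0)"
    unfolding TN_def kernel_form_def
    by (intro sum.cong refl) (auto simp: ortho q_def power2_norm_eq_inner)
  also have "\<dots> = (\<Sum>n<N. q n / lam n / 2)" by (simp add: sum.delta)
  finally show ?thesis by (simp add: sum_divide_distrib)
qed

lemma TN_inner_le: "TN N inner \<le> trK"
  unfolding TN_inner trK_def using q_nonneg lam_pos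
  by (intro divide_right_mono sum_le_suminf summable_q) (auto simp: less_imp_le)

text \<open>The price of the compression to \<open>N\<close> modes in \<open>TN_Th\<close>: the
  tails of the truncated resolvents, entering four times, and the trace missing from
  \<open>TN N inner\<close>. It vanishes as \<open>N\<close> grows with the discretization
  fixed.\<close>

definition trunc_err :: "nat \<Rightarrow> real" where
  "trunc_err N = 4 * (cq * trA * lam N powr - \<gamma>) + (trK - TN N inner)"

lemma trunc_err_lim: "trunc_err \<longlonglongrightarrow> 0"
proof -
  have "(\<lambda>N. lam N powr - \<gamma>) \<longlonglongrightarrow> 0"
    using \<gamma>0 by (intro tendsto_neg_powr lam_lim) auto
  moreover have "(\<lambda>N. (\<Sum>n<N. q n / lam n) / 2) \<longlonglongrightarrow> trK"
    unfolding trK_def using summable_LIMSEQ[OF summable_q] by (intro tendsto_divide) auto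
  ultimately have "(\<lambda>N. 4 * (cq * trA * lam N powr - \<gamma>) + (trK - (\<Sum>n<N. q n / lam n) / 2)) \<longlonglongrightarrow>
      4 * (cq * trA * 0) + (trK - trK)"
    by (intro tendsto_intros)
  then show ?thesis unfolding trunc_err_def TN_inner by simp
qed

lemma resolv_trunc:
  assumes "0 \<le> x"
  shows "norm (resolv x w - (\<Sum>k<N. (resolv x w \<bullet> e k) *\<^sub>R e k)) \<le> 1 / (x + lam N) * norm w"
proof (rule norm_le_of_coeff)
  fix i
  have p: "0 < x + lam N" using assms lam_pos[of N] by simp
  show "\<bar>(resolv x w - (\<Sum>k<N. (resolv x w \<bullet> e k) *\<^sub>R e k)) \<bullet> e i\<bar> \<le> 1 / (x + lam N) * \<bar>w \<bullet> e i\<bar>"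
  proof (cases "i < N")
    case True
    then show ?thesis using p by (simp add: inner_diff_left inner_sum_e)
  next
    case False
    then have "lam N \<le> lam i" by (intro monoD[OF mono_lam]) simp
    then have "1 / (x + lam i) \<le> 1 / (x + lam N)" using p by (intro frac_le) auto
    then have "1 / (x + lam i) * \<bar>w \<bullet> e i\<bar> \<le> 1 / (x + lam N) * \<bar>w \<bullet> e i\<bar>" by (rule mult_right_mono) simp
    moreover have "\<bar>resolv x w \<bullet> e i\<bar> = 1 / (x + lam i) * \<bar>w \<bullet> e i\<bar>"
      using assms lam_pos[of i] by (simp add: resolv_coeff abs_mult)
    ultimately show ?thesis using False by (simp add: inner_diff_left inner_sum_e)
  qed
qed (use assms lam_pos[of N] in simp)

text \<open>\<open>k\<^sup>2 + k\<close> comes from the duality bound for resolvents,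
  \<open>2\<close> from the trivial bound, and the maximum absorbs the surplus factor
  \<open>lam n powr - \<gamma>\<close> that appears when the mesh size exceeds 1.\<close>

definition Cz :: "real \<Rightarrow> real" where
  "Cz k = cq * (k\<^sup>2 + k + 2) * max 1 (lam 0 powr - \<gamma>)"

lemma Cz_nonneg: "0 \<le> k \<Longrightarrow> 0 \<le> Cz k"
  using cq by (simp add: Cz_def)

end

locale galerkin_noise = galerkin e lam d f mu \<kappa> h + noise e lam R cq \<alpha> \<beta>
  for e :: "nat \<Rightarrow> 'h::{real_inner, banach, second_countable_topology}" and lam d f mu \<kappa> h R cq \<alpha> \<beta>
begin

lemma trace_monotone:
  assumes "0 \<le> x"
  shows "(\<Sum>m<d. (norm (R (f m)))\<^sup>2 / (x + mu m)) \<le> (\<Sum>n. q n / (x + lam n))"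
proof -
  have "(\<lambda>i. \<Sum>m<d. (R (e i) \<bullet> f m)\<^sup>2 / (x + mu m)) sums (\<Sum>m<d. (norm (R (f m)))\<^sup>2 / (x + mu m))"
    using parseval[of "R (f _)"]
    by (intro sums_sum sums_divide) (simp add: R_sym inner_commute[of "f _"])
  then have lim: "(\<lambda>I. \<Sum>i<I. \<Sum>m<d. (R (e i) \<bullet> f m)\<^sup>2 / (x + mu m)) \<longlonglongrightarrow>
      (\<Sum>m<d. (norm (R (f m)))\<^sup>2 / (x + mu m))"
    by (simp add: sums_def)
  show ?thesis
  proof (rule LIMSEQ_le_const2[OF lim], intro exI[of _ 0] allI impI)
    fix I :: nat
    have s: "(\<lambda>n. (R (e i) \<bullet> e n)\<^sup>2 / (x + lam n)) sums (R (e i) \<bullet> resolv x (R (e i)))" for i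
      using parseval_inner[of "R (e i)" "resolv x (R (e i))"] assms
      by (simp add: resolv_coeff power2_eq_square)
    have S: "(\<lambda>n. \<Sum>i<I. (R (e i) \<bullet> e n)\<^sup>2 / (x + lam n)) sums (\<Sum>i<I. R (e i) \<bullet> resolv x (R (e i)))"
      by (intro sums_sum s)
    have "(\<Sum>i<I. \<Sum>m<d. (R (e i) \<bullet> f m)\<^sup>2 / (x + mu m)) \<le> (\<Sum>i<I. R (e i) \<bullet> resolv x (R (e i)))"
      by (intro sum_mono resolvent_monotone assms)
    also have "\<dots> \<le> (\<Sum>n. q n / (x + lam n))"
    proof (rule sums_le[OF _ S summable_sums[OF summable_q_resolvent[OF assms]]])
      fix n
      have "(\<Sum>i<I. (R (e n) \<bullet> e i)\<^sup>2) \<le> q n" unfolding q_def by (rule bessel) simp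
      then have "(\<Sum>i<I. (R (e n) \<bullet> e i)\<^sup>2) / (x + lam n) \<le> q n / (x + lam n)"
        using assms lam_pos[of n] by (intro divide_right_mono) auto
      then show "(\<Sum>i<I. (R (e i) \<bullet> e n)\<^sup>2 / (x + lam n)) \<le> q n / (x + lam n)"
        by (simp add: R_sym inner_commute[of "e n"] sum_divide_distrib R_sym[of "e n", symmetric])
    qed
    finally show "(\<Sum>i<I. \<Sum>m<d. (R (e i) \<bullet> f m)\<^sup>2 / (x + mu m)) \<le> (\<Sum>n. q n / (x + lam n))" .
  qed
qed

definition Th :: "('h \<Rightarrow> 'h \<Rightarrow> real) \<Rightarrow> real" where
  "Th b = kernel_form {..<d} (\<lambda>j k. (R (f j) \<bullet> R (f k)) / (mu j + mu k)) f b"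

text \<open>For \<open>\<delta> = (2 * \<theta> - 1) * dt\<close> this is the stationary covariance
  of the \<open>\<theta>\<close>-scheme; the denominator is identified in
  \<open>TD_horizon\<close>.\<close>

definition TD :: "real \<Rightarrow> ('h \<Rightarrow> 'h \<Rightarrow> real) \<Rightarrow> real" where
  "TD \<delta> b = kernel_form {..<d} (\<lambda>j k. (R (f j) \<bullet> R (f k)) / (mu j + mu k + \<delta> * mu j * mu k)) f b"

lemma kernel_form_f_inner: "kernel_form {..<d} p f inner = (\<Sum>m<d. p m m)"
proof -
  have "kernel_form {..<d} p f inner = (\<Sum>j<d. \<Sum>k<d. if j = k then p j j else 0)"
    unfolding kernel_form_def by (intro sum.cong refl) (auto simp: f_ortho)
  then show ?thesis by (simp add: sum.delta)
qed

lemma Th_inner_le: "Th inner \<le> trK"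
proof -
  have "Th inner = (\<Sum>m<d. (norm (R (f m)))\<^sup>2 / (0 + mu m)) / 2"
    unfolding Th_def kernel_form_f_inner
    by (simp add: sum_divide_distrib power2_norm_eq_inner mult.commute)
  then show ?thesis using trace_monotone[of 0] by (simp add: trK_def)
qed

text \<open>The difference of the two kernels is the kernel of \<open>Th\<close> times
  \<open>\<delta> / ((1 / mu j + \<delta> / 2) + (1 / mu k + \<delta> / 2))\<close>. This is again
  division by a sum of a positive function of \<open>j\<close> and the same function of
  \<open>k\<close>, so the difference is of positive type and only its trace matters. That trace is
  half the discrete resolvent trace at \<open>x = 2 / \<delta>\<close>, hence of order
  \<open>\<delta> powr \<gamma>\<close>.\<close>

lemma Th_TD:
  assumes b: "bform K b" and \<delta>: "0 < \<delta>"
  shows "\<bar>Th b - TD \<delta> b\<bar> \<le> K * (cq * trA * \<delta> powr \<gamma>)"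
proof -
  define p where "p = (\<lambda>j k. (R (f j) \<bullet> R (f k)) / (mu j + mu k) / ((1 / mu j + \<delta> / 2) + (1 / mu k + \<delta> / 2)))"
  have p_eq: "\<delta> * p j k = (R (f j) \<bullet> R (f k)) / (mu j + mu k)
      - (R (f j) \<bullet> R (f k)) / (mu j + mu k + \<delta> * mu j * mu k)" if "j < d" "k < d" for j k
  proof -
    define a b' u where "a = mu j" and "b' = mu k" and "u = R (f j) \<bullet> R (f k)"
    have pos: "0 < a" "0 < b'" using mu_pos that by (auto simp: a_def b'_def)
    have s: "1 / a + \<delta> / 2 + (1 / b' + \<delta> / 2) = (a + b' + \<delta> * a * b') / (a * b')"
      using pos by (simp add: field_simps)
    have n: "a + b' \<noteq> 0" "a + b' + \<delta> * a * b' \<noteq> 0"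
      using pos \<delta> by (auto simp: add_pos_pos less_imp_neq[symmetric])
    have "\<delta> * (u / (a + b') / ((a + b' + \<delta> * a * b') / (a * b'))) = u / (a + b') - u / (a + b' + \<delta> * a * b')"
      using n pos by (simp add: divide_simps) (simp add: algebra_simps)
    then show ?thesis unfolding p_def a_def[symmetric] b'_def[symmetric] u_def[symmetric] s .
  qed
  have "dominated K b {..<d} (\<lambda>j k. \<delta> * p j k)"
    unfolding p_def using \<delta> mu_pos
    by (intro dominated_mult_pos dominated_divide_add dominated_gram b bformD(1)[OF b])
      (auto intro: add_pos_pos)
  then have dom: "\<bar>kernel_form {..<d} (\<lambda>j k. \<delta> * p j k) f b\<bar> \<le> K * kernel_form {..<d} (\<lambda>j k. \<delta> * p j k) f inner"
    by (auto simp: dominated_def)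
  have "kernel_form {..<d} (\<lambda>j k. \<delta> * p j k) f b = (\<Sum>j<d. \<Sum>k<d. ((R (f j) \<bullet> R (f k)) / (mu j + mu k)
      - (R (f j) \<bullet> R (f k)) / (mu j + mu k + \<delta> * mu j * mu k)) * b (f j) (f k))"
    unfolding kernel_form_def by (intro sum.cong refl) (simp add: p_eq)
  also have "\<dots> = Th b - TD \<delta> b"
    unfolding Th_def TD_def kernel_form_def by (simp add: left_diff_distrib sum_subtractf)
  finally have 1: "kernel_form {..<d} (\<lambda>j k. \<delta> * p j k) f b = Th b - TD \<delta> b" .
  have "kernel_form {..<d} (\<lambda>j k. \<delta> * p j k) f inner = (\<Sum>m<d. (norm (R (f m)))\<^sup>2 / (2 / \<delta> + mu m)) / 2"
    unfolding kernel_form_f_inner sum_divide_distrib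
  proof (intro sum.cong refl)
    fix m assume "m \<in> {..<d}"
    then have "0 < mu m" using mu_pos by simp
    then have "\<delta> * (u / (mu m + mu m) / (1 / mu m + \<delta> / 2 + (1 / mu m + \<delta> / 2))) = u / (2 / \<delta> + mu m) / 2" for u
      using \<delta> by (simp add: divide_simps add_pos_pos less_imp_neq[symmetric])
    then show "\<delta> * p m m = (norm (R (f m)))\<^sup>2 / (2 / \<delta> + mu m) / 2"
      unfolding p_def power2_norm_eq_inner .
  qed
  also have "\<dots> \<le> (\<Sum>n. q n / (2 / \<delta> + lam n)) / 2"
    using \<delta> by (intro divide_right_mono trace_monotone) auto
  also have "\<dots> \<le> (\<Sum>n. q n / (2 / \<delta> + lam n))"
  proof -
    have "0 \<le> (\<Sum>n. q n / (2 / \<delta> + lam n))"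
      using \<delta> by (intro suminf_nonneg summable_q_resolvent divide_nonneg_nonneg q_nonneg
          add_nonneg_nonneg order.strict_implies_order[OF lam_pos]) auto
    then show ?thesis by simp
  qed
  also have "\<dots> \<le> (\<Sum>n. cq * (2 / \<delta>) powr - \<gamma> * lam n powr - \<alpha>)"
    using \<delta> by (intro suminf_le q_resolvent summable_q_resolvent summable_mult trace) auto
  also have "\<dots> = cq * (2 / \<delta>) powr - \<gamma> * trA"
    unfolding trA_def by (rule suminf_mult[OF trace])
  also have "\<dots> \<le> cq * \<delta> powr \<gamma> * trA"
  proof -
    have "(2 / \<delta>) powr - g = (\<delta> / 2) powr g" for g
      using \<delta> by (simp add: powr_minus powr_divide inverse_eq_divide)
    then have "(2 / \<delta>) powr - \<gamma> = (\<delta> / 2) powr \<gamma>" .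
    also have "\<dots> \<le> \<delta> powr \<gamma>" using \<delta> \<gamma>0 by (intro powr_mono2) auto
    finally show ?thesis using cq trA_nonneg by (intro mult_right_mono mult_left_mono) auto
  qed
  finally have "kernel_form {..<d} (\<lambda>j k. \<delta> * p j k) f inner \<le> cq * \<delta> powr \<gamma> * trA" .
  then have "K * kernel_form {..<d} (\<lambda>j k. \<delta> * p j k) f inner \<le> K * (cq * \<delta> powr \<gamma> * trA)"
    by (intro mult_left_mono bform_nonneg[OF b])
  then show ?thesis using dom unfolding 1 by (simp add: mult_ac)
qed

text \<open>For \<open>h > 1\<close> only the trivial bounds for resolvents and propagators are
  used. The cap at 1 records this, and the passage to smaller exponents would fail without
  it.\<close>

definition \<eta> :: real where "\<eta> = min 1 (h powr (2 * \<gamma>))"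

text \<open>The duality bound is of size \<open>h\<^sup>2\<close>, the trivial bound of size
  \<open>1 / lam n\<close>. Their minimum, interpolated with weights \<open>\<gamma>\<close> and
  \<open>1 - \<gamma>\<close>, meets the decay \<open>lam n powr - \<beta>\<close> and leaves
  exactly the summable \<open>lam n powr - \<alpha>\<close>: no power of \<open>lam n\<close> is
  wasted, which is why the endpoint rate is reached.\<close>

lemma resolvent_error_noise:
  "norm (resolv (lam n) (R (R (e n))) - gal (lam n) (R (R (e n)))) \<le> Cz \<kappa> * \<eta> * lam n powr - \<alpha>"
proof -
  let ?w = "R (R (e n))" and ?c = "\<kappa>\<^sup>2 + \<kappa> + 2" and ?M = "max 1 (lam 0 powr - \<gamma>)"
  have l: "0 < lam n" by (rule lam_pos)
  have c: "0 \<le> ?c" using \<kappa> by simp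
  have e1: "norm (resolv (lam n) ?w - gal (lam n) ?w) \<le> (\<kappa>\<^sup>2 + \<kappa>) * h\<^sup>2 * norm ?w"
    using l by (intro resolvent_error) simp
  have e2: "norm (resolv (lam n) ?w - gal (lam n) ?w) \<le> 2 / lam n * norm ?w"
    using l by (rule resolvent_error_trivial)
  have *: "lam n powr - \<beta> * lam n powr - (1 - \<gamma>) = lam n powr - \<alpha>"
    by (simp add: powr_add[symmetric])
  show ?thesis
  proof (cases "h \<le> 1")
    case True
    have "h powr (2 * \<gamma>) \<le> 1 powr (2 * \<gamma>)" using True h \<gamma>0 by (intro powr_mono2) auto
    then have "\<eta> = h powr (2 * \<gamma>)" by (simp add: \<eta>_def min_absorb2)
    also have "\<dots> = (h powr 2) powr \<gamma>" by (rule powr_powr[symmetric])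
    also have "h powr 2 = h\<^sup>2" using h by simp
    finally have \<eta>: "\<eta> = (h\<^sup>2) powr \<gamma>" .
    have "norm (resolv (lam n) ?w - gal (lam n) ?w) \<le> ?c * min (h\<^sup>2) (1 / lam n) * norm ?w"
    proof (cases "h\<^sup>2 \<le> 1 / lam n")
      case True
      have "(\<kappa>\<^sup>2 + \<kappa>) * h\<^sup>2 * norm ?w \<le> ?c * h\<^sup>2 * norm ?w" by (intro mult_right_mono) auto
      then show ?thesis using e1 True by (simp add: min_absorb1)
    next
      case False
      have "2 * (1 / lam n) * norm ?w \<le> ?c * (1 / lam n) * norm ?w"
        using \<kappa> l by (intro mult_right_mono) auto
      then show ?thesis using e2 False by (simp add: min_absorb2)
    qed
    also have "\<dots> \<le> ?c * ((h\<^sup>2) powr \<gamma> * (1 / lam n) powr (1 - \<gamma>)) * (cq * lam n powr - \<beta>)"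
      using c h l \<gamma>0 \<gamma>1 cq Q_decay[of n]
      by (intro mult_mono mult_left_mono min_le_powr mult_nonneg_nonneg) auto
    also have "(1 / lam n) powr (1 - \<gamma>) = lam n powr - (1 - \<gamma>)"
      using l by (simp only: powr_divide powr_minus inverse_eq_divide powr_one_eq_one less_imp_le zero_le_one)
    also have "?c * ((h\<^sup>2) powr \<gamma> * lam n powr - (1 - \<gamma>)) * (cq * lam n powr - \<beta>) =
        cq * ?c * 1 * \<eta> * (lam n powr - \<beta> * lam n powr - (1 - \<gamma>))"
      by (simp only: \<eta> mult_ac mult_1)
    also have "\<dots> \<le> cq * ?c * ?M * \<eta> * (lam n powr - \<beta> * lam n powr - (1 - \<gamma>))"
      using cq c by (intro mult_right_mono mult_left_mono) (auto simp: \<eta>_def)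
    finally show ?thesis unfolding * Cz_def .
  next
    case False
    have "1 powr (2 * \<gamma>) \<le> h powr (2 * \<gamma>)" using False \<gamma>0 by (intro powr_mono2) auto
    then have \<eta>: "\<eta> = 1" by (simp add: \<eta>_def)
    \<comment> \<open>For \<open>h > 1\<close> no interpolation is made. The product
      \<open>lam n powr - \<beta> * lam n powr - 1\<close> exceeds the needed decay by
      \<open>lam n powr - \<gamma>\<close>, which is bounded by its value at the smallest
      eigenvalue.\<close>
    have "2 / lam n * norm ?w \<le> 2 / lam n * (cq * lam n powr - \<beta>)"
      using l by (intro mult_left_mono Q_decay) auto
    also have "\<dots> = cq * 2 * (lam n powr - \<beta> * lam n powr - 1)"
    proof -
      have "inverse (lam n) = lam n powr - 1" using l by (simp add: powr_minus)
      then show ?thesis unfolding divide_inverse by (simp only: mult_ac)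
    qed
    also have "lam n powr - \<beta> * lam n powr - 1 = lam n powr - \<gamma> * lam n powr - \<alpha>"
      by (rule lam_powr_split)
    also have "cq * 2 * (lam n powr - \<gamma> * lam n powr - \<alpha>) \<le> cq * ?c * (?M * lam n powr - \<alpha>)"
      using cq c \<kappa> lam_powr_\<gamma>[of n] by (intro mult_mono mult_left_mono mult_nonneg_nonneg) auto
    finally show ?thesis using e2 by (simp add: \<eta> Cz_def mult_ac)
  qed
qed

text \<open>With \<open>E = e\<^sup>-\<^sup>s\<^sup>A - e\<^sup>-\<^sup>s\<^sup>A\<^sup>h P\<^sub>h\<close> and \<open>S = e\<^sup>-\<^sup>s\<^sup>A\<close> one has \<open>S Q S - S\<^sub>h Q S\<^sub>h = E Q S + S Q E - E Q E\<close>. Integrated over \<open>s\<close>, the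
  first two terms are sums over the eigenvectors of resolvent differences applied to \<open>Q e\<^sub>n\<close>; the
  last one is positive, so its trace norm is its trace, which is controlled by the first two since
  the trace of the discrete covariance does not exceed the trace of the exact one.\<close>

lemma TN_Th:
  assumes b: "bform K b"
  shows "\<bar>TN N b - Th b\<bar> \<le> K * (4 * (Cz \<kappa> * trA) * \<eta> + trunc_err N)"
proof -
  \<comment> \<open>\<open>Y n\<close> is the truncated exact resolvent at shift
    \<open>lam n\<close> minus the Galerkin one, both applied to \<open>R (R (e n))\<close>. The
    shift arises because the time integral of \<open>exp (- s * lam n)\<close> against a semigroup
    is a resolvent.\<close>
  define Y where "Y = (\<lambda>n. (\<Sum>k<N. ((R (e k) \<bullet> R (e n)) / (lam k + lam n)) *\<^sub>R e k)
      - (\<Sum>m<d. ((R (f m) \<bullet> R (e n)) / (mu m + lam n)) *\<^sub>R f m))"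
  have Y_le: "norm (Y n) \<le> (Cz \<kappa> * \<eta> + cq * lam N powr - \<gamma>) * lam n powr - \<alpha>" for n
  proof -
    let ?w = "R (R (e n))" and ?r = "resolv (lam n) (R (R (e n)))"
    have l: "0 < lam n" "0 < lam N" by (rule lam_pos)+
    have "(R (e k) \<bullet> R (e n)) / (lam k + lam n) = ?r \<bullet> e k" for k
      using l by (simp add: resolv_coeff R_sym inner_commute[of "e k"] add.commute)
    moreover have "(\<Sum>m<d. ((R (f m) \<bullet> R (e n)) / (mu m + lam n)) *\<^sub>R f m) = gal (lam n) ?w"
      by (simp add: gal_def R_sym inner_commute[of "f _"] add.commute)
    ultimately have "Y n = (?r - gal (lam n) ?w) - (?r - (\<Sum>k<N. (?r \<bullet> e k) *\<^sub>R e k))"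
      by (simp add: Y_def)
    then have "norm (Y n) \<le> norm (?r - gal (lam n) ?w) + norm (?r - (\<Sum>k<N. (?r \<bullet> e k) *\<^sub>R e k))"
      using norm_triangle_ineq4 by metis
    also have "norm (?r - (\<Sum>k<N. (?r \<bullet> e k) *\<^sub>R e k)) \<le> 1 / (lam n + lam N) * norm ?w"
      using l by (intro resolv_trunc) simp
    also have "\<dots> \<le> (lam n powr - (1 - \<gamma>) * lam N powr - \<gamma>) * (cq * lam n powr - \<beta>)"
      using l \<gamma>0 \<gamma>1 by (intro mult_mono inverse_add_le_powr Q_decay) auto
    also have "\<dots> = cq * lam N powr - \<gamma> * (lam n powr - \<beta> * lam n powr - (1 - \<gamma>))" by (simp only: mult_ac)
    also have "lam n powr - \<beta> * lam n powr - (1 - \<gamma>) = lam n powr - \<alpha>"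
      by (simp add: powr_add[symmetric])
    finally show ?thesis using resolvent_error_noise[of n] by (simp add: algebra_simps)
  qed
  define \<sigma> where "\<sigma> = (\<Sum>n<N. norm (Y n))"
  have \<sigma>: "\<sigma> \<le> (Cz \<kappa> * \<eta> + cq * lam N powr - \<gamma>) * trA"
  proof -
    have "\<sigma> \<le> (\<Sum>n<N. (Cz \<kappa> * \<eta> + cq * lam N powr - \<gamma>) * lam n powr - \<alpha>)"
      unfolding \<sigma>_def by (intro sum_mono Y_le)
    also have "\<dots> \<le> (Cz \<kappa> * \<eta> + cq * lam N powr - \<gamma>) * trA"
      unfolding sum_distrib_left[symmetric] using cq Cz_nonneg[of \<kappa>] \<kappa>
      by (intro mult_left_mono sum_trace_le) (simp add: \<eta>_def)
    finally show ?thesis .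
  qed
  \<comment> \<open>\<open>M1\<close> and \<open>M2\<close> are the mixed terms, with the discrete
    semigroup on one side of \<open>Q\<close> and the exact one on the other.\<close>
  define M1 where "M1 = (\<lambda>c. \<Sum>n<N. \<Sum>m<d. (R (f m) \<bullet> R (e n)) / (mu m + lam n) * c (f m) (e n) :: real)"
  define M2 where "M2 = (\<lambda>c. \<Sum>n<N. \<Sum>m<d. (R (f m) \<bullet> R (e n)) / (mu m + lam n) * c (e n) (f m) :: real)"
  \<comment> \<open>The disjoint union of both index sets, with a minus sign on the discrete
    vectors, turns \<open>E Q E\<close> into a single kernel form. One application of
    \<open>dominated_divide_add\<close> then covers all four blocks.\<close>
  define J where "J = {..<N} <+> {..<d}"
  define p where "p = (\<lambda>j k. (case_sum (\<lambda>n. R (e n)) (\<lambda>m. R (f m)) j \<bullet> case_sum (\<lambda>n. R (e n)) (\<lambda>m. R (f m)) k) /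
     (case_sum lam mu j + case_sum lam mu k))"
  define g where "g = case_sum e (\<lambda>m. - f m)"
  have split: "kernel_form J p g c = TN N c - M1 c - M2 c + Th c"
    if c: "bounded_bilinear c" for c :: "'h \<Rightarrow> 'h \<Rightarrow> real"
  proof -
    interpret c: bounded_bilinear c by (rule c)
    have "kernel_form J p g c = TN N c + (\<Sum>n<N. \<Sum>m<d. p (Inl n) (Inr m) * c (g (Inl n)) (g (Inr m)))
       + ((\<Sum>m<d. \<Sum>n<N. p (Inr m) (Inl n) * c (g (Inr m)) (g (Inl n))) + Th c)"
      unfolding kernel_form_def J_def
      by (simp add: sum.Plus sum.distrib p_def g_def TN_def Th_def kernel_form_def c.minus_left c.minus_right)
    also have "(\<Sum>n<N. \<Sum>m<d. p (Inl n) (Inr m) * c (g (Inl n)) (g (Inr m))) = - M2 c"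
      unfolding M2_def sum_negf[symmetric]
      by (intro sum.cong refl) (simp add: p_def g_def c.minus_right add.commute inner_commute)
    also have "(\<Sum>m<d. \<Sum>n<N. p (Inr m) (Inl n) * c (g (Inr m)) (g (Inl n))) = - M1 c"
      unfolding M1_def sum_negf[symmetric]
      by (subst sum.swap, intro sum.cong refl) (simp add: p_def g_def c.minus_left)
    finally show ?thesis by simp
  qed
  have "dominated K b J p"
    unfolding p_def J_def using lam_pos mu_pos
    by (intro dominated_divide_add dominated_gram b bformD(1)[OF b]) (auto split: sum.splits)
  then have "\<bar>kernel_form J p g b\<bar> \<le> K * kernel_form J p g inner"
    by (auto simp: dominated_def)
  then have EE: "\<bar>TN N b - M1 b - M2 b + Th b\<bar> \<le> K * (TN N inner - M1 inner - M2 inner + Th inner)"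
    by (simp only: split bformD(1)[OF b] bounded_bilinear_inner)
  have d1: "\<bar>TN N c - M1 c\<bar> \<le> L * \<sigma>" and d2: "\<bar>TN N c - M2 c\<bar> \<le> L * \<sigma>"
    if c: "bform L c" for c :: "'h \<Rightarrow> 'h \<Rightarrow> real" and L
  proof -
    interpret c: bounded_bilinear c by (rule bformD(1)[OF c])
    have T: "TN N c = (\<Sum>n<N. \<Sum>k<N. (R (e k) \<bullet> R (e n)) / (lam k + lam n) * c (e k) (e n))"
      unfolding TN_def kernel_form_def by (subst sum.swap) simp
    have T': "TN N c = (\<Sum>n<N. \<Sum>k<N. (R (e k) \<bullet> R (e n)) / (lam k + lam n) * c (e n) (e k))"
      unfolding TN_def kernel_form_def
      by (intro sum.cong refl) (simp add: inner_commute add.commute)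
    have "TN N c - M1 c = (\<Sum>n<N. c (Y n) (e n))"
      unfolding T M1_def Y_def
      by (simp add: c.diff_left c.sum_left c.scaleR_left sum_subtractf)
    also have "\<bar>\<dots>\<bar> \<le> (\<Sum>n<N. L * norm (Y n))"
      using bformD(2)[OF c, of "Y _" "e _"] by (intro order_trans[OF sum_abs] sum_mono) simp
    finally show "\<bar>TN N c - M1 c\<bar> \<le> L * \<sigma>" by (simp add: \<sigma>_def sum_distrib_left)
    have "TN N c - M2 c = (\<Sum>n<N. c (e n) (Y n))"
      unfolding T' M2_def Y_def
      by (simp add: c.diff_right c.sum_right c.scaleR_right sum_subtractf)
    also have "\<bar>\<dots>\<bar> \<le> (\<Sum>n<N. L * norm (Y n))"
      using bformD(2)[OF c, of "e _" "Y _"] by (intro order_trans[OF sum_abs] sum_mono) simp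
    finally show "\<bar>TN N c - M2 c\<bar> \<le> L * \<sigma>" by (simp add: \<sigma>_def sum_distrib_left)
  qed
  have K: "0 \<le> K" by (rule bform_nonneg[OF b])
  \<comment> \<open>Here the comparison of traces enters: the trace of \<open>E Q E\<close> equals
    two mixed differences plus \<open>Th inner - TN N inner\<close>, and \<open>Th inner\<close> is
    at most \<open>trK\<close>.\<close>
  have "TN N inner - M1 inner - M2 inner + Th inner \<le> 2 * \<sigma> + (trK - TN N inner)"
    using d1[OF bform_inner] d2[OF bform_inner] Th_inner_le by linarith
  then have "K * (TN N inner - M1 inner - M2 inner + Th inner) \<le> K * (2 * \<sigma> + (trK - TN N inner))"
    by (rule mult_left_mono[OF _ K])
  \<comment> \<open>Uses \<open>TN - Th = (TN - M1) + (TN - M2) - (TN - M1 - M2 + Th)\<close>. Two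
    mixed differences and the bound \<open>2 * \<sigma>\<close> for the square explain the factor
    4.\<close>
  then have "\<bar>TN N b - Th b\<bar> \<le> K * \<sigma> + K * \<sigma> + K * (2 * \<sigma> + (trK - TN N inner))"
    using EE d1[OF b] d2[OF b] by linarith
  also have "\<dots> = K * (4 * \<sigma> + (trK - TN N inner))" by (simp add: algebra_simps)
  also have "\<dots> \<le> K * (4 * ((Cz \<kappa> * \<eta> + cq * lam N powr - \<gamma>) * trA) + (trK - TN N inner))"
    using \<sigma> by (intro mult_left_mono K) simp
  finally show ?thesis by (simp add: trunc_err_def algebra_simps)
qed

end

section \<open>Propagators and covariances at the final time\<close>

lemma mult_exp_minus_le: "x * exp (- x) \<le> (1::real)"
proof -
  have "x \<le> exp x" using exp_ge_add_one_self[of x] by linarith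
  then show ?thesis by (simp add: exp_minus divide_simps)
qed

lemma square_exp_minus_le:
  fixes x :: real
  assumes "0 \<le> x" shows "x\<^sup>2 * exp (- x) \<le> 2"
  using exp_lower_Taylor_quadratic[OF assms] assms by (simp add: exp_minus divide_simps)

lemma exp_minus_quadratic_bounds:
  fixes z :: real
  assumes "0 \<le> z"
  shows "1 - z \<le> exp (- z)" "exp (- z) \<le> 1 - z + z\<^sup>2"
proof -
  show "1 - z \<le> exp (- z)" using exp_ge_add_one_self[of "- z"] by simp
  have "exp (- z) * (1 + z) \<le> 1"
    using exp_ge_add_one_self[of z] by (simp add: exp_minus divide_simps)
  \<comment> \<open>The product on the right equals \<open>1 + z ^ 3\<close>.\<close>
  also have "1 \<le> (1 - z + z\<^sup>2) * (1 + z)"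
    using assms zero_le_power[OF assms, of 3] by (simp add: algebra_simps power2_eq_square power3_eq_cube)
  finally show "exp (- z) \<le> 1 - z + z\<^sup>2"
    using assms by (simp add: mult_le_cancel_right)
qed

lemma power_diff_le:
  fixes a b M :: real
  assumes "\<bar>a\<bar> \<le> M" "\<bar>b\<bar> \<le> M"
  shows "\<bar>a ^ N - b ^ N\<bar> \<le> real N * M ^ (N - 1) * \<bar>a - b\<bar>"
proof (cases N)
  case (Suc n)
  have M: "0 \<le> M" using assms by linarith
  have "a ^ Suc n - b ^ Suc n = (a - b) * (\<Sum>p<Suc n. a ^ p * b ^ (n - p))"
    by (rule diff_power_eq_sum)
  also have "\<bar>\<dots>\<bar> \<le> \<bar>a - b\<bar> * (\<Sum>p<Suc n. M ^ n)"
    unfolding abs_mult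
  proof (intro mult_left_mono order_trans[OF sum_abs] sum_mono)
    fix p assume p: "p \<in> {..<Suc n}"
    have "\<bar>a ^ p * b ^ (n - p)\<bar> \<le> M ^ p * M ^ (n - p)"
      unfolding abs_mult power_abs using assms M by (intro mult_mono power_mono) auto
    also have "\<dots> = M ^ n" using p by (simp add: power_add[symmetric])
    finally show "\<bar>a ^ p * b ^ (n - p)\<bar> \<le> M ^ n" .
  qed simp
  finally show ?thesis using Suc by (simp add: mult_ac del: sum.lessThan_Suc)
qed simp

text \<open>The signs follow the chain of six legs joining the two semigroups in
  \<open>semigroup_error_modes\<close>.\<close>

lemma norm_sum6_le:
  "norm (a + b + c - p + q + r) \<le> norm a + norm b + norm c + norm p + norm q + norm (r::'v::real_normed_vector)"
  using norm_triangle_ineq[of a b] norm_triangle_ineq[of "a + b" c] norm_triangle_ineq4[of "a + b + c" p]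
    norm_triangle_ineq[of "a + b + c - p" q] norm_triangle_ineq[of "a + b + c - p + q" r]
  by linarith

text \<open>The amplification factor of one step of the \<open>\<theta>\<close>-scheme on a mode
  with \<open>z = mu m * dt\<close>, the rational approximation of \<open>exp (- z)\<close>.\<close>

definition theta_ratio :: "real \<Rightarrow> real \<Rightarrow> real" where
  "theta_ratio \<theta> z = (1 - (1 - \<theta>) * z) / (1 + \<theta> * z)"

lemma theta_ratio_le_1:
  assumes "1/2 < \<theta>" "\<theta> \<le> 1" "0 \<le> z"
  shows "\<bar>theta_ratio \<theta> z\<bar> \<le> 1"
proof -
  have "0 \<le> \<theta> * z" "0 \<le> (1 - \<theta>) * z" "0 \<le> (2 * \<theta> - 1) * z" using assms by auto
  then show ?thesis
    unfolding theta_ratio_def by (auto simp: abs_le_iff divide_simps algebra_simps)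
qed

text \<open>Small \<open>z\<close>: both factors are at most \<open>exp (- z / 2)\<close> and differ by \<open>O(z\<^sup>2)\<close>. Large \<open>z\<close>: since
  \<open>\<theta> > 1/2\<close>, the ratio stays away from \<open>-1\<close>.\<close>

lemma theta_ratio_power_error:
  assumes \<theta>: "1/2 < \<theta>" "\<theta> \<le> 1"
  shows "\<exists>C>0. \<forall>N\<ge>1. \<forall>z>0. \<bar>exp (- (real N * z)) - theta_ratio \<theta> z ^ N\<bar> \<le> C / real N"
proof -
  \<comment> \<open>On \<open>z > 1\<close> the ratio lies between its limit at infinity,
    \<open>- (1 - \<theta>) / \<theta>\<close>, and its value at 1,
    \<open>\<theta> / (1 + \<theta>)\<close>; both have modulus below 1 exactly because
    \<open>\<theta> > 1/2\<close>.\<close>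
  define \<rho> where "\<rho> = max (\<theta> / (1 + \<theta>)) ((1 - \<theta>) / \<theta>)"
  have \<rho>: "0 \<le> \<rho>" "\<rho> < 1" using \<theta> by (auto simp: \<rho>_def le_max_iff_disj)
  show ?thesis
  \<comment> \<open>For small \<open>z\<close>, replacing \<open>N - 1\<close> by \<open>N\<close>
    in the exponent costs a factor of at most 4, and
    \<open>4 * N * z\<^sup>2 = 16 / N * (N * z / 2)\<^sup>2\<close> together with
    \<open>square_exp_minus_le\<close> yields 32. For large \<open>z\<close>, the exponential yields
    1, and \<open>N * \<rho> ^ N\<close>, at most the geometric series, yields the last
    summand.\<close>
  proof (intro exI[of _ "32 + 1 + 1 / (1 - \<rho>)"] conjI allI impI)
    show "0 < 32 + 1 + 1 / (1 - \<rho>)" using \<rho> by (intro add_pos_pos) auto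
    fix N :: nat and z :: real
    assume N: "1 \<le> N" and z: "0 < z"
    let ?r = "theta_ratio \<theta> z"
    have pos: "0 < 1 + \<theta> * z" using \<theta> z by (intro add_pos_pos) auto
    show "\<bar>exp (- (real N * z)) - ?r ^ N\<bar> \<le> (32 + 1 + 1 / (1 - \<rho>)) / real N"
    proof (cases "z \<le> 1")
      case True
      have r_eq: "?r = 1 - z / (1 + \<theta> * z)" using pos by (simp add: theta_ratio_def field_simps)
      have "z / 2 \<le> z / (1 + \<theta> * z)"
      proof -
        have "\<theta> * z \<le> 1 * 1" using \<theta> z True by (intro mult_mono) auto
        then show ?thesis using z pos by (intro divide_left_mono) auto
      qed
      then have rle: "?r \<le> exp (- (z / 2))"
        unfolding r_eq using exp_ge_add_one_self[of "- (z / 2)"] by linarith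
      have "(1 - \<theta>) * z \<le> 1 * 1" using \<theta> z True by (intro mult_mono) auto
      then have r0: "0 \<le> ?r" unfolding theta_ratio_def using pos by simp
      have r_low: "1 - z \<le> ?r"
      proof -
        have "z / (1 + \<theta> * z) \<le> z / 1" using z \<theta> by (intro frac_le) auto
        then show ?thesis unfolding r_eq by simp
      qed
      have r_up: "?r \<le> 1 - z + z\<^sup>2"
      proof -
        have "?r = 1 - z + \<theta> * z\<^sup>2 / (1 + \<theta> * z)"
          unfolding r_eq using pos by (simp add: field_simps power2_eq_square)
        also have "\<theta> * z\<^sup>2 / (1 + \<theta> * z) \<le> 1 * z\<^sup>2 / 1"
          using \<theta> z by (intro frac_le mult_right_mono) auto
        finally show ?thesis by simp
      qed
      have diff: "\<bar>exp (- z) - ?r\<bar> \<le> z\<^sup>2"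
        using exp_minus_quadratic_bounds[of z] r_low r_up z by (simp add: abs_le_iff)
      have "\<bar>exp (- z) ^ N - ?r ^ N\<bar> \<le> real N * exp (- (z / 2)) ^ (N - 1) * \<bar>exp (- z) - ?r\<bar>"
        using rle r0 z by (intro power_diff_le) auto
      also have "\<dots> \<le> real N * exp (- (z / 2)) ^ (N - 1) * z\<^sup>2"
        by (intro mult_left_mono diff) auto
      also have "exp (- (z / 2)) ^ (N - 1) \<le> 2 * 2 * exp (- (real N * z / 2))"
      proof -
        have "exp (- (z / 2)) ^ (N - 1) = exp (z / 2) * exp (- (real N * z / 2))"
          unfolding exp_of_nat_mult[symmetric] exp_add[symmetric] using N
          by (simp add: of_nat_diff algebra_simps diff_divide_distrib)
        also have "exp (z / 2) \<le> 2 * 2"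
        proof -
          have "exp (z / 2) \<le> 1 + z / 2 + (z / 2)\<^sup>2" using z True by (intro exp_bound) auto
          moreover have "(z / 2)\<^sup>2 \<le> 1" using z True by (intro power_le_one) auto
          ultimately show ?thesis using True by simp
        qed
        finally show ?thesis by simp
      qed
      finally have "\<bar>exp (- z) ^ N - ?r ^ N\<bar> \<le> real N * (2 * 2 * exp (- (real N * z / 2))) * z\<^sup>2"
        by (simp add: mult_right_mono mult_left_mono)
      also have "\<dots> = 16 / real N * ((real N * z / 2)\<^sup>2 * exp (- (real N * z / 2)))"
        using N by (simp add: power2_eq_square field_simps)
      also have "\<dots> \<le> 16 / real N * 2"
        using z by (intro mult_left_mono square_exp_minus_le) auto
      also have "\<dots> \<le> (32 + 1 + 1 / (1 - \<rho>)) / real N"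
        using \<rho> N by (simp add: divide_right_mono)
      finally show ?thesis by (simp add: exp_of_nat_mult[symmetric])
    next
      case False
      have "?r \<le> \<theta> / (1 + \<theta>)"
        unfolding theta_ratio_def using \<theta> z False pos by (simp add: divide_simps algebra_simps)
      moreover have "- ((1 - \<theta>) / \<theta>) \<le> ?r"
        unfolding theta_ratio_def using \<theta> z pos by (simp add: divide_simps algebra_simps)
      ultimately have r: "\<bar>?r\<bar> \<le> \<rho>" by (auto simp: \<rho>_def abs_le_iff)
      have "real N * \<rho> ^ N \<le> (\<Sum>k<N. \<rho> ^ k)"
      proof -
        have "(\<Sum>k<N. \<rho> ^ N) \<le> (\<Sum>k<N. \<rho> ^ k)"
          using \<rho> by (intro sum_mono power_decreasing) auto
        then show ?thesis by simp
      qed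
      also have "\<dots> \<le> (\<Sum>k. \<rho> ^ k)"
        using \<rho> by (intro sum_le_suminf summable_geometric) auto
      also have "\<dots> = 1 / (1 - \<rho>)" using \<rho> by (intro suminf_geometric) simp
      finally have "\<rho> ^ N * real N \<le> 1 / (1 - \<rho>)" by (simp only: mult.commute)
      then have 1: "\<rho> ^ N \<le> (1 / (1 - \<rho>)) / real N"
        using N by (subst pos_le_divide_eq) auto
      have "\<bar>?r ^ N\<bar> \<le> \<rho> ^ N" unfolding power_abs by (intro power_mono r) simp
      moreover have "exp (- (real N * z)) \<le> 1 / real N"
      proof -
        have "real N * exp (- (real N * z)) \<le> (real N * z) * exp (- (real N * z))"
          using False N by (intro mult_right_mono) auto
        also have "\<dots> \<le> 1" using z by (intro mult_exp_minus_le)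
        finally show ?thesis using N by (simp add: pos_le_divide_eq mult.commute)
      qed
      moreover have "0 \<le> exp (- (real N * z))" by simp
      ultimately have "\<bar>exp (- (real N * z)) - ?r ^ N\<bar> \<le> 1 / real N + (1 / (1 - \<rho>)) / real N"
        using 1 by linarith
      also have "\<dots> \<le> (32 + 1 + 1 / (1 - \<rho>)) / real N"
        unfolding add_divide_distrib[symmetric] by (intro divide_right_mono) auto
      finally show ?thesis .
    qed
  qed
qed

section \<open>Exact and discrete semigroups at a positive time, for arbitrary initial data\<close>

context spectral_basis
begin

definition expA :: "real \<Rightarrow> 'h \<Rightarrow> 'h" where
  "expA t v = (\<Sum>n. (exp (- (lam n * t)) * (v \<bullet> e n)) *\<^sub>R e n)"

lemma expA_coeff:
  assumes "0 \<le> t" shows "expA t v \<bullet> e n = exp (- (lam n * t)) * (v \<bullet> e n)"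
  unfolding expA_def
  using assms lam_pos by (intro diag_coeff[where K=1]) (simp add: less_imp_le)

lemma norm_expA: "0 \<le> t \<Longrightarrow> norm (expA t v) \<le> norm v"
  using norm_le_of_coeff[of "expA t v" 1 v] lam_pos
  by (simp add: expA_coeff abs_mult mult_left_le_one_le less_imp_le)

lemma expA_linear: assumes "0 \<le> t" shows "bounded_linear (expA t)"
proof (rule bounded_linear_intro[where K=1])
  show "expA t (u + v) = expA t u + expA t v" for u v
    by (rule eq_of_coeff) (simp add: expA_coeff assms inner_add_left distrib_left)
  show "expA t (c *\<^sub>R v) = c *\<^sub>R expA t v" for c v
    by (rule eq_of_coeff) (simp add: expA_coeff assms)
  show "norm (expA t v) \<le> norm v * 1" for v using norm_expA[OF assms] by simp
qed

lemma expA_e: "0 \<le> t \<Longrightarrow> expA t (e n) = exp (- (lam n * t)) *\<^sub>R e n"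
  by (rule eq_of_coeff) (simp add: expA_coeff ortho)

end

context galerkin
begin

text \<open>The functional calculus \<open>c(A_h) P_h\<close>; the constant function 1 gives
  \<open>P_h\<close>.\<close>

definition fdiag :: "(nat \<Rightarrow> real) \<Rightarrow> 'h \<Rightarrow> 'h" where
  "fdiag c v = (\<Sum>m<d. (c m * (v \<bullet> f m)) *\<^sub>R f m)"

lemma norm_fdiag:
  assumes "\<And>m. m < d \<Longrightarrow> \<bar>c m\<bar> \<le> C" "0 \<le> C"
  shows "norm (fdiag c v) \<le> C * norm v"
  unfolding fdiag_def by (rule norm_sum_f_mult_le[OF assms])

lemma fdiag_linear: "bounded_linear (fdiag c)"
  unfolding fdiag_def by (intro bounded_linear_sum bounded_linear_compose[OF bounded_linear_scaleR_left]
      bounded_linear_const_mult bounded_linear_inner_left)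

lemma fdiag_diff: "fdiag c u - fdiag c v = fdiag c (u - v)"
  using bounded_linear.linear[OF fdiag_linear] by (simp add: linear_diff)

lemma fdiag_inner_f: "l < d \<Longrightarrow> fdiag c v \<bullet> f l = c l * (v \<bullet> f l)"
  unfolding fdiag_def by (rule f_inner_sum(2))

lemma fdiag_cong: "(\<And>m. m < d \<Longrightarrow> c m * (u \<bullet> f m) = c' m * (v \<bullet> f m)) \<Longrightarrow> fdiag c u = fdiag c' v"
  unfolding fdiag_def by (intro sum.cong refl) simp

abbreviation expH :: "real \<Rightarrow> 'h \<Rightarrow> 'h" where
  "expH t \<equiv> fdiag (\<lambda>m. exp (- (mu m * t)))"

lemma inner_gal: "m < d \<Longrightarrow> gal 0 w \<bullet> f m = w \<bullet> f m / mu m"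
  unfolding gal_def by (simp add: f_inner_sum)

lemma error0: "norm (resolv 0 w - gal 0 w) \<le> \<kappa> * h\<^sup>2 * norm w"
  using approx2[of w] by (simp add: gal_def)

text \<open>\<open>exp(-sA)\<close> applied to a finite eigenfunction sum. Powers of
  \<open>A\<close> are absorbed in the weights \<open>w\<close>, and finiteness allows
  differentiation in \<open>s\<close> term by term.\<close>

definition modes :: "nat \<Rightarrow> (nat \<Rightarrow> real) \<Rightarrow> real \<Rightarrow> 'h" where
  "modes N w s = (\<Sum>n<N. (w n * exp (- (lam n * s))) *\<^sub>R e n)"

lemma norm_modes_le:
  assumes "\<And>n. \<bar>w n * exp (- (lam n * s))\<bar> \<le> C * \<bar>c n\<bar>" "0 \<le> C"
  shows "norm (modes N w s) \<le> C * norm (\<Sum>n<N. c n *\<^sub>R e n)"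
  using assms by (intro norm_le_of_coeff) (simp_all add: modes_def inner_sum_e)

lemma resolv_modes: "resolv 0 (modes N (\<lambda>n. lam n * w n) s) = modes N w s"
  using lam_pos by (intro eq_of_coeff)
    (simp add: resolv_coeff modes_def inner_sum_e less_imp_neq[symmetric])

text \<open>The derivative in \<open>s\<close> of \<open>a(A\<^sub>h) e\<^sup>-\<^sup>(\<^sup>t\<^sup>-\<^sup>s\<^sup>)\<^sup>A\<^sup>h P\<^sub>h e\<^sup>-\<^sup>s\<^sup>A w\<close> only involves the elliptic error \<open>A\<inverse> - A\<^sub>h\<inverse> P\<^sub>h\<close>.\<close>

lemma transport_error:
  assumes s: "s1 < s2"
    and C1: "\<And>m s. m < d \<Longrightarrow> s1 < s \<Longrightarrow> s < s2 \<Longrightarrow> \<bar>a m * mu m * exp (- (mu m * (t - s)))\<bar> \<le> C1" "0 \<le> C1"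
    and C2: "\<And>s. s1 < s \<Longrightarrow> s < s2 \<Longrightarrow> norm (modes N (\<lambda>n. lam n * w n) s) \<le> C2"
  shows "norm (fdiag (\<lambda>m. a m * exp (- (mu m * (t - s2)))) (modes N w s2)
      - fdiag (\<lambda>m. a m * exp (- (mu m * (t - s1)))) (modes N w s1)) \<le> C1 * (\<kappa> * h\<^sup>2 * C2) * (s2 - s1)"
proof -
  define F where "F = (\<lambda>s. fdiag (\<lambda>m. a m * exp (- (mu m * (t - s)))) (modes N w s))"
  \<comment> \<open>Product rule together with
    \<open>A_h P_h - P_h A = A_h P_h (A^-1 - A_h^-1 P_h) A\<close>, where the right-hand factor
    \<open>A\<close> is absorbed in the weights \<open>lam n * w n\<close>.\<close>
  define F' where "F' = (\<lambda>s. fdiag (\<lambda>m. a m * mu m * exp (- (mu m * (t - s))))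
      (resolv 0 (modes N (\<lambda>n. lam n * w n) s) - gal 0 (modes N (\<lambda>n. lam n * w n) s)))"
  have F: "F s = (\<Sum>m<d. (a m * exp (- (mu m * (t - s))) *
      (\<Sum>n<N. w n * exp (- (lam n * s)) * (e n \<bullet> f m))) *\<^sub>R f m)" for s
    by (simp add: F_def fdiag_def modes_def inner_sum_left)
  have F'eq: "F' s = (\<Sum>m<d. (a m * exp (- (mu m * (t - s))) * mu m *
      (\<Sum>n<N. w n * exp (- (lam n * s)) * (e n \<bullet> f m)) +
      a m * exp (- (mu m * (t - s))) * (\<Sum>n<N. w n * (- lam n * exp (- (lam n * s))) * (e n \<bullet> f m))) *\<^sub>R f m)" for s
    unfolding F'_def fdiag_def
  proof (intro sum.cong refl arg_cong2[where f=scaleR])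
    fix m assume "m \<in> {..<d}"
    then have m: "m < d" "0 < mu m" using mu_pos by auto
    have "(resolv 0 (modes N (\<lambda>n. lam n * w n) s) - gal 0 (modes N (\<lambda>n. lam n * w n) s)) \<bullet> f m =
        (\<Sum>n<N. w n * exp (- (lam n * s)) * (e n \<bullet> f m)) -
        (\<Sum>n<N. lam n * w n * exp (- (lam n * s)) * (e n \<bullet> f m)) / mu m"
      by (simp add: inner_diff_left inner_gal m(1) resolv_modes) (simp add: modes_def inner_sum_left)
    moreover have "(\<Sum>n<N. w n * (- lam n * exp (- (lam n * s))) * (e n \<bullet> f m)) =
        - (\<Sum>n<N. lam n * w n * exp (- (lam n * s)) * (e n \<bullet> f m))"
      by (simp add: sum_negf mult_ac)
    ultimately show "a m * mu m * exp (- (mu m * (t - s))) *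
      ((resolv 0 (modes N (\<lambda>n. lam n * w n) s) - gal 0 (modes N (\<lambda>n. lam n * w n) s)) \<bullet> f m) =
      a m * exp (- (mu m * (t - s))) * mu m * (\<Sum>n<N. w n * exp (- (lam n * s)) * (e n \<bullet> f m)) +
      a m * exp (- (mu m * (t - s))) * (\<Sum>n<N. w n * (- lam n * exp (- (lam n * s))) * (e n \<bullet> f m))"
      using m(2) by (simp add: right_diff_distrib)
  qed
  have deriv: "(F has_vector_derivative F' s) (at s)" for s
    unfolding F'eq F
    by (auto intro!: derivative_eq_intros sum.cong simp: sum_distrib_left sum_distrib_right
        sum.distrib[symmetric] algebra_simps)
  have "\<exists>s\<in>{s1<..<s2}. norm (F s2 - F s1) \<le> norm ((\<lambda>x. x *\<^sub>R F' s) (s2 - s1))"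
  proof (rule mvt_general[OF s])
    show "continuous_on {s1..s2} F"
      using deriv by (meson continuous_at_imp_continuous_on has_vector_derivative_continuous)
    show "\<And>x. s1 < x \<Longrightarrow> x < s2 \<Longrightarrow> (F has_derivative (\<lambda>y. y *\<^sub>R F' x)) (at x)"
      using deriv by (simp add: has_vector_derivative_def)
  qed
  then obtain \<xi> where \<xi>: "s1 < \<xi>" "\<xi> < s2" and le: "norm (F s2 - F s1) \<le> (s2 - s1) * norm (F' \<xi>)"
    using s by auto
  let ?u = "modes N (\<lambda>n. lam n * w n) \<xi>"
  have "norm (F' \<xi>) \<le> C1 * norm (resolv 0 ?u - gal 0 ?u)"
    unfolding F'_def using C1 \<xi> by (intro norm_fdiag) auto
  also have "\<dots> \<le> C1 * (\<kappa> * h\<^sup>2 * norm ?u)" by (intro mult_left_mono error0 C1(2))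
  also have "\<dots> \<le> C1 * (\<kappa> * h\<^sup>2 * C2)"
    using C1(2) C2[OF \<xi>] \<kappa> by (intro mult_left_mono) auto
  finally have "(s2 - s1) * norm (F' \<xi>) \<le> (s2 - s1) * (C1 * (\<kappa> * h\<^sup>2 * C2))"
    using s by (intro mult_left_mono) auto
  then show ?thesis using le by (simp add: F_def mult_ac)
qed

text \<open>The direct estimate along \<open>[0, 2\<tau>]\<close> has a derivative of size
  \<open>1 / (s (2\<tau> - s))\<close>, not integrable at either end. Hence the interval is cut at
  \<open>\<tau>\<close>: on the right half both powers of \<open>A\<close> fall on the exact factor,
  which is smooth there, and on the left half on the discrete one. Each rearrangement costs one
  elliptic error at an end of a half. The six legs are bounded by \<open>B\<close>,
  \<open>2 * B\<close>, \<open>B\<close>, \<open>B\<close>, \<open>2 * B\<close>, \<open>B\<close>,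
  whence the 8.\<close>

lemma semigroup_error_modes:
  assumes \<tau>: "0 < \<tau>"
  shows "norm (modes N c (2 * \<tau>) - expH (2 * \<tau>) (modes N c 0)) \<le> 8 / \<tau> * (\<kappa> * h\<^sup>2) * norm (modes N c 0)"
proof -
  have mu: "0 \<le> mu m" if "m < d" for m using mu_pos[OF that] by simp
  have lam': "0 \<le> lam n" for n using lam_pos[of n] by simp
  have xe: "x * exp (- (x * s)) \<le> 1 / \<tau>" if "0 \<le> x" "\<tau> \<le> s" for x s :: real
  proof -
    have "x * \<tau> * exp (- (x * s)) \<le> (x * \<tau>) * exp (- (x * \<tau>))"
      using that \<tau> by (intro mult_left_mono) (auto intro: mult_left_mono)
    also have "\<dots> \<le> 1" using that \<tau> by (intro mult_exp_minus_le)
    finally show ?thesis using \<tau> by (simp add: divide_simps mult_ac)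
  qed
  have xxe: "x * x * exp (- (x * s)) \<le> 2 / \<tau>\<^sup>2" if "0 \<le> x" "\<tau> \<le> s" for x s :: real
  proof -
    have "(x * \<tau>)\<^sup>2 * exp (- (x * s)) \<le> (x * \<tau>)\<^sup>2 * exp (- (x * \<tau>))"
      using that \<tau> by (intro mult_left_mono) (auto intro: mult_left_mono)
    also have "\<dots> \<le> 2" using that \<tau> by (intro square_exp_minus_le) auto
    finally show ?thesis using \<tau> by (simp add: divide_simps power2_eq_square mult_ac)
  qed
  define v where "v = modes N c 0"
  have v: "v = (\<Sum>n<N. c n *\<^sub>R e n)" by (simp add: v_def modes_def)
  let ?K = "\<kappa> * h\<^sup>2"
  have K: "0 \<le> ?K" using \<kappa> by simp
  let ?a1 = "modes N (\<lambda>n. lam n * c n)"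
  have na1: "norm (?a1 s) \<le> 1 / \<tau> * norm v" if "\<tau> \<le> s" for s
    unfolding v
  proof (rule norm_modes_le)
    fix n show "\<bar>lam n * c n * exp (- (lam n * s))\<bar> \<le> 1 / \<tau> * \<bar>c n\<bar>"
      using mult_right_mono[OF xe[OF lam'[of n] that], of "\<bar>c n\<bar>"] lam'[of n] by (simp add: abs_mult mult_ac)
  qed (use \<tau> in simp)
  have na2: "norm (modes N (\<lambda>n. lam n * (lam n * c n)) s) \<le> 2 / \<tau>\<^sup>2 * norm v" if "\<tau> \<le> s" for s
    unfolding v
  proof (rule norm_modes_le)
    fix n show "\<bar>lam n * (lam n * c n) * exp (- (lam n * s))\<bar> \<le> 2 / \<tau>\<^sup>2 * \<bar>c n\<bar>"
      using mult_right_mono[OF xxe[OF lam'[of n] that], of "\<bar>c n\<bar>"] lam'[of n] by (simp add: abs_mult mult_ac)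
  qed (use \<tau> in simp)
  have nu: "norm (modes N c s) \<le> 1 * norm v" if "0 \<le> s" for s
    unfolding v
  proof (rule norm_modes_le)
    fix n show "\<bar>c n * exp (- (lam n * s))\<bar> \<le> 1 * \<bar>c n\<bar>"
      using that lam'[of n] by (simp add: abs_mult mult_left_le)
  qed simp
  \<comment> \<open>On the right half: \<open>A_h^-1 exp(-(2\<tau>-s)A_h) P_h A exp(-sA)\<close>.
    The inserted \<open>A_h^-1\<close> cancels the power of \<open>A_h\<close> produced by
    differentiation.\<close>
  let ?P = "\<lambda>s. fdiag (\<lambda>m. 1 / mu m * exp (- (mu m * (2 * \<tau> - s)))) (?a1 s)"
  have A: "norm (?P (2 * \<tau>) - ?P \<tau>) \<le> 1 * (?K * (2 / \<tau>\<^sup>2 * norm v)) * (2 * \<tau> - \<tau>)"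
  proof (rule transport_error)
    fix m s assume "m < d" "\<tau> < s" "s < 2 * \<tau>"
    then show "\<bar>1 / mu m * mu m * exp (- (mu m * (2 * \<tau> - s)))\<bar> \<le> 1"
      using mu_pos[of m] by simp
  qed (use \<tau> na2 in auto)
  have B: "norm (modes N c (2 * \<tau>) - ?P (2 * \<tau>)) \<le> ?K * (1 / \<tau> * norm v)"
  proof -
    have "?P (2 * \<tau>) = gal 0 (?a1 (2 * \<tau>))" by (simp add: fdiag_def gal_def)
    moreover have "modes N c (2 * \<tau>) = resolv 0 (?a1 (2 * \<tau>))" by (simp add: resolv_modes)
    ultimately show ?thesis
      using error0[of "?a1 (2 * \<tau>)"] mult_left_mono[OF na1[of "2 * \<tau>"] K] \<tau> by simp
  qed
  have C: "norm (?P \<tau> - expH \<tau> (modes N c \<tau>)) \<le> ?K * (1 / \<tau> * norm v)"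
  proof -
    have "?P \<tau> = expH \<tau> (gal 0 (?a1 \<tau>))"
      by (rule fdiag_cong) (simp add: inner_gal)
    moreover have "modes N c \<tau> = resolv 0 (?a1 \<tau>)" by (simp add: resolv_modes)
    ultimately have "?P \<tau> - expH \<tau> (modes N c \<tau>) = - expH \<tau> (resolv 0 (?a1 \<tau>) - gal 0 (?a1 \<tau>))"
      by (simp add: fdiag_diff[symmetric])
    then have "norm (?P \<tau> - expH \<tau> (modes N c \<tau>)) \<le> 1 * norm (resolv 0 (?a1 \<tau>) - gal 0 (?a1 \<tau>))"
      using norm_fdiag[of "\<lambda>m. exp (- (mu m * \<tau>))" 1] mu \<tau> by simp
    then show ?thesis
      using error0[of "?a1 \<tau>"] mult_left_mono[OF na1[of \<tau>] K] \<tau> by simp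
  qed
  let ?w = "\<lambda>n. c n / lam n"
  \<comment> \<open>On the left half the roles are exchanged: \<open>A_h\<close> in front and
    \<open>A^-1\<close> behind, so that differentiation leaves no unbounded factor on the exact
    side.\<close>
  let ?G = "\<lambda>s. fdiag (\<lambda>m. mu m * exp (- (mu m * (2 * \<tau> - s)))) (modes N ?w s)"
  have lw: "(\<lambda>n. lam n * (c n / lam n)) = c" using lam_pos by (auto simp: less_imp_neq[symmetric])
  have Gm: "resolv 0 (modes N c s) = modes N ?w s" for s
    using resolv_modes[of N ?w s] unfolding lw .
  have D: "norm (?G \<tau> - ?G 0) \<le> 2 / \<tau>\<^sup>2 * (?K * norm v) * (\<tau> - 0)"
  proof (rule transport_error)
    fix m s assume "m < d" "0 < s" "s < \<tau>"
    then show "\<bar>mu m * mu m * exp (- (mu m * (2 * \<tau> - s)))\<bar> \<le> 2 / \<tau>\<^sup>2"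
      using xxe[of "mu m" "2 * \<tau> - s"] mu[of m] by simp
  qed (use \<tau> nu lw in auto)
  have E': "norm (?G s - expH (2 * \<tau> - s) (modes N c s)) \<le> 1 / \<tau> * (?K * norm v)" if "0 \<le> s" "s \<le> \<tau>" for s
  proof -
    have "expH (2 * \<tau> - s) (modes N c s) = fdiag (\<lambda>m. mu m * exp (- (mu m * (2 * \<tau> - s)))) (gal 0 (modes N c s))"
      using mu_pos by (intro fdiag_cong) (simp add: inner_gal less_imp_neq[symmetric])
    then have "?G s - expH (2 * \<tau> - s) (modes N c s) = fdiag (\<lambda>m. mu m * exp (- (mu m * (2 * \<tau> - s))))
        (resolv 0 (modes N c s) - gal 0 (modes N c s))"
      by (simp add: fdiag_diff Gm)
    also have "norm \<dots> \<le> 1 / \<tau> * norm (resolv 0 (modes N c s) - gal 0 (modes N c s))"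
      using xe[of "mu _" "2 * \<tau> - s"] mu that \<tau> by (intro norm_fdiag) auto
    also have "\<dots> \<le> 1 / \<tau> * (?K * norm v)"
      using error0[of "modes N c s"] mult_left_mono[OF nu[OF that(1)] K] \<tau> by (intro mult_left_mono) auto
    finally show ?thesis .
  qed
  have E1: "norm (?G \<tau> - expH \<tau> (modes N c \<tau>)) \<le> 1 / \<tau> * (?K * norm v)"
    using E'[of \<tau>] \<tau> by simp
  have E2: "norm (?G 0 - expH (2 * \<tau>) v) \<le> 1 / \<tau> * (?K * norm v)"
    using E'[of 0] \<tau> unfolding v_def by simp
  define B where "B = ?K * norm v / \<tau>"
  have bounds: "?K * (1 / \<tau> * norm v) = B" "1 / \<tau> * (?K * norm v) = B"
    "1 * (?K * (2 / \<tau>\<^sup>2 * norm v)) * (2 * \<tau> - \<tau>) = 2 * B" "2 / \<tau>\<^sup>2 * (?K * norm v) * (\<tau> - 0) = 2 * B"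
    using \<tau> by (simp_all add: B_def power2_eq_square)
  have sum6: "norm (x1 - y) \<le> 8 * B"
    if "norm (x1 - x2) \<le> B" "norm (x2 - x3) \<le> 2 * B" "norm (x3 - x4) \<le> B"
      "norm (x5 - x4) \<le> B" "norm (x5 - x6) \<le> 2 * B" "norm (x6 - y) \<le> B" for x1 x2 x3 x4 x5 x6 y :: 'h
    using norm_sum6_le[of "x1 - x2" "x2 - x3" "x3 - x4" "x5 - x4" "x5 - x6" "x6 - y"] that by simp
  have "norm (modes N c (2 * \<tau>) - expH (2 * \<tau>) v) \<le> 8 * B"
    by (rule sum6[OF B[unfolded bounds] A[unfolded bounds] C[unfolded bounds] E1[unfolded bounds]
        D[unfolded bounds] E2[unfolded bounds]])
  also have "8 * B = 8 / \<tau> * ?K * norm v" by (simp add: B_def)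
  finally show ?thesis by (simp add: v_def)
qed

text \<open>Density of finite eigenfunction sums, with \<open>\<tau> = t / 2\<close>.\<close>

lemma semigroup_error:
  assumes t: "0 < t"
  shows "norm (expA t v - expH t v) \<le> 16 / t * (\<kappa> * h\<^sup>2) * norm v"
proof -
  define w where "w = (\<lambda>N. \<Sum>n<N. (v \<bullet> e n) *\<^sub>R e n)"
  have w: "w \<longlonglongrightarrow> v" using expansion[of v] by (simp add: w_def sums_def)
  have "modes N (\<lambda>n. v \<bullet> e n) 0 = w N" "modes N (\<lambda>n. v \<bullet> e n) t = expA t (w N)" for N
    using t by (auto intro!: eq_of_coeff simp: modes_def w_def inner_sum_e expA_coeff mult.commute)
  then have "norm (expA t (w N) - expH t (w N)) \<le> 16 / t * (\<kappa> * h\<^sup>2) * norm (w N)" for N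
    using semigroup_error_modes[of "t / 2" N "\<lambda>n. v \<bullet> e n"] t by simp
  moreover have "(\<lambda>N. norm (expA t (w N) - expH t (w N))) \<longlonglongrightarrow> norm (expA t v - expH t v)"
    using t by (intro tendsto_norm tendsto_diff bounded_linear.tendsto[OF _ w] expA_linear fdiag_linear) simp
  moreover have "(\<lambda>N. 16 / t * (\<kappa> * h\<^sup>2) * norm (w N)) \<longlonglongrightarrow> 16 / t * (\<kappa> * h\<^sup>2) * norm v"
    by (intro tendsto_intros w)
  ultimately show ?thesis by (intro LIMSEQ_le[of "\<lambda>N. norm (expA t (w N) - expH t (w N))"]) auto
qed

end

section \<open>Comparison of propagators and of covariances over the whole time interval\<close>

context galerkin_noise
begin

text \<open>\<open>T \<ge> 1\<close> disposes of the singular factor \<open>1 / T\<close> of the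
  smoothing estimate and turns \<open>C\<theta> / N\<close> into \<open>C\<theta>\<close> times the
  time step; a step of at most 1 is below its power \<open>\<gamma>\<close>. The summand 2 of the
  constant is the contraction bound used for \<open>h > 1\<close>.\<close>

lemma propagator_error:
  assumes \<theta>: "1/2 < \<theta>" "\<theta> \<le> 1" and T: "1 \<le> T" and N: "1 \<le> N" and dt: "T / real N \<le> 1"
    and C\<theta>: "0 < C\<theta>" "\<And>z. 0 < z \<Longrightarrow> \<bar>exp (- (real N * z)) - theta_ratio \<theta> z ^ N\<bar> \<le> C\<theta> / real N"
  shows "norm (expA T v - fdiag (\<lambda>m. theta_ratio \<theta> (mu m * (T / real N)) ^ N) v)
    \<le> (16 * \<kappa> + 2 + C\<theta>) * (\<eta> + (T / real N) powr \<gamma>) * norm v"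
proof -
  let ?r = "\<lambda>m. theta_ratio \<theta> (mu m * (T / real N)) ^ N" and ?dt = "T / real N"
  have dt0: "0 < ?dt" using T N by simp
  have \<eta>0: "0 \<le> \<eta>" by (simp add: \<eta>_def)
  have "?dt powr 1 \<le> ?dt powr \<gamma>" using dt dt0 \<gamma>1 by (intro powr_mono') auto
  then have dtg: "?dt \<le> ?dt powr \<gamma>" by (simp only: powr_one[OF less_imp_le[OF dt0]])
  have 1: "norm (expA T v - expH T v) \<le> (16 * \<kappa> + 2) * \<eta> * norm v"
  proof (cases "h \<le> 1")
    case True
    have "h powr (2 * \<gamma>) \<le> 1 powr (2 * \<gamma>)" using True h \<gamma>0 by (intro powr_mono2) auto
    then have "\<eta> = h powr (2 * \<gamma>)" by (simp add: \<eta>_def min_absorb2)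
    moreover have "h powr 2 \<le> h powr (2 * \<gamma>)" using True h \<gamma>1 by (intro powr_mono') auto
    ultimately have h2: "h\<^sup>2 \<le> \<eta>" using h by simp
    have "16 / T \<le> 16" using T by (simp add: divide_simps)
    then have "16 / T * (\<kappa> * h\<^sup>2) * norm v \<le> 16 * (\<kappa> * \<eta>) * norm v"
      using \<kappa> T h2 \<eta>0 by (intro mult_right_mono mult_mono mult_left_mono) auto
    also have "\<dots> \<le> (16 * \<kappa> + 2) * \<eta> * norm v"
      unfolding mult.assoc[symmetric] using \<eta>0 by (intro mult_right_mono) auto
    finally show ?thesis using semigroup_error[of T v] T by simp
  next
    case False
    have "1 powr (2 * \<gamma>) \<le> h powr (2 * \<gamma>)" using False \<gamma>0 by (intro powr_mono2) auto
    then have \<eta>: "\<eta> = 1" by (simp add: \<eta>_def)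
    have "norm (expA T v) \<le> norm v" using T by (intro norm_expA) simp
    moreover have "norm (expH T v) \<le> 1 * norm v"
      using mu_pos T by (intro norm_fdiag) (auto intro: mult_nonneg_nonneg less_imp_le)
    ultimately have "norm (expA T v - expH T v) \<le> 2 * norm v"
      using norm_triangle_ineq4[of "expA T v" "expH T v"] by simp
    also have "\<dots> \<le> (16 * \<kappa> + 2) * \<eta> * norm v" using \<kappa> by (intro mult_right_mono) (auto simp: \<eta>)
    finally show ?thesis .
  qed
  have "norm (expH T v - fdiag ?r v) \<le> C\<theta> * ?dt * norm v"
  proof -
    have "expH T v - fdiag ?r v = fdiag (\<lambda>m. exp (- (mu m * T)) - ?r m) v"
      by (simp add: fdiag_def left_diff_distrib scaleR_diff_left sum_subtractf)
    also have "norm \<dots> \<le> C\<theta> * ?dt * norm v"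
    proof (rule norm_fdiag)
      fix m assume "m < d"
      then have "0 < mu m * ?dt" by (intro mult_pos_pos mu_pos dt0)
      then have "\<bar>exp (- (real N * (mu m * ?dt))) - ?r m\<bar> \<le> C\<theta> / real N" by (rule C\<theta>(2))
      also have "\<dots> \<le> C\<theta> * ?dt" using C\<theta>(1) T N by (simp add: divide_simps)
      finally show "\<bar>exp (- (mu m * T)) - ?r m\<bar> \<le> C\<theta> * ?dt" using N by (simp add: mult_ac)
    qed (use C\<theta>(1) T in simp)
    finally show ?thesis .
  qed
  also have "\<dots> \<le> C\<theta> * ?dt powr \<gamma> * norm v"
    using C\<theta>(1) dtg by (intro mult_right_mono mult_left_mono) auto
  finally have "norm (expA T v - fdiag ?r v) \<le> (16 * \<kappa> + 2) * \<eta> * norm v + C\<theta> * ?dt powr \<gamma> * norm v"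
    using 1 norm_triangle_ineq[of "expA T v - expH T v" "expH T v - fdiag ?r v"] by simp
  also have "\<dots> \<le> (16 * \<kappa> + 2 + C\<theta>) * (\<eta> + ?dt powr \<gamma>) * norm v"
    unfolding distrib_right[symmetric]
  proof (rule mult_right_mono)
    have "0 \<le> C\<theta> * \<eta>" "0 \<le> (16 * \<kappa> + 2) * ?dt powr \<gamma>" using C\<theta>(1) \<eta>0 \<kappa> by auto
    then show "(16 * \<kappa> + 2) * \<eta> + C\<theta> * ?dt powr \<gamma> \<le> (16 * \<kappa> + 2 + C\<theta>) * (\<eta> + ?dt powr \<gamma>)"
      by (simp add: algebra_simps)
  qed simp
  finally show ?thesis .
qed

lemma TN_diff: "TN N (\<lambda>u v. b u v - c u v) = TN N b - TN N c"
  by (simp add: TN_def kernel_form_def right_diff_distrib sum_subtractf)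

text \<open>Covariances at the final time are the stationary ones minus their images under the
  propagator.\<close>

lemma covariance_error:
  assumes b: "bform K b" and \<delta>: "0 < \<delta>" "\<delta> \<le> dt" and T: "0 \<le> T"
    and r: "\<And>m. m < d \<Longrightarrow> \<bar>r m\<bar> \<le> 1"
    and E: "\<And>v. norm (expA T v - fdiag r v) \<le> CE * (\<eta> + dt powr \<gamma>) * norm v" "0 \<le> CE"
  shows "\<bar>(TN N b - TN N (\<lambda>u v. b (expA T u) (expA T v))) - (TD \<delta> b - TD \<delta> (\<lambda>u v. b (fdiag r u) (fdiag r v)))\<bar>
    \<le> K * ((8 * (Cz \<kappa> * trA) + 2 * (cq * trA) + 2 * (CE * trK)) * (\<eta> + dt powr \<gamma>) + 2 * trunc_err N)"
proof -
  interpret b: bounded_bilinear b by (rule bformD(1)[OF b])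
  have K: "0 \<le> K" by (rule bform_nonneg[OF b])
  have \<eta>0: "0 \<le> \<eta>" by (simp add: \<eta>_def)
  have \<delta>\<gamma>: "\<delta> powr \<gamma> \<le> dt powr \<gamma>" using \<delta> \<gamma>0 by (intro powr_mono2) auto
  have main: "\<bar>TN N c - TD \<delta> c\<bar> \<le> K * (4 * (Cz \<kappa> * trA) * \<eta> + trunc_err N + cq * trA * dt powr \<gamma>)"
    if c: "bform K c" for c
  proof -
    have "\<bar>TN N c - TD \<delta> c\<bar> \<le> K * (4 * (Cz \<kappa> * trA) * \<eta> + trunc_err N) + K * (cq * trA * \<delta> powr \<gamma>)"
      using TN_Th[OF c, of N] Th_TD[OF c \<delta>(1)] by linarith
    also have "\<dots> \<le> K * (4 * (Cz \<kappa> * trA) * \<eta> + trunc_err N) + K * (cq * trA * dt powr \<gamma>)"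
      using \<delta>\<gamma> K cq trA_nonneg by (intro add_left_mono mult_left_mono) auto
    finally show ?thesis by (simp add: algebra_simps)
  qed
  let ?bS = "\<lambda>u v. b (expA T u) (expA T v)" and ?br = "\<lambda>u v. b (fdiag r u) (fdiag r v)"
  have n1: "norm (expA T v) \<le> 1 * norm v" for v using norm_expA[OF T] by simp
  have n2: "norm (fdiag r v) \<le> 1 * norm v" for v by (rule norm_fdiag) (use r in auto)
  have bS: "bform K ?bS" using bform_comp[OF b expA_linear[OF T] n1 _ expA_linear[OF T] n1 K] by simp
  have br: "bform K ?br" using bform_comp[OF b fdiag_linear n2 _ fdiag_linear n2 K] by simp
  let ?\<epsilon> = "CE * (\<eta> + dt powr \<gamma>)"
  have \<epsilon>0: "0 \<le> ?\<epsilon>" using E(2) \<eta>0 by simp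
  have dl: "bounded_linear (\<lambda>v. expA T v - fdiag r v)"
    by (intro bounded_linear_sub expA_linear T fdiag_linear)
  \<comment> \<open>The difference of two squares is written with one propagator difference in each
    term, so that it is a form of bound \<open>2 * K * ?\<epsilon>\<close>.\<close>
  have "bform (K * ?\<epsilon> * 1 + K * 1 * ?\<epsilon>)
     (\<lambda>u v. b (expA T u - fdiag r u) (expA T v) + b (fdiag r u) (expA T v - fdiag r v))"
    by (intro bform_add bform_comp b dl E(1) \<epsilon>0 K expA_linear T fdiag_linear n1 n2) simp
  also have "(\<lambda>u v. b (expA T u - fdiag r u) (expA T v) + b (fdiag r u) (expA T v - fdiag r v)) =
      (\<lambda>u v. ?bS u v - ?br u v)"
    by (simp add: b.diff_left b.diff_right)
  finally have "\<bar>TN N (\<lambda>u v. ?bS u v - ?br u v)\<bar> \<le> (K * ?\<epsilon> * 1 + K * 1 * ?\<epsilon>) * TN N inner"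
    by (rule TN_dominated)
  also have "\<dots> \<le> (K * ?\<epsilon> * 1 + K * 1 * ?\<epsilon>) * trK"
    using K E(2) \<eta>0 by (intro mult_left_mono TN_inner_le add_nonneg_nonneg mult_nonneg_nonneg) auto
  finally have 3: "\<bar>TN N ?bS - TN N ?br\<bar> \<le> (K * ?\<epsilon> * 1 + K * 1 * ?\<epsilon>) * trK" by (simp only: TN_diff)
  \<comment> \<open>The stationary comparison is used twice, for \<open>b\<close> and for
    \<open>b\<close> composed with the discrete propagator, which has the same bound
    \<open>K\<close>. The propagator error is then only felt by the exact covariance, whose trace is
    at most \<open>trK\<close>.\<close>
  have "\<bar>(TN N b - TN N ?bS) - (TD \<delta> b - TD \<delta> ?br)\<bar> \<le>
      \<bar>TN N b - TD \<delta> b\<bar> + \<bar>TN N ?br - TD \<delta> ?br\<bar> + \<bar>TN N ?bS - TN N ?br\<bar>"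
    by linarith
  also have "\<dots> \<le> 2 * (K * (4 * (Cz \<kappa> * trA) * \<eta> + trunc_err N + cq * trA * dt powr \<gamma>))
      + (K * ?\<epsilon> * 1 + K * 1 * ?\<epsilon>) * trK"
    using main[OF b] main[OF br] 3 by linarith
  also have "\<dots> = K * (8 * (Cz \<kappa> * trA) * \<eta> + 2 * (cq * trA) * dt powr \<gamma> + 2 * (CE * trK) * (\<eta> + dt powr \<gamma>) + 2 * trunc_err N)"
    by (simp add: algebra_simps)
  also have "\<dots> \<le> K * ((8 * (Cz \<kappa> * trA) + 2 * (cq * trA) + 2 * (CE * trK)) * (\<eta> + dt powr \<gamma>) + 2 * trunc_err N)"
  proof (rule mult_left_mono[OF _ K])
    have "0 \<le> 8 * (Cz \<kappa> * trA) * dt powr \<gamma>" "0 \<le> 2 * (cq * trA) * \<eta>"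
      using cq \<eta>0 trA_nonneg Cz_nonneg[of \<kappa>] \<kappa> by (auto intro!: mult_nonneg_nonneg)
    then show "8 * (Cz \<kappa> * trA) * \<eta> + 2 * (cq * trA) * dt powr \<gamma> + 2 * (CE * trK) * (\<eta> + dt powr \<gamma>) + 2 * trunc_err N
      \<le> (8 * (Cz \<kappa> * trA) + 2 * (cq * trA) + 2 * (CE * trK)) * (\<eta> + dt powr \<gamma>) + 2 * trunc_err N"
      by (simp add: algebra_simps)
  qed
  finally show ?thesis .
qed

text \<open>The factor on the right is the integral of \<open>exp (- s * (lam j + lam k))\<close>
  over \<open>[0, T]\<close>, so this is the compressed covariance of the stochastic
  convolution.\<close>

lemma TN_horizon:
  assumes b: "bounded_bilinear b" and T: "0 \<le> T"
  shows "TN N b - TN N (\<lambda>u v. b (expA T u) (expA T v)) = kernel_form {..<N}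
    (\<lambda>j k. (R (e j) \<bullet> R (e k)) * ((1 - exp (- ((lam j + lam k) * T))) / (lam j + lam k))) e b"
proof -
  interpret b: bounded_bilinear b by (rule b)
  have "b (expA T (e j)) (expA T (e k)) = exp (- ((lam j + lam k) * T)) * b (e j) (e k)" for j k
    by (simp add: expA_e[OF T] b.scaleR_left b.scaleR_right distrib_right exp_add[symmetric])
  then show ?thesis
    unfolding TN_def kernel_form_def sum_subtractf[symmetric]
    by (intro sum.cong refl) (simp add: diff_divide_distrib algebra_simps)
qed

text \<open>A finite geometric series with quotient \<open>r_j r_k\<close>, where \<open>r\<close>
  is the amplification factor. Expanding gives \<open>1 - r_j r_k = dt * (mu j + mu k + (2 *
  \<theta> - 1) * dt * mu j * mu k) / (g_j g_k)\<close>, with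
  \<open>g = 1 + \<theta> * mu * dt\<close>; this is where the denominator of \<open>TD\<close>
  comes from. The right-hand side is the covariance after \<open>N\<close> steps.\<close>

lemma TD_horizon:
  assumes b: "bounded_bilinear b" and \<theta>: "1/2 < \<theta>" "\<theta> \<le> 1" and dt: "0 < dt"
  shows "TD ((2 * \<theta> - 1) * dt) b - TD ((2 * \<theta> - 1) * dt)
     (\<lambda>u v. b (fdiag (\<lambda>m. theta_ratio \<theta> (mu m * dt) ^ N) u) (fdiag (\<lambda>m. theta_ratio \<theta> (mu m * dt) ^ N) v)) =
   kernel_form {..<d} (\<lambda>j k. (R (f j) \<bullet> R (f k)) * (\<Sum>n<N. dt *
     (theta_ratio \<theta> (mu j * dt) ^ n / (1 + \<theta> * (mu j * dt)) * (theta_ratio \<theta> (mu k * dt) ^ n / (1 + \<theta> * (mu k * dt)))))) f b"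
proof -
  interpret b: bounded_bilinear b by (rule b)
  let ?r = "\<lambda>m. theta_ratio \<theta> (mu m * dt)" and ?g = "\<lambda>m. 1 + \<theta> * (mu m * dt)"
  let ?D = "\<lambda>j k. mu j + mu k + (2 * \<theta> - 1) * dt * mu j * mu k"
  have f: "fdiag c (f m) = c m *\<^sub>R f m" if "m < d" for c m
  proof -
    have "fdiag c (f m) = (\<Sum>l<d. if l = m then c m *\<^sub>R f m else 0)"
      unfolding fdiag_def using that by (intro sum.cong refl) (auto simp: f_ortho)
    then show ?thesis using that by simp
  qed
  have geo: "(1 - ?r j ^ N * ?r k ^ N) / ?D j k = (\<Sum>n<N. dt * (?r j ^ n / ?g j * (?r k ^ n / ?g k)))"
    if jk: "j < d" "k < d" for j k
  proof -
    have pos: "0 < mu j" "0 < mu k" using mu_pos jk by auto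
    have g: "0 < ?g j" "0 < ?g k" using pos \<theta> dt by (auto intro!: add_pos_nonneg)
    have D: "0 < ?D j k" using pos \<theta> dt by (intro add_pos_nonneg mult_nonneg_nonneg) auto
    have rr: "1 - ?r j * ?r k = dt * ?D j k / (?g j * ?g k)"
    proof -
      have "1 - a / p * (b / q) = (p * q - a * b) / (p * q)" if "0 < p" "0 < q" for a b p q :: real
        using that by (simp add: field_simps)
      from this[OF g] have "1 - ?r j * ?r k = (?g j * ?g k - (1 - (1 - \<theta>) * (mu j * dt)) * (1 - (1 - \<theta>) * (mu k * dt))) / (?g j * ?g k)"
        unfolding theta_ratio_def .
      also have "?g j * ?g k - (1 - (1 - \<theta>) * (mu j * dt)) * (1 - (1 - \<theta>) * (mu k * dt)) = dt * ?D j k"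
        by (simp add: algebra_simps)
      finally show ?thesis .
    qed
    then have ne: "?r j * ?r k \<noteq> 1" using D g dt by auto
    have "(\<Sum>n<N. dt * (?r j ^ n / ?g j * (?r k ^ n / ?g k))) = dt / (?g j * ?g k) * (\<Sum>n<N. (?r j * ?r k) ^ n)"
      by (simp add: sum_distrib_left power_mult_distrib)
    also have "(\<Sum>n<N. (?r j * ?r k) ^ n) = (1 - (?r j * ?r k) ^ N) / (1 - ?r j * ?r k)"
      using ne by (simp add: sum_gp_strict)
    also have "dt / (?g j * ?g k) * ((1 - (?r j * ?r k) ^ N) / (1 - ?r j * ?r k)) = (1 - (?r j * ?r k) ^ N) / ?D j k"
    proof -
      have "dt / G * (X / (dt * D' / G)) = X / D'" if "0 < G" "0 < D'" for X G D'
        using that dt by simp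
      from this[OF mult_pos_pos[OF g] D] show ?thesis unfolding rr .
    qed
    finally show ?thesis by (simp add: power_mult_distrib)
  qed
  show ?thesis
    unfolding TD_def kernel_form_def sum_subtractf[symmetric]
  proof (intro sum.cong refl)
    fix j k assume "j \<in> {..<d}" "k \<in> {..<d}"
    then have jk: "j < d" "k < d" by auto
    show "R (f j) \<bullet> R (f k) / ?D j k * b (f j) (f k) - R (f j) \<bullet> R (f k) / ?D j k *
        b (fdiag (\<lambda>m. ?r m ^ N) (f j)) (fdiag (\<lambda>m. ?r m ^ N) (f k)) =
      R (f j) \<bullet> R (f k) * (\<Sum>n<N. dt * (?r j ^ n / ?g j * (?r k ^ n / ?g k))) * b (f j) (f k)"
      unfolding geo[OF jk, symmetric] f[OF jk(1)] f[OF jk(2)]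
      by (simp add: b.scaleR_left b.scaleR_right diff_divide_distrib algebra_simps)
  qed
qed

end

section \<open>Comparison of Gaussian expectations\<close>

lemma normal_density_tendsto_0:
  fixes \<psi> :: "real \<Rightarrow> real"
  assumes \<sigma>: "0 < \<sigma>" and \<psi>: "\<And>y. \<bar>\<psi> y\<bar> \<le> a + B * \<bar>y\<bar>" and F: "filterlim (\<lambda>y::real. \<bar>y\<bar>) at_top F"
  shows "((\<lambda>y. normal_density 0 \<sigma> y * \<psi> y) \<longlongrightarrow> 0) F"
proof -
  define c where "c = 1 / sqrt (2 * pi * \<sigma>\<^sup>2)"
  have c0: "0 \<le> c" by (simp add: c_def)
  have a0: "0 \<le> a" using \<psi>[of 0] by simp
  have bound: "norm (normal_density 0 \<sigma> y * \<psi> y) \<le> (c * 2 * \<sigma>\<^sup>2 * (a + B)) * (1 / \<bar>y\<bar>)" if y: "\<bar>y\<bar> \<ge> 1" for y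
  proof -
    define u where "u = y\<^sup>2 / (2 * \<sigma>\<^sup>2)"
    have y2: "0 < y\<^sup>2" using y by auto
    then have u0: "0 < u" using \<sigma> by (simp add: u_def)
    have "u \<le> exp u" using exp_ge_add_one_self[of u] by linarith
    then have "exp (- u) \<le> 1 / u" using u0 by (simp add: exp_minus divide_simps)
    also have "1 / u = 2 * \<sigma>\<^sup>2 / \<bar>y\<bar>\<^sup>2" by (simp add: u_def)
    finally have "c * exp (- u) \<le> c * (2 * \<sigma>\<^sup>2 / \<bar>y\<bar>\<^sup>2)" by (rule mult_left_mono[OF _ c0])
    then have "normal_density 0 \<sigma> y \<le> c * (2 * \<sigma>\<^sup>2 / \<bar>y\<bar>\<^sup>2)"
      unfolding normal_density_def c_def[symmetric] by (simp add: u_def)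
    moreover have "\<bar>\<psi> y\<bar> \<le> (a + B) * \<bar>y\<bar>"
    proof -
      have "a * 1 \<le> a * \<bar>y\<bar>" using y a0 by (intro mult_left_mono) auto
      then show ?thesis using \<psi>[of y] by (simp add: algebra_simps)
    qed
    ultimately have "normal_density 0 \<sigma> y * \<bar>\<psi> y\<bar> \<le> (c * (2 * \<sigma>\<^sup>2 / \<bar>y\<bar>\<^sup>2)) * ((a + B) * \<bar>y\<bar>)"
      using c0 by (intro mult_mono) auto
    also have "\<dots> = (c * 2 * \<sigma>\<^sup>2 * (a + B)) * (1 / \<bar>y\<bar>)" using y by (simp add: field_simps power2_eq_square)
    finally show ?thesis by (simp add: abs_mult)
  qed
  have "((\<lambda>y. (c * 2 * \<sigma>\<^sup>2 * (a + B)) * (1 / \<bar>y\<bar>)) \<longlongrightarrow> (c * 2 * \<sigma>\<^sup>2 * (a + B)) * 0) F"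
    by (intro tendsto_mult tendsto_const tendsto_divide_0[OF tendsto_const] filterlim_at_top_imp_at_infinity F)
  then have "((\<lambda>y. (c * 2 * \<sigma>\<^sup>2 * (a + B)) * (1 / \<bar>y\<bar>)) \<longlongrightarrow> 0) F" by simp
  then show ?thesis
    by (rule Lim_null_comparison[rotated])
      (use bound F in \<open>auto simp: filterlim_at_top elim!: allE[of _ 1] eventually_mono\<close>)
qed

lemma lipschitz_linear_growth:
  fixes \<psi> :: "real \<Rightarrow> real"
  assumes "\<And>y. (\<psi> has_real_derivative \<psi>' y) (at y)" and "\<And>y. \<bar>\<psi>' y\<bar> \<le> B"
  shows "\<bar>\<psi> y\<bar> \<le> \<bar>\<psi> 0\<bar> + B * \<bar>y\<bar>"
proof -
  have "norm (\<psi> y - \<psi> 0) \<le> B * norm (y - 0)"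
    by (rule field_differentiable_bound[where S=UNIV and f'=\<psi>'])
      (use assms in \<open>auto intro: has_field_derivative_at_within\<close>)
  then show ?thesis by simp
qed

text \<open>The normal density \<open>n\<close> satisfies
  \<open>n' = - (y / \<sigma>\<^sup>2) * n\<close>. Hence the integrand \<open>f\<close> is the
  derivative of \<open>n * \<psi>\<close>, which vanishes at both ends because \<open>\<psi>\<close>
  grows at most linearly.\<close>

lemma normal_integration_by_parts:
  fixes \<psi> \<psi>' :: "real \<Rightarrow> real"
  assumes \<sigma>: "0 < \<sigma>"
    and d: "\<And>y. (\<psi> has_real_derivative \<psi>' y) (at y)" and c: "continuous_on UNIV \<psi>'"
    and B: "\<And>y. \<bar>\<psi>' y\<bar> \<le> B"
  shows "(\<integral>y. normal_density 0 \<sigma> y * (y * \<psi> y) \<partial>lborel) = \<sigma>\<^sup>2 * (\<integral>y. normal_density 0 \<sigma> y * \<psi>' y \<partial>lborel)"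
proof -
  let ?n = "normal_density 0 \<sigma>"
  define f where "f = (\<lambda>y. ?n y * \<psi>' y - (1 / \<sigma>\<^sup>2) * (?n y * (y * \<psi> y)))"
  have \<psi>c: "continuous_on UNIV \<psi>"
    using d by (meson DERIV_continuous continuous_at_imp_continuous_on)
  have [measurable]: "\<psi> \<in> borel_measurable borel" "\<psi>' \<in> borel_measurable borel"
    using \<psi>c c by (auto intro: borel_measurable_continuous_onI)
  note growth = lipschitz_linear_growth[OF d B]
  have i1: "integrable lborel (\<lambda>y. ?n y * \<psi>' y)"
  proof (rule Bochner_Integration.integrable_bound[where f="\<lambda>y. B * ?n y"])
    show "integrable lborel (\<lambda>y. B * ?n y)" using \<sigma> by simp
    show "AE y in lborel. norm (?n y * \<psi>' y) \<le> norm (B * ?n y)"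
      using B by (auto simp: abs_mult mult.commute[of _ "?n _"] intro!: mult_left_mono order_trans[OF B abs_ge_self])
  qed simp
  have i2: "integrable lborel (\<lambda>y. ?n y * (y * \<psi> y))"
  proof (rule Bochner_Integration.integrable_bound)
    show "integrable lborel (\<lambda>y. \<bar>\<psi> 0\<bar> * (?n y * \<bar>y - 0\<bar> ^ 1) + B * (?n y * \<bar>y - 0\<bar> ^ 2))"
      using \<sigma> by (intro Bochner_Integration.integrable_add integrable_mult_right integrable_normal_moment_abs)
    show "AE y in lborel. norm (?n y * (y * \<psi> y)) \<le> norm (\<bar>\<psi> 0\<bar> * (?n y * \<bar>y - 0\<bar> ^ 1) + B * (?n y * \<bar>y - 0\<bar> ^ 2))"
    proof (rule AE_I2)
      fix y
      have "?n y * (\<bar>y\<bar> * \<bar>\<psi> y\<bar>) \<le> ?n y * (\<bar>y\<bar> * (\<bar>\<psi> 0\<bar> + B * \<bar>y\<bar>))"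
        by (intro mult_left_mono growth) auto
      also have "\<dots> = \<bar>\<psi> 0\<bar> * (?n y * \<bar>y - 0\<bar> ^ 1) + B * (?n y * \<bar>y - 0\<bar> ^ 2)"
        by (simp add: algebra_simps power2_eq_square)
      finally show "norm (?n y * (y * \<psi> y)) \<le> norm (\<bar>\<psi> 0\<bar> * (?n y * \<bar>y - 0\<bar> ^ 1) + B * (?n y * \<bar>y - 0\<bar> ^ 2))"
        by (simp add: abs_mult)
    qed
  qed simp
  have fi: "integrable lborel f" unfolding f_def using i1 i2 by simp
  have lim: "((\<lambda>y. ?n y * \<psi> y) \<longlongrightarrow> 0) F" if "filterlim (\<lambda>y::real. \<bar>y\<bar>) at_top F" for F
    by (rule normal_density_tendsto_0[OF \<sigma> growth that])
  have "(LBINT y=-\<infinity>..\<infinity>. f y) = 0 - 0"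
  proof (rule interval_integral_FTC_integrable[where F="\<lambda>y. ?n y * \<psi> y"])
    fix y :: real
    define k where "k = 1 / sqrt (2 * pi * \<sigma>\<^sup>2)"
    have n: "?n = (\<lambda>y. k * exp (- y\<^sup>2 / (2 * \<sigma>\<^sup>2)))"
      by (simp add: fun_eq_iff normal_density_def k_def)
    have "(?n has_real_derivative - (y / \<sigma>\<^sup>2) * ?n y) (at y)"
      unfolding n by (auto intro!: derivative_eq_intros) (use \<sigma> in \<open>simp_all add: divide_simps power2_eq_square power4_eq_xxxx\<close>)
    from DERIV_mult[OF this d[of y]]
    have "((\<lambda>y. ?n y * \<psi> y) has_real_derivative f y) (at y)"
      unfolding f_def by (rule back_subst[where P="\<lambda>D. (_ has_real_derivative D) _"]) (simp add: algebra_simps)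
    then show "((\<lambda>y. ?n y * \<psi> y) has_vector_derivative f y) (at y)"
      by (simp add: has_real_derivative_iff_has_vector_derivative)
    have "continuous_on UNIV f"
      unfolding f_def normal_density_def using \<sigma> by (intro continuous_intros c \<psi>c) auto
    then show "isCont f y" by (simp add: continuous_on_eq_continuous_at)
  next
    show "set_integrable lborel (einterval (-\<infinity>) \<infinity>) f"
      using fi by (simp add: set_integrable_def einterval_def)
    show "(((\<lambda>y. ?n y * \<psi> y) \<circ> real_of_ereal) \<longlongrightarrow> 0) (at_right (-\<infinity>))"
      unfolding ereal_tendsto_simps 
    proof (rule lim, unfold filterlim_at_top eventually_at_bot_linorder, intro allI)
      fix Z :: real
      show "\<exists>N. \<forall>n\<le>N. Z \<le> \<bar>n\<bar>" by (intro exI[of _ "- \<bar>Z\<bar>"]) auto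
    qed
    show "(((\<lambda>y. ?n y * \<psi> y) \<circ> real_of_ereal) \<longlongrightarrow> 0) (at_left \<infinity>)"
      unfolding ereal_tendsto_simps by (intro lim filterlim_abs_real)
  qed simp
  then have "(\<integral>y. f y \<partial>lborel) = 0"
    by (simp add: interval_lebesgue_integral_def set_lebesgue_integral_def einterval_def)
  then have "(\<integral>y. ?n y * \<psi>' y \<partial>lborel) = (1 / \<sigma>\<^sup>2) * (\<integral>y. ?n y * (y * \<psi> y) \<partial>lborel)"
    unfolding f_def using i1 i2 by simp
  then show ?thesis using \<sigma> by simp
qed

text \<open>Laws are given by densities, so degenerate members with \<open>\<sigma> j = 0\<close>
  have to be left out of \<open>J\<close>.\<close>

definition gauss_family :: "'w measure \<Rightarrow> 'i set \<Rightarrow> ('i \<Rightarrow> 'w \<Rightarrow> real) \<Rightarrow> ('i \<Rightarrow> real) \<Rightarrow> bool" where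
  "gauss_family M J \<zeta> \<sigma> \<longleftrightarrow> finite J \<and> prob_space.indep_vars M (\<lambda>_. borel) \<zeta> J \<and>
     (\<forall>j\<in>J. 0 < \<sigma> j \<and> distributed M lborel (\<zeta> j) (\<lambda>y. ennreal (normal_density 0 (\<sigma> j) y)))"

lemma gauss_familyD:
  assumes "gauss_family M J \<zeta> \<sigma>"
  shows "finite J" "prob_space.indep_vars M (\<lambda>_. borel) \<zeta> J"
    "j \<in> J \<Longrightarrow> 0 < \<sigma> j" "j \<in> J \<Longrightarrow> distributed M lborel (\<zeta> j) (\<lambda>y. ennreal (normal_density 0 (\<sigma> j) y))"
    "j \<in> J \<Longrightarrow> \<zeta> j \<in> borel_measurable M"
  using assms by (auto simp: gauss_family_def dest: distributed_measurable[where N=lborel, simplified])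

lemma gauss_family_integrable:
  assumes G: "gauss_family M J \<zeta> \<sigma>" and j: "j \<in> J"
  shows "integrable M (\<lambda>\<omega>. (\<zeta> j \<omega>)\<^sup>2)"
proof -
  note d = gauss_familyD[OF G]
  have "integrable lborel (\<lambda>x. normal_density 0 (\<sigma> j) x * (x - 0) ^ 2)"
    by (rule integrable_normal_moment[OF d(3)[OF j]])
  then show ?thesis
    using distributed_integrable[OF d(4)[OF j], of "\<lambda>x. x\<^sup>2"] by simp
qed

lemma gauss_family_norm_integrable:
  fixes g :: "'i \<Rightarrow> 'h::{real_inner, second_countable_topology}"
  assumes M: "prob_space M" and G: "gauss_family M J \<zeta> \<sigma>"
  shows "(\<lambda>\<omega>. \<Sum>k\<in>J. \<zeta> k \<omega> *\<^sub>R g k) \<in> borel_measurable M"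
    "integrable M (\<lambda>\<omega>. norm (\<Sum>k\<in>J. \<zeta> k \<omega> *\<^sub>R g k))"
proof -
  interpret prob_space M by (rule M)
  note d = gauss_familyD[OF G]
  show m: "(\<lambda>\<omega>. \<Sum>k\<in>J. \<zeta> k \<omega> *\<^sub>R g k) \<in> borel_measurable M"
    by (intro borel_measurable_sum borel_measurable_scaleR d(5) borel_measurable_const)
  show "integrable M (\<lambda>\<omega>. norm (\<Sum>k\<in>J. \<zeta> k \<omega> *\<^sub>R g k))"
  proof (rule Bochner_Integration.integrable_bound)
    show "integrable M (\<lambda>\<omega>. \<Sum>k\<in>J. (1 + (\<zeta> k \<omega>)\<^sup>2) * norm (g k))"
      by (intro Bochner_Integration.integrable_sum integrable_mult_left Bochner_Integration.integrable_add
          integrable_const gauss_family_integrable[OF G])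
    show "AE \<omega> in M. norm (norm (\<Sum>k\<in>J. \<zeta> k \<omega> *\<^sub>R g k)) \<le> norm (\<Sum>k\<in>J. (1 + (\<zeta> k \<omega>)\<^sup>2) * norm (g k))"
    proof (rule AE_I2)
      fix \<omega>
      have le: "\<bar>z\<bar> \<le> 1 + z\<^sup>2" for z :: real
        using sum_squares_bound[of "\<bar>z\<bar>" 1] by simp
      have "norm (\<Sum>k\<in>J. \<zeta> k \<omega> *\<^sub>R g k) \<le> (\<Sum>k\<in>J. (1 + (\<zeta> k \<omega>)\<^sup>2) * norm (g k))"
        by (intro order_trans[OF norm_sum] sum_mono) (simp add: mult_right_mono le)
      then show "norm (norm (\<Sum>k\<in>J. \<zeta> k \<omega> *\<^sub>R g k)) \<le> norm (\<Sum>k\<in>J. (1 + (\<zeta> k \<omega>)\<^sup>2) * norm (g k))"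
        by simp
    qed
  qed (use m in measurable)
qed

lemma lipschitz_of_derivative:
  fixes F :: "'h::real_normed_vector \<Rightarrow> 'v::real_normed_vector"
  assumes "\<And>x. (F has_derivative F' x) (at x)" and "\<And>x v. norm (F' x v) \<le> B * norm v" and "0 \<le> B"
  shows "norm (F x - F y) \<le> B * norm (x - y)"
proof (rule differentiable_bound[where S=UNIV and f'=F'])
  show "onorm (F' x) \<le> B" for x
    using assms by (intro onorm_bound)
qed (use assms in \<open>auto intro: has_derivative_at_withinI\<close>)

text \<open>Independence makes the joint law of coordinate \<open>j\<close> and the remaining ones a
  product. For frozen remaining coordinates the claim is the one-dimensional integration by parts
  along \<open>g j\<close>; Fubini does the rest.\<close>

lemma stein_family:
  fixes g :: "'i \<Rightarrow> 'h::{real_inner, banach, second_countable_topology}"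
    and F :: "'h \<Rightarrow> real"
  assumes M: "prob_space M" and G: "gauss_family M J \<zeta> \<sigma>" and j: "j \<in> J"
    and dF: "\<And>x. (F has_derivative F' x) (at x)"
    and cF: "continuous_on UNIV (\<lambda>x. F' x (g j))"
    and B: "\<And>x v. \<bar>F' x v\<bar> \<le> B * norm v" "0 \<le> B"
  shows "(\<integral>\<omega>. \<zeta> j \<omega> * F (\<Sum>k\<in>J. \<zeta> k \<omega> *\<^sub>R g k) \<partial>M)
    = (\<sigma> j)\<^sup>2 * (\<integral>\<omega>. F' (\<Sum>k\<in>J. \<zeta> k \<omega> *\<^sub>R g k) (g j) \<partial>M)"
    and "integrable M (\<lambda>\<omega>. \<zeta> j \<omega> * F (\<Sum>k\<in>J. \<zeta> k \<omega> *\<^sub>R g k))"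
proof -
  interpret prob_space M by (rule M)
  note d = gauss_familyD[OF G]
  define Y where "Y = (\<lambda>\<omega>. \<Sum>k\<in>J - {j}. \<zeta> k \<omega> *\<^sub>R g k)"
  have sum_eq: "(\<Sum>k\<in>J. \<zeta> k \<omega> *\<^sub>R g k) = \<zeta> j \<omega> *\<^sub>R g j + Y \<omega>" for \<omega>
    unfolding Y_def using d(1) j by (simp add: sum.remove)
  have [measurable]: "\<zeta> j \<in> borel_measurable M" "Y \<in> borel_measurable M"
    unfolding Y_def using j d(5) by (auto intro!: borel_measurable_sum borel_measurable_scaleR)
  have Fc: "continuous_on UNIV F"
    using dF by (meson has_derivative_continuous continuous_at_imp_continuous_on)
  have [measurable]: "F \<in> borel_measurable borel" "(\<lambda>x. F' x (g j)) \<in> borel_measurable borel"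
    using Fc cF by (auto intro: borel_measurable_continuous_onI)
  have B0: "0 \<le> B * norm v" for v :: 'h using B(2) by simp
  show int1: "integrable M (\<lambda>\<omega>. \<zeta> j \<omega> * F (\<Sum>k\<in>J. \<zeta> k \<omega> *\<^sub>R g k))"
  proof (rule Bochner_Integration.integrable_bound)
    \<comment> \<open>The majorant comes from the linear growth of \<open>F\<close>, with each
      product of two coordinates bounded by the sum of their squares.\<close>
    show "integrable M (\<lambda>\<omega>. (1 + (\<zeta> j \<omega>)\<^sup>2) * \<bar>F 0\<bar> + (\<Sum>k\<in>J. ((\<zeta> j \<omega>)\<^sup>2 + (\<zeta> k \<omega>)\<^sup>2) * (B * norm (g k))))"
      by (intro Bochner_Integration.integrable_sum integrable_mult_left Bochner_Integration.integrable_add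
          integrable_const gauss_family_integrable[OF G] j)
    show "AE \<omega> in M. norm (\<zeta> j \<omega> * F (\<Sum>k\<in>J. \<zeta> k \<omega> *\<^sub>R g k)) \<le>
      norm ((1 + (\<zeta> j \<omega>)\<^sup>2) * \<bar>F 0\<bar> + (\<Sum>k\<in>J. ((\<zeta> j \<omega>)\<^sup>2 + (\<zeta> k \<omega>)\<^sup>2) * (B * norm (g k))))"
    proof (rule AE_I2)
      fix \<omega>
      let ?y = "\<bar>\<zeta> j \<omega>\<bar>"
      have 1: "?y \<le> 1 + (\<zeta> j \<omega>)\<^sup>2" using sum_squares_bound[of ?y 1] by simp
      have 2: "?y * \<bar>\<zeta> k \<omega>\<bar> \<le> (\<zeta> j \<omega>)\<^sup>2 + (\<zeta> k \<omega>)\<^sup>2" for k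
      proof -
        have "0 \<le> ?y * \<bar>\<zeta> k \<omega>\<bar>" by simp
        then show ?thesis using sum_squares_bound[of ?y "\<bar>\<zeta> k \<omega>\<bar>"] unfolding power2_abs by linarith
      qed
      have "\<bar>F (\<Sum>k\<in>J. \<zeta> k \<omega> *\<^sub>R g k)\<bar> \<le> \<bar>F 0\<bar> + (\<Sum>k\<in>J. \<bar>\<zeta> k \<omega>\<bar> * (B * norm (g k)))"
      proof -
        have "norm (F (\<Sum>k\<in>J. \<zeta> k \<omega> *\<^sub>R g k) - F 0) \<le> B * norm (\<Sum>k\<in>J. \<zeta> k \<omega> *\<^sub>R g k)"
          using lipschitz_of_derivative[of F F' B _ 0, OF dF] B by simp
        also have "\<dots> \<le> (\<Sum>k\<in>J. \<bar>\<zeta> k \<omega>\<bar> * (B * norm (g k)))"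
        proof -
          have "B * norm (\<Sum>k\<in>J. \<zeta> k \<omega> *\<^sub>R g k) \<le> B * (\<Sum>k\<in>J. norm (\<zeta> k \<omega> *\<^sub>R g k))"
            by (intro mult_left_mono norm_sum B(2))
          then show ?thesis by (simp add: sum_distrib_left mult_ac)
        qed
        finally show ?thesis by simp
      qed
      then have "?y * \<bar>F (\<Sum>k\<in>J. \<zeta> k \<omega> *\<^sub>R g k)\<bar> \<le> ?y * (\<bar>F 0\<bar> + (\<Sum>k\<in>J. \<bar>\<zeta> k \<omega>\<bar> * (B * norm (g k))))"
        by (intro mult_left_mono) auto
      also have "\<dots> = ?y * \<bar>F 0\<bar> + (\<Sum>k\<in>J. (?y * \<bar>\<zeta> k \<omega>\<bar>) * (B * norm (g k)))"
        by (simp add: distrib_left sum_distrib_left mult.assoc)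
      also have "\<dots> \<le> (1 + (\<zeta> j \<omega>)\<^sup>2) * \<bar>F 0\<bar> + (\<Sum>k\<in>J. ((\<zeta> j \<omega>)\<^sup>2 + (\<zeta> k \<omega>)\<^sup>2) * (B * norm (g k)))"
        by (intro add_mono sum_mono mult_right_mono 1 2 B0) auto
      finally show "norm (\<zeta> j \<omega> * F (\<Sum>k\<in>J. \<zeta> k \<omega> *\<^sub>R g k)) \<le>
        norm ((1 + (\<zeta> j \<omega>)\<^sup>2) * \<bar>F 0\<bar> + (\<Sum>k\<in>J. ((\<zeta> j \<omega>)\<^sup>2 + (\<zeta> k \<omega>)\<^sup>2) * (B * norm (g k))))"
        by (simp add: abs_mult)
    qed
  qed (simp add: sum_eq)
  have int2: "integrable M (\<lambda>\<omega>. F' (\<Sum>k\<in>J. \<zeta> k \<omega> *\<^sub>R g k) (g j))"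
    by (rule integrable_const_bound[where B="B * norm (g j)"]) (use B in \<open>auto simp: sum_eq\<close>)
  define Z where "Z = (\<lambda>z. \<Sum>k\<in>J - {j}. z k *\<^sub>R g k)"
  have [measurable]: "Z \<in> borel_measurable (PiM (J - {j}) (\<lambda>_. borel))"
    unfolding Z_def by measurable
  have [measurable]: "(\<lambda>y. y j) \<in> borel_measurable (PiM {j} (\<lambda>_. borel :: real measure))" by measurable
  define \<zeta>1 where "\<zeta>1 = (\<lambda>\<omega>. restrict (\<lambda>i. \<zeta> i \<omega>) {j})"
  define \<zeta>2 where "\<zeta>2 = (\<lambda>\<omega>. restrict (\<lambda>i. \<zeta> i \<omega>) (J - {j}))"
  have \<zeta>1: "\<zeta>1 \<omega> j = \<zeta> j \<omega>" and \<zeta>2: "Z (\<zeta>2 \<omega>) = Y \<omega>" for \<omega>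
    by (auto simp: \<zeta>1_def \<zeta>2_def Z_def Y_def)
  have ind: "indep_var (PiM {j} (\<lambda>_. borel)) \<zeta>1 (PiM (J - {j}) (\<lambda>_. borel)) \<zeta>2"
    unfolding \<zeta>1_def \<zeta>2_def by (rule indep_var_restrict[OF d(2)]) (use j in auto)
  have [measurable]: "\<zeta>1 \<in> measurable M (PiM {j} (\<lambda>_. borel))" "\<zeta>2 \<in> measurable M (PiM (J - {j}) (\<lambda>_. borel))"
    using ind by (auto dest: indep_var_rv1 indep_var_rv2)
  define M1 where "M1 = distr M (PiM {j} (\<lambda>_. borel)) \<zeta>1"
  define M2 where "M2 = distr M (PiM (J - {j}) (\<lambda>_. borel)) \<zeta>2"
  have P: "M1 \<Otimes>\<^sub>M M2 = distr M (PiM {j} (\<lambda>_. borel) \<Otimes>\<^sub>M PiM (J - {j}) (\<lambda>_. borel)) (\<lambda>\<omega>. (\<zeta>1 \<omega>, \<zeta>2 \<omega>))"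
    using ind unfolding indep_var_distribution_eq M1_def M2_def by simp
  interpret M1: prob_space M1 unfolding M1_def by (rule prob_space_distr) simp
  interpret M2: prob_space M2 unfolding M2_def by (rule prob_space_distr) simp
  interpret P: pair_prob_space M1 M2 ..
  have inner: "(\<integral>y. y j * F (y j *\<^sub>R g j + z) \<partial>M1) = (\<integral>y. (\<sigma> j)\<^sup>2 * F' (y j *\<^sub>R g j + z) (g j) \<partial>M1)" for z
  proof -
    let ?n = "normal_density 0 (\<sigma> j)"
    have tr: "(\<integral>y. h (y j) \<partial>M1) = (\<integral>y. ?n y * h y \<partial>lborel)" if [measurable]: "h \<in> borel_measurable borel" for h :: "real \<Rightarrow> real"
      unfolding M1_def using distributed_integral[OF d(4)[OF j], of h] by (simp add: integral_distr \<zeta>1)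
    have "(\<integral>y. ?n y * (y * F (y *\<^sub>R g j + z)) \<partial>lborel) = (\<sigma> j)\<^sup>2 * (\<integral>y. ?n y * F' (y *\<^sub>R g j + z) (g j) \<partial>lborel)"
    proof (rule normal_integration_by_parts[OF d(3)[OF j]])
      fix y
      have "((\<lambda>y. F (y *\<^sub>R g j + z)) has_derivative (\<lambda>s. F' (y *\<^sub>R g j + z) (s *\<^sub>R g j))) (at y)"
        by (rule has_derivative_compose[OF _ dF]) (auto intro!: derivative_eq_intros)
      moreover have "F' x (s *\<^sub>R v) = F' x v * s" for x s v
        using linear_scale[OF has_derivative_linear[OF dF]] by (simp add: mult.commute)
      ultimately show "((\<lambda>y. F (y *\<^sub>R g j + z)) has_real_derivative F' (y *\<^sub>R g j + z) (g j)) (at y)"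
        by (simp add: has_field_derivative_def)
      show "\<bar>F' (y *\<^sub>R g j + z) (g j)\<bar> \<le> B * norm (g j)" by (rule B(1))
    next
      show "continuous_on UNIV (\<lambda>y. F' (y *\<^sub>R g j + z) (g j))"
        by (rule continuous_on_compose2[OF cF]) (auto intro!: continuous_intros)
    qed
    then show ?thesis
      using tr[of "\<lambda>y. y * F (y *\<^sub>R g j + z)"] tr[of "\<lambda>y. F' (y *\<^sub>R g j + z) (g j)"] by simp
  qed
  have "(\<integral>\<omega>. \<zeta> j \<omega> * F (\<Sum>k\<in>J. \<zeta> k \<omega> *\<^sub>R g k) \<partial>M) = (\<integral>p. (case p of (y, z) \<Rightarrow> y j * F (y j *\<^sub>R g j + Z z)) \<partial>(M1 \<Otimes>\<^sub>M M2))"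
    unfolding P by (subst integral_distr) (auto simp: sum_eq \<zeta>1 \<zeta>2)
  also have "\<dots> = (\<integral>z. (\<integral>y. y j * F (y j *\<^sub>R g j + Z z) \<partial>M1) \<partial>M2)"
  proof (rule P.integral_snd[symmetric])
    show "integrable (M1 \<Otimes>\<^sub>M M2) (\<lambda>(y, z). y j * F (y j *\<^sub>R g j + Z z))"
      unfolding P by (subst integrable_distr_eq) (use int1 in \<open>auto simp: sum_eq \<zeta>1 \<zeta>2\<close>)
  qed
  also have "\<dots> = (\<integral>z. (\<integral>y. (\<sigma> j)\<^sup>2 * F' (y j *\<^sub>R g j + Z z) (g j) \<partial>M1) \<partial>M2)" by (simp only: inner)
  also have "\<dots> = (\<integral>p. (case p of (y, z) \<Rightarrow> (\<sigma> j)\<^sup>2 * F' (y j *\<^sub>R g j + Z z) (g j)) \<partial>(M1 \<Otimes>\<^sub>M M2))"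
  proof (rule P.integral_snd)
    show "integrable (M1 \<Otimes>\<^sub>M M2) (\<lambda>(y, z). (\<sigma> j)\<^sup>2 * F' (y j *\<^sub>R g j + Z z) (g j))"
      unfolding P by (subst integrable_distr_eq) (use int2 in \<open>auto simp: sum_eq \<zeta>1 \<zeta>2\<close>)
  qed
  also have "\<dots> = (\<integral>\<omega>. (\<sigma> j)\<^sup>2 * F' (\<Sum>k\<in>J. \<zeta> k \<omega> *\<^sub>R g k) (g j) \<partial>M)"
    unfolding P by (subst integral_distr) (auto simp: sum_eq \<zeta>1 \<zeta>2)
  finally show "(\<integral>\<omega>. \<zeta> j \<omega> * F (\<Sum>k\<in>J. \<zeta> k \<omega> *\<^sub>R g k) \<partial>M)
    = (\<sigma> j)\<^sup>2 * (\<integral>\<omega>. F' (\<Sum>k\<in>J. \<zeta> k \<omega> *\<^sub>R g k) (g j) \<partial>M)" by simp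
qed

lemma C2b_obtain:
  fixes \<phi> :: "'h::real_normed_vector \<Rightarrow> real"
  assumes "C2b \<phi>"
  obtains D1 :: "'h \<Rightarrow> 'h \<Rightarrow>\<^sub>L real" and D2 :: "'h \<Rightarrow> 'h \<Rightarrow>\<^sub>L 'h \<Rightarrow>\<^sub>L real" and C1 C2 where
    "\<And>x. (\<phi> has_derivative blinfun_apply (D1 x)) (at x)" "\<And>x. (D1 has_derivative blinfun_apply (D2 x)) (at x)"
    "continuous_on UNIV D2" "\<And>x. norm (D1 x) \<le> C1" "\<And>x. norm (D2 x) \<le> C2" "0 < C1" "0 < C2"
proof -
  obtain D1 :: "'h \<Rightarrow> 'h \<Rightarrow>\<^sub>L real" and D2 :: "'h \<Rightarrow> 'h \<Rightarrow>\<^sub>L 'h \<Rightarrow>\<^sub>L real" where D: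
    "\<And>x. (\<phi> has_derivative blinfun_apply (D1 x)) (at x)" "\<And>x. (D1 has_derivative blinfun_apply (D2 x)) (at x)"
    "continuous_on UNIV D2" "bounded (range D1)" "bounded (range D2)"
    using assms unfolding C2b_def by blast
  obtain C1 where C1: "0 < C1" "\<And>y. y \<in> range D1 \<Longrightarrow> norm y \<le> C1" using D(4) unfolding bounded_pos by auto
  obtain C2 where C2: "0 < C2" "\<And>y. y \<in> range D2 \<Longrightarrow> norm y \<le> C2" using D(5) unfolding bounded_pos by auto
  show thesis by (rule that[of D1 D2 C1 C2]) (use D C1 C2 in auto)
qed

lemma distr_pair_snd:
  assumes "prob_space M" "prob_space N"
  shows "distr (M \<Otimes>\<^sub>M N) N snd = N"
proof -
  interpret M: prob_space M by fact
  interpret N: prob_space N by fact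
  interpret P: pair_prob_space M N ..
  have "distr (M \<Otimes>\<^sub>M N) N snd = distr (distr (N \<Otimes>\<^sub>M M) (M \<Otimes>\<^sub>M N) (\<lambda>(x, y). (y, x))) N snd"
    using P.distr_pair_swap by simp
  also have "\<dots> = distr (N \<Otimes>\<^sub>M M) N fst"
    by (subst distr_distr) (auto intro!: distr_cong)
  also have "\<dots> = N" by (rule M.distr_pair_fst)
  finally show ?thesis .
qed

lemma pair_projections:
  fixes f :: "'a \<Rightarrow> real"
  assumes "prob_space M" "prob_space N"
  shows integrable_pair_fst: "integrable M f \<Longrightarrow> integrable (M \<Otimes>\<^sub>M N) (\<lambda>p. f (fst p))"
    and integral_pair_fst: "integrable M f \<Longrightarrow> (\<integral>p. f (fst p) \<partial>(M \<Otimes>\<^sub>M N)) = (\<integral>x. f x \<partial>M)"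
proof -
  interpret N: prob_space N by fact
  have d: "distr (M \<Otimes>\<^sub>M N) M fst = M" by (rule N.distr_pair_fst)
  show "integrable (M \<Otimes>\<^sub>M N) (\<lambda>p. f (fst p))" if "integrable M f"
    using integrable_distr[of fst "M \<Otimes>\<^sub>M N" M f] that by (simp add: d)
  show "(\<integral>p. f (fst p) \<partial>(M \<Otimes>\<^sub>M N)) = (\<integral>x. f x \<partial>M)" if "integrable M f"
    using integral_distr[of fst "M \<Otimes>\<^sub>M N" M f] that by (simp add: d)
qed

lemma pair_projections':
  fixes f :: "'a \<Rightarrow> real"
  assumes "prob_space M" "prob_space N"
  shows integrable_pair_snd: "integrable N f \<Longrightarrow> integrable (M \<Otimes>\<^sub>M N) (\<lambda>p. f (snd p))"
    and integral_pair_snd: "integrable N f \<Longrightarrow> (\<integral>p. f (snd p) \<partial>(M \<Otimes>\<^sub>M N)) = (\<integral>x. f x \<partial>N)"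
proof -
  have d: "distr (M \<Otimes>\<^sub>M N) N snd = N" by (rule distr_pair_snd[OF assms])
  show "integrable (M \<Otimes>\<^sub>M N) (\<lambda>p. f (snd p))" if "integrable N f"
    using integrable_distr[of snd "M \<Otimes>\<^sub>M N" N f] that by (simp add: d)
  show "(\<integral>p. f (snd p) \<partial>(M \<Otimes>\<^sub>M N)) = (\<integral>x. f x \<partial>N)" if "integrable N f"
    using integral_distr[of snd "M \<Otimes>\<^sub>M N" N f] that by (simp add: d)
qed

text \<open>Rotation \<open>cos t G + sin t G'\<close> of two independent Gaussian vectors: by Stein's identity the
  derivative of the expectation only involves the difference of the covariances.\<close>

lemma gaussian_comparison:
  fixes g :: "'i \<Rightarrow> 'h::{real_inner, banach, second_countable_topology}" and g' :: "'k \<Rightarrow> 'h"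
    and \<phi> :: "'h \<Rightarrow> real" and D1 :: "'h \<Rightarrow> 'h \<Rightarrow>\<^sub>L real" and D2 :: "'h \<Rightarrow> 'h \<Rightarrow>\<^sub>L 'h \<Rightarrow>\<^sub>L real"
  assumes M: "prob_space M" and M': "prob_space M'"
    and G: "gauss_family M J \<zeta> \<sigma>" and G': "gauss_family M' J' \<zeta>' \<sigma>'"
    and D1: "\<And>x. (\<phi> has_derivative blinfun_apply (D1 x)) (at x)"
    and D2: "\<And>x. (D1 has_derivative blinfun_apply (D2 x)) (at x)"
    and cD2: "continuous_on UNIV D2" and C1: "\<And>x. norm (D1 x) \<le> C1" and C2: "\<And>x. norm (D2 x) \<le> C2"
    and \<epsilon>: "\<And>x. \<bar>(\<Sum>j\<in>J. (\<sigma> j)\<^sup>2 * D2 x (g j) (g j)) - (\<Sum>j\<in>J'. (\<sigma>' j)\<^sup>2 * D2 x (g' j) (g' j))\<bar> \<le> \<epsilon>"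
  shows "\<bar>(\<integral>\<omega>. \<phi> (m + (\<Sum>j\<in>J. \<zeta> j \<omega> *\<^sub>R g j)) \<partial>M) - (\<integral>\<omega>. \<phi> (m + (\<Sum>j\<in>J'. \<zeta>' j \<omega> *\<^sub>R g' j)) \<partial>M')\<bar> \<le> 2 * \<epsilon>"
proof -
  interpret M: prob_space M by (rule M)
  interpret M': prob_space M' by (rule M')
  interpret P: pair_prob_space M M' ..
  define X where "X = (\<lambda>\<omega>. \<Sum>j\<in>J. \<zeta> j \<omega> *\<^sub>R g j)"
  define X' where "X' = (\<lambda>\<omega>. \<Sum>j\<in>J'. \<zeta>' j \<omega> *\<^sub>R g' j)"
  have [measurable]: "X \<in> borel_measurable M" "X' \<in> borel_measurable M'"
    unfolding X_def X'_def
    by (rule gauss_family_norm_integrable(1)[OF M G]) (rule gauss_family_norm_integrable(1)[OF M' G'])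
  have iX: "integrable M (\<lambda>\<omega>. norm (X \<omega>))" and iX': "integrable M' (\<lambda>\<omega>. norm (X' \<omega>))"
    unfolding X_def X'_def
    by (rule gauss_family_norm_integrable(2)[OF M G]) (rule gauss_family_norm_integrable(2)[OF M' G'])
  have C10: "0 \<le> C1" and C20: "0 \<le> C2" using order_trans[OF norm_ge_zero C1] order_trans[OF norm_ge_zero C2] by auto
  have \<phi>c: "continuous_on UNIV \<phi>" using D1 by (meson has_derivative_continuous continuous_at_imp_continuous_on)
  have D1c: "continuous_on UNIV D1" using D2 by (meson has_derivative_continuous continuous_at_imp_continuous_on)
  have [measurable]: "\<phi> \<in> borel_measurable borel" using \<phi>c by (rule borel_measurable_continuous_onI)
  have D1m: "(\<lambda>x. D1 (u x) (v x)) \<in> borel_measurable N"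
    if "u \<in> borel_measurable N" "v \<in> borel_measurable N" for u v and N :: "'z measure"
  proof (rule borel_measurable_continuous_Pair[OF that])
    show "continuous_on UNIV (\<lambda>x. D1 (fst x) (snd x))"
      by (intro continuous_intros continuous_on_compose2[OF D1c]) auto
  qed
  have D1b: "\<bar>D1 x v\<bar> \<le> C1 * norm v" for x v
    using norm_blinfun[of "D1 x" v] mult_right_mono[OF C1[of x], of "norm v"] by simp
  have D2b: "\<bar>D2 x u v\<bar> \<le> C2 * norm u * norm v" for x u v
  proof -
    have "\<bar>D2 x u v\<bar> \<le> norm (D2 x u) * norm v" using norm_blinfun[of "D2 x u" v] by simp
    also have "\<dots> \<le> (norm (D2 x) * norm u) * norm v" by (intro mult_right_mono norm_blinfun) simp
    also have "\<dots> \<le> (C2 * norm u) * norm v" by (intro mult_right_mono C2) auto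
    finally show ?thesis .
  qed
  have D2c: "continuous_on UNIV (\<lambda>x. D2 (a + c *\<^sub>R x) u v)" for a c u v
    by (intro continuous_intros continuous_on_compose2[OF cD2]) auto
  have D2m: "(\<lambda>x. D2 (U x) u v) \<in> borel_measurable N" if "U \<in> borel_measurable N" for U u v and N :: "'z measure"
  proof -
    have "(\<lambda>x. D2 x u v) \<in> borel_measurable borel"
      using D2c[of 0 1 u v] by (intro borel_measurable_continuous_onI) simp
    from measurable_compose[OF that this] show ?thesis .
  qed
  have dF: "((\<lambda>x. D1 (a + c *\<^sub>R x) w) has_derivative (\<lambda>v. D2 (a + c *\<^sub>R x) (c *\<^sub>R v) w)) (at x)" for a c w x
  proof -
    have "((\<lambda>x. a + c *\<^sub>R x) has_derivative (\<lambda>v. c *\<^sub>R v)) (at x)"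
      by (auto intro!: derivative_eq_intros)
    then have "((\<lambda>x. D1 (a + c *\<^sub>R x)) has_derivative (\<lambda>v. D2 (a + c *\<^sub>R x) (c *\<^sub>R v))) (at x)"
      by (rule has_derivative_compose[OF _ D2])
    then show ?thesis
      by (rule bounded_linear.has_derivative[OF blinfun.bounded_linear_left])
  qed
  have stein: "(\<integral>\<omega>. D1 (a + c *\<^sub>R (\<Sum>j\<in>I. z j \<omega> *\<^sub>R w j)) (\<Sum>j\<in>I. z j \<omega> *\<^sub>R w j) \<partial>N) =
      c * (\<integral>\<omega>. (\<Sum>j\<in>I. (s j)\<^sup>2 * D2 (a + c *\<^sub>R (\<Sum>j\<in>I. z j \<omega> *\<^sub>R w j)) (w j) (w j)) \<partial>N)"
    if N: "prob_space N" and F: "gauss_family N I z s" for a c and N :: "'z measure" and I :: "'l set" and z s w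
  proof -
    interpret N: prob_space N by (rule N)
    let ?Y = "\<lambda>\<omega>. \<Sum>j\<in>I. z j \<omega> *\<^sub>R w j"
    have [measurable]: "?Y \<in> borel_measurable N" by (rule gauss_family_norm_integrable(1)[OF N F])
    have b: "\<bar>D2 (a + c *\<^sub>R x) (c *\<^sub>R v) u\<bar> \<le> C2 * \<bar>c\<bar> * norm u * norm v" for x v u
      using D2b[of "a + c *\<^sub>R x" "c *\<^sub>R v" u] by (simp add: mult_ac)
    have c': "continuous_on UNIV (\<lambda>x. D2 (a + c *\<^sub>R x) (c *\<^sub>R u) v)" for u v by (rule D2c)
    have st: "(\<integral>\<omega>. z j \<omega> * D1 (a + c *\<^sub>R ?Y \<omega>) (w j) \<partial>N) = (s j)\<^sup>2 * (\<integral>\<omega>. D2 (a + c *\<^sub>R ?Y \<omega>) (c *\<^sub>R w j) (w j) \<partial>N)"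
      "integrable N (\<lambda>\<omega>. z j \<omega> * D1 (a + c *\<^sub>R ?Y \<omega>) (w j))" if "j \<in> I" for j
      using stein_family[OF N F that dF c' b] C20 by auto
    have int: "integrable N (\<lambda>\<omega>. D2 (a + c *\<^sub>R ?Y \<omega>) u v)" for u v
      by (rule N.integrable_const_bound[where B="C2 * norm u * norm v"]) (use D2b in \<open>auto intro!: D2m\<close>)
    have "(\<integral>\<omega>. D1 (a + c *\<^sub>R ?Y \<omega>) (?Y \<omega>) \<partial>N) = (\<integral>\<omega>. (\<Sum>j\<in>I. z j \<omega> * D1 (a + c *\<^sub>R ?Y \<omega>) (w j)) \<partial>N)"
      by (simp add: blinfun.sum_right blinfun.scaleR_right)
    also have "\<dots> = (\<Sum>j\<in>I. (s j)\<^sup>2 * (\<integral>\<omega>. D2 (a + c *\<^sub>R ?Y \<omega>) (c *\<^sub>R w j) (w j) \<partial>N))"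
      using st by (simp add: Bochner_Integration.integral_sum)
    also have "\<dots> = c * (\<Sum>j\<in>I. (s j)\<^sup>2 * (\<integral>\<omega>. D2 (a + c *\<^sub>R ?Y \<omega>) (w j) (w j) \<partial>N))"
      by (simp add: blinfun.scaleR_right blinfun.scaleR_left sum_distrib_left mult_ac)
    also have "(\<Sum>j\<in>I. (s j)\<^sup>2 * (\<integral>\<omega>. D2 (a + c *\<^sub>R ?Y \<omega>) (w j) (w j) \<partial>N)) =
        (\<integral>\<omega>. (\<Sum>j\<in>I. (s j)\<^sup>2 * D2 (a + c *\<^sub>R ?Y \<omega>) (w j) (w j)) \<partial>N)"
      using int by (simp add: Bochner_Integration.integral_sum)
    finally show ?thesis .
  qed
  \<comment> \<open>The rotation starts at \<open>X\<close> and ends at \<open>X'\<close>, and its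
    derivative stays bounded up to both ends, unlike that of an interpolation with square-root
    weights.\<close>
  define U where "U = (\<lambda>t p. m + cos t *\<^sub>R X (fst p) + sin t *\<^sub>R X' (snd p))"
  define H where "H = (\<lambda>t p. D1 (U t p) (- sin t *\<^sub>R X (fst p) + cos t *\<^sub>R X' (snd p)))"
  let ?P = "M \<Otimes>\<^sub>M M'"
  have iXP: "integrable ?P (\<lambda>p. norm (X (fst p)))" and iXP': "integrable ?P (\<lambda>p. norm (X' (snd p)))"
    using iX iX' by (auto intro: integrable_pair_fst integrable_pair_snd M M')
  have Hb: "\<bar>H t p\<bar> \<le> C1 * (norm (X (fst p)) + norm (X' (snd p)))" for t p
  proof -
    have "norm (- sin t *\<^sub>R X (fst p) + cos t *\<^sub>R X' (snd p)) \<le> \<bar>sin t\<bar> * norm (X (fst p)) + \<bar>cos t\<bar> * norm (X' (snd p))"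
      by (rule order_trans[OF norm_triangle_ineq]) simp
    also have "\<dots> \<le> 1 * norm (X (fst p)) + 1 * norm (X' (snd p))"
      by (intro add_mono mult_right_mono) auto
    finally have "C1 * norm (- sin t *\<^sub>R X (fst p) + cos t *\<^sub>R X' (snd p)) \<le> C1 * (norm (X (fst p)) + norm (X' (snd p)))"
      using C10 by (intro mult_left_mono) auto
    then show ?thesis using D1b[of "U t p" "- sin t *\<^sub>R X (fst p) + cos t *\<^sub>R X' (snd p)"] by (simp add: H_def)
  qed
  have iB: "integrable ?P (\<lambda>p. C1 * (norm (X (fst p)) + norm (X' (snd p))))" using iXP iXP' by simp
  have iH: "integrable ?P (H t)" for t
  proof (rule Bochner_Integration.integrable_bound[OF iB])
    show "H t \<in> borel_measurable ?P" unfolding H_def U_def by (intro D1m) measurable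
  qed (use Hb in \<open>auto intro!: AE_I2 order_trans[OF _ abs_ge_self]\<close>)
  \<comment> \<open>Stein's identity in \<open>X\<close> brings out a factor \<open>cos t\<close>,
    in \<open>X'\<close> a factor \<open>sin t\<close>. Both terms thus carry
    \<open>sin t * cos t\<close> with opposite signs and the same argument of \<open>D2\<close>, so
    the hypothesis on the covariances applies pointwise.\<close>
  have EH: "\<bar>\<integral>p. H t p \<partial>?P\<bar> \<le> \<epsilon>" for t
  proof -
    have iA: "integrable ?P (\<lambda>p. D1 (U t p) (X (fst p)))" "integrable ?P (\<lambda>p. D1 (U t p) (X' (snd p)))"
      unfolding U_def
      by (rule Bochner_Integration.integrable_bound[OF integrable_mult_right[OF iXP, of C1]],
          intro D1m, measurable, use D1b in \<open>auto intro!: AE_I2 order_trans[OF _ abs_ge_self]\<close>)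
        (rule Bochner_Integration.integrable_bound[OF integrable_mult_right[OF iXP', of C1]],
          intro D1m, measurable, use D1b in \<open>auto intro!: AE_I2 order_trans[OF _ abs_ge_self]\<close>)
    define S where "S = (\<lambda>p. \<Sum>j\<in>J. (\<sigma> j)\<^sup>2 * D2 (U t p) (g j) (g j))"
    define S' where "S' = (\<lambda>p. \<Sum>j\<in>J'. (\<sigma>' j)\<^sup>2 * D2 (U t p) (g' j) (g' j))"
    have iD: "integrable ?P (\<lambda>p. D2 (U t p) u v)" for u v
    proof (rule P.integrable_const_bound[where B="C2 * norm u * norm v"])
      show "(\<lambda>p. D2 (U t p) u v) \<in> borel_measurable ?P" unfolding U_def by (intro D2m) measurable
    qed (use D2b in auto)
    have iS: "integrable ?P S" "integrable ?P S'"
      unfolding S_def S'_def by (intro Bochner_Integration.integrable_sum integrable_mult_right iD)+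
    have 1: "(\<integral>p. D1 (U t p) (X (fst p)) \<partial>?P) = cos t * (\<integral>p. S p \<partial>?P)"
    proof -
      have "(\<integral>p. D1 (U t p) (X (fst p)) \<partial>?P) = (\<integral>y. (\<integral>x. D1 (U t (x, y)) (X x) \<partial>M) \<partial>M')"
        using P.integral_snd[of "\<lambda>x y. D1 (U t (x, y)) (X x)"] iA(1) by (simp add: case_prod_beta')
      also have "\<dots> = (\<integral>y. cos t * (\<integral>x. S (x, y) \<partial>M) \<partial>M')"
      proof (rule Bochner_Integration.integral_cong[OF refl])
        fix y
        show "(\<integral>x. D1 (U t (x, y)) (X x) \<partial>M) = cos t * (\<integral>x. S (x, y) \<partial>M)"
        proof -
          have "U t (x, y) = (m + sin t *\<^sub>R X' y) + cos t *\<^sub>R X x" for x by (simp add: U_def add_ac)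
          then show ?thesis unfolding S_def by (simp only: X_def) (rule stein[OF M G])
        qed
      qed
      also have "\<dots> = cos t * (\<integral>p. S p \<partial>?P)"
        using P.integral_snd[of "\<lambda>x y. S (x, y)"] iS(1) by (simp add: case_prod_beta')
      finally show ?thesis .
    qed
    have 2: "(\<integral>p. D1 (U t p) (X' (snd p)) \<partial>?P) = sin t * (\<integral>p. S' p \<partial>?P)"
    proof -
      have "(\<integral>p. D1 (U t p) (X' (snd p)) \<partial>?P) = (\<integral>x. (\<integral>y. D1 (U t (x, y)) (X' y) \<partial>M') \<partial>M)"
        using P.integral_fst[of "\<lambda>x y. D1 (U t (x, y)) (X' y)"] iA(2) by (simp add: case_prod_beta')
      also have "\<dots> = (\<integral>x. sin t * (\<integral>y. S' (x, y) \<partial>M') \<partial>M)"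
      proof (rule Bochner_Integration.integral_cong[OF refl])
        fix x
        show "(\<integral>y. D1 (U t (x, y)) (X' y) \<partial>M') = sin t * (\<integral>y. S' (x, y) \<partial>M')"
        proof -
          have "U t (x, y) = (m + cos t *\<^sub>R X x) + sin t *\<^sub>R X' y" for y by (simp add: U_def add_ac)
          then show ?thesis unfolding S'_def by (simp only: X'_def) (rule stein[OF M' G'])
        qed
      qed
      also have "\<dots> = sin t * (\<integral>p. S' p \<partial>?P)"
        using P.integral_fst[of "\<lambda>x y. S' (x, y)"] iS(2) by (simp add: case_prod_beta')
      finally show ?thesis .
    qed
    have "(\<integral>p. H t p \<partial>?P) = - sin t * (\<integral>p. D1 (U t p) (X (fst p)) \<partial>?P) + cos t * (\<integral>p. D1 (U t p) (X' (snd p)) \<partial>?P)"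
      unfolding H_def using iA by (simp add: blinfun.add_right blinfun.scaleR_right blinfun.diff_right blinfun.minus_right)
    also have "\<dots> = - (sin t * cos t) * (\<integral>p. S p - S' p \<partial>?P)"
      unfolding 1 2 using iS by (simp add: algebra_simps)
    also have "\<bar>\<dots>\<bar> \<le> 1 * \<epsilon>"
      unfolding abs_mult
    proof (rule mult_mono)
      have "\<bar>sin t\<bar> * \<bar>cos t\<bar> \<le> 1 * 1" by (intro mult_mono) auto
      then show "\<bar>- (sin t * cos t)\<bar> \<le> 1" by (simp add: abs_mult)
      have "\<bar>\<integral>p. S p - S' p \<partial>?P\<bar> \<le> (\<integral>p. \<bar>S p - S' p\<bar> \<partial>?P)" by (rule integral_abs_bound)
      also have "\<dots> \<le> (\<integral>p. \<epsilon> \<partial>?P)"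
        using iS \<epsilon> by (intro integral_mono) (auto simp: S_def S'_def)
      also have "\<dots> = \<epsilon>" by (simp add: P.prob_space)
      finally show "\<bar>\<integral>p. S p - S' p \<partial>?P\<bar> \<le> \<epsilon>" .
    qed auto
    finally show ?thesis by simp
  qed
  have \<epsilon>0: "0 \<le> \<epsilon>" using order_trans[OF abs_ge_zero \<epsilon>] .
  have \<phi>int: "integrable N (\<lambda>\<omega>. \<phi> (m + Z \<omega>))"
    if N: "prob_space N" and Zm[measurable]: "Z \<in> borel_measurable N" and iZ: "integrable N (\<lambda>\<omega>. norm (Z \<omega>))" for N :: "'z measure" and Z
  proof (rule Bochner_Integration.integrable_bound)
    interpret N: prob_space N by (rule N)
    show "integrable N (\<lambda>\<omega>. \<bar>\<phi> m\<bar> + C1 * norm (Z \<omega>))" using iZ by simp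
    have "\<bar>\<phi> (m + z) - \<phi> m\<bar> \<le> C1 * norm z" for z
      using lipschitz_of_derivative[OF D1, of C1 "m + z" m] D1b C10 by simp
    then have "\<bar>\<phi> (m + z)\<bar> \<le> \<bar>\<phi> m\<bar> + C1 * norm z" for z by (smt (verit))
    then show "AE \<omega> in N. norm (\<phi> (m + Z \<omega>)) \<le> norm (\<bar>\<phi> m\<bar> + C1 * norm (Z \<omega>))"
      using C10 by simp
  qed measurable
  have ftc: "\<phi> (m + X' (snd p)) - \<phi> (m + X (fst p)) = (\<integral>t. indicator {0..pi/2} t *\<^sub>R H t p \<partial>lborel)" for p
  proof -
    have "(\<integral>t. indicator {0..pi/2} t *\<^sub>R H t p \<partial>lborel) = \<phi> (U (pi/2) p) - \<phi> (U 0 p)"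
    proof (rule integral_FTC_atLeastAtMost)
      fix t
      have "((\<lambda>t. U t p) has_derivative (\<lambda>s. s *\<^sub>R (- sin t *\<^sub>R X (fst p) + cos t *\<^sub>R X' (snd p)))) (at t)"
        unfolding U_def by (auto intro!: derivative_eq_intros simp: fun_eq_iff algebra_simps)
      from has_derivative_compose[OF this D1]
      have "((\<lambda>t. \<phi> (U t p)) has_vector_derivative H t p) (at t)"
        by (simp add: has_vector_derivative_def H_def blinfun.scaleR_right)
      then show "((\<lambda>t. \<phi> (U t p)) has_vector_derivative H t p) (at t within {0..pi/2})"
        by (rule has_vector_derivative_at_within)
    next
      show "continuous_on {0..pi/2} (\<lambda>t. H t p)"
        unfolding H_def U_def
        by (intro continuous_intros continuous_on_compose2[OF D1c]) auto
    qed simp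
    then show ?thesis by (simp add: U_def)
  qed
  interpret L: pair_sigma_finite lborel ?P
    by (intro pair_sigma_finite.intro sigma_finite_lborel P.sigma_finite_measure_axioms)
  let ?f = "\<lambda>t p. indicator {0..pi/2} t *\<^sub>R H t p"
  have iL: "integrable (lborel \<Otimes>\<^sub>M ?P) (\<lambda>(t, p). ?f t p)"
  proof (rule L.Fubini_integrable)
    show "(\<lambda>(t, p). ?f t p) \<in> borel_measurable (lborel \<Otimes>\<^sub>M ?P)"
    proof -
      have [measurable]: "(\<lambda>x. H (fst x) (snd x)) \<in> borel_measurable (lborel \<Otimes>\<^sub>M ?P)"
        unfolding H_def U_def by (intro D1m) measurable
      show ?thesis by (simp add: case_prod_beta')
    qed
    define K where "K = (\<integral>p. C1 * (norm (X (fst p)) + norm (X' (snd p))) \<partial>?P)"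
    show "integrable lborel (\<lambda>x. \<integral>y. norm (case (x, y) of (t, p) \<Rightarrow> ?f t p) \<partial>?P)"
    proof (rule Bochner_Integration.integrable_bound)
      show "integrable lborel (\<lambda>t. indicator {0..pi/2} t * K)" by simp
      have [measurable]: "(\<lambda>x. H (fst x) (snd x)) \<in> borel_measurable (lborel \<Otimes>\<^sub>M ?P)"
        unfolding H_def U_def by (intro D1m) measurable
      show "(\<lambda>x. \<integral>y. norm (case (x, y) of (t, p) \<Rightarrow> ?f t p) \<partial>?P) \<in> borel_measurable lborel"
        by (rule P.borel_measurable_lebesgue_integral) (simp add: case_prod_beta')
      show "AE t in lborel. norm (\<integral>y. norm (case (t, y) of (t, p) \<Rightarrow> ?f t p) \<partial>?P) \<le> norm (indicator {0..pi/2} t * K)"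
      proof (rule AE_I2)
        fix t :: real
        have "(\<integral>p. \<bar>H t p\<bar> \<partial>?P) \<le> K"
          unfolding K_def using iH[of t] iB Hb by (intro integral_mono) auto
        moreover have "0 \<le> (\<integral>p. \<bar>H t p\<bar> \<partial>?P)" by simp
        ultimately have "(\<integral>p. \<bar>H t p\<bar> \<partial>?P) \<le> \<bar>K\<bar>" by linarith
        then show "norm (\<integral>y. norm (case (t, y) of (t, p) \<Rightarrow> ?f t p) \<partial>?P) \<le> norm (indicator {0..pi/2} t * K)"
          by (simp add: indicator_def)
      qed
    qed
    show "AE x in lborel. integrable ?P (\<lambda>y. case (x, y) of (t, p) \<Rightarrow> ?f t p)"
      using iH by simp
  qed
  have "(\<integral>\<omega>. \<phi> (m + X' \<omega>) \<partial>M') - (\<integral>\<omega>. \<phi> (m + X \<omega>) \<partial>M) = (\<integral>p. \<phi> (m + X' (snd p)) - \<phi> (m + X (fst p)) \<partial>?P)"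
  proof -
    have 1: "integrable M (\<lambda>\<omega>. \<phi> (m + X \<omega>))" by (rule \<phi>int[OF M _ iX]) measurable
    have 2: "integrable M' (\<lambda>\<omega>. \<phi> (m + X' \<omega>))" by (rule \<phi>int[OF M' _ iX']) measurable
    show ?thesis
      using integrable_pair_fst[OF M M' 1] integral_pair_fst[OF M M' 1]
        integrable_pair_snd[OF M M' 2] integral_pair_snd[OF M M' 2] by simp
  qed
  also have "\<dots> = (\<integral>p. (\<integral>t. ?f t p \<partial>lborel) \<partial>?P)" by (simp only: ftc)
  also have "\<dots> = (\<integral>t. (\<integral>p. ?f t p \<partial>?P) \<partial>lborel)" by (rule L.Fubini_integral[OF iL])
  also have "\<bar>\<dots>\<bar> \<le> (\<integral>t. indicator {0..pi/2} t * \<epsilon> \<partial>lborel)"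
  proof (rule order_trans[OF integral_abs_bound integral_mono])
    show "integrable lborel (\<lambda>t. \<bar>\<integral>p. ?f t p \<partial>?P\<bar>)"
      using L.integrable_fst[OF iL] by simp
    show "\<bar>\<integral>p. ?f t p \<partial>?P\<bar> \<le> indicator {0..pi/2} t * \<epsilon>" for t
      using EH[of t] by (simp add: indicator_def)
  qed simp
  also have "\<dots> = pi / 2 * \<epsilon>" by simp
  \<comment> \<open>The length \<open>pi / 2\<close> of the rotation is rounded up to 2.\<close>
  also have "\<dots> \<le> 2 * \<epsilon>" using pi_less_4 \<epsilon>0 by (intro mult_right_mono) auto
  finally show ?thesis by (simp add: X_def X'_def abs_minus_commute)
qed

section \<open>Gaussian limits and Wiener increments\<close>

text \<open>Independence of the Brownian motions is given for whole paths, independence of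
  increments for one motion at a time. The probability of a finite intersection factors first over
  the blocks \<open>i\<close> and then inside each block.\<close>

lemma (in prob_space) indep_vars_Sigma:
  assumes X: "indep_vars N X UNIV" and I: "finite I"
    and h: "\<And>i j. i \<in> I \<Longrightarrow> j \<in> J i \<Longrightarrow> h i j \<in> measurable (N i) L"
    and Y: "\<And>i j \<omega>. i \<in> I \<Longrightarrow> j \<in> J i \<Longrightarrow> \<omega> \<in> space M \<Longrightarrow> Y i j \<omega> = h i j (X i \<omega>)"
    and ind: "\<And>i. i \<in> I \<Longrightarrow> indep_vars (\<lambda>_. L) (Y i) (J i)"
  shows "indep_vars (\<lambda>_. L) (\<lambda>(i, j). Y i j) (Sigma I J)"
  unfolding indep_vars_def2
proof (intro conjI ballI indep_setsI)
  show rv0: "(case k of (i, j) \<Rightarrow> Y i j) \<in> measurable M L" if "k \<in> Sigma I J" for k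
    using that ind by (auto simp: indep_vars_def2)
  have rv: "Y i j \<in> measurable M L" if "i \<in> I" "j \<in> J i" for i j
    using that ind by (auto simp: indep_vars_def2)
  fix k assume k: "k \<in> Sigma I J"
  then show "{(case k of (i, j) \<Rightarrow> Y i j) -` A \<inter> space M |A. A \<in> sets L} \<subseteq> events"
    using rv by (auto simp: measurable_sets)
next
  fix A K
  assume K: "K \<noteq> {}" "K \<subseteq> Sigma I J" "finite K"
    and A: "\<forall>k\<in>K. A k \<in> {(case k of (i, j) \<Rightarrow> Y i j) -` B \<inter> space M |B. B \<in> sets L}"
  have "\<forall>k\<in>K. \<exists>B. B \<in> sets L \<and> A k = (case k of (i, j) \<Rightarrow> Y i j) -` B \<inter> space M"
    using A by auto
  from bchoice[OF this] obtain B where "\<forall>k\<in>K. B k \<in> sets L \<and> A k = (case k of (i, j) \<Rightarrow> Y i j) -` B k \<inter> space M"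
    by blast
  then have B: "\<And>k. k \<in> K \<Longrightarrow> B k \<in> sets L"
    "\<And>i j. (i, j) \<in> K \<Longrightarrow> A (i, j) = Y i j -` B (i, j) \<inter> space M" by auto
  define I0 where "I0 = fst ` K"
  define K' where "K' i = {j. (i, j) \<in> K}" for i
  have I0: "finite I0" "I0 \<noteq> {}" "I0 \<subseteq> I" using K by (auto simp: I0_def)
  have K': "finite (K' i)" "K' i \<subseteq> J i" if "i \<in> I0" for i
  proof -
    have "K' i = snd ` (K \<inter> {i} \<times> UNIV)" by (force simp: K'_def)
    then show "finite (K' i)" using K(3) by simp
  qed (use K in \<open>auto simp: K'_def\<close>)
  have K'0: "K' i \<noteq> {}" if "i \<in> I0" for i using that by (auto simp: K'_def I0_def)
  have KS: "K = Sigma I0 K'" by (force simp: I0_def K'_def)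
  define D where "D i = (\<Inter>j\<in>K' i. h i j -` B (i, j) \<inter> space (N i))" for i
  have D: "D i \<in> sets (N i)" if "i \<in> I0" for i
    unfolding D_def
  proof (rule sets.finite_INT)
    fix j assume j: "j \<in> K' i"
    then have "h i j \<in> measurable (N i) L" using h K'(2)[OF that] that I0 by auto
    moreover have "B (i, j) \<in> sets L" using B(1) j by (simp add: K'_def)
    ultimately show "h i j -` B (i, j) \<inter> space (N i) \<in> sets (N i)" by (rule measurable_sets)
  qed (use K'[OF that] K'0[OF that] in auto)
  have XN: "X i \<in> measurable M (N i)" for i using X by (auto simp: indep_vars_def2)
  have C: "X i -` D i \<inter> space M = (\<Inter>j\<in>K' i. A (i, j))" if i: "i \<in> I0" for i
  proof -
    have "X i \<omega> \<in> D i \<longleftrightarrow> (\<forall>j\<in>K' i. \<omega> \<in> A (i, j))" if w: "\<omega> \<in> space M" for \<omega>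
    proof -
      have "X i \<omega> \<in> space (N i)" using w XN by (rule measurable_space[rotated])
      moreover have "Y i j \<omega> = h i j (X i \<omega>)" if "j \<in> K' i" for j
        using Y[of i j \<omega>] i I0 K'(2)[OF i] that w by auto
      ultimately show ?thesis using w B(2) by (auto simp: D_def K'_def)
    qed
    moreover have "\<omega> \<in> space M" if "\<forall>j\<in>K' i. \<omega> \<in> A (i, j)" for \<omega>
      using that K'0[OF i] B(2) by (auto simp: K'_def)
    ultimately show ?thesis by auto
  qed
  have "(\<Inter>k\<in>K. A k) = (\<Inter>i\<in>I0. X i -` D i \<inter> space M)"
    using C by (auto simp: KS)
  then have "prob (\<Inter>k\<in>K. A k) = (\<Prod>i\<in>I0. prob (X i -` D i \<inter> space M))"
    using indep_varsD[OF X I0(2,1) _ D] by simp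
  also have "\<dots> = (\<Prod>i\<in>I0. \<Prod>j\<in>K' i. prob (A (i, j)))"
  proof (intro prod.cong refl)
    fix i assume i: "i \<in> I0"
    have "X i -` D i \<inter> space M = (\<Inter>j\<in>K' i. Y i j -` B (i, j) \<inter> space M)"
      using C[OF i] B(2) by (auto simp: K'_def)
    also have "prob \<dots> = (\<Prod>j\<in>K' i. prob (Y i j -` B (i, j) \<inter> space M))"
      using i I0 K'[OF i] K'0[OF i] B(1)
      by (intro indep_varsD[OF ind]) (auto simp: K'_def)
    finally show "prob (X i -` D i \<inter> space M) = (\<Prod>j\<in>K' i. prob (A (i, j)))"
      using B(2) by (simp add: K'_def)
  qed
  also have "\<dots> = (\<Prod>k\<in>K. prob (A k))"
    unfolding KS using I0 K' by (subst prod.Sigma) auto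
  finally show "prob (\<Inter>k\<in>K. A k) = (\<Prod>k\<in>K. prob (A k))" .
qed

section \<open>Increments of independent Brownian motions along finite partitions\<close>

definition partition_points :: "real \<Rightarrow> nat \<Rightarrow> (nat \<Rightarrow> real) \<Rightarrow> bool" where
  "partition_points T n p \<longleftrightarrow> (\<forall>j<n. 0 \<le> p j \<and> p j \<le> p (Suc j) \<and> p (Suc j) \<le> T)"

text \<open>Each motion has its own partition. Steps of zero length are dropped since their
  increments have no density; \<open>sum_increments_index\<close> restores them in sums, where they
  contribute nothing.\<close>

definition increments_index :: "nat \<Rightarrow> (nat \<Rightarrow> nat) \<Rightarrow> (nat \<Rightarrow> nat \<Rightarrow> real) \<Rightarrow> (nat \<times> nat) set" where
  "increments_index I n p = Sigma {..<I} (\<lambda>i. {j. j < n i \<and> p i j < p i (Suc j)})"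

lemma wiener_gauss_family:
  assumes M: "prob_space M" and W: "cylindrical_wiener M T F b"
    and p: "\<And>i. i < I \<Longrightarrow> partition_points T (n i) (p i)"
  shows "gauss_family M (increments_index I n p) (\<lambda>(i, j) \<omega>. b i (p i (Suc j)) \<omega> - b i (p i j) \<omega>)
     (\<lambda>(i, j). sqrt (p i (Suc j) - p i j))"
  unfolding gauss_family_def
proof (intro conjI ballI)
  interpret prob_space M by (rule M)
  let ?J = "\<lambda>i. {j. j < n i \<and> p i j < p i (Suc j)}"
  show "finite (increments_index I n p)" unfolding increments_index_def by auto
  have bm: "brownian_motion M T (b i)" for i using W by (simp add: cylindrical_wiener_def)
  have pts: "p i j \<in> {0..T}" "p i (Suc j) \<in> {0..T}" if "i < I" "j < n i" for i j
    using p[OF that(1)] that(2) order_trans[of 0 "p i j" "p i (Suc j)"] order_trans[of "p i j" "p i (Suc j)" T]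
    by (auto simp: partition_points_def)
  have ind1: "indep_vars (\<lambda>_. borel) (\<lambda>j \<omega>. b i (p i (Suc j)) \<omega> - b i (p i j) \<omega>) {..<n i}" if i: "i < I" for i
  proof (cases "n i")
    \<comment> \<open>Without steps the node \<open>p i 0\<close> is unconstrained, so the
      independence clause of a Brownian motion cannot be invoked and the claim is checked
      directly.\<close>
    case 0
    then show ?thesis by (simp add: indep_vars_def2 indep_sets_def)
  next
    case (Suc m)
    have "p i j \<in> {0..T}" if j: "j \<le> n i" for j
    proof (cases "j < n i")
      case False
      then have "j = Suc m" using j Suc by simp
      then show ?thesis using pts(2)[OF i, of m] Suc by simp
    qed (rule pts(1)[OF i])
    moreover have "p i j \<le> p i (Suc j)" if "j < n i" for j
      using p[OF i] that by (auto simp: partition_points_def)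
    ultimately show ?thesis using bm[of i] unfolding brownian_motion_def by blast
  qed
  show "indep_vars (\<lambda>_. borel) (\<lambda>(i, j) \<omega>. b i (p i (Suc j)) \<omega> - b i (p i j) \<omega>) (increments_index I n p)"
    unfolding increments_index_def
  proof (rule indep_vars_Sigma)
    show "indep_vars (\<lambda>_. PiM {0..T} (\<lambda>_. borel)) (\<lambda>i \<omega>. restrict (\<lambda>t. b i t \<omega>) {0..T}) UNIV"
      using W by (simp add: cylindrical_wiener_def)
    show "(\<lambda>x. x (p i (Suc j)) - x (p i j)) \<in> measurable (PiM {0..T} (\<lambda>_. borel)) (borel :: real measure)"
      if "i \<in> {..<I}" "j \<in> ?J i" for i j
      using pts[of i j] that by (intro borel_measurable_diff measurable_component_singleton) auto
    show "b i (p i (Suc j)) \<omega> - b i (p i j) \<omega> = restrict (\<lambda>t. b i t \<omega>) {0..T} (p i (Suc j)) - restrict (\<lambda>t. b i t \<omega>) {0..T} (p i j)"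
      if "i \<in> {..<I}" "j \<in> ?J i" for i j \<omega>
      using pts[of i j] that by simp
    show "indep_vars (\<lambda>_. borel) (\<lambda>j \<omega>. b i (p i (Suc j)) \<omega> - b i (p i j) \<omega>) (?J i)" if "i \<in> {..<I}" for i
      using that by (intro indep_vars_subset[OF ind1]) auto
  qed simp
  fix k assume "k \<in> increments_index I n p"
  then obtain i j where k: "k = (i, j)" "i < I" "j < n i" "p i j < p i (Suc j)"
    by (auto simp: increments_index_def)
  show "0 < (case k of (i, j) \<Rightarrow> sqrt (p i (Suc j) - p i j))" using k by simp
  have "\<forall>s t. 0 \<le> s \<and> s < t \<and> t \<le> T \<longrightarrow> distributed M lborel (\<lambda>\<omega>. b i t \<omega> - b i s \<omega>)
          (\<lambda>y. ennreal (normal_density 0 (sqrt (t - s)) y))"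
    using bm[of i] unfolding brownian_motion_def by blast
  then show "distributed M lborel ((\<lambda>(i, j) \<omega>. b i (p i (Suc j)) \<omega> - b i (p i j) \<omega>) k)
      (\<lambda>y. ennreal (normal_density 0 ((\<lambda>(i, j). sqrt (p i (Suc j) - p i j)) k) y))"
    using pts[OF k(2,3)] k by simp
qed

lemma sum_increments_index:
  fixes x :: "nat \<Rightarrow> nat \<Rightarrow> 'v::comm_monoid_add"
  assumes p: "\<And>i. i < I \<Longrightarrow> partition_points T (n i) (p i)"
    and 0: "\<And>i j. i < I \<Longrightarrow> j < n i \<Longrightarrow> p i (Suc j) = p i j \<Longrightarrow> x i j = 0"
  shows "(\<Sum>(i, j)\<in>increments_index I n p. x i j) = (\<Sum>i<I. \<Sum>j<n i. x i j)"
proof -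
  have "(\<Sum>(i, j)\<in>increments_index I n p. x i j) = (\<Sum>i<I. \<Sum>j\<in>{j. j < n i \<and> p i j < p i (Suc j)}. x i j)"
    unfolding increments_index_def by (rule sum.Sigma[symmetric]) auto
  also have "\<dots> = (\<Sum>i<I. \<Sum>j<n i. x i j)"
  proof (rule sum.cong[OF refl])
    fix i assume i: "i \<in> {..<I}"
    have "x i j = 0" if "j < n i" "\<not> p i j < p i (Suc j)" for j
      using 0[of i j] p[of i] i that by (force simp: partition_points_def)
    then show "(\<Sum>j\<in>{j. j < n i \<and> p i j < p i (Suc j)}. x i j) = (\<Sum>j<n i. x i j)"
      by (intro sum.mono_neutral_left) auto
  qed
  finally show ?thesis .
qed

text \<open>\<open>Z\<close> is centered Gaussian with covariance \<open>C\<close>, where a covariance is encoded as the functional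
  \<open>b \<mapsto> E b(Z, Z)\<close> on bilinear forms.\<close>

definition gauss_limit :: "'w measure \<Rightarrow> ('w \<Rightarrow> 'h::{real_inner, banach, second_countable_topology}) \<Rightarrow>
    (('h \<Rightarrow> 'h \<Rightarrow> real) \<Rightarrow> real) \<Rightarrow> bool" where
  "gauss_limit M Z C \<longleftrightarrow> Z \<in> borel_measurable M \<and>
     (\<forall>\<epsilon>>0. \<exists>(J :: (nat \<times> nat) set) \<zeta> \<sigma> g. gauss_family M J \<zeta> \<sigma> \<and>
        (\<integral>\<^sup>+ \<omega>. ennreal (norm (Z \<omega> - (\<Sum>j\<in>J. \<zeta> j \<omega> *\<^sub>R g j))) \<partial>M) \<le> ennreal \<epsilon> \<and>
        (\<forall>K b. bform K b \<longrightarrow> \<bar>C b - (\<Sum>j\<in>J. (\<sigma> j)\<^sup>2 * b (g j) (g j))\<bar> \<le> \<epsilon> * K))"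

lemma nn_integral_norm_le_imp_integrable:
  fixes Z :: "'w \<Rightarrow> 'h::{banach, second_countable_topology}"
  assumes "Z \<in> borel_measurable M" "(\<integral>\<^sup>+ \<omega>. ennreal (norm (Z \<omega>)) \<partial>M) \<le> ennreal \<epsilon>" "0 \<le> \<epsilon>"
  shows "integrable M Z" "(\<integral>\<omega>. norm (Z \<omega>) \<partial>M) \<le> \<epsilon>"
proof -
  show i: "integrable M Z"
    using assms le_less_trans[OF assms(2) ennreal_less_top] by (simp add: integrable_iff_bounded)
  have "ennreal (\<integral>\<omega>. norm (Z \<omega>) \<partial>M) = (\<integral>\<^sup>+ \<omega>. ennreal (norm (Z \<omega>)) \<partial>M)"
    using i by (intro nn_integral_eq_integral[symmetric]) auto
  then have "ennreal (\<integral>\<omega>. norm (Z \<omega>) \<partial>M) \<le> ennreal \<epsilon>" using assms(2) by simp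
  then show "(\<integral>\<omega>. norm (Z \<omega>) \<partial>M) \<le> \<epsilon>" by (rule iffD1[OF ennreal_le_iff[OF assms(3)]])
qed

lemma bform_second_derivative:
  fixes B :: "'h::real_inner \<Rightarrow>\<^sub>L 'h \<Rightarrow>\<^sub>L real"
  assumes "norm B \<le> C"
  shows "bform C (\<lambda>u v. B u v)"
  unfolding bform_def
proof (intro conjI allI)
  show bound: "\<bar>B u v\<bar> \<le> C * norm u * norm v" for u v
  proof -
    have "\<bar>B u v\<bar> \<le> norm (B u) * norm v" using norm_blinfun[of "B u" v] by simp
    also have "\<dots> \<le> (norm B * norm u) * norm v" by (intro mult_right_mono norm_blinfun) simp
    also have "\<dots> \<le> (C * norm u) * norm v" by (intro mult_right_mono assms) auto
    finally show ?thesis .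
  qed
  show "bounded_bilinear (\<lambda>u v. B u v)"
  proof
    show "\<exists>K. \<forall>u v. norm (B u v) \<le> norm u * norm v * K"
      using bound by (intro exI[of _ C]) (simp add: mult_ac)
  qed (simp_all add: blinfun.add_right blinfun.scaleR_right blinfun.add_left blinfun.scaleR_left)
qed

section \<open>Stability of expectations under mean approximation\<close>

lemma C2b_lipschitz:
  fixes \<phi> :: "'h::{real_inner, banach, second_countable_topology} \<Rightarrow> real"
  assumes M: "prob_space M" and lip: "\<And>x y. \<bar>\<phi> x - \<phi> y\<bar> \<le> C1 * norm (x - y)"
    and Y: "Y \<in> borel_measurable M" and Z: "integrable M Z" and YZ: "integrable M (\<lambda>\<omega>. norm (Y \<omega> - Z \<omega>))"
    and c: "continuous_on UNIV \<phi>"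
  shows "integrable M (\<lambda>\<omega>. \<phi> (Y \<omega>))"
    "\<bar>(\<integral>\<omega>. \<phi> (Y \<omega>) \<partial>M) - (\<integral>\<omega>. \<phi> (Z \<omega>) \<partial>M)\<bar> \<le> C1 * (\<integral>\<omega>. norm (Y \<omega> - Z \<omega>) \<partial>M)"
proof -
  interpret prob_space M by (rule M)
  have [measurable]: "\<phi> \<in> borel_measurable borel" "Y \<in> borel_measurable M" "Z \<in> borel_measurable M"
    using c Y Z by (auto intro: borel_measurable_continuous_onI)
  have int: "integrable M (\<lambda>\<omega>. \<phi> (V \<omega>))" if V: "integrable M V" for V
  proof (rule Bochner_Integration.integrable_bound)
    show "integrable M (\<lambda>\<omega>. \<bar>\<phi> 0\<bar> + C1 * norm (V \<omega>))" using V by simp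
    have "\<bar>\<phi> v\<bar> \<le> \<bar>\<phi> 0\<bar> + C1 * norm v" for v using lip[of v 0] by simp
    then show "AE \<omega> in M. norm (\<phi> (V \<omega>)) \<le> norm (\<bar>\<phi> 0\<bar> + C1 * norm (V \<omega>))"
      by (intro AE_I2) (metis abs_ge_self order_trans real_norm_def)
  qed (use V in measurable)
  have "integrable M (\<lambda>\<omega>. (Y \<omega> - Z \<omega>) + Z \<omega>)"
    using YZ Z by (intro Bochner_Integration.integrable_add) (auto simp: integrable_norm_iff)
  then have Yi: "integrable M Y" by simp
  show iY: "integrable M (\<lambda>\<omega>. \<phi> (Y \<omega>))" by (rule int[OF Yi])
  have "\<bar>(\<integral>\<omega>. \<phi> (Y \<omega>) \<partial>M) - (\<integral>\<omega>. \<phi> (Z \<omega>) \<partial>M)\<bar> = \<bar>\<integral>\<omega>. \<phi> (Y \<omega>) - \<phi> (Z \<omega>) \<partial>M\<bar>"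
    using iY int[OF Z] by simp
  also have "\<dots> \<le> (\<integral>\<omega>. \<bar>\<phi> (Y \<omega>) - \<phi> (Z \<omega>)\<bar> \<partial>M)" by (rule integral_abs_bound)
  also have "\<dots> \<le> (\<integral>\<omega>. C1 * norm (Y \<omega> - Z \<omega>) \<partial>M)"
    using iY int[OF Z] YZ lip by (intro integral_mono) auto
  finally show "\<bar>(\<integral>\<omega>. \<phi> (Y \<omega>) \<partial>M) - (\<integral>\<omega>. \<phi> (Z \<omega>) \<partial>M)\<bar> \<le> C1 * (\<integral>\<omega>. norm (Y \<omega> - Z \<omega>) \<partial>M)" by simp
qed

text \<open>Both variables are replaced by finite Gaussian sums at accuracy \<open>\<delta>\<close>,
  compared there, and \<open>\<delta>\<close> is sent to 0. \<open>L\<close> depends on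
  \<open>\<phi>\<close> alone, and means enter through the Lipschitz bound.\<close>

lemma gauss_limit_comparison:
  fixes \<phi> :: "'h::{real_inner, banach, second_countable_topology} \<Rightarrow> real"
  assumes M: "prob_space M" and \<phi>: "C2b \<phi>"
  shows "\<exists>L>0. (\<forall>x y. \<bar>\<phi> x - \<phi> y\<bar> \<le> L * norm (x - y)) \<and>
    (\<forall>m m' Z Z' C C' \<epsilon>. gauss_limit M Z C \<longrightarrow> gauss_limit M Z' C' \<longrightarrow>
      (\<forall>K b. bform K b \<longrightarrow> \<bar>C b - C' b\<bar> \<le> K * \<epsilon>) \<longrightarrow>
      \<bar>(\<integral>\<omega>. \<phi> (m + Z \<omega>) \<partial>M) - (\<integral>\<omega>. \<phi> (m' + Z' \<omega>) \<partial>M)\<bar> \<le> L * (norm (m - m') + \<epsilon>))"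
proof -
  interpret prob_space M by (rule M)
  obtain D1 :: "'h \<Rightarrow> 'h \<Rightarrow>\<^sub>L real" and D2 :: "'h \<Rightarrow> 'h \<Rightarrow>\<^sub>L 'h \<Rightarrow>\<^sub>L real" and C1 C2 where
    D1: "\<And>x. (\<phi> has_derivative blinfun_apply (D1 x)) (at x)" and D2: "\<And>x. (D1 has_derivative blinfun_apply (D2 x)) (at x)"
    and cD2: "continuous_on UNIV D2" and C1: "\<And>x. norm (D1 x) \<le> C1" and C2: "\<And>x. norm (D2 x) \<le> C2"
    and pos: "0 < C1" "0 < C2"
    by (rule C2b_obtain[OF \<phi>], rule that)
  have D1b: "norm (D1 x v) \<le> C1 * norm v" for x v
    using norm_blinfun[of "D1 x" v] mult_right_mono[OF C1[of x], of "norm v"] by simp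
  have lip: "\<bar>\<phi> x - \<phi> y\<bar> \<le> C1 * norm (x - y)" for x y
    using lipschitz_of_derivative[OF D1 D1b, of x y] pos by simp
  have \<phi>c: "continuous_on UNIV \<phi>" using D1 by (meson has_derivative_continuous continuous_at_imp_continuous_on)
  have C2f: "bform C2 (\<lambda>u v. D2 x u v)" for x by (rule bform_second_derivative[OF C2])
  let ?L = "C1 + 2 * C2"
  show ?thesis
  proof (intro exI[of _ ?L] conjI allI impI)
    show "0 < ?L" using pos by simp
    show "\<bar>\<phi> x - \<phi> y\<bar> \<le> ?L * norm (x - y)" for x y
      using lip[of x y] pos mult_right_mono[of C1 ?L "norm (x - y)"] by simp
    fix m m' :: 'h and Z Z' :: "'a \<Rightarrow> 'h" and C C' and \<epsilon> :: real
    assume Z: "gauss_limit M Z C" and Z': "gauss_limit M Z' C'"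
      and CC: "\<forall>K b. bform K b \<longrightarrow> \<bar>C b - C' b\<bar> \<le> K * \<epsilon>"
    show "\<bar>(\<integral>\<omega>. \<phi> (m + Z \<omega>) \<partial>M) - (\<integral>\<omega>. \<phi> (m' + Z' \<omega>) \<partial>M)\<bar> \<le> ?L * (norm (m - m') + \<epsilon>)"
    proof (rule field_le_epsilon)
      fix e :: real assume e: "0 < e"
      \<comment> \<open>The two replacements cost \<open>C1 * \<delta>\<close> each, and the two
        covariance errors \<open>\<delta> * C2\<close> are doubled by
        \<open>gaussian_comparison\<close>: in total
        \<open>(2 * C1 + 4 * C2) * \<delta> = e\<close>.\<close>
      define \<delta> where "\<delta> = e / (2 * C1 + 4 * C2)"
      have \<delta>: "0 < \<delta>" using e pos by (simp add: \<delta>_def)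
      obtain J :: "(nat \<times> nat) set" and \<zeta> \<sigma> g where J: "gauss_family M J \<zeta> \<sigma>"
        "(\<integral>\<^sup>+ \<omega>. ennreal (norm (Z \<omega> - (\<Sum>j\<in>J. \<zeta> j \<omega> *\<^sub>R g j))) \<partial>M) \<le> ennreal \<delta>"
        "\<And>K b. bform K b \<Longrightarrow> \<bar>C b - (\<Sum>j\<in>J. (\<sigma> j)\<^sup>2 * b (g j) (g j))\<bar> \<le> \<delta> * K"
        using Z \<delta> unfolding gauss_limit_def by blast
      obtain J' :: "(nat \<times> nat) set" and \<zeta>' \<sigma>' g' where J': "gauss_family M J' \<zeta>' \<sigma>'"
        "(\<integral>\<^sup>+ \<omega>. ennreal (norm (Z' \<omega> - (\<Sum>j\<in>J'. \<zeta>' j \<omega> *\<^sub>R g' j))) \<partial>M) \<le> ennreal \<delta>"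
        "\<And>K b. bform K b \<Longrightarrow> \<bar>C' b - (\<Sum>j\<in>J'. (\<sigma>' j)\<^sup>2 * b (g' j) (g' j))\<bar> \<le> \<delta> * K"
        using Z' \<delta> unfolding gauss_limit_def by blast
      define X where "X = (\<lambda>\<omega>. \<Sum>j\<in>J. \<zeta> j \<omega> *\<^sub>R g j)"
      define X' where "X' = (\<lambda>\<omega>. \<Sum>j\<in>J'. \<zeta>' j \<omega> *\<^sub>R g' j)"
      have mX: "X \<in> borel_measurable M" "integrable M (\<lambda>\<omega>. norm (X \<omega>))"
        unfolding X_def by (rule gauss_family_norm_integrable[OF M J(1)])+
      have mX': "X' \<in> borel_measurable M" "integrable M (\<lambda>\<omega>. norm (X' \<omega>))"
        unfolding X'_def by (rule gauss_family_norm_integrable[OF M J'(1)])+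
      have mZ: "Z \<in> borel_measurable M" "Z' \<in> borel_measurable M" using Z Z' by (auto simp: gauss_limit_def)
      have 1: "\<bar>(\<integral>\<omega>. \<phi> (a + Z \<omega>) \<partial>M) - (\<integral>\<omega>. \<phi> (a + X \<omega>) \<partial>M)\<bar> \<le> C1 * \<delta>" for a
      proof -
        have mm: "(\<lambda>\<omega>. Z \<omega> - X \<omega>) \<in> borel_measurable M" using mX(1) mZ by (intro borel_measurable_diff)
        have dd: "(\<integral>\<^sup>+ \<omega>. ennreal (norm (Z \<omega> - X \<omega>)) \<partial>M) \<le> ennreal \<delta>" unfolding X_def by (rule J(2))
        note d = nn_integral_norm_le_imp_integrable[OF mm dd less_imp_le[OF \<delta>]]
        have "\<bar>(\<integral>\<omega>. \<phi> (a + Z \<omega>) \<partial>M) - (\<integral>\<omega>. \<phi> (a + X \<omega>) \<partial>M)\<bar> \<le> C1 * (\<integral>\<omega>. norm ((a + Z \<omega>) - (a + X \<omega>)) \<partial>M)"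
        proof (rule C2b_lipschitz(2)[OF M lip _ _ _ \<phi>c])
          show "integrable M (\<lambda>\<omega>. a + X \<omega>)" using mX by (simp add: integrable_norm_iff)
          show "integrable M (\<lambda>\<omega>. norm ((a + Z \<omega>) - (a + X \<omega>)))" using d(1) by simp
        qed (use mZ in measurable)
        also have "\<dots> \<le> C1 * \<delta>" using d(2) pos by simp
        finally show ?thesis .
      qed
      have 2: "\<bar>(\<integral>\<omega>. \<phi> (m' + Z' \<omega>) \<partial>M) - (\<integral>\<omega>. \<phi> (m' + X' \<omega>) \<partial>M)\<bar> \<le> C1 * \<delta>"
      proof -
        have mm: "(\<lambda>\<omega>. Z' \<omega> - X' \<omega>) \<in> borel_measurable M" using mX'(1) mZ by (intro borel_measurable_diff)
        have dd: "(\<integral>\<^sup>+ \<omega>. ennreal (norm (Z' \<omega> - X' \<omega>)) \<partial>M) \<le> ennreal \<delta>" unfolding X'_def by (rule J'(2))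
        note d = nn_integral_norm_le_imp_integrable[OF mm dd less_imp_le[OF \<delta>]]
        have "\<bar>(\<integral>\<omega>. \<phi> (m' + Z' \<omega>) \<partial>M) - (\<integral>\<omega>. \<phi> (m' + X' \<omega>) \<partial>M)\<bar> \<le> C1 * (\<integral>\<omega>. norm ((m' + Z' \<omega>) - (m' + X' \<omega>)) \<partial>M)"
        proof (rule C2b_lipschitz(2)[OF M lip _ _ _ \<phi>c])
          show "integrable M (\<lambda>\<omega>. m' + X' \<omega>)" using mX' by (simp add: integrable_norm_iff)
          show "integrable M (\<lambda>\<omega>. norm ((m' + Z' \<omega>) - (m' + X' \<omega>)))" using d(1) by simp
        qed (use mZ in measurable)
        also have "\<dots> \<le> C1 * \<delta>" using d(2) pos by simp
        finally show ?thesis .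
      qed
      have 3: "\<bar>(\<integral>\<omega>. \<phi> (m' + X \<omega>) \<partial>M) - (\<integral>\<omega>. \<phi> (m' + X' \<omega>) \<partial>M)\<bar> \<le> 2 * (C2 * \<epsilon> + 2 * (\<delta> * C2))"
        unfolding X_def X'_def
      proof (rule gaussian_comparison[OF M M J(1) J'(1) D1 D2 cD2 C1 C2])
        fix x
        show "\<bar>(\<Sum>j\<in>J. (\<sigma> j)\<^sup>2 * D2 x (g j) (g j)) - (\<Sum>j\<in>J'. (\<sigma>' j)\<^sup>2 * D2 x (g' j) (g' j))\<bar> \<le> C2 * \<epsilon> + 2 * (\<delta> * C2)"
          using J(3)[OF C2f[of x]] J'(3)[OF C2f[of x]] CC[rule_format, OF C2f[of x]] by linarith
      qed
      have 4: "\<bar>(\<integral>\<omega>. \<phi> (m + X \<omega>) \<partial>M) - (\<integral>\<omega>. \<phi> (m' + X \<omega>) \<partial>M)\<bar> \<le> C1 * norm (m - m')"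
      proof -
        have "\<bar>(\<integral>\<omega>. \<phi> (m + X \<omega>) \<partial>M) - (\<integral>\<omega>. \<phi> (m' + X \<omega>) \<partial>M)\<bar> \<le> C1 * (\<integral>\<omega>. norm ((m + X \<omega>) - (m' + X \<omega>)) \<partial>M)"
        proof (rule C2b_lipschitz(2)[OF M lip _ _ _ \<phi>c])
          show "integrable M (\<lambda>\<omega>. m' + X \<omega>)" using mX by (simp add: integrable_norm_iff)
        qed (use mX in \<open>simp_all\<close>)
        then show ?thesis by (simp add: prob_space)
      qed
      have "\<bar>(\<integral>\<omega>. \<phi> (m + Z \<omega>) \<partial>M) - (\<integral>\<omega>. \<phi> (m' + Z' \<omega>) \<partial>M)\<bar> \<le>
          C1 * norm (m - m') + 2 * C2 * \<epsilon> + (2 * C1 + 4 * C2) * \<delta>"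
        using 1[of m] 2 3 4 by (simp add: algebra_simps)
      also have "(2 * C1 + 4 * C2) * \<delta> = e" using pos by (simp add: \<delta>_def)
      also have "C1 * norm (m - m') + 2 * C2 * \<epsilon> + e \<le> ?L * (norm (m - m') + \<epsilon>) + e"
      proof -
        have "0 \<le> \<epsilon>"
        proof -
          have "0 \<le> C2 * \<epsilon>" using CC[rule_format, OF C2f[of 0]] order_trans[OF abs_ge_zero] by blast
          then show ?thesis using pos by (simp add: zero_le_mult_iff)
        qed
        then have "0 \<le> C1 * \<epsilon>" "0 \<le> C2 * norm (m - m')" using pos by auto
        then show ?thesis by (simp add: algebra_simps)
      qed
      finally show "\<bar>(\<integral>\<omega>. \<phi> (m + Z \<omega>) \<partial>M) - (\<integral>\<omega>. \<phi> (m' + Z' \<omega>) \<partial>M)\<bar> \<le> ?L * (norm (m - m') + \<epsilon>) + e" .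
    qed
  qed
qed

section \<open>The noise of the discrete scheme\<close>

text \<open>Integrates the pointwise inequality
  \<open>norm z \<le> \<delta> + (norm z)\<^sup>2 / \<delta>\<close>. On a finite measure it turns
  mean-square convergence into mean convergence.\<close>

lemma nn_integral_norm_le_square:
  fixes Z :: "'a \<Rightarrow> 'h::{second_countable_topology, real_normed_vector}"
  assumes [measurable]: "Z \<in> borel_measurable M" and \<delta>: "0 < \<delta>"
  shows "(\<integral>\<^sup>+ \<omega>. ennreal (norm (Z \<omega>)) \<partial>M) \<le>
    ennreal \<delta> * emeasure M (space M) + ennreal (1 / \<delta>) * (\<integral>\<^sup>+ \<omega>. ennreal ((norm (Z \<omega>))\<^sup>2) \<partial>M)"
proof -
  have "norm z \<le> \<delta> + 1 / \<delta> * (norm z)\<^sup>2" for z :: 'h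
  proof -
    have "0 \<le> (norm z)\<^sup>2" by simp
    then have "norm z * \<delta> \<le> \<delta>\<^sup>2 + (norm z)\<^sup>2"
      using sum_squares_bound[of "norm z" \<delta>] mult_nonneg_nonneg[of "norm z" \<delta>] \<delta> norm_ge_zero[of z] by linarith
    then show ?thesis using \<delta> by (simp add: field_simps power2_eq_square)
  qed
  then have "(\<integral>\<^sup>+ \<omega>. ennreal (norm (Z \<omega>)) \<partial>M) \<le> (\<integral>\<^sup>+ \<omega>. ennreal \<delta> + ennreal (1 / \<delta>) * ennreal ((norm (Z \<omega>))\<^sup>2) \<partial>M)"
    using \<delta> by (intro nn_integral_mono) (simp add: ennreal_mult'[symmetric] ennreal_plus[symmetric] del: ennreal_plus)
  also have "\<dots> = ennreal \<delta> * emeasure M (space M) + ennreal (1 / \<delta>) * (\<integral>\<^sup>+ \<omega>. ennreal ((norm (Z \<omega>))\<^sup>2) \<partial>M)"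
    by (subst nn_integral_add) (auto simp: nn_integral_cmult)
  finally show ?thesis .
qed

lemma tendsto_L2_eventually:
  fixes Y :: "nat \<Rightarrow> 'a \<Rightarrow> 'h::{second_countable_topology, real_normed_vector}"
  assumes fin: "finite_measure M" and L: "tendsto_L2 M Y Z" and \<epsilon>: "0 < \<epsilon>"
  shows "\<forall>\<^sub>F k in sequentially. (\<integral>\<^sup>+ \<omega>. ennreal (norm (Y k \<omega> - Z \<omega>)) \<partial>M) \<le> ennreal \<epsilon>"
    "\<forall>\<^sub>F k in sequentially. (\<integral>\<^sup>+ \<omega>. ennreal ((norm (Y k \<omega> - Z \<omega>))\<^sup>2) \<partial>M) \<le> ennreal \<epsilon>"
proof -
  interpret finite_measure M by (rule fin)
  have [measurable]: "Y k \<in> borel_measurable M" "Z \<in> borel_measurable M" for k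
    using L by (auto simp: tendsto_L2_def)
  have lim: "(\<lambda>k. \<integral>\<^sup>+ \<omega>. ennreal ((norm (Y k \<omega> - Z \<omega>))\<^sup>2) \<partial>M) \<longlonglongrightarrow> 0"
    using L by (simp add: tendsto_L2_def)
  have ev: "\<forall>\<^sub>F k in sequentially. (\<integral>\<^sup>+ \<omega>. ennreal ((norm (Y k \<omega> - Z \<omega>))\<^sup>2) \<partial>M) \<le> ennreal e" if "0 < e" for e
    using order_tendstoD(2)[OF lim, of "ennreal e"] that by (auto elim: eventually_mono)
  show "\<forall>\<^sub>F k in sequentially. (\<integral>\<^sup>+ \<omega>. ennreal ((norm (Y k \<omega> - Z \<omega>))\<^sup>2) \<partial>M) \<le> ennreal \<epsilon>" by (rule ev[OF \<epsilon>])
  define c where "c = measure M (space M)"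
  have c: "0 \<le> c" "emeasure M (space M) = ennreal c" by (simp_all add: c_def emeasure_eq_measure)
  \<comment> \<open>Half of \<open>\<epsilon>\<close> is spent on the total mass;
    \<open>c + 1\<close> keeps the quotient defined when the mass is 0.\<close>
  define \<delta> where "\<delta> = \<epsilon> / (2 * (c + 1))"
  have \<delta>: "0 < \<delta>" using \<epsilon> c by (simp add: \<delta>_def)
  have \<delta>c: "\<delta> * c \<le> \<epsilon> / 2"
  proof -
    have "\<delta> * c \<le> \<delta> * (c + 1)" using \<delta> by simp
    also have "\<dots> = \<epsilon> / 2" using c by (simp add: \<delta>_def field_simps)
    finally show ?thesis .
  qed
  have "0 < \<delta> * (\<epsilon> / 2)" using \<delta> \<epsilon> by simp
  from ev[OF this] show "\<forall>\<^sub>F k in sequentially. (\<integral>\<^sup>+ \<omega>. ennreal (norm (Y k \<omega> - Z \<omega>)) \<partial>M) \<le> ennreal \<epsilon>"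
  proof eventually_elim
    fix k assume k: "(\<integral>\<^sup>+ \<omega>. ennreal ((norm (Y k \<omega> - Z \<omega>))\<^sup>2) \<partial>M) \<le> ennreal (\<delta> * (\<epsilon> / 2))"
    have "(\<integral>\<^sup>+ \<omega>. ennreal (norm (Y k \<omega> - Z \<omega>)) \<partial>M) \<le>
        ennreal \<delta> * ennreal c + ennreal (1 / \<delta>) * (\<integral>\<^sup>+ \<omega>. ennreal ((norm (Y k \<omega> - Z \<omega>))\<^sup>2) \<partial>M)"
      unfolding c(2)[symmetric] by (rule nn_integral_norm_le_square[OF _ \<delta>]) measurable
    also have "\<dots> \<le> ennreal \<delta> * ennreal c + ennreal (1 / \<delta>) * ennreal (\<delta> * (\<epsilon> / 2))"
      by (intro add_left_mono mult_left_mono k) auto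
    also have "\<dots> = ennreal (\<delta> * c + 1 / \<delta> * (\<delta> * (\<epsilon> / 2)))"
    proof -
      have "ennreal \<delta> * ennreal c = ennreal (\<delta> * c)"
        by (rule ennreal_mult[symmetric]) (use \<delta> c in auto)
      moreover have "ennreal (1 / \<delta>) * ennreal (\<delta> * (\<epsilon> / 2)) = ennreal (1 / \<delta> * (\<delta> * (\<epsilon> / 2)))"
        by (rule ennreal_mult[symmetric]) (use \<delta> \<epsilon> in auto)
      moreover have "0 \<le> \<delta> * c" "0 \<le> 1 / \<delta> * (\<delta> * (\<epsilon> / 2))" using \<delta> c \<epsilon> by auto
      ultimately show ?thesis by (simp only: ennreal_plus)
    qed
    also have "\<dots> \<le> ennreal \<epsilon>"
      using \<delta> \<delta>c by (intro ennreal_leI) (simp add: field_simps)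
    finally show "(\<integral>\<^sup>+ \<omega>. ennreal (norm (Y k \<omega> - Z \<omega>)) \<partial>M) \<le> ennreal \<epsilon>" .
  qed
qed

lemma kernel_form_sum_left:
  "(\<Sum>n\<in>A. kernel_form J (p n) g b) = kernel_form J (\<lambda>j k. \<Sum>n\<in>A. p n j k) g b"
  unfolding kernel_form_def sum_distrib_right
  by (subst sum.swap, intro sum.cong refl, subst sum.swap) (rule refl)

context hilbert_basis
begin

text \<open>For every \<open>b\<close> of bound \<open>K\<close> the tail of the Gram expansion is
  controlled by the tail of its trace. A truncation index chosen for the trace therefore serves all
  forms at once, as \<open>gauss_limit\<close> demands.\<close>

lemma gram_tail:
  fixes J :: "'i set" and u :: "'i \<Rightarrow> 'h" and b :: "'h \<Rightarrow> 'h \<Rightarrow> real"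
  assumes b: "bform K b" and J: "finite J"
    and w: "\<And>i. w i = (\<Sum>j\<in>J. (u j \<bullet> e i) *\<^sub>R g j)"
  shows "\<bar>kernel_form J (\<lambda>j k. u j \<bullet> u k) g b - (\<Sum>i<I. b (w i) (w i))\<bar>
     \<le> K * (kernel_form J (\<lambda>j k. u j \<bullet> u k) g inner - (\<Sum>i<I. w i \<bullet> w i))"
proof -
  let ?k = "kernel_form J (\<lambda>j k. u j \<bullet> u k) g"
  have 1: "(\<lambda>i. b (w (i + I)) (w (i + I))) sums (?k b - (\<Sum>i<I. b (w i) (w i)))"
    unfolding w by (rule sums_split_initial_segment[OF gram_expansion[OF bformD(1)[OF b] J]])
  have 2: "(\<lambda>i. K * (w (i + I) \<bullet> w (i + I))) sums (K * (?k inner - (\<Sum>i<I. w i \<bullet> w i)))"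
    unfolding w
    by (rule sums_mult[OF sums_split_initial_segment[OF gram_expansion[OF bounded_bilinear_inner J]]])
  have le: "\<bar>b x x\<bar> \<le> K * (x \<bullet> x)" for x
    using bformD(2)[OF b, of x x] by (simp only: dot_square_norm power2_eq_square mult.assoc)
  have "?k b - (\<Sum>i<I. b (w i) (w i)) \<le> K * (?k inner - (\<Sum>i<I. w i \<bullet> w i))"
    by (rule sums_le[OF _ 1 2]) (use le abs_le_D1 in blast)
  moreover have "- (?k b - (\<Sum>i<I. b (w i) (w i))) \<le> K * (?k inner - (\<Sum>i<I. w i \<bullet> w i))"
    by (rule sums_le[OF _ sums_minus[OF 1] 2]) (use le abs_le_D2 in blast)
  ultimately show ?thesis by simp
qed

end

context galerkin_noise
begin

text \<open>Each \<open>W n\<close> is a mean-square limit of finite sums of increments over the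
  common time grid. As there are only \<open>N\<close> of them, one truncation index
  \<open>I\<close> serves all, and \<open>\<bar>c n m\<bar> \<le> 1\<close> makes every
  \<open>fdiag (c n)\<close> a contraction that does not enlarge the error.\<close>

lemma scheme_gauss_limit:
  fixes M :: "'w measure" and W :: "nat \<Rightarrow> 'w \<Rightarrow> 'h"
  assumes M: "prob_space M" and BM: "cylindrical_wiener M T F B" and dt: "0 < dt" "real N * dt \<le> T"
    and W: "\<And>n. n < N \<Longrightarrow> sums_L2 M
        (\<lambda>i \<omega>. (B i (real (Suc n) * dt) \<omega> - B i (real n * dt) \<omega>) *\<^sub>R fdiag (\<lambda>_. 1) (R (e i))) (W n)"
    and c: "\<And>n m. n < N \<Longrightarrow> m < d \<Longrightarrow> \<bar>c n m\<bar> \<le> 1"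
  shows "gauss_limit M (\<lambda>\<omega>. \<Sum>n<N. fdiag (c n) (W n \<omega>))
    (kernel_form {..<d} (\<lambda>j k. (R (f j) \<bullet> R (f k)) * (\<Sum>n<N. dt * (c n j * c n k))) f)"
  unfolding gauss_limit_def
proof (intro conjI allI impI)
  interpret prob_space M by (rule M)
  define G where "G = (\<lambda>i. fdiag (\<lambda>_. 1) (R (e i)))"
  define S where "S = (\<lambda>n I \<omega>. \<Sum>i<I. (B i (real (Suc n) * dt) \<omega> - B i (real n * dt) \<omega>) *\<^sub>R G i)"
  have W': "tendsto_L2 M (S n) (W n)" if "n < N" for n
    using W[OF that] unfolding sums_L2_def S_def G_def .
  have [measurable]: "W n \<in> borel_measurable M" "S n I \<in> borel_measurable M" if "n < N" for n I
    using W'[OF that] by (auto simp: tendsto_L2_def)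
  have nf: "norm (fdiag (c n) v) \<le> norm v" if "n < N" for n v
    using norm_fdiag[of "c n" 1 v] c[OF that] by simp
  have fm: "fdiag (c n) \<in> borel_measurable borel" for n
    by (intro borel_measurable_continuous_onI linear_continuous_on fdiag_linear)
  show "(\<lambda>\<omega>. \<Sum>n<N. fdiag (c n) (W n \<omega>)) \<in> borel_measurable M"
    by (intro borel_measurable_sum measurable_compose[OF _ fm]) auto
  fix \<epsilon> :: real assume \<epsilon>: "0 < \<epsilon>"
  define \<delta> where "\<delta> = \<epsilon> / (real N + 1)"
  have \<delta>: "0 < \<delta>" "real N * \<delta> \<le> \<epsilon>" using \<epsilon> by (auto simp: \<delta>_def field_simps)
  define g where "g = (\<lambda>(i, n). fdiag (c n) (G i))"
  define w where "w = (\<lambda>n i. fdiag (c n) (G i))"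
  let ?u = "\<lambda>m. R (f m)" and ?k = "\<lambda>n. kernel_form {..<d} (\<lambda>j k. R (f j) \<bullet> R (f k)) (\<lambda>m. c n m *\<^sub>R f m)"
  have w: "w n i = (\<Sum>m<d. (R (f m) \<bullet> e i) *\<^sub>R (c n m *\<^sub>R f m))" for n i
    unfolding w_def G_def fdiag_def[of "c n"]
  proof (intro sum.cong refl)
    fix m assume "m \<in> {..<d}"
    then have "fdiag (\<lambda>_. 1) (R (e i)) \<bullet> f m = R (f m) \<bullet> e i"
      by (simp add: fdiag_inner_f R_sym inner_commute[of "e i"])
    then show "(c n m * (fdiag (\<lambda>_. 1) (R (e i)) \<bullet> f m)) *\<^sub>R f m = (R (f m) \<bullet> e i) *\<^sub>R (c n m *\<^sub>R f m)"
      by (simp add: mult.commute)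
  qed
  have lim_in: "(\<lambda>I. \<Sum>i<I. w n i \<bullet> w n i) \<longlonglongrightarrow> ?k n inner" for n
    using gram_expansion[OF bounded_bilinear_inner finite_lessThan, of ?u "\<lambda>m. c n m *\<^sub>R f m" d]
    unfolding w sums_def .
  have ev1: "\<forall>\<^sub>F I in sequentially. \<forall>n\<in>{..<N}. (\<integral>\<^sup>+ \<omega>. ennreal (norm (S n I \<omega> - W n \<omega>)) \<partial>M) \<le> ennreal \<delta>"
    by (intro eventually_ball_finite) (auto intro!: tendsto_L2_eventually(1)[OF finite_measure_axioms W' \<delta>(1)])
  have ev2: "\<forall>\<^sub>F I in sequentially. \<forall>n\<in>{..<N}. ?k n inner - (\<Sum>i<I. w n i \<bullet> w n i) < \<delta> / dt"
  proof (intro eventually_ball_finite ballI)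
    fix n
    have "(\<lambda>I. ?k n inner - (\<Sum>i<I. w n i \<bullet> w n i)) \<longlonglongrightarrow> ?k n inner - ?k n inner"
      by (intro tendsto_diff tendsto_const lim_in)
    then show "\<forall>\<^sub>F I in sequentially. ?k n inner - (\<Sum>i<I. w n i \<bullet> w n i) < \<delta> / dt"
      using \<delta> dt by (intro order_tendstoD(2)) auto
  qed simp
  \<comment> \<open>The tolerance \<open>\<delta> / dt\<close> for the traces compensates the
    variance \<open>dt\<close> of each increment; summing over \<open>N\<close> steps then stays
    below \<open>\<epsilon>\<close>.\<close>
  obtain I where I1: "\<And>n. n < N \<Longrightarrow> (\<integral>\<^sup>+ \<omega>. ennreal (norm (S n I \<omega> - W n \<omega>)) \<partial>M) \<le> ennreal \<delta>"
    and I2: "\<And>n. n < N \<Longrightarrow> ?k n inner - (\<Sum>i<I. w n i \<bullet> w n i) < \<delta> / dt"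
    using eventually_happens'[OF _ eventually_conj[OF ev1 ev2]] by auto
  let ?p = "\<lambda>(_::nat) j. real j * dt" and ?n = "\<lambda>_::nat. N"
  have pp: "partition_points T N (\<lambda>j. real j * dt)"
    unfolding partition_points_def
  proof (intro allI impI conjI)
    fix j assume j: "j < N"
    show "0 \<le> real j * dt" "real j * dt \<le> real (Suc j) * dt" using dt by (auto intro: mult_right_mono)
    have "real (Suc j) * dt \<le> real N * dt" using j dt by (intro mult_right_mono) auto
    then show "real (Suc j) * dt \<le> T" using dt(2) by linarith
  qed
  let ?J = "increments_index I ?n ?p"
  let ?\<zeta> = "\<lambda>(i, j) \<omega>. B i (real (Suc j) * dt) \<omega> - B i (real j * dt) \<omega>"
  let ?\<sigma> = "\<lambda>(i::nat, j). sqrt (real (Suc j) * dt - real j * dt)"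
  show "\<exists>J \<zeta> \<sigma> g. gauss_family M (J :: (nat \<times> nat) set) \<zeta> \<sigma> \<and>
      (\<integral>\<^sup>+ \<omega>. ennreal (norm ((\<Sum>n<N. fdiag (c n) (W n \<omega>)) - (\<Sum>j\<in>J. \<zeta> j \<omega> *\<^sub>R g j))) \<partial>M) \<le> ennreal \<epsilon> \<and>
      (\<forall>K b. bform K b \<longrightarrow> \<bar>kernel_form {..<d} (\<lambda>j k. (R (f j) \<bullet> R (f k)) * (\<Sum>n<N. dt * (c n j * c n k))) f b
         - (\<Sum>j\<in>J. (\<sigma> j)\<^sup>2 * b (g j) (g j))\<bar> \<le> \<epsilon> * K)"
  proof (intro exI conjI allI impI)
    show "gauss_family M ?J ?\<zeta> ?\<sigma>"
      using wiener_gauss_family[OF M BM, of I ?n ?p] pp by simp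
    have eq: "(\<Sum>j\<in>?J. ?\<zeta> j \<omega> *\<^sub>R g j) = (\<Sum>n<N. fdiag (c n) (S n I \<omega>))" for \<omega>
    proof -
      have "(\<Sum>j\<in>?J. ?\<zeta> j \<omega> *\<^sub>R g j) = (\<Sum>(i, j)\<in>?J. (B i (real (Suc j) * dt) \<omega> - B i (real j * dt) \<omega>) *\<^sub>R w j i)"
        by (intro sum.cong refl) (auto simp: g_def w_def)
      also have "\<dots> = (\<Sum>i<I. \<Sum>j<N. (B i (real (Suc j) * dt) \<omega> - B i (real j * dt) \<omega>) *\<^sub>R w j i)"
        by (rule sum_increments_index[where T=T]) (use pp in \<open>auto simp: w_def\<close>)
      also have "\<dots> = (\<Sum>n<N. fdiag (c n) (S n I \<omega>))"
        unfolding S_def w_def linear_sum[OF bounded_linear.linear[OF fdiag_linear]]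
          linear_scale[OF bounded_linear.linear[OF fdiag_linear]]
        by (rule sum.swap)
      finally show ?thesis .
    qed
    have "(\<integral>\<^sup>+ \<omega>. ennreal (norm ((\<Sum>n<N. fdiag (c n) (W n \<omega>)) - (\<Sum>j\<in>?J. ?\<zeta> j \<omega> *\<^sub>R g j))) \<partial>M) \<le>
        (\<integral>\<^sup>+ \<omega>. (\<Sum>n<N. ennreal (norm (S n I \<omega> - W n \<omega>))) \<partial>M)"
    proof (intro nn_integral_mono)
      fix \<omega>
      have "norm ((\<Sum>n<N. fdiag (c n) (W n \<omega>)) - (\<Sum>j\<in>?J. ?\<zeta> j \<omega> *\<^sub>R g j)) = norm (\<Sum>n<N. fdiag (c n) (W n \<omega> - S n I \<omega>))"
        unfolding eq by (simp add: sum_subtractf[symmetric] fdiag_diff)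
      also have "\<dots> \<le> (\<Sum>n<N. norm (S n I \<omega> - W n \<omega>))"
        by (intro order_trans[OF norm_sum] sum_mono) (metis nf norm_minus_commute lessThan_iff)
      finally show "ennreal (norm ((\<Sum>n<N. fdiag (c n) (W n \<omega>)) - (\<Sum>j\<in>?J. ?\<zeta> j \<omega> *\<^sub>R g j))) \<le> (\<Sum>n<N. ennreal (norm (S n I \<omega> - W n \<omega>)))"
        by (simp add: sum_ennreal ennreal_leI)
    qed
    also have "\<dots> = (\<Sum>n<N. \<integral>\<^sup>+ \<omega>. ennreal (norm (S n I \<omega> - W n \<omega>)) \<partial>M)"
      by (intro nn_integral_sum) auto
    also have "\<dots> \<le> (\<Sum>n<N. ennreal \<delta>)" by (intro sum_mono I1) auto
    also have "\<dots> = ennreal (real N * \<delta>)" using \<delta> by (simp add: ennreal_of_nat_eq_real_of_nat ennreal_mult')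
    also have "\<dots> \<le> ennreal \<epsilon>" by (intro ennreal_leI \<delta>)
    finally show "(\<integral>\<^sup>+ \<omega>. ennreal (norm ((\<Sum>n<N. fdiag (c n) (W n \<omega>)) - (\<Sum>j\<in>?J. ?\<zeta> j \<omega> *\<^sub>R g j))) \<partial>M) \<le> ennreal \<epsilon>" .
    fix K and b :: "'h \<Rightarrow> 'h \<Rightarrow> real" assume b: "bform K b"
    interpret b: bounded_bilinear b by (rule bformD(1)[OF b])
    have K: "0 \<le> K" by (rule bform_nonneg[OF b])
    have "(\<Sum>j\<in>?J. (?\<sigma> j)\<^sup>2 * b (g j) (g j)) = (\<Sum>(i, j)\<in>?J. (real (Suc j) * dt - real j * dt) * b (w j i) (w j i))"
      using dt by (intro sum.cong refl) (auto simp: g_def w_def algebra_simps)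
    also have "\<dots> = (\<Sum>i<I. \<Sum>j<N. (real (Suc j) * dt - real j * dt) * b (w j i) (w j i))"
      by (rule sum_increments_index[where T=T]) (use pp in auto)
    also have "\<dots> = (\<Sum>n<N. dt * (\<Sum>i<I. b (w n i) (w n i)))"
      by (subst sum.swap) (simp add: sum_distrib_left algebra_simps)
    finally have s: "(\<Sum>j\<in>?J. (?\<sigma> j)\<^sup>2 * b (g j) (g j)) = (\<Sum>n<N. dt * (\<Sum>i<I. b (w n i) (w n i)))" .
    have "kernel_form {..<d} (\<lambda>j k. (R (f j) \<bullet> R (f k)) * (\<Sum>n<N. dt * (c n j * c n k))) f b = (\<Sum>n<N. dt * ?k n b)"
    proof -
      have "dt * ?k n b = kernel_form {..<d} (\<lambda>j k. (R (f j) \<bullet> R (f k)) * (dt * (c n j * c n k))) f b" for n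
        unfolding kernel_form_def sum_distrib_left
        by (intro sum.cong refl) (simp add: b.scaleR_left b.scaleR_right)
      then show ?thesis by (simp add: kernel_form_sum_left sum_distrib_left)
    qed
    then have "\<bar>kernel_form {..<d} (\<lambda>j k. (R (f j) \<bullet> R (f k)) * (\<Sum>n<N. dt * (c n j * c n k))) f b - (\<Sum>j\<in>?J. (?\<sigma> j)\<^sup>2 * b (g j) (g j))\<bar>
       = \<bar>\<Sum>n<N. dt * (?k n b - (\<Sum>i<I. b (w n i) (w n i)))\<bar>"
      unfolding s by (simp add: sum_subtractf right_diff_distrib)
    also have "\<dots> \<le> (\<Sum>n<N. K * \<delta>)"
    proof (intro order_trans[OF sum_abs] sum_mono)
      fix n assume n: "n \<in> {..<N}"
      have "\<bar>?k n b - (\<Sum>i<I. b (w n i) (w n i))\<bar> \<le> K * (?k n inner - (\<Sum>i<I. w n i \<bullet> w n i))"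
        by (rule gram_tail[OF b finite_lessThan w])
      also have "\<dots> \<le> K * (\<delta> / dt)" using I2[of n] n K by (intro mult_left_mono) auto
      finally have "dt * \<bar>?k n b - (\<Sum>i<I. b (w n i) (w n i))\<bar> \<le> dt * (K * (\<delta> / dt))"
        using dt by (intro mult_left_mono) auto
      also have "dt * (K * (\<delta> / dt)) = K * \<delta>" using dt by simp
      finally show "\<bar>dt * (?k n b - (\<Sum>i<I. b (w n i) (w n i)))\<bar> \<le> K * \<delta>"
        by (simp only: abs_mult abs_of_pos[OF dt(1)])
    qed
    also have "\<dots> = (real N * \<delta>) * K" by simp
    also have "\<dots> \<le> \<epsilon> * K" by (intro mult_right_mono \<delta> K)
    finally show "\<bar>kernel_form {..<d} (\<lambda>j k. (R (f j) \<bullet> R (f k)) * (\<Sum>n<N. dt * (c n j * c n k))) f b - (\<Sum>j\<in>?J. (?\<sigma> j)\<^sup>2 * b (g j) (g j))\<bar> \<le> \<epsilon> * K" .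
  qed
qed

end

section \<open>The stochastic convolution\<close>

lemma partition_points_mono:
  assumes "partition_points T n p" "j \<le> k" "k \<le> n"
  shows "p j \<le> p k"
  using assms(2,3)
proof (induction k rule: dec_induct)
  case (step k)
  then have "p k \<le> p (Suc k)" using assms(1) by (auto simp: partition_points_def)
  then show ?case using step by simp
qed simp

text \<open>The left-open intervals of a partition are disjoint, so the mixed terms of the product
  vanish.\<close>

lemma step_fun_inner_mult:
  fixes c :: "nat \<Rightarrow> 'h::real_inner"
  assumes p: "partition_points T n p"
  shows "(step_fun n p c s \<bullet> u) * (step_fun n p c s \<bullet> v) =
    (\<Sum>j<n. indicator {p j<..p (Suc j)} s * ((c j \<bullet> u) * (c j \<bullet> v)))"
proof -
  have disj: "indicator {p j<..p (Suc j)} s * indicator {p k<..p (Suc k)} s = (0::real)"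
    if "j < k" "k < n" for j k
    using partition_points_mono[OF p, of "Suc j" k] that by (auto simp: indicator_def)
  have *: "indicator {p j<..p (Suc j)} s * indicator {p k<..p (Suc k)} s =
      (if j = k then indicator {p j<..p (Suc j)} s else (0::real))" if "j < n" "k < n" for j k
  proof (cases j k rule: linorder_cases)
    case less
    then show ?thesis using disj[OF less that(2)] by simp
  next
    case greater
    then show ?thesis using disj[OF greater that(1)] by (simp add: mult.commute)
  qed (simp add: indicator_def)
  have "(step_fun n p c s \<bullet> u) * (step_fun n p c s \<bullet> v) =
     (\<Sum>j<n. \<Sum>k<n. (indicator {p j<..p (Suc j)} s * indicator {p k<..p (Suc k)} s) * ((c j \<bullet> u) * (c k \<bullet> v)))"
    unfolding step_fun_def inner_sum_left sum_product
    by (intro sum.cong refl) (simp only: inner_scaleR_left mult_ac)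
  also have "\<dots> = (\<Sum>j<n. \<Sum>k<n. if j = k then indicator {p j<..p (Suc j)} s * ((c j \<bullet> u) * (c j \<bullet> v)) else 0)"
    by (intro sum.cong refl) (auto simp: *)
  finally show ?thesis by simp
qed

context
  fixes T :: real
  assumes T0: "0 \<le> T"
begin

abbreviation "time \<equiv> restrict_space lborel {0..T}"

lemma finite_measure_time: "finite_measure time"
  by (rule finite_measureI) (use T0 in \<open>simp add: emeasure_restrict_space space_restrict_space\<close>)

lemma step_fun_inner_integral:
  fixes c :: "nat \<Rightarrow> 'h::real_inner"
  assumes p: "partition_points T n p"
  shows "integrable time (\<lambda>s. (step_fun n p c s \<bullet> u) * (step_fun n p c s \<bullet> v))"
    "(\<integral>s. (step_fun n p c s \<bullet> u) * (step_fun n p c s \<bullet> v) \<partial>time) = (\<Sum>j<n. (p (Suc j) - p j) * ((c j \<bullet> u) * (c j \<bullet> v)))"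
proof -
  interpret finite_measure time by (rule finite_measure_time)
  have m: "measure time {p j<..p (Suc j)} = p (Suc j) - p j" "{p j<..p (Suc j)} \<in> sets time"
    "{p j<..p (Suc j)} \<inter> {0..T} = {p j<..p (Suc j)}" if j: "j < n" for j
  proof -
    have le: "0 \<le> p j" "p j \<le> p (Suc j)" "p (Suc j) \<le> T" using p j by (auto simp: partition_points_def)
    then have sub: "{p j<..p (Suc j)} \<subseteq> {0..T}" by auto
    then show "measure time {p j<..p (Suc j)} = p (Suc j) - p j"
      using le by (subst measure_restrict_space) auto
    show "{p j<..p (Suc j)} \<inter> {0..T} = {p j<..p (Suc j)}" using sub by blast
    show "{p j<..p (Suc j)} \<in> sets time" using sub by (subst sets_restrict_space_iff) auto
  qed
  have i: "integrable time (\<lambda>s. indicator {p j<..p (Suc j)} s * a)" if "j < n" for j and a :: real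
    using m(2)[OF that] by (intro integrable_mult_left integrable_real_indicator) (auto simp: emeasure_eq_measure)
  show "integrable time (\<lambda>s. (step_fun n p c s \<bullet> u) * (step_fun n p c s \<bullet> v))"
    unfolding step_fun_inner_mult[OF p] by (intro Bochner_Integration.integrable_sum i) auto
  have "(\<integral>s. (step_fun n p c s \<bullet> u) * (step_fun n p c s \<bullet> v) \<partial>time) =
      (\<Sum>j<n. \<integral>s. indicator {p j<..p (Suc j)} s * ((c j \<bullet> u) * (c j \<bullet> v)) \<partial>time)"
    unfolding step_fun_inner_mult[OF p] by (intro Bochner_Integration.integral_sum i) auto
  also have "\<dots> = (\<Sum>j<n. (p (Suc j) - p j) * ((c j \<bullet> u) * (c j \<bullet> v)))"
    using m by (intro sum.cong refl) (simp add: integral_mult_left_zero)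
  finally show "(\<integral>s. (step_fun n p c s \<bullet> u) * (step_fun n p c s \<bullet> v) \<partial>time) = (\<Sum>j<n. (p (Suc j) - p j) * ((c j \<bullet> u) * (c j \<bullet> v)))" .
qed

text \<open>With the error \<open>\<Delta>\<close> of the step function, the product of the two
  coefficients changes by at most \<open>(norm \<Delta>)\<^sup>2 + 2 * B * norm \<Delta>\<close>,
  and both terms are small in the mean. Single matrix entries suffice, as only finitely many will be
  needed.\<close>

lemma step_covariance_eventually:
  fixes f :: "real \<Rightarrow> 'h::{real_inner, second_countable_topology}"
  assumes p: "\<And>k. partition_points T (n k) (p k)"
    and L: "tendsto_L2 time (\<lambda>k. step_fun (n k) (p k) (c k)) f"
    and f: "\<And>s. s \<in> {0..T} \<Longrightarrow> norm (f s) \<le> B" and B: "0 < B"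
    and uv: "norm u \<le> 1" "norm v \<le> 1" and \<epsilon>: "0 < \<epsilon>"
  shows "\<forall>\<^sub>F k in sequentially. \<bar>(\<Sum>j<n k. (p k (Suc j) - p k j) * ((c k j \<bullet> u) * (c k j \<bullet> v)))
     - (\<integral>s. (f s \<bullet> u) * (f s \<bullet> v) \<partial>time)\<bar> \<le> \<epsilon>"
proof -
  interpret finite_measure time by (rule finite_measure_time)
  let ?g = "\<lambda>k. step_fun (n k) (p k) (c k)"
  have [measurable]: "?g k \<in> borel_measurable time" "f \<in> borel_measurable time" for k
    using L by (auto simp: tendsto_L2_def)
  have fi: "integrable time (\<lambda>s. (f s \<bullet> u) * (f s \<bullet> v))"
  proof (rule integrable_const_bound[where B="B * B"])
    show "AE s in time. norm ((f s \<bullet> u) * (f s \<bullet> v)) \<le> B * B"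
    proof (rule AE_I2)
      fix s assume "s \<in> space time"
      then have "norm (f s) \<le> B" using f by (simp add: space_restrict_space)
      moreover have "\<bar>f s \<bullet> w\<bar> \<le> norm (f s)" if "norm w \<le> 1" for w
        using Cauchy_Schwarz_ineq2[of "f s" w] mult_left_mono[OF that norm_ge_zero[of "f s"]] by simp
      ultimately show "norm ((f s \<bullet> u) * (f s \<bullet> v)) \<le> B * B"
        unfolding real_norm_def abs_mult using uv B by (intro mult_mono) (auto intro: order_trans)
    qed
  qed measurable
  define e1 where "e1 = \<epsilon> / (4 * B)"
  have e1: "0 < e1" "2 * B * e1 = \<epsilon> / 2" using \<epsilon> B by (simp_all add: e1_def)
  have "\<forall>\<^sub>F k in sequentially. (\<integral>\<^sup>+ s. ennreal (norm (?g k s - f s)) \<partial>time) \<le> ennreal e1 \<and>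
      (\<integral>\<^sup>+ s. ennreal ((norm (?g k s - f s))\<^sup>2) \<partial>time) \<le> ennreal (\<epsilon> / 2)"
    using e1 \<epsilon> by (intro eventually_conj tendsto_L2_eventually[OF finite_measure_time L]) auto
  then show ?thesis
  proof eventually_elim
    fix k
    assume k: "(\<integral>\<^sup>+ s. ennreal (norm (?g k s - f s)) \<partial>time) \<le> ennreal e1 \<and>
      (\<integral>\<^sup>+ s. ennreal ((norm (?g k s - f s))\<^sup>2) \<partial>time) \<le> ennreal (\<epsilon> / 2)"
    let ?D = "\<lambda>s. (?g k s \<bullet> u) * (?g k s \<bullet> v) - (f s \<bullet> u) * (f s \<bullet> v)"
    have pw: "\<bar>?D s\<bar> \<le> (norm (?g k s - f s))\<^sup>2 + 2 * B * norm (?g k s - f s)" if "s \<in> space time" for s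
    proof -
      define \<Delta> where "\<Delta> = ?g k s - f s"
      have g: "?g k s = f s + \<Delta>" by (simp add: \<Delta>_def)
      have cs: "\<bar>x \<bullet> w\<bar> \<le> norm x" if "norm w \<le> 1" for x w :: 'h
        using Cauchy_Schwarz_ineq2[of x w] mult_left_mono[OF that norm_ge_zero[of x]] by simp
      have nB: "norm (f s) \<le> B" using f that by (simp add: space_restrict_space)
      have "?D s = (\<Delta> \<bullet> u) * (f s \<bullet> v) + (f s \<bullet> u) * (\<Delta> \<bullet> v) + (\<Delta> \<bullet> u) * (\<Delta> \<bullet> v)"
        unfolding g by (simp add: inner_add_left algebra_simps)
      also have "\<bar>\<dots>\<bar> \<le> \<bar>\<Delta> \<bullet> u\<bar> * \<bar>f s \<bullet> v\<bar> + \<bar>f s \<bullet> u\<bar> * \<bar>\<Delta> \<bullet> v\<bar> + \<bar>\<Delta> \<bullet> u\<bar> * \<bar>\<Delta> \<bullet> v\<bar>"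
        unfolding abs_mult[symmetric] by linarith
      also have "\<dots> \<le> norm \<Delta> * B + B * norm \<Delta> + norm \<Delta> * norm \<Delta>"
        using cs[OF uv(1)] cs[OF uv(2)] nB B
        by (intro add_mono mult_mono) (auto intro: order_trans)
      finally show ?thesis by (simp add: \<Delta>_def power2_eq_square algebra_simps)
    qed
    have gi: "integrable time (\<lambda>s. (?g k s \<bullet> u) * (?g k s \<bullet> v))" by (rule step_fun_inner_integral(1)[OF p])
    have Di: "integrable time ?D" using gi fi by simp
    have "ennreal \<bar>\<integral>s. ?D s \<partial>time\<bar> \<le> (\<integral>\<^sup>+ s. ennreal (norm (?D s)) \<partial>time)"
      using integral_norm_bound_ennreal[OF Di] by simp
    also have "\<dots> \<le> (\<integral>\<^sup>+ s. ennreal ((norm (?g k s - f s))\<^sup>2) + ennreal (2 * B) * ennreal (norm (?g k s - f s)) \<partial>time)"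
      using pw B by (intro nn_integral_mono) (simp add: ennreal_mult'[symmetric] ennreal_plus[symmetric] ennreal_leI del: ennreal_plus)
    also have "\<dots> = (\<integral>\<^sup>+ s. ennreal ((norm (?g k s - f s))\<^sup>2) \<partial>time) + ennreal (2 * B) * (\<integral>\<^sup>+ s. ennreal (norm (?g k s - f s)) \<partial>time)"
      by (subst nn_integral_add) (auto simp: nn_integral_cmult)
    also have "\<dots> \<le> ennreal (\<epsilon> / 2) + ennreal (2 * B) * ennreal e1"
      using k by (intro add_mono mult_left_mono) auto
    also have "\<dots> = ennreal \<epsilon>"
      using e1 B \<epsilon> by (simp add: ennreal_mult'[symmetric] ennreal_plus[symmetric] del: ennreal_plus)
    finally have "\<bar>\<integral>s. ?D s \<partial>time\<bar> \<le> \<epsilon>" using \<epsilon> by (simp add: ennreal_le_iff)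
    moreover have "(\<integral>s. ?D s \<partial>time) = (\<Sum>j<n k. (p k (Suc j) - p k j) * ((c k j \<bullet> u) * (c k j \<bullet> v)))
       - (\<integral>s. (f s \<bullet> u) * (f s \<bullet> v) \<partial>time)"
      using Bochner_Integration.integral_diff[OF gi fi] step_fun_inner_integral(2)[OF p[of k], of "c k" u v] by simp
    ultimately show "\<bar>(\<Sum>j<n k. (p k (Suc j) - p k j) * ((c k j \<bullet> u) * (c k j \<bullet> v)))
       - (\<integral>s. (f s \<bullet> u) * (f s \<bullet> v) \<partial>time)\<bar> \<le> \<epsilon>" by (simp only:)
  qed
qed

lemma exp_integral_time:
  assumes a: "0 < a"
  shows "(\<integral>s. exp (- (a * (T - s))) \<partial>time) = (1 - exp (- (a * T))) / a"
proof -
  have "(\<integral>s. exp (- (a * (T - s))) \<partial>time) = (\<integral>s. indicator {0..T} s *\<^sub>R exp (- (a * (T - s))) \<partial>lborel)"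
    by (subst integral_restrict_space) auto
  also have "\<dots> = exp (- (a * (T - T))) / a - exp (- (a * (T - 0))) / a"
  proof (rule integral_FTC_atLeastAtMost[OF T0])
    fix s
    have "((\<lambda>s. exp (- (a * (T - s))) / a) has_real_derivative exp (- (a * (T - s)))) (at s)"
      using a by (auto intro!: derivative_eq_intros)
    then show "((\<lambda>s. exp (- (a * (T - s))) / a) has_vector_derivative exp (- (a * (T - s)))) (at s within {0..T})"
      by (simp add: has_real_derivative_iff_has_vector_derivative has_vector_derivative_at_within)
  qed (intro continuous_intros)
  finally show ?thesis by (simp add: diff_divide_distrib)
qed

end

context noise
begin

text \<open>Two approximations in a row: the series over the Brownian motions is cut at
  \<open>I\<close>, then every Wiener integral is replaced by a step integral. The covariance is
  controlled only in the first \<open>N\<close> eigendirections. In the last factor,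
  \<open>1 / lam 0\<close> bounds the time integral multiplying the error of the cut, and 1 accounts
  for the steps.\<close>

lemma exact_approximation:
  fixes M :: "'w measure" and Z :: "'w \<Rightarrow> 'h"
  assumes M: "prob_space M" and BM: "cylindrical_wiener M T F B" and T: "0 \<le> T"
    and st: "has_stoch_integral M e B T \<Phi> Z"
    and \<Phi>: "\<forall>s\<in>{0..T}. \<forall>v. \<Phi> s v = expA (T - s) (R v)"
    and \<delta>: "0 < \<delta>"
  shows "\<exists>I n p (c :: nat \<Rightarrow> nat \<Rightarrow> 'h). (\<forall>i. partition_points T (n i) (p i)) \<and>
    (\<integral>\<^sup>+ \<omega>. ennreal (norm (Z \<omega> - (\<Sum>i<I. step_integral (B i) (n i) (p i) (c i) \<omega>))) \<partial>M) \<le> ennreal \<delta> \<and>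
    (\<forall>m<N. \<forall>l<N. \<bar>(\<Sum>i<I. \<Sum>j<n i. (p i (Suc j) - p i j) * ((c i j \<bullet> e m) * (c i j \<bullet> e l)))
       - (R (e m) \<bullet> R (e l)) * ((1 - exp (- ((lam m + lam l) * T))) / (lam m + lam l))\<bar> \<le> (1 / lam 0 + 1) * \<delta>)"
proof -
  interpret prob_space M by (rule M)
  let ?E = "\<lambda>m l. (1 - exp (- ((lam m + lam l) * T))) / (lam m + lam l)"
  obtain V where V: "\<And>i. has_wiener_integral M (B i) T (\<lambda>s. \<Phi> s (e i)) (V i)" and VZ: "sums_L2 M V Z"
    using st unfolding has_stoch_integral_def by blast
  \<comment> \<open>Steps, nodes and values are packed in one tuple so that a single choice over
    \<open>i\<close> fixes them together.\<close>
  define ok where "ok = (\<lambda>i t. (\<forall>k. partition_points T (fst t k) (fst (snd t) k)) \<and>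
     tendsto_L2 (restrict_space lborel {0..T}) (\<lambda>k. step_fun (fst t k) (fst (snd t) k) (snd (snd t) k)) (\<lambda>s. \<Phi> s (e i)) \<and>
     tendsto_L2 M (\<lambda>k. step_integral (B i) (fst t k) (fst (snd t) k) (snd (snd t) k)) (V i))"
  have "\<exists>t. ok i t" for i
  proof -
    obtain n p c where "\<forall>k. \<forall>j<n k. 0 \<le> p k j \<and> p k j \<le> p k (Suc j) \<and> p k (Suc j) \<le> T"
      "tendsto_L2 (restrict_space lborel {0..T}) (\<lambda>k. step_fun (n k) (p k) (c k)) (\<lambda>s. \<Phi> s (e i))"
      "tendsto_L2 M (\<lambda>k. step_integral (B i) (n k) (p k) (c k)) (V i)"
      using V[of i] unfolding has_wiener_integral_def by blast
    then have "ok i (n, p, c)" by (simp add: ok_def partition_points_def)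
    then show ?thesis by blast
  qed
  then obtain tt where tt: "\<And>i. ok i (tt i)" by metis
  define nn where "nn = (\<lambda>i. fst (tt i))"
  define pp where "pp = (\<lambda>i. fst (snd (tt i)))"
  define cc where "cc = (\<lambda>i. snd (snd (tt i)))"
  have P: "partition_points T (nn i k) (pp i k)"
    and Lf: "tendsto_L2 (restrict_space lborel {0..T}) (\<lambda>k. step_fun (nn i k) (pp i k) (cc i k)) (\<lambda>s. \<Phi> s (e i))"
    and LV: "tendsto_L2 M (\<lambda>k. step_integral (B i) (nn i k) (pp i k) (cc i k)) (V i)" for i k
    using tt[of i] by (auto simp: ok_def nn_def pp_def cc_def)
  have cov: "(\<integral>s. (\<Phi> s (e i) \<bullet> e m) * (\<Phi> s (e i) \<bullet> e l) \<partial>restrict_space lborel {0..T}) =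
      (R (e i) \<bullet> e m) * (R (e i) \<bullet> e l) * ?E m l" for i m l
  proof -
    have "(\<integral>s. (\<Phi> s (e i) \<bullet> e m) * (\<Phi> s (e i) \<bullet> e l) \<partial>restrict_space lborel {0..T}) =
        (\<integral>s. (R (e i) \<bullet> e m) * (R (e i) \<bullet> e l) * exp (- ((lam m + lam l) * (T - s))) \<partial>restrict_space lborel {0..T})"
    proof (rule Bochner_Integration.integral_cong[OF refl])
      fix s assume "s \<in> space (restrict_space lborel {0..T})"
      then have s: "s \<in> {0..T}" by (simp add: space_restrict_space)
      have "exp (- (lam m * (T - s))) * exp (- (lam l * (T - s))) = exp (- ((lam m + lam l) * (T - s)))"
        by (simp add: exp_add[symmetric] algebra_simps)
      then show "(\<Phi> s (e i) \<bullet> e m) * (\<Phi> s (e i) \<bullet> e l) =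
          (R (e i) \<bullet> e m) * (R (e i) \<bullet> e l) * exp (- ((lam m + lam l) * (T - s)))"
        using s by (simp add: \<Phi> expA_coeff)
    qed
    also have "\<dots> = (R (e i) \<bullet> e m) * (R (e i) \<bullet> e l) * ?E m l"
      using exp_integral_time[OF T, of "lam m + lam l"] lam_pos[of m] lam_pos[of l] by simp
    finally show ?thesis .
  qed
  have sym: "R (e m) \<bullet> e i = R (e i) \<bullet> e m" for m i
    using R_sym[of "e m" "e i"] inner_commute[of "e m" "R (e i)"] by simp
  have lim: "(\<lambda>I. \<Sum>i<I. (R (e i) \<bullet> e m) * (R (e i) \<bullet> e l)) \<longlonglongrightarrow> R (e m) \<bullet> R (e l)" for m l
    using parseval_inner[of "R (e m)" "R (e l)"] unfolding sums_def sym[of m] sym[of l] .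
  have ev1: "\<forall>\<^sub>F I in sequentially. (\<integral>\<^sup>+ \<omega>. ennreal (norm ((\<Sum>i<I. V i \<omega>) - Z \<omega>)) \<partial>M) \<le> ennreal (\<delta> / 2)"
    using VZ \<delta> unfolding sums_L2_def by (intro tendsto_L2_eventually(1)[OF finite_measure_axioms]) auto
  have ev2: "\<forall>\<^sub>F I in sequentially. \<forall>m\<in>{..<N}. \<forall>l\<in>{..<N}.
      dist (\<Sum>i<I. (R (e i) \<bullet> e m) * (R (e i) \<bullet> e l)) (R (e m) \<bullet> R (e l)) < \<delta>"
    using \<delta> by (intro eventually_ball_finite ballI tendstoD[OF lim]) auto
  obtain I where I1: "(\<integral>\<^sup>+ \<omega>. ennreal (norm ((\<Sum>i<I. V i \<omega>) - Z \<omega>)) \<partial>M) \<le> ennreal (\<delta> / 2)"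
    and I2: "\<And>m l. m < N \<Longrightarrow> l < N \<Longrightarrow> \<bar>(\<Sum>i<I. (R (e i) \<bullet> e m) * (R (e i) \<bullet> e l)) - R (e m) \<bullet> R (e l)\<bar> < \<delta>"
    using eventually_happens'[OF _ eventually_conj[OF ev1 ev2]] by (auto simp: dist_real_def)
  \<comment> \<open>The remaining half of \<open>\<delta>\<close> is shared by the \<open>I\<close>
    step integrals; \<open>I + 1\<close> covers the empty sum.\<close>
  define \<delta>' where "\<delta>' = \<delta> / (2 * (real I + 1))"
  have \<delta>': "0 < \<delta>'" "real I * \<delta>' \<le> \<delta> / 2"
  proof -
    show "0 < \<delta>'" using \<delta> by (simp add: \<delta>'_def)
    then have "real I * \<delta>' \<le> (real I + 1) * \<delta>'" by (intro mult_right_mono) auto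
    also have "\<dots> = \<delta> / 2" by (simp add: \<delta>'_def field_simps)
    finally show "real I * \<delta>' \<le> \<delta> / 2" .
  qed
  define good where "good = (\<lambda>i k. (\<integral>\<^sup>+ \<omega>. ennreal (norm (step_integral (B i) (nn i k) (pp i k) (cc i k) \<omega> - V i \<omega>)) \<partial>M) \<le> ennreal \<delta>' \<and>
     (\<forall>m\<in>{..<N}. \<forall>l\<in>{..<N}. \<bar>(\<Sum>j<nn i k. (pp i k (Suc j) - pp i k j) * ((cc i k j \<bullet> e m) * (cc i k j \<bullet> e l)))
       - (\<integral>s. (\<Phi> s (e i) \<bullet> e m) * (\<Phi> s (e i) \<bullet> e l) \<partial>restrict_space lborel {0..T})\<bar> \<le> \<delta>'))"
  have exk: "\<exists>k. good i k" for i
  proof -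
    have evB: "\<forall>\<^sub>F k in sequentially. \<bar>(\<Sum>j<nn i k. (pp i k (Suc j) - pp i k j) * ((cc i k j \<bullet> e m) * (cc i k j \<bullet> e l)))
       - (\<integral>s. (\<Phi> s (e i) \<bullet> e m) * (\<Phi> s (e i) \<bullet> e l) \<partial>restrict_space lborel {0..T})\<bar> \<le> \<delta>'" for m l
    proof (rule step_covariance_eventually[OF T P Lf])
      show "norm (\<Phi> s (e i)) \<le> norm (R (e i)) + 1" if "s \<in> {0..T}" for s
        using norm_expA[of "T - s" "R (e i)"] that by (simp add: \<Phi>)
      show "0 < norm (R (e i)) + 1" by (rule add_nonneg_pos) auto
    qed (use \<delta>' in auto)
    have evA: "\<forall>\<^sub>F k in sequentially. (\<integral>\<^sup>+ \<omega>. ennreal (norm (step_integral (B i) (nn i k) (pp i k) (cc i k) \<omega> - V i \<omega>)) \<partial>M) \<le> ennreal \<delta>'"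
      by (rule tendsto_L2_eventually(1)[OF finite_measure_axioms LV \<delta>'(1)])
    have "\<forall>\<^sub>F k in sequentially. \<forall>m\<in>{..<N}. \<forall>l\<in>{..<N}. \<bar>(\<Sum>j<nn i k. (pp i k (Suc j) - pp i k j) * ((cc i k j \<bullet> e m) * (cc i k j \<bullet> e l)))
       - (\<integral>s. (\<Phi> s (e i) \<bullet> e m) * (\<Phi> s (e i) \<bullet> e l) \<partial>restrict_space lborel {0..T})\<bar> \<le> \<delta>'"
      by (rule eventually_ball_finite[OF finite_lessThan], rule ballI, rule eventually_ball_finite[OF finite_lessThan],
          rule ballI, rule evB)
    from eventually_happens'[OF sequentially_bot eventually_conj[OF evA this]] show ?thesis unfolding good_def .
  qed
  then obtain kk where "\<And>i. good i (kk i)" by metis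
  note kk = this[unfolded good_def cov]
  have k1: "\<And>i. (\<integral>\<^sup>+ \<omega>. ennreal (norm (step_integral (B i) (nn i (kk i)) (pp i (kk i)) (cc i (kk i)) \<omega> - V i \<omega>)) \<partial>M) \<le> ennreal \<delta>'"
    and k2: "\<And>i m l. m < N \<Longrightarrow> l < N \<Longrightarrow> \<bar>(\<Sum>j<nn i (kk i). (pp i (kk i) (Suc j) - pp i (kk i) j) * ((cc i (kk i) j \<bullet> e m) * (cc i (kk i) j \<bullet> e l)))
       - (R (e i) \<bullet> e m) * (R (e i) \<bullet> e l) * ?E m l\<bar> \<le> \<delta>'"
    using kk by (simp_all only: lessThan_iff Ball_def)
  let ?G = "\<lambda>i. step_integral (B i) (nn i (kk i)) (pp i (kk i)) (cc i (kk i))"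
  have [measurable]: "V i \<in> borel_measurable M" "?G i \<in> borel_measurable M" "Z \<in> borel_measurable M" for i
    using LV[of i] VZ by (auto simp: tendsto_L2_def sums_L2_def)
  show ?thesis
  proof (intro exI conjI allI impI)
    show "partition_points T (nn i (kk i)) (pp i (kk i))" for i by (rule P)
    have "(\<integral>\<^sup>+ \<omega>. ennreal (norm (Z \<omega> - (\<Sum>i<I. ?G i \<omega>))) \<partial>M) \<le>
        (\<integral>\<^sup>+ \<omega>. ennreal (norm ((\<Sum>i<I. V i \<omega>) - Z \<omega>)) + (\<Sum>i<I. ennreal (norm (?G i \<omega> - V i \<omega>))) \<partial>M)"
    proof (intro nn_integral_mono)
      fix \<omega>
      have "norm (Z \<omega> - (\<Sum>i<I. ?G i \<omega>)) = norm (((\<Sum>i<I. V i \<omega>) - Z \<omega>) + (\<Sum>i<I. ?G i \<omega> - V i \<omega>))"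
        by (subst norm_minus_commute) (simp add: sum_subtractf)
      also have "\<dots> \<le> norm ((\<Sum>i<I. V i \<omega>) - Z \<omega>) + (\<Sum>i<I. norm (?G i \<omega> - V i \<omega>))"
        by (intro order_trans[OF norm_triangle_ineq] add_left_mono norm_sum)
      finally show "ennreal (norm (Z \<omega> - (\<Sum>i<I. ?G i \<omega>))) \<le>
          ennreal (norm ((\<Sum>i<I. V i \<omega>) - Z \<omega>)) + (\<Sum>i<I. ennreal (norm (?G i \<omega> - V i \<omega>)))"
        by (simp add: sum_ennreal ennreal_plus[symmetric] ennreal_leI sum_nonneg del: ennreal_plus)
    qed
    also have "\<dots> = (\<integral>\<^sup>+ \<omega>. ennreal (norm ((\<Sum>i<I. V i \<omega>) - Z \<omega>)) \<partial>M) + (\<Sum>i<I. \<integral>\<^sup>+ \<omega>. ennreal (norm (?G i \<omega> - V i \<omega>)) \<partial>M)"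
    proof -
      have "(\<integral>\<^sup>+ \<omega>. (\<Sum>i<I. ennreal (norm (?G i \<omega> - V i \<omega>))) \<partial>M) = (\<Sum>i<I. \<integral>\<^sup>+ \<omega>. ennreal (norm (?G i \<omega> - V i \<omega>)) \<partial>M)"
        by (rule nn_integral_sum) measurable
      note * = this
      show ?thesis unfolding *[symmetric] by (rule nn_integral_add) measurable
    qed
    also have "\<dots> \<le> ennreal (\<delta> / 2) + (\<Sum>i<I. ennreal \<delta>')"
      by (intro add_mono I1 sum_mono k1)
    also have "\<dots> = ennreal (\<delta> / 2 + real I * \<delta>')"
      using \<delta> \<delta>' by (simp add: ennreal_of_nat_eq_real_of_nat ennreal_mult' ennreal_plus)
    also have "\<dots> \<le> ennreal \<delta>" using \<delta>' by (intro ennreal_leI) simp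
    finally show "(\<integral>\<^sup>+ \<omega>. ennreal (norm (Z \<omega> - (\<Sum>i<I. ?G i \<omega>))) \<partial>M) \<le> ennreal \<delta>" .
    fix m l assume ml: "m < N" "l < N"
    have E0: "0 \<le> ?E m l" "?E m l \<le> 1 / lam 0"
    proof -
      have s: "0 < lam m + lam l" "lam 0 \<le> lam m + lam l"
        using lam_pos[of m] lam_pos[of l] monoD[OF mono_lam, of 0 m] by auto
      have "exp (- ((lam m + lam l) * T)) \<le> 1" using s T by simp
      then show "0 \<le> ?E m l" using s by simp
      have "?E m l \<le> 1 / (lam m + lam l)" using s by (intro divide_right_mono) auto
      also have "\<dots> \<le> 1 / lam 0" using s lam0 by (intro frac_le) auto
      finally show "?E m l \<le> 1 / lam 0" .
    qed
    let ?s = "\<lambda>i. (\<Sum>j<nn i (kk i). (pp i (kk i) (Suc j) - pp i (kk i) j) * ((cc i (kk i) j \<bullet> e m) * (cc i (kk i) j \<bullet> e l)))"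
    let ?r = "\<lambda>i. (R (e i) \<bullet> e m) * (R (e i) \<bullet> e l)"
    have "(\<Sum>i<I. ?s i) - (R (e m) \<bullet> R (e l)) * ?E m l =
       (\<Sum>i<I. ?s i - ?r i * ?E m l) + ((\<Sum>i<I. ?r i) - R (e m) \<bullet> R (e l)) * ?E m l"
    proof -
      have "S - r * E = (S - Y * E) + (Y - r) * E" for S r Y E :: real by (simp add: algebra_simps)
      moreover have "(\<Sum>i<I. ?s i - ?r i * ?E m l) = (\<Sum>i<I. ?s i) - (\<Sum>i<I. ?r i) * ?E m l"
        by (simp only: sum_subtractf sum_distrib_right)
      ultimately show ?thesis by (simp only:)
    qed
    also have "\<bar>\<dots>\<bar> \<le> (\<Sum>i<I. \<delta>') + \<delta> * (1 / lam 0)"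
    proof (rule order_trans[OF abs_triangle_ineq add_mono])
      show "\<bar>\<Sum>i<I. ?s i - ?r i * ?E m l\<bar> \<le> (\<Sum>i<I. \<delta>')"
        by (intro order_trans[OF sum_abs] sum_mono k2 ml)
      show "\<bar>((\<Sum>i<I. ?r i) - R (e m) \<bullet> R (e l)) * ?E m l\<bar> \<le> \<delta> * (1 / lam 0)"
        unfolding abs_mult abs_of_nonneg[OF E0(1)]
        by (intro mult_mono E0 less_imp_le[OF I2[OF ml]] less_imp_le[OF \<delta>])
    qed
    also have "\<dots> \<le> (1 / lam 0 + 1) * \<delta>" using \<delta>' \<delta> by (simp add: algebra_simps)
    finally show "\<bar>(\<Sum>i<I. ?s i) - (R (e m) \<bullet> R (e l)) * ?E m l\<bar> \<le> (1 / lam 0 + 1) * \<delta>" .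
  qed
qed

lemma sum_swap3: "(\<Sum>j\<in>A. \<Sum>m\<in>B. \<Sum>l\<in>C. x j m l) = (\<Sum>m\<in>B. \<Sum>l\<in>C. \<Sum>j\<in>A. x j m l)"
  by (subst sum.swap, rule sum.cong[OF refl], rule sum.swap)

lemma step_integral_gauss:
  fixes M :: "'w measure" and c :: "nat \<Rightarrow> nat \<Rightarrow> 'h"
  assumes M: "prob_space M" and BM: "cylindrical_wiener M T F B"
    and p: "\<And>i. partition_points T (n i) (p i)"
  shows "(\<Sum>(i, j)\<in>increments_index I n p. (B i (p i (Suc j)) \<omega> - B i (p i j) \<omega>) *\<^sub>R c i j) =
    (\<Sum>i<I. step_integral (B i) (n i) (p i) (c i) \<omega>)"
    and "(\<Sum>(i, j)\<in>increments_index I n p. (sqrt (p i (Suc j) - p i j))\<^sup>2 * x i j) =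
    (\<Sum>i<I. \<Sum>j<n i. (p i (Suc j) - p i j) * x i j)"
    and "integrable M (\<lambda>\<omega>. \<Sum>i<I. step_integral (B i) (n i) (p i) (c i) \<omega>)"
proof -
  show 1: "(\<Sum>(i, j)\<in>increments_index I n p. (B i (p i (Suc j)) \<omega> - B i (p i j) \<omega>) *\<^sub>R c i j) =
    (\<Sum>i<I. step_integral (B i) (n i) (p i) (c i) \<omega>)" for \<omega>
    unfolding step_integral_def by (rule sum_increments_index[where T=T]) (use p in auto)
  have "(\<Sum>(i, j)\<in>increments_index I n p. (sqrt (p i (Suc j) - p i j))\<^sup>2 * x i j) =
      (\<Sum>(i, j)\<in>increments_index I n p. (p i (Suc j) - p i j) * x i j)"
    by (intro sum.cong refl) (auto simp: increments_index_def)
  also have "\<dots> = (\<Sum>i<I. \<Sum>j<n i. (p i (Suc j) - p i j) * x i j)"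
    by (rule sum_increments_index[where T=T]) (use p in auto)
  finally show "(\<Sum>(i, j)\<in>increments_index I n p. (sqrt (p i (Suc j) - p i j))\<^sup>2 * x i j) =
    (\<Sum>i<I. \<Sum>j<n i. (p i (Suc j) - p i j) * x i j)" .
  have "integrable M (\<lambda>\<omega>. \<Sum>(i, j)\<in>increments_index I n p. (B i (p i (Suc j)) \<omega> - B i (p i j) \<omega>) *\<^sub>R c i j)"
  proof -
    have gf: "gauss_family M (increments_index I n p) (\<lambda>(i, j) \<omega>. B i (p i (Suc j)) \<omega> - B i (p i j) \<omega>)
        (\<lambda>(i, j). sqrt (p i (Suc j) - p i j))"
      by (rule wiener_gauss_family[OF M BM p])
    show ?thesis
      using gauss_family_norm_integrable[OF M gf, of "\<lambda>(i, j). c i j"]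
      by (simp add: integrable_norm_iff case_prod_beta')
  qed
  then show "integrable M (\<lambda>\<omega>. \<Sum>i<I. step_integral (B i) (n i) (p i) (c i) \<omega>)" unfolding 1 .
qed

text \<open>The projection on \<open>N\<close> modes is what makes the covariance estimate uniform
  over forms: only \<open>N\<close> times \<open>N\<close> entries matter, each weighted by
  \<open>b (e m) (e l)\<close>, at most \<open>K\<close> in modulus. The whole variable is recovered
  in the expectation by \<open>expectation_truncation\<close>.\<close>

lemma exact_gauss_limit:
  fixes M :: "'w measure" and Z :: "'w \<Rightarrow> 'h"
  assumes M: "prob_space M" and BM: "cylindrical_wiener M T F B" and T: "0 \<le> T"
    and st: "has_stoch_integral M e B T \<Phi> Z"
    and \<Phi>: "\<forall>s\<in>{0..T}. \<forall>v. \<Phi> s v = expA (T - s) (R v)"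
  shows "integrable M Z"
    and "gauss_limit M (\<lambda>\<omega>. \<Sum>n<N. (Z \<omega> \<bullet> e n) *\<^sub>R e n) (kernel_form {..<N}
      (\<lambda>j k. (R (e j) \<bullet> R (e k)) * ((1 - exp (- ((lam j + lam k) * T))) / (lam j + lam k))) e)"
proof -
  interpret prob_space M by (rule M)
  have Zm[measurable]: "Z \<in> borel_measurable M"
    using st by (auto simp: has_stoch_integral_def sums_L2_def tendsto_L2_def)
  show "integrable M Z"
  proof -
    obtain I n p and c :: "nat \<Rightarrow> nat \<Rightarrow> 'h" where p: "\<And>i. partition_points T (n i) (p i)"
      and le: "(\<integral>\<^sup>+ \<omega>. ennreal (norm (Z \<omega> - (\<Sum>i<I. step_integral (B i) (n i) (p i) (c i) \<omega>))) \<partial>M) \<le> ennreal 1"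
      using exact_approximation[OF M BM T st \<Phi> zero_less_one, of 0] by (elim exE conjE) (rule that, erule spec)
    have i: "integrable M (\<lambda>\<omega>. \<Sum>i<I. step_integral (B i) (n i) (p i) (c i) \<omega>)" by (rule step_integral_gauss(3)[OF M BM p])
    have "integrable M (\<lambda>\<omega>. Z \<omega> - (\<Sum>i<I. step_integral (B i) (n i) (p i) (c i) \<omega>))"
      by (rule nn_integral_norm_le_imp_integrable(1)[OF _ le]) (use i in auto)
    from Bochner_Integration.integrable_add[OF this i] show ?thesis by simp
  qed
  define \<pi> where "\<pi> = (\<lambda>v. \<Sum>n<N. (v \<bullet> e n) *\<^sub>R e n)"
  have \<pi>_eq: "(\<Sum>n<N. (v \<bullet> e n) *\<^sub>R e n) = \<pi> v" for v by (simp add: \<pi>_def)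
  have \<pi>_lin: "linear \<pi>"
    unfolding \<pi>_def by (intro linearI) (simp_all add: inner_add_left scaleR_add_left sum.distrib scaleR_sum_right)
  have \<pi>_norm: "norm (\<pi> v) \<le> norm v" for v
    using bessel[of "{..<N}" v] norm_sum_e[of "{..<N}" "\<lambda>n. v \<bullet> e n"]
    by (intro power2_le_imp_le[OF _ norm_ge_zero]) (simp add: \<pi>_def)
  show "gauss_limit M (\<lambda>\<omega>. \<Sum>n<N. (Z \<omega> \<bullet> e n) *\<^sub>R e n) (kernel_form {..<N}
      (\<lambda>j k. (R (e j) \<bullet> R (e k)) * ((1 - exp (- ((lam j + lam k) * T))) / (lam j + lam k))) e)"
    unfolding gauss_limit_def \<pi>_eq
  proof (intro conjI allI impI)
    show "(\<lambda>\<omega>. \<pi> (Z \<omega>)) \<in> borel_measurable M" unfolding \<pi>_def by measurable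
    fix \<epsilon> :: real assume \<epsilon>: "0 < \<epsilon>"
    \<comment> \<open>Number of matrix entries times the error factor of
      \<open>exact_approximation\<close>; the additional 1 ensures \<open>?A \<ge> 1\<close>, so
      that \<open>\<delta> \<le> \<epsilon>\<close> as well.\<close>
    let ?A = "(real N * real N + 1) * (1 / lam 0 + 1)"
    define \<delta> where "\<delta> = \<epsilon> / ?A"
    have L: "1 \<le> 1 / lam 0 + 1" using lam0 by simp
    have "1 * 1 \<le> ?A" using L by (intro mult_mono) auto
    then have A: "1 \<le> ?A" by simp
    have \<delta>: "0 < \<delta>" "\<delta> \<le> \<epsilon>"
    proof -
      show "0 < \<delta>" unfolding \<delta>_def using \<epsilon> A by (intro divide_pos_pos) linarith+
      have "\<epsilon> / ?A \<le> \<epsilon> / 1" using \<epsilon> A by (intro divide_left_mono) auto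
      then show "\<delta> \<le> \<epsilon>" by (simp add: \<delta>_def)
    qed
    have \<delta>A: "real N * real N * ((1 / lam 0 + 1) * \<delta>) \<le> \<epsilon>"
    proof -
      have "real N * real N * ((1 / lam 0 + 1) * \<delta>) \<le> (real N * real N + 1) * ((1 / lam 0 + 1) * \<delta>)"
        using \<delta> L by (intro mult_right_mono mult_nonneg_nonneg) auto
      also have "\<dots> = ?A * \<delta>" by simp
      also have "\<dots> = \<epsilon>"
      proof -
        have "?A \<noteq> 0" using A by linarith
        then show ?thesis unfolding \<delta>_def times_divide_eq_right by (rule nonzero_mult_div_cancel_left)
      qed
      finally show ?thesis .
    qed
    obtain I n p and c :: "nat \<Rightarrow> nat \<Rightarrow> 'h" where p: "\<And>i. partition_points T (n i) (p i)"
      and le: "(\<integral>\<^sup>+ \<omega>. ennreal (norm (Z \<omega> - (\<Sum>i<I. step_integral (B i) (n i) (p i) (c i) \<omega>))) \<partial>M) \<le> ennreal \<delta>"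
      and cov: "\<And>m l. m < N \<Longrightarrow> l < N \<Longrightarrow> \<bar>(\<Sum>i<I. \<Sum>j<n i. (p i (Suc j) - p i j) * ((c i j \<bullet> e m) * (c i j \<bullet> e l)))
       - (R (e m) \<bullet> R (e l)) * ((1 - exp (- ((lam m + lam l) * T))) / (lam m + lam l))\<bar> \<le> (1 / lam 0 + 1) * \<delta>"
      using exact_approximation[OF M BM T st \<Phi> \<delta>(1), of N]
      by (elim exE conjE) (rule that, erule spec, assumption, blast)
    let ?J = "increments_index I n p"
    let ?g = "\<lambda>(i, j). \<pi> (c i j)"
    let ?\<zeta> = "\<lambda>(i, j) \<omega>. B i (p i (Suc j)) \<omega> - B i (p i j) \<omega>"
    let ?\<sigma> = "\<lambda>(i, j). sqrt (p i (Suc j) - p i j)"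
    show "\<exists>(J :: (nat \<times> nat) set) \<zeta> \<sigma> g. gauss_family M J \<zeta> \<sigma> \<and>
        (\<integral>\<^sup>+ \<omega>. ennreal (norm (\<pi> (Z \<omega>) - (\<Sum>j\<in>J. \<zeta> j \<omega> *\<^sub>R g j))) \<partial>M) \<le> ennreal \<epsilon> \<and>
        (\<forall>K b. bform K b \<longrightarrow> \<bar>kernel_form {..<N}
          (\<lambda>j k. (R (e j) \<bullet> R (e k)) * ((1 - exp (- ((lam j + lam k) * T))) / (lam j + lam k))) e b
          - (\<Sum>j\<in>J. (\<sigma> j)\<^sup>2 * b (g j) (g j))\<bar> \<le> \<epsilon> * K)"
    proof (intro exI conjI allI impI)
      show "gauss_family M ?J ?\<zeta> ?\<sigma>" by (rule wiener_gauss_family[OF M BM p])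
      have eq: "(\<Sum>j\<in>?J. ?\<zeta> j \<omega> *\<^sub>R ?g j) = \<pi> (\<Sum>i<I. step_integral (B i) (n i) (p i) (c i) \<omega>)" for \<omega>
      proof -
        have "(\<Sum>j\<in>?J. ?\<zeta> j \<omega> *\<^sub>R ?g j) = (\<Sum>(i, j)\<in>?J. \<pi> ((B i (p i (Suc j)) \<omega> - B i (p i j) \<omega>) *\<^sub>R c i j))"
          by (intro sum.cong refl) (auto simp: linear_scale[OF \<pi>_lin])
        also have "\<dots> = \<pi> (\<Sum>(i, j)\<in>?J. (B i (p i (Suc j)) \<omega> - B i (p i j) \<omega>) *\<^sub>R c i j)"
          by (simp add: linear_sum[OF \<pi>_lin] case_prod_beta')
        finally show ?thesis unfolding step_integral_gauss(1)[OF M BM p] .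
      qed
      have "(\<integral>\<^sup>+ \<omega>. ennreal (norm (\<pi> (Z \<omega>) - (\<Sum>j\<in>?J. ?\<zeta> j \<omega> *\<^sub>R ?g j))) \<partial>M) \<le>
          (\<integral>\<^sup>+ \<omega>. ennreal (norm (Z \<omega> - (\<Sum>i<I. step_integral (B i) (n i) (p i) (c i) \<omega>))) \<partial>M)"
        unfolding eq linear_diff[OF \<pi>_lin, symmetric] by (intro nn_integral_mono ennreal_leI \<pi>_norm)
      also have "\<dots> \<le> ennreal \<epsilon>" using le \<delta>(2) by (meson ennreal_leI order_trans)
      finally show "(\<integral>\<^sup>+ \<omega>. ennreal (norm (\<pi> (Z \<omega>) - (\<Sum>j\<in>?J. ?\<zeta> j \<omega> *\<^sub>R ?g j))) \<partial>M) \<le> ennreal \<epsilon>" .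
      fix K and b :: "'h \<Rightarrow> 'h \<Rightarrow> real" assume b: "bform K b"
      interpret b: bounded_bilinear b by (rule bformD(1)[OF b])
      have K: "0 \<le> K" by (rule bform_nonneg[OF b])
      have be: "\<bar>b (e m) (e l)\<bar> \<le> K" for m l using bformD(2)[OF b, of "e m" "e l"] by simp
      have "b (\<pi> v) (\<pi> v) = (\<Sum>m<N. \<Sum>l<N. ((v \<bullet> e m) * (v \<bullet> e l)) * b (e m) (e l))" for v
        unfolding \<pi>_def by (subst b.sum_left, intro sum.cong refl, subst b.sum_right)
          (simp add: b.scaleR_left b.scaleR_right sum_distrib_left mult_ac)
      note b\<pi> = this
      let ?s = "\<lambda>m l. \<Sum>i<I. \<Sum>j<n i. (p i (Suc j) - p i j) * ((c i j \<bullet> e m) * (c i j \<bullet> e l))"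
      have "(\<Sum>j\<in>?J. (?\<sigma> j)\<^sup>2 * b (?g j) (?g j)) = (\<Sum>(i, j)\<in>?J. (sqrt (p i (Suc j) - p i j))\<^sup>2 * b (\<pi> (c i j)) (\<pi> (c i j)))"
        by (intro sum.cong refl) auto
      also have "\<dots> = (\<Sum>i<I. \<Sum>j<n i. (p i (Suc j) - p i j) * b (\<pi> (c i j)) (\<pi> (c i j)))"
        by (rule step_integral_gauss(2)[OF M BM p])
      also have "\<dots> = (\<Sum>i<I. \<Sum>j<n i. \<Sum>m<N. \<Sum>l<N. (p i (Suc j) - p i j) * ((c i j \<bullet> e m) * (c i j \<bullet> e l)) * b (e m) (e l))"
        unfolding b\<pi> sum_distrib_left by (intro sum.cong refl) (simp add: mult.assoc)
      also have "\<dots> = (\<Sum>i<I. \<Sum>m<N. \<Sum>l<N. \<Sum>j<n i. (p i (Suc j) - p i j) * ((c i j \<bullet> e m) * (c i j \<bullet> e l)) * b (e m) (e l))"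
        by (rule sum.cong[OF refl], rule sum_swap3)
      also have "\<dots> = (\<Sum>m<N. \<Sum>l<N. \<Sum>i<I. \<Sum>j<n i. (p i (Suc j) - p i j) * ((c i j \<bullet> e m) * (c i j \<bullet> e l)) * b (e m) (e l))"
        by (rule sum_swap3)
      also have "\<dots> = (\<Sum>m<N. \<Sum>l<N. ?s m l * b (e m) (e l))"
        by (simp add: sum_distrib_right)
      finally have s: "(\<Sum>j\<in>?J. (?\<sigma> j)\<^sup>2 * b (?g j) (?g j)) = (\<Sum>m<N. \<Sum>l<N. ?s m l * b (e m) (e l))" .
      let ?x = "\<lambda>m l. (R (e m) \<bullet> R (e l)) * ((1 - exp (- ((lam m + lam l) * T))) / (lam m + lam l))"
      have eq': "kernel_form {..<N} ?x e b - (\<Sum>j\<in>?J. (?\<sigma> j)\<^sup>2 * b (?g j) (?g j)) = (\<Sum>m<N. \<Sum>l<N. (?x m l - ?s m l) * b (e m) (e l))"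
        unfolding s kernel_form_def by (simp only: sum_subtractf left_diff_distrib)
      have "\<bar>\<Sum>m<N. \<Sum>l<N. (?x m l - ?s m l) * b (e m) (e l)\<bar> \<le> (\<Sum>m<N. \<Sum>l<N. ((1 / lam 0 + 1) * \<delta>) * K)"
      proof (rule order_trans[OF sum_abs], rule sum_mono)
        fix m assume m: "m \<in> {..<N}"
        show "\<bar>\<Sum>l<N. (?x m l - ?s m l) * b (e m) (e l)\<bar> \<le> (\<Sum>l<N. ((1 / lam 0 + 1) * \<delta>) * K)"
        proof (rule order_trans[OF sum_abs], rule sum_mono)
          fix l assume l: "l \<in> {..<N}"
          have "\<bar>?x m l - ?s m l\<bar> \<le> (1 / lam 0 + 1) * \<delta>"
            using cov[of m l] m l by (simp only: abs_minus_commute lessThan_iff)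
          then show "\<bar>(?x m l - ?s m l) * b (e m) (e l)\<bar> \<le> ((1 / lam 0 + 1) * \<delta>) * K"
            unfolding abs_mult using be[of m l] K by (intro mult_mono) (auto intro: order_trans)
        qed
      qed
      also have "\<dots> = real N * real N * ((1 / lam 0 + 1) * \<delta>) * K"
        by (simp only: sum_constant card_lessThan mult.assoc)
      also have "\<dots> \<le> \<epsilon> * K" by (rule mult_right_mono[OF \<delta>A K])
      finally have "\<bar>\<Sum>m<N. \<Sum>l<N. (?x m l - ?s m l) * b (e m) (e l)\<bar> \<le> \<epsilon> * K" .
      then show "\<bar>kernel_form {..<N} ?x e b - (\<Sum>j\<in>?J. (?\<sigma> j)\<^sup>2 * b (?g j) (?g j))\<bar> \<le> \<epsilon> * K" unfolding eq' .
    qed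
  qed
qed

end

section \<open>The semigroup in the eigenbasis\<close>

context spectral_basis
begin

text \<open>A sequence that nearly satisfies \<open>w (Suc j) = q *\<^sub>R w j\<close> grows at
  most like \<open>(1 + c) ^ j\<close>, below \<open>exp (j * c)\<close>. Telescoping then adds up
  \<open>N\<close> errors of size \<open>c\<close> times that growth.\<close>

lemma contraction_iteration:
  fixes w :: "nat \<Rightarrow> 'h"
  assumes w0: "norm (w 0) \<le> 1" and q: "0 \<le> q" "q \<le> 1" and c: "0 \<le> c"
    and step: "\<And>j. norm (w (Suc j) - q *\<^sub>R w j) \<le> c * norm (w j)"
  shows "norm (w N - q ^ N *\<^sub>R w 0) \<le> real N * c * exp (real N * c)"
proof -
  have n: "norm (w j) \<le> exp (real j * c)" for j
  proof (induction j)
    case (Suc j)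
    have "norm (w (Suc j)) \<le> norm (w (Suc j) - q *\<^sub>R w j) + norm (q *\<^sub>R w j)"
      using norm_triangle_sub[of "w (Suc j)" "q *\<^sub>R w j"] by (simp add: add.commute)
    also have "\<dots> \<le> c * norm (w j) + 1 * norm (w j)"
      using step[of j] q by (intro add_mono) (auto intro: mult_left_le_one_le)
    also have "\<dots> = (1 + c) * norm (w j)" by (simp add: algebra_simps)
    also have "\<dots> \<le> exp c * exp (real j * c)"
      using Suc c exp_ge_add_one_self[of c] by (intro mult_mono) auto
    finally show ?case by (simp add: exp_add[symmetric] algebra_simps)
  qed (use w0 in simp)
  have "norm (w k - q ^ k *\<^sub>R w 0) \<le> real k * (c * exp (real N * c))" if "k \<le> N" for k
    using that
  proof (induction k)
    case (Suc k)
    have "w (Suc k) - q ^ Suc k *\<^sub>R w 0 = (w (Suc k) - q *\<^sub>R w k) + q *\<^sub>R (w k - q ^ k *\<^sub>R w 0)"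
      by (simp add: scaleR_diff_right)
    then have "norm (w (Suc k) - q ^ Suc k *\<^sub>R w 0) \<le> norm (w (Suc k) - q *\<^sub>R w k) + norm (q *\<^sub>R (w k - q ^ k *\<^sub>R w 0))"
      using norm_triangle_ineq by metis
    also have "\<dots> \<le> c * exp (real N * c) + 1 * (real k * (c * exp (real N * c)))"
    proof (rule add_mono)
      have "exp (real k * c) \<le> exp (real N * c)" using Suc.prems c by (simp add: mult_right_mono)
      then have "norm (w k) \<le> exp (real N * c)" by (rule order_trans[OF n])
      then have "c * norm (w k) \<le> c * exp (real N * c)" using c by (rule mult_left_mono)
      then show "norm (w (Suc k) - q *\<^sub>R w k) \<le> c * exp (real N * c)" using step[of k] by linarith
      have "\<bar>q\<bar> * norm (w k - q ^ k *\<^sub>R w 0) \<le> 1 * (real k * (c * exp (real N * c)))"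
        using Suc q by (intro mult_mono) auto
      then show "norm (q *\<^sub>R (w k - q ^ k *\<^sub>R w 0)) \<le> 1 * (real k * (c * exp (real N * c)))" by simp
    qed
    finally show ?case by (simp add: algebra_simps)
  qed simp
  from this[of N] show ?thesis by (simp add: mult.assoc)
qed

text \<open>\<open>S t (e n)\<close> is an eigenvector of \<open>A\<close>, so it stays in the finite-dimensional eigenspace of
  \<open>lam n\<close>. There the semigroup is locally bounded without an appeal to the uniform boundedness
  principle, and a telescoping argument identifies it.\<close>

lemma semigroup_eigenvector:
  assumes gen: "generates D (\<lambda>v. - A v) S" and sa: "self_adjoint_op D A"
    and eigen: "\<And>n. e n \<in> D \<and> A (e n) = lam n *\<^sub>R e n"
    and lim: "filterlim lam at_top sequentially" and t: "0 \<le> t"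
  shows "S t (e n) = exp (- (lam n * t)) *\<^sub>R e n"
proof -
  have bl: "bounded_linear (S s)" if "0 \<le> s" for s using gen that by (auto simp: generates_def C0_semigroup_def)
  have S0: "S 0 v = v" for v using gen by (auto simp: generates_def C0_semigroup_def)
  have Sadd: "S (a + b) v = S a (S b v)" if "0 \<le> a" "0 \<le> b" for a b v
    using gen that by (auto simp: generates_def C0_semigroup_def)
  have G: "(v \<in> D \<and> w = - A v) \<longleftrightarrow> ((\<lambda>t. (S t v - v) /\<^sub>R t) \<longlongrightarrow> w) (at_right 0)" for v w
    using gen by (auto simp: generates_def)
  define K where "K = {k. lam k = lam n}"
  \<comment> \<open>Since \<open>lam\<close> tends to infinity, each eigenvalue has finite
    multiplicity.\<close>
  have Kf: "finite K"
  proof -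
    obtain N where N: "\<And>k. k \<ge> N \<Longrightarrow> lam n + 1 \<le> lam k"
      using lim unfolding filterlim_at_top eventually_sequentially by blast
    have "k < N" if "k \<in> K" for k
    proof (rule ccontr)
      assume "\<not> k < N"
      then show False using N[of k] that by (simp add: K_def)
    qed
    then have "K \<subseteq> {..<N}" by auto
    then show ?thesis by (rule finite_subset) simp
  qed
  have de: "((\<lambda>s. (S s (e k) - e k) /\<^sub>R s) \<longlongrightarrow> - (lam k *\<^sub>R e k)) (at_right 0)" for k
    using G[of "e k" "- (lam k *\<^sub>R e k)"] eigen[of k] by simp
  have sym: "A u \<bullet> e k = u \<bullet> A (e k)" if "u \<in> D" for u k
  proof -
    have "(e k, A (e k)) \<in> adjoint_graph D A" using sa eigen[of k] by (auto simp: self_adjoint_op_def)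
    then show ?thesis using that by (auto simp: adjoint_graph_def)
  qed
  \<comment> \<open>\<open>S s\<close> commutes with difference quotients at 0, so
    \<open>S s (e n)\<close> lies in \<open>D\<close> and is an eigenvector for
    \<open>lam n\<close>; symmetry of \<open>A\<close> makes it orthogonal to the other
    eigenspaces.\<close>
  have orth: "S s (e n) \<bullet> e k = 0" if s: "0 \<le> s" and k: "k \<notin> K" for s k
  proof -
    have "((\<lambda>r. S s ((S r (e n) - e n) /\<^sub>R r)) \<longlongrightarrow> S s (- (lam n *\<^sub>R e n))) (at_right 0)"
      by (rule bounded_linear.tendsto[OF bl[OF s] de])
    moreover have "\<forall>\<^sub>F r in at_right 0. S s ((S r (e n) - e n) /\<^sub>R r) = (S r (S s (e n)) - S s (e n)) /\<^sub>R r"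
      unfolding eventually_at_right_field
    proof (intro exI[of _ 1] conjI allI impI)
      fix r :: real assume r: "0 < r"
      have "S s (S r (e n)) = S r (S s (e n))"
        using Sadd[of s r "e n"] Sadd[of r s "e n"] s r by (simp add: add.commute)
      then show "S s ((S r (e n) - e n) /\<^sub>R r) = (S r (S s (e n)) - S s (e n)) /\<^sub>R r"
        using bounded_linear.linear[OF bl[OF s]] by (simp add: linear_scale linear_diff)
    qed simp
    ultimately have "((\<lambda>r. (S r (S s (e n)) - S s (e n)) /\<^sub>R r) \<longlongrightarrow> S s (- (lam n *\<^sub>R e n))) (at_right 0)"
      by (rule Lim_transform_eventually)
    then have "S s (e n) \<in> D \<and> S s (- (lam n *\<^sub>R e n)) = - A (S s (e n))" by (rule iffD2[OF G])
    then have u: "S s (e n) \<in> D" "S s (- (lam n *\<^sub>R e n)) = - A (S s (e n))" by simp_all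
    have "S s (- (lam n *\<^sub>R e n)) = - (lam n *\<^sub>R S s (e n))"
      using bounded_linear.linear[OF bl[OF s]] by (simp add: linear_scale linear_neg)
    then have "A (S s (e n)) = lam n *\<^sub>R S s (e n)" using u(2) by simp
    then have "lam n * (S s (e n) \<bullet> e k) = lam k * (S s (e n) \<bullet> e k)"
      using sym[OF u(1), of k] eigen[of k] by simp
    then show ?thesis using k by (simp add: K_def)
  qed
  have rep: "S s (e n) = (\<Sum>k\<in>K. (S s (e n) \<bullet> e k) *\<^sub>R e k)" if "0 \<le> s" for s
    using orth[OF that] Kf by (intro eq_of_coeff) (simp add: inner_sum_e)
  \<comment> \<open>\<open>S r (e k)\<close> and \<open>exp (- (lam n * r)) *\<^sub>R e k\<close>
    have the same value and the same right derivative at 0, hence differ by \<open>o(r)\<close>,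
    uniformly over the finite set \<open>K\<close>.\<close>
  have small: "\<forall>\<^sub>F r in at_right 0. \<forall>k\<in>K. norm (S r (e k) - exp (- (lam n * r)) *\<^sub>R e k) \<le> \<epsilon> * r" if \<epsilon>: "0 < \<epsilon>" for \<epsilon>
  proof (rule eventually_ball_finite[OF Kf], rule ballI)
    fix k assume "k \<in> K"
    then have lk: "lam k = lam n" by (simp add: K_def)
    have "((\<lambda>r. exp (- (lam n * r))) has_real_derivative - lam n) (at 0)"
      by (auto intro!: derivative_eq_intros)
    then have "((\<lambda>r. exp (- (lam n * r))) has_real_derivative - lam n) (at 0 within {0<..})"
      by (rule has_field_derivative_at_within)
    then have "((\<lambda>r. (exp (- (lam n * r)) - 1) / r) \<longlongrightarrow> - lam n) (at_right 0)"
      by (simp add: has_field_derivative_iff)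
    then have "((\<lambda>r. (S r (e k) - e k) /\<^sub>R r - ((exp (- (lam n * r)) - 1) / r) *\<^sub>R e k) \<longlongrightarrow>
        - (lam k *\<^sub>R e k) - (- lam n) *\<^sub>R e k) (at_right 0)"
      by (intro tendsto_diff de tendsto_scaleR tendsto_const)
    then have "((\<lambda>r. (S r (e k) - e k) /\<^sub>R r - ((exp (- (lam n * r)) - 1) / r) *\<^sub>R e k) \<longlongrightarrow> 0) (at_right 0)"
      by (simp add: lk)
    from tendstoD[OF this \<epsilon>] eventually_at_right_less[of 0]
    show "\<forall>\<^sub>F r in at_right 0. norm (S r (e k) - exp (- (lam n * r)) *\<^sub>R e k) \<le> \<epsilon> * r"
    proof eventually_elim
      fix r :: real assume r: "dist ((S r (e k) - e k) /\<^sub>R r - ((exp (- (lam n * r)) - 1) / r) *\<^sub>R e k) 0 < \<epsilon>" "0 < r"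
      have "(S r (e k) - e k) /\<^sub>R r - ((exp (- (lam n * r)) - 1) / r) *\<^sub>R e k = (S r (e k) - exp (- (lam n * r)) *\<^sub>R e k) /\<^sub>R r"
        by (simp add: scaleR_diff_right scaleR_diff_left divide_inverse algebra_simps)
      then have "norm (S r (e k) - exp (- (lam n * r)) *\<^sub>R e k) / r < \<epsilon>" using r by (simp add: divide_inverse mult.commute)
      then show "norm (S r (e k) - exp (- (lam n * r)) *\<^sub>R e k) \<le> \<epsilon> * r" using r(2) by (simp add: divide_simps)
    qed
  qed
  have bound: "norm (S t (e n) - exp (- (lam n * t)) *\<^sub>R e n) \<le> \<epsilon> * (t * exp t)" if \<epsilon>: "0 < \<epsilon>" "\<epsilon> \<le> 1" for \<epsilon>
  proof -
    \<comment> \<open>An element of the eigenspace is a sum of \<open>card K\<close> basis vectors,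
      each contributing one error \<open>\<epsilon>' * r\<close>.\<close>
    define \<epsilon>' where "\<epsilon>' = \<epsilon> / (real (card K) + 1)"
    have \<epsilon>': "0 < \<epsilon>'" "real (card K) * \<epsilon>' \<le> \<epsilon>" using \<epsilon> by (auto simp: \<epsilon>'_def field_simps)
    obtain r0 where r0: "0 < r0" "\<And>r k. 0 < r \<Longrightarrow> r < r0 \<Longrightarrow> k \<in> K \<Longrightarrow> norm (S r (e k) - exp (- (lam n * r)) *\<^sub>R e k) \<le> \<epsilon>' * r"
      using small[OF \<epsilon>'(1)] unfolding eventually_at_right_field by blast
    obtain N :: nat where N: "t / r0 < real N" using reals_Archimedean2 by blast
    show ?thesis
    proof (cases "t = 0")
      case True
      then show ?thesis by (simp add: S0)
    next
      case False
      then have t0: "0 < t" using t by simp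
      then have "0 < t / r0" using r0(1) by simp
      then have N0: "0 < real N" using N by linarith
      define r where "r = t / real N"
      have r: "0 < r" "r < r0" using t0 N0 N r0(1) by (auto simp: r_def field_simps)
      define w where "w = (\<lambda>j. S (real j * r) (e n))"
      have "norm (w N - exp (- (lam n * r)) ^ N *\<^sub>R w 0) \<le> real N * (\<epsilon> * r) * exp (real N * (\<epsilon> * r))"
      proof (rule contraction_iteration)
        show "norm (w 0) \<le> 1" by (simp add: w_def S0)
        show "exp (- (lam n * r)) \<le> 1" using lam_pos[of n] r by simp
        fix j
        have j0: "0 \<le> real j * r" using r by simp
        have wrep: "w j = (\<Sum>k\<in>K. (w j \<bullet> e k) *\<^sub>R e k)" for j
          unfolding w_def by (rule rep) (use r in simp)
        have linS: "linear (S r)" using r by (intro bounded_linear.linear[OF bl]) simp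
        have "w (Suc j) = S r (w j)" unfolding w_def using Sadd[of r "real j * r" "e n"] r j0 by (simp add: algebra_simps)
        also have "\<dots> = (\<Sum>k\<in>K. (w j \<bullet> e k) *\<^sub>R S r (e k))"
          using arg_cong[OF wrep[of j], of "S r"] by (simp only: linear_sum[OF linS] linear_scale[OF linS])
        finally have "w (Suc j) - exp (- (lam n * r)) *\<^sub>R w j =
            (\<Sum>k\<in>K. (w j \<bullet> e k) *\<^sub>R S r (e k)) - exp (- (lam n * r)) *\<^sub>R (\<Sum>k\<in>K. (w j \<bullet> e k) *\<^sub>R e k)"
          using wrep[of j] by (rule arg_cong2[where f="\<lambda>a b. a - exp (- (lam n * r)) *\<^sub>R b"])
        also have "\<dots> = (\<Sum>k\<in>K. (w j \<bullet> e k) *\<^sub>R (S r (e k) - exp (- (lam n * r)) *\<^sub>R e k))"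
          by (simp add: scaleR_sum_right sum_subtractf scaleR_diff_right mult.commute)
        also have "norm \<dots> \<le> (\<Sum>k\<in>K. norm (w j) * (\<epsilon>' * r))"
        proof (rule order_trans[OF norm_sum], rule sum_mono)
          fix k assume k: "k \<in> K"
          have "\<bar>w j \<bullet> e k\<bar> \<le> norm (w j)" using Cauchy_Schwarz_ineq2[of "w j" "e k"] by simp
          then show "norm ((w j \<bullet> e k) *\<^sub>R (S r (e k) - exp (- (lam n * r)) *\<^sub>R e k)) \<le> norm (w j) * (\<epsilon>' * r)"
            unfolding norm_scaleR using r0(2)[OF r k] by (intro mult_mono) auto
        qed
        also have "\<dots> = (real (card K) * \<epsilon>') * (norm (w j) * r)" by simp
        also have "\<dots> \<le> \<epsilon> * (norm (w j) * r)" using \<epsilon>'(2) r by (intro mult_right_mono) auto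
        finally show "norm (w (Suc j) - exp (- (lam n * r)) *\<^sub>R w j) \<le> \<epsilon> * r * norm (w j)" by (simp add: mult_ac)
      qed (use \<epsilon> r in auto)
      moreover have "real N * r = t" using N0 by (simp add: r_def)
      moreover have "exp (- (lam n * r)) ^ N = exp (- (lam n * t))"
        unfolding exp_of_nat_mult[symmetric] using \<open>real N * r = t\<close> by (simp add: algebra_simps)
      moreover have "real N * (\<epsilon> * r) = \<epsilon> * t" using \<open>real N * r = t\<close> by (simp add: algebra_simps)
      ultimately have "norm (S t (e n) - exp (- (lam n * t)) *\<^sub>R e n) \<le> \<epsilon> * t * exp (\<epsilon> * t)"
        by (simp add: w_def S0)
      also have "\<dots> \<le> \<epsilon> * t * exp t"
        using \<epsilon> t0 by (intro mult_left_mono) (auto intro: mult_left_le_one_le)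
      finally show ?thesis by (simp add: mult.assoc)
    qed
  qed
  have "norm (S t (e n) - exp (- (lam n * t)) *\<^sub>R e n) \<le> 0"
  proof (rule tendsto_lowerbound[where F="at_right 0" and f="\<lambda>\<epsilon>. \<epsilon> * (t * exp t)"])
    have "((\<lambda>\<epsilon>. \<epsilon> * (t * exp t)) \<longlongrightarrow> 0 * (t * exp t)) (at_right 0)" by (intro tendsto_intros)
    then show "((\<lambda>\<epsilon>. \<epsilon> * (t * exp t)) \<longlongrightarrow> 0) (at_right 0)" by simp
    show "\<forall>\<^sub>F \<epsilon> in at_right 0. norm (S t (e n) - exp (- (lam n * t)) *\<^sub>R e n) \<le> \<epsilon> * (t * exp t)"
      unfolding eventually_at_right_field using bound by (intro exI[of _ 1]) auto
  qed simp
  then show ?thesis by simp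
qed

lemma semigroup_eq_expA:
  assumes gen: "generates D (\<lambda>v. - A v) S" and sa: "self_adjoint_op D A"
    and eigen: "\<And>n. e n \<in> D \<and> A (e n) = lam n *\<^sub>R e n"
    and lim: "filterlim lam at_top sequentially" and t: "0 \<le> t"
  shows "S t v = expA t v"
proof -
  have bl: "bounded_linear (S t)" using gen t by (auto simp: generates_def C0_semigroup_def)
  have "(\<lambda>i. S t ((v \<bullet> e i) *\<^sub>R e i)) sums S t v" by (rule bounded_linear.sums[OF bl expansion])
  moreover have "(\<lambda>i. expA t ((v \<bullet> e i) *\<^sub>R e i)) sums expA t v" by (rule bounded_linear.sums[OF expA_linear[OF t] expansion])
  moreover have "S t ((v \<bullet> e i) *\<^sub>R e i) = expA t ((v \<bullet> e i) *\<^sub>R e i)" for i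
    using semigroup_eigenvector[OF gen sa eigen lim t, of i] expA_e[OF t, of i]
    by (simp add: linear_scale[OF bounded_linear.linear[OF bl]] linear_scale[OF bounded_linear.linear[OF expA_linear[OF t]]])
  ultimately show ?thesis by (simp add: sums_unique2)
qed

section \<open>Agreement with the spectral powers\<close>

lemma pow_op_half: "pow_op e lam (1/2) v = rt 0 v"
  using lam_pos by (simp add: pow_op_def rt_def powr_half_sqrt less_imp_le)

lemma pow_dom_half: "pow_dom e lam (1/2) = energy_dom"
  using lam_pos by (simp add: pow_dom_def energy_dom_def powr_half_sqrt less_imp_le power_mult_distrib)

lemma resolv_pow_1:
  "resolv 0 w \<in> pow_dom e lam 1" "pow_op e lam 1 (resolv 0 w) = w"
proof -
  have eq: "lam n powr 1 * (resolv 0 w \<bullet> e n) = w \<bullet> e n" for n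
    using lam_pos[of n] by (simp add: resolv_coeff)
  show "resolv 0 w \<in> pow_dom e lam 1" unfolding pow_dom_def using summable_coeff_sq[of w] by (simp only: eq mem_Collect_eq)
  show "pow_op e lam 1 (resolv 0 w) = w" unfolding pow_op_def eq using expansion[of w] by (rule sums_unique[symmetric])
qed

end

section \<open>The discrete spaces and the recursion\<close>

context spectral_basis
begin

lemma rt0_eq_0:
  assumes "v \<in> energy_dom" "rt 0 v = 0" shows "v = 0"
proof (rule eq_of_coeff)
  fix n
  have "sqrt (0 + lam n) * (v \<bullet> e n) = 0" using rt_coeff[OF order_refl assms(1), of n] assms(2) by simp
  then show "v \<bullet> e n = 0 \<bullet> e n" using lam_pos[of n] by simp
qed

text \<open>The energy form is diagonalized on \<open>U\<close> with respect to the inner product of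
  the space. The approximation bounds of orders 1 and 2, applied to \<open>A^-1 w\<close>, become
  those of the locale once the elliptic projection is identified.\<close>

lemma galerkin_exists:
  assumes U: "finite_dim_subspace U" "U \<subseteq> pow_dom e lam (1/2)" and \<kappa>: "0 < \<kappa>" and h: "0 < h"
    and ap1: "\<And>v. v \<in> pow_dom e lam (1/2) \<Longrightarrow>
        norm (orth_proj (energy_inner e lam) U v - v) \<le> \<kappa> * h powr 1 * norm (pow_op e lam (1/2) v)"
    and ap2: "\<And>v. v \<in> pow_dom e lam 1 \<Longrightarrow>
        norm (orth_proj (energy_inner e lam) U v - v) \<le> \<kappa> * h powr 2 * norm (pow_op e lam 1 v)"
  shows "\<exists>d f mu. galerkin e lam d f mu \<kappa> h \<and> U = span (f ` {..<d})"
proof -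
  have Ud: "U \<subseteq> energy_dom" using U(2) by (simp add: pow_dom_half)
  have ei: "energy_inner e lam u v = rt 0 u \<bullet> rt 0 v" for u v by (simp add: energy_inner_def pow_op_half)
  obtain d :: nat and f mu where
    o: "\<forall>m<d. \<forall>l<d. f m \<bullet> f l = (if m = l then 1 else 0)" and span: "U = span (f ` {..<d})"
    and eig: "\<forall>m<d. \<forall>v\<in>U. rt 0 (f m) \<bullet> rt 0 v = mu m * (f m \<bullet> v)"
  proof -
    have "\<exists>(d::nat) f mu. (\<forall>m<d. \<forall>l<d. f m \<bullet> f l = (if m = l then 1 else 0)) \<and>
      U = span (f ` {..<d}) \<and> (\<forall>m<d. \<forall>v\<in>U. rt 0 (f m) \<bullet> rt 0 v = mu m * (f m \<bullet> v))"
    proof (rule simultaneous_diagonalization[OF U(1), where a="\<lambda>u v. rt 0 u \<bullet> rt 0 v"])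
      show "rt 0 u \<bullet> rt 0 v = rt 0 v \<bullet> rt 0 u" for u v by (rule inner_commute)
      show "rt 0 (u + v) \<bullet> rt 0 w = rt 0 u \<bullet> rt 0 w + rt 0 v \<bullet> rt 0 w" if "u \<in> U" "v \<in> U" for u v w
        using that Ud by (subst rt_linear(1)) (auto simp: inner_add_left)
      show "rt 0 (c *\<^sub>R u) \<bullet> rt 0 w = c * (rt 0 u \<bullet> rt 0 w)" if "u \<in> U" for c u w
        using that Ud by (subst rt_linear(2)) auto
    qed
    then show ?thesis using that by blast
  qed
  have fU: "f m \<in> U" if "m < d" for m using that unfolding span by (intro span_base) auto
  have en: "rt 0 (f m) \<bullet> rt 0 (f l) = (if m = l then mu m else 0)" if "m < d" "l < d" for m l
    using eig[rule_format, OF that(1) fU[OF that(2)]] o that by auto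
  have fd: "f m \<in> energy_dom" if "m < d" for m using fU[OF that] Ud by auto
  have mu: "0 < mu m" if m: "m < d" for m
  proof -
    have "f m \<noteq> 0" using o m by (metis inner_zero_left zero_neq_one)
    then have "rt 0 (f m) \<noteq> 0" using rt0_eq_0[OF fd[OF m]] by auto
    then show ?thesis using en[OF m m] by (metis inner_gt_zero_iff)
  qed
  \<comment> \<open>Testing with \<open>f l\<close> shows that the projection of
    \<open>A^-1 w\<close> has coefficient \<open>w \<bullet> f l / mu l\<close>, that is
    \<open>\<Pi>_h A^-1 = A_h^-1 P_h\<close>.\<close>
  have proj: "orth_proj (energy_inner e lam) U (resolv 0 w) = (\<Sum>m<d. (w \<bullet> f m / mu m) *\<^sub>R f m)" for w
    unfolding orth_proj_def ei
  proof (rule the_equality)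
    let ?p = "\<Sum>m<d. (w \<bullet> f m / mu m) *\<^sub>R f m" and ?z = "resolv 0 w"
    have pU: "?p \<in> U" unfolding span by (intro span_sum span_scale span_base) auto
    have pd: "?p \<in> energy_dom" using pU Ud by auto
    have zd: "?z \<in> energy_dom" by (rule resolv_dom) simp
    have orthf: "rt 0 (?z - ?p) \<bullet> rt 0 (f l) = 0" if l: "l < d" for l
    proof -
      have "rt 0 ?p \<bullet> rt 0 (f l) = (\<Sum>m<d. (w \<bullet> f m / mu m) * (rt 0 (f m) \<bullet> rt 0 (f l)))"
        by (subst rt_linear(4)) (use fd in \<open>auto simp: inner_sum_left\<close>)
      also have "\<dots> = (\<Sum>m<d. if m = l then w \<bullet> f l else 0)"
        using l mu[OF l] by (intro sum.cong refl) (auto simp: en)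
      finally show ?thesis
        using l rt_resolv[OF order_refl fd[OF l], of w] by (simp add: rt_linear(3) zd pd inner_diff_left)
    qed
    have orthU: "rt 0 (?z - ?p) \<bullet> rt 0 u = 0" if "u \<in> U" for u
    proof -
      have "u \<in> span (f ` {..<d})" using that span by simp
      then have "u \<in> energy_dom \<and> rt 0 (?z - ?p) \<bullet> rt 0 u = 0"
      proof (induction rule: span_induct_alt)
        case base
        have "rt 0 0 = (0 :: 'h)" by (simp add: rt_def)
        then show ?case using subspace_0[OF energy_dom_subspace] by simp
      next
        case (step c a y)
        have a: "a \<in> energy_dom" "rt 0 (?z - ?p) \<bullet> rt 0 a = 0" using step(1) fd orthf by auto
        have y: "y \<in> energy_dom" "rt 0 (?z - ?p) \<bullet> rt 0 y = 0" using step(2) by auto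
        have ca: "c *\<^sub>R a \<in> energy_dom" using a(1) energy_dom_subspace by (rule subspace_scale[rotated])
        show ?case
          using subspace_add[OF energy_dom_subspace ca y(1)]
          by (simp add: rt_linear(1)[OF order_refl ca y(1)] rt_linear(2)[OF order_refl a(1)] inner_add_right a(2) y(2))
      qed
      then show ?thesis by (rule conjunct2)
    qed
    show "?p \<in> U \<and> (\<forall>u\<in>U. rt 0 (?z - ?p) \<bullet> rt 0 u = 0)" using pU orthU by blast
    fix p assume p: "p \<in> U \<and> (\<forall>u\<in>U. rt 0 (?z - p) \<bullet> rt 0 u = 0)"
    have pd': "p \<in> energy_dom" using p Ud by auto
    have sU: "p - ?p \<in> U" using p pU unfolding span by (auto intro: span_diff)
    have "rt 0 (p - ?p) = rt 0 (?z - ?p) - rt 0 (?z - p)"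
      by (simp add: rt_linear(3) zd pd pd')
    from arg_cong[OF this, of "\<lambda>y. y \<bullet> rt 0 (p - ?p)"]
    have "rt 0 (p - ?p) \<bullet> rt 0 (p - ?p) = 0"
      using p[THEN conjunct2, rule_format, OF sU] orthU[OF sU] by (simp only: inner_diff_left)
    then have "rt 0 (p - ?p) = 0" by simp
    then have "p - ?p = 0" by (rule rt0_eq_0[OF subsetD[OF Ud sU]])
    then show "p = ?p" by simp
  qed
  have "galerkin e lam d f mu \<kappa> h"
  proof (unfold_locales)
    show "f m \<bullet> f l = (if m = l then 1 else 0)" if "m < d" "l < d" for m l using o that by blast
    show "f m \<in> energy_dom" if "m < d" for m by (rule fd[OF that])
    show "rt 0 (f m) \<bullet> rt 0 (f l) = (if m = l then mu m else 0)" if "m < d" "l < d" for m l by (rule en[OF that])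
    show "0 < \<kappa>" by (rule \<kappa>)
    show "0 < h" by (rule h)
    fix w
    have n: "norm (resolv 0 w - (\<Sum>m<d. (w \<bullet> f m / mu m) *\<^sub>R f m)) = norm (orth_proj (energy_inner e lam) U (resolv 0 w) - resolv 0 w)"
      unfolding proj by (rule norm_minus_commute)
    have "h powr 2 = h\<^sup>2" using h by simp
    then show "norm (resolv 0 w - (\<Sum>m<d. (w \<bullet> f m / mu m) *\<^sub>R f m)) \<le> \<kappa> * h\<^sup>2 * norm w"
      unfolding n using ap2[OF resolv_pow_1(1), of w] by (simp only: resolv_pow_1(2))
    have "h powr 1 = h" using h by simp
    moreover have "resolv 0 w \<in> pow_dom e lam (1/2)" unfolding pow_dom_half by (rule resolv_dom) simp
    ultimately show "norm (resolv 0 w - (\<Sum>m<d. (w \<bullet> f m / mu m) *\<^sub>R f m)) \<le> \<kappa> * h * norm (rt 0 (resolv 0 w))"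
      unfolding n using ap1[of "resolv 0 w"] by (simp only: pow_op_half)
  qed
  then show ?thesis using span by blast
qed

end

context galerkin
begin

lemma in_span_f:
  assumes "u \<in> span (f ` {..<d})"
  shows "u = fdiag (\<lambda>_. 1) u"
  using assms
proof (induction rule: span_induct_alt)
  case base
  show ?case by (simp add: fdiag_def)
next
  case (step c a y)
  then obtain k where k: "k < d" "a = f k" by auto
  have "fdiag (\<lambda>_. 1) a = (\<Sum>m<d. if m = k then f k else 0)"
    unfolding fdiag_def k(2) using k(1) by (intro sum.cong refl) (auto simp: f_ortho)
  then have a: "fdiag (\<lambda>_. 1) a = a" using k by simp
  have "linear (fdiag (\<lambda>_. 1))" by (rule bounded_linear.linear[OF fdiag_linear])
  then show ?case using a step.IH by (simp add: linear_add linear_scale)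
qed

lemma fdiag_in_span: "fdiag c v \<in> span (f ` {..<d})"
  unfolding fdiag_def by (intro span_sum span_scale span_base) auto

lemma span_eqI:
  assumes "u \<in> span (f ` {..<d})" "v \<in> span (f ` {..<d})" "\<And>m. m < d \<Longrightarrow> u \<bullet> f m = v \<bullet> f m"
  shows "u = v"
proof -
  have "fdiag (\<lambda>_. 1) u = fdiag (\<lambda>_. 1) v" using assms(3) by (intro fdiag_cong) simp
  then show ?thesis using in_span_f[OF assms(1)] in_span_f[OF assms(2)] by simp
qed

lemma orth_proj_inner: "orth_proj inner (span (f ` {..<d})) v = fdiag (\<lambda>_. 1) v"
  unfolding orth_proj_def
proof (rule the_equality)
  have "(v - fdiag (\<lambda>_. 1) v) \<bullet> w = 0" if "w \<in> span (f ` {..<d})" for w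
    using that
  proof (induction rule: span_induct_alt)
    case (step c a y)
    then have "(v - fdiag (\<lambda>_. 1) v) \<bullet> a = 0" by (auto simp: inner_diff_left fdiag_inner_f)
    then show ?case using step.IH by (simp add: inner_add_right)
  qed simp
  then show "fdiag (\<lambda>_. 1) v \<in> span (f ` {..<d}) \<and> (\<forall>w\<in>span (f ` {..<d}). (v - fdiag (\<lambda>_. 1) v) \<bullet> w = 0)"
    using fdiag_in_span by blast
  fix p assume p: "p \<in> span (f ` {..<d}) \<and> (\<forall>w\<in>span (f ` {..<d}). (v - p) \<bullet> w = 0)"
  show "p = fdiag (\<lambda>_. 1) v"
  proof (rule span_eqI[OF _ fdiag_in_span])
    fix m assume m: "m < d"
    then have "f m \<in> span (f ` {..<d})" by (intro span_base) auto
    then have "(v - p) \<bullet> f m = 0" using p by blast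
    then show "p \<bullet> f m = fdiag (\<lambda>_. 1) v \<bullet> f m" using m by (simp add: fdiag_inner_f inner_diff_left)
  qed (use p in blast)
qed

lemma discrete_op_eq:
  assumes u: "u \<in> span (f ` {..<d})"
  shows "discrete_op e lam (span (f ` {..<d})) u = fdiag mu u"
  unfolding discrete_op_def
proof (rule the_equality)
  have ei: "energy_inner e lam u v = rt 0 u \<bullet> rt 0 v" for u v by (simp add: energy_inner_def pow_op_half)
  have ef: "energy_inner e lam u (f l) = mu l * (u \<bullet> f l)" if l: "l < d" for l
  proof -
    have "rt 0 u = (\<Sum>m<d. (u \<bullet> f m) *\<^sub>R rt 0 (f m))"
      using rt_linear(4)[of 0 "{..<d}" f "\<lambda>m. u \<bullet> f m"] f_dom in_span_f[OF u] by (simp add: fdiag_def)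
    then have "rt 0 u \<bullet> rt 0 (f l) = (\<Sum>m<d. (u \<bullet> f m) * (rt 0 (f m) \<bullet> rt 0 (f l)))" by (simp add: inner_sum_left)
    also have "\<dots> = (\<Sum>m<d. if m = l then mu l * (u \<bullet> f l) else 0)"
      using l by (intro sum.cong refl) (auto simp: f_energy)
    finally show ?thesis using l by (simp add: ei)
  qed
  have "v \<in> energy_dom \<and> fdiag mu u \<bullet> v = energy_inner e lam u v" if "v \<in> span (f ` {..<d})" for v
    using that
  proof (induction rule: span_induct_alt)
    case base
    have "rt 0 0 = (0 :: 'h)" by (simp add: rt_def)
    then show ?case using subspace_0[OF energy_dom_subspace] by (simp add: ei)
  next
    case (step c a y)
    then obtain l where l: "l < d" "a = f l" by auto
    have a: "a \<in> energy_dom" "c *\<^sub>R a \<in> energy_dom" using l f_dom subspace_scale[OF energy_dom_subspace] by auto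
    have "fdiag mu u \<bullet> a = energy_inner e lam u a" using ef[OF l(1)] l by (simp add: fdiag_inner_f)
    moreover have y: "y \<in> energy_dom" "fdiag mu u \<bullet> y = energy_inner e lam u y" using step(2) by auto
    ultimately show ?case
      using subspace_add[OF energy_dom_subspace a(2) y(1)]
      by (simp add: ei rt_linear(1)[OF order_refl a(2) y(1)] rt_linear(2)[OF order_refl a(1)] inner_add_right)
  qed
  then show "fdiag mu u \<in> span (f ` {..<d}) \<and> (\<forall>v\<in>span (f ` {..<d}). fdiag mu u \<bullet> v = energy_inner e lam u v)"
    using fdiag_in_span by blast
  fix w assume w: "w \<in> span (f ` {..<d}) \<and> (\<forall>v\<in>span (f ` {..<d}). w \<bullet> v = energy_inner e lam u v)"
  show "w = fdiag mu u"
  proof (rule span_eqI[OF _ fdiag_in_span])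
    fix m assume m: "m < d"
    then have "f m \<in> span (f ` {..<d})" by (intro span_base) auto
    then have "w \<bullet> f m = energy_inner e lam u (f m)" using w by blast
    then show "w \<bullet> f m = fdiag mu u \<bullet> f m" using m ef[OF m] by (simp add: fdiag_inner_f)
  qed (use w in blast)
qed

text \<open>Discrete variation of constants, solved mode by mode. The noise \<open>w n\<close>
  enters at step \<open>Suc n\<close> through the implicit factor
  \<open>1 / (1 + \<theta> * (mu m * dt))\<close> and is then amplified \<open>N - Suc n\<close>
  times.\<close>

lemma theta_recursion:
  assumes \<theta>: "1/2 < \<theta>" "\<theta> \<le> 1" and dt: "0 < dt"
    and y: "\<And>n. n \<le> N \<Longrightarrow> y n \<in> span (f ` {..<d})" and y0: "y 0 = fdiag (\<lambda>_. 1) x"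
    and w: "\<And>n. n < N \<Longrightarrow> w n = y (Suc n) - y n + dt *\<^sub>R discrete_op e lam (span (f ` {..<d})) (\<theta> *\<^sub>R y (Suc n) + (1 - \<theta>) *\<^sub>R y n)"
  shows "y N = fdiag (\<lambda>m. theta_ratio \<theta> (mu m * dt) ^ N) x +
    (\<Sum>n<N. fdiag (\<lambda>m. theta_ratio \<theta> (mu m * dt) ^ (N - Suc n) / (1 + \<theta> * (mu m * dt))) (w n))"
proof -
  have step: "y (Suc n) \<bullet> f m = theta_ratio \<theta> (mu m * dt) * (y n \<bullet> f m) + (w n \<bullet> f m) / (1 + \<theta> * (mu m * dt))"
    if n: "n < N" and m: "m < d" for n m
  proof -
    have g: "0 < 1 + \<theta> * (mu m * dt)" using \<theta> dt mu_pos[OF m] by (intro add_pos_nonneg) auto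
    have "\<theta> *\<^sub>R y (Suc n) + (1 - \<theta>) *\<^sub>R y n \<in> span (f ` {..<d})"
      using y[of n] y[of "Suc n"] n by (intro span_add span_scale) auto
    then have "w n \<bullet> f m = y (Suc n) \<bullet> f m - y n \<bullet> f m + dt * (mu m * (\<theta> * (y (Suc n) \<bullet> f m) + (1 - \<theta>) * (y n \<bullet> f m)))"
      using w[OF n] m by (simp add: discrete_op_eq fdiag_inner_f inner_add_left inner_diff_left)
    then have "(1 + \<theta> * (mu m * dt)) * (y (Suc n) \<bullet> f m) = (1 - (1 - \<theta>) * (mu m * dt)) * (y n \<bullet> f m) + w n \<bullet> f m"
      by (simp add: algebra_simps)
    then have "y (Suc n) \<bullet> f m = ((1 - (1 - \<theta>) * (mu m * dt)) * (y n \<bullet> f m) + w n \<bullet> f m) / (1 + \<theta> * (mu m * dt))"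
      using g by (intro eq_divide_imp) (simp_all add: mult.commute)
    then show ?thesis by (simp only: theta_ratio_def add_divide_distrib times_divide_eq_left)
  qed
  have sol: "y k \<bullet> f m = theta_ratio \<theta> (mu m * dt) ^ k * (x \<bullet> f m) +
      (\<Sum>n<k. theta_ratio \<theta> (mu m * dt) ^ (k - Suc n) / (1 + \<theta> * (mu m * dt)) * (w n \<bullet> f m))"
    if "k \<le> N" and m: "m < d" for k m
    using that(1)
  proof (induction k)
    case 0
    then show ?case using m by (simp add: y0 fdiag_inner_f)
  next
    case (Suc k)
    let ?r = "theta_ratio \<theta> (mu m * dt)" and ?g = "1 + \<theta> * (mu m * dt)"
    have "(\<Sum>n<k. ?r ^ (Suc k - Suc n) / ?g * (w n \<bullet> f m)) = ?r * (\<Sum>n<k. ?r ^ (k - Suc n) / ?g * (w n \<bullet> f m))"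
      unfolding sum_distrib_left
    proof (rule sum.cong[OF refl])
      fix n assume "n \<in> {..<k}"
      then have "Suc k - Suc n = Suc (k - Suc n)" by auto
      then show "?r ^ (Suc k - Suc n) / ?g * (w n \<bullet> f m) = ?r * (?r ^ (k - Suc n) / ?g * (w n \<bullet> f m))"
        by (simp only: power_Suc mult.assoc times_divide_eq_right times_divide_eq_left)
    qed
    then have "(\<Sum>n<Suc k. ?r ^ (Suc k - Suc n) / ?g * (w n \<bullet> f m)) =
        ?r * (\<Sum>n<k. ?r ^ (k - Suc n) / ?g * (w n \<bullet> f m)) + (w k \<bullet> f m) / ?g" by simp
    moreover have "y (Suc k) \<bullet> f m = ?r * (y k \<bullet> f m) + (w k \<bullet> f m) / ?g"
      using Suc.prems m by (intro step) auto
    moreover have "y k \<bullet> f m = ?r ^ k * (x \<bullet> f m) + (\<Sum>n<k. ?r ^ (k - Suc n) / ?g * (w n \<bullet> f m))"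
      using Suc by simp
    ultimately show ?case by (simp only: distrib_left power_Suc mult.assoc add.assoc)
  qed
  show ?thesis
  proof (rule span_eqI)
    fix m assume m: "m < d"
    then show "y N \<bullet> f m = (fdiag (\<lambda>m. theta_ratio \<theta> (mu m * dt) ^ N) x +
      (\<Sum>n<N. fdiag (\<lambda>m. theta_ratio \<theta> (mu m * dt) ^ (N - Suc n) / (1 + \<theta> * (mu m * dt))) (w n))) \<bullet> f m"
      using sol[OF order_refl m] by (simp add: inner_add_left inner_sum_left fdiag_inner_f)
  qed (use y in \<open>auto intro!: span_add span_sum fdiag_in_span\<close>)
qed

end

section \<open>The weak error\<close>

context hilbert_basis
begin

lemma norm_partial_sum_le: "norm (\<Sum>i<n. (v \<bullet> e i) *\<^sub>R e i) \<le> norm v"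
proof (rule power2_le_imp_le)
  show "(norm (\<Sum>i<n. (v \<bullet> e i) *\<^sub>R e i))\<^sup>2 \<le> (norm v)\<^sup>2"
    using bessel[of "{..<n}" v] by (simp add: norm_sum_e)
qed simp

text \<open>Dominated convergence for the projection error, with majorant
  \<open>2 * norm (Z \<omega>)\<close>, combined with the Lipschitz bound.\<close>

lemma expectation_truncation:
  assumes M: "prob_space M" and lip: "\<And>x y. \<bar>\<phi> x - \<phi> y\<bar> \<le> L * norm (x - y)" and Z: "integrable M Z"
  shows "(\<lambda>n. \<integral>\<omega>. \<phi> (m + (\<Sum>i<n. (Z \<omega> \<bullet> e i) *\<^sub>R e i)) \<partial>M) \<longlonglongrightarrow> (\<integral>\<omega>. \<phi> (m + Z \<omega>) \<partial>M)"
proof -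
  interpret prob_space M by (rule M)
  let ?P = "\<lambda>n \<omega>. \<Sum>i<n. (Z \<omega> \<bullet> e i) *\<^sub>R e i"
  have [measurable]: "Z \<in> borel_measurable M" using Z by auto
  have "\<bar>L\<bar>-lipschitz_on UNIV \<phi>"
  proof (rule lipschitz_onI)
    fix x y
    have "\<bar>\<phi> x - \<phi> y\<bar> \<le> \<bar>L\<bar> * norm (x - y)" by (rule order_trans[OF lip]) (simp add: mult_right_mono)
    then show "dist (\<phi> x) (\<phi> y) \<le> \<bar>L\<bar> * dist x y" by (simp add: dist_norm)
  qed simp
  then have cont: "continuous_on UNIV \<phi>" by (rule lipschitz_on_continuous_on)
  have resid: "norm (?P n \<omega> - Z \<omega>) \<le> 2 * norm (Z \<omega>)" for n \<omega>
    using norm_triangle_ineq4[of "?P n \<omega>" "Z \<omega>"] norm_partial_sum_le[of "Z \<omega>" n] by linarith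
  have int: "integrable M (\<lambda>\<omega>. norm (?P n \<omega> - Z \<omega>))" for n
    by (rule Bochner_Integration.integrable_bound[where f="\<lambda>\<omega>. 2 * norm (Z \<omega>)"]) (use Z resid in auto)
  have "(\<lambda>n. \<integral>\<omega>. norm (?P n \<omega> - Z \<omega>) \<partial>M) \<longlonglongrightarrow> (\<integral>\<omega>. 0 \<partial>M)"
  proof (rule integral_dominated_convergence[where w="\<lambda>\<omega>. 2 * norm (Z \<omega>)"])
    show "AE \<omega> in M. (\<lambda>n. norm (?P n \<omega> - Z \<omega>)) \<longlonglongrightarrow> 0"
    proof (rule AE_I2)
      fix \<omega>
      have "(\<lambda>n. ?P n \<omega>) \<longlonglongrightarrow> Z \<omega>" using expansion[of "Z \<omega>"] by (simp add: sums_def)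
      then show "(\<lambda>n. norm (?P n \<omega> - Z \<omega>)) \<longlonglongrightarrow> 0" by (simp add: tendsto_norm_zero_iff LIM_zero_iff)
    qed
    show "AE \<omega> in M. norm (norm (?P n \<omega> - Z \<omega>)) \<le> 2 * norm (Z \<omega>)" for n
      using resid by (intro AE_I2) simp
  qed (use Z in auto)
  then have "(\<lambda>n. L * (\<integral>\<omega>. norm (?P n \<omega> - Z \<omega>) \<partial>M)) \<longlonglongrightarrow> L * 0" by (intro tendsto_mult_left) simp
  then have lim: "(\<lambda>n. L * (\<integral>\<omega>. norm (?P n \<omega> - Z \<omega>) \<partial>M)) \<longlonglongrightarrow> 0" by simp
  have "(\<lambda>n. (\<integral>\<omega>. \<phi> (m + ?P n \<omega>) \<partial>M) - (\<integral>\<omega>. \<phi> (m + Z \<omega>) \<partial>M)) \<longlonglongrightarrow> 0"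
  proof (rule Lim_null_comparison[OF always_eventually lim], rule allI)
    fix n
    have diff: "m + ?P n \<omega> - (m + Z \<omega>) = ?P n \<omega> - Z \<omega>" for \<omega> by simp
    have "\<bar>(\<integral>\<omega>. \<phi> (m + ?P n \<omega>) \<partial>M) - (\<integral>\<omega>. \<phi> (m + Z \<omega>) \<partial>M)\<bar> \<le> L * (\<integral>\<omega>. norm (m + ?P n \<omega> - (m + Z \<omega>)) \<partial>M)"
      by (rule C2b_lipschitz(2)[OF M lip _ _ _ cont]) (use Z int in \<open>auto simp only: diff, auto\<close>)
    then show "norm ((\<integral>\<omega>. \<phi> (m + ?P n \<omega>) \<partial>M) - (\<integral>\<omega>. \<phi> (m + Z \<omega>) \<partial>M)) \<le> L * (\<integral>\<omega>. norm (?P n \<omega> - Z \<omega>) \<partial>M)"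
      by (simp only: diff real_norm_def)
  qed
  then show ?thesis by (rule LIM_zero_cancel)
qed

end

text \<open>Boundedness of \<open>A^\<beta> Q\<close> passes by duality to
  \<open>Q A^\<beta>\<close>, evaluated at \<open>e n\<close>. Concretely,
  \<open>A^\<beta> Q\<close> is applied to \<open>Q (e n)\<close> and paired with
  \<open>e n\<close>, which gives \<open>lam n powr \<beta> * (norm (Q (e n)))\<^sup>2 \<le> c *
  norm (Q (e n))\<close>.\<close>

lemma (in spectral_basis) covariance_decay:
  assumes R: "bounded_linear R" "\<And>u v. R u \<bullet> v = u \<bullet> R v" and RQ: "\<And>v. R (R v) = Q v"
    and AQ: "range Q \<subseteq> pow_dom e lam \<beta>" "bounded_linear (\<lambda>v. pow_op e lam \<beta> (Q v))"
  shows "\<exists>c\<ge>0. \<forall>n. norm (R (R (e n))) \<le> c * lam n powr - \<beta>"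
proof -
  obtain c where c: "0 \<le> c" "\<And>v. norm (pow_op e lam \<beta> (Q v)) \<le> norm v * c"
    using bounded_linear.nonneg_bounded[OF AQ(2)] by blast
  show ?thesis
  proof (intro exI[of _ c] conjI allI)
    fix n
    let ?w = "Q (e n)"
    have "summable (\<lambda>k. (lam k powr \<beta> * (Q ?w \<bullet> e k))\<^sup>2)" using AQ(1) by (auto simp: pow_dom_def)
    then have "pow_op e lam \<beta> (Q ?w) \<bullet> e n = lam n powr \<beta> * (Q ?w \<bullet> e n)" unfolding pow_op_def by (rule series_coeff(2))
    moreover have "Q ?w \<bullet> e n = (norm ?w)\<^sup>2" unfolding power2_norm_eq_inner by (simp add: RQ[symmetric] R(2))
    moreover have "pow_op e lam \<beta> (Q ?w) \<bullet> e n \<le> norm (pow_op e lam \<beta> (Q ?w))"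
      using Cauchy_Schwarz_ineq2[of "pow_op e lam \<beta> (Q ?w)" "e n"] by simp
    ultimately have "lam n powr \<beta> * (norm ?w)\<^sup>2 \<le> norm ?w * c" using c(2)[of ?w] by simp
    then have "norm ?w * (lam n powr \<beta> * norm ?w) \<le> norm ?w * c" by (simp add: power2_eq_square mult_ac)
    then have "lam n powr \<beta> * norm ?w \<le> c" using c(1) by (cases "?w = 0") auto
    then show "norm (R (R (e n))) \<le> c * lam n powr - \<beta>"
      using lam_pos[of n] by (simp add: RQ powr_minus field_simps)
  qed (rule c(1))
qed

context galerkin_noise
begin

lemma scheme_decomposition:
  fixes M :: "'w measure"
  assumes M: "prob_space M" and BM: "cylindrical_wiener M T F B" and T: "1 \<le> T" and N: "1 \<le> N"
    and \<theta>: "1/2 < \<theta>" "\<theta> \<le> 1"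
    and sch: "theta_scheme M e lam B R (span (f ` {..<d})) \<theta> T x N Y"
  defines "dt \<equiv> T / real N"
  shows "\<exists>Z. gauss_limit M Z (kernel_form {..<d} (\<lambda>j k. (R (f j) \<bullet> R (f k)) * (\<Sum>n<N. dt *
     (theta_ratio \<theta> (mu j * dt) ^ n / (1 + \<theta> * (mu j * dt)) * (theta_ratio \<theta> (mu k * dt) ^ n / (1 + \<theta> * (mu k * dt)))))) f) \<and>
     (\<forall>\<omega>\<in>space M. Y N \<omega> = fdiag (\<lambda>m. theta_ratio \<theta> (mu m * dt) ^ N) x + Z \<omega>)"
proof -
  have dt0: "0 < dt" using T N by (simp add: dt_def)
  have NT: "real N * dt = T" using N by (simp add: dt_def)
  have U: "Y n \<omega> \<in> span (f ` {..<d})" if "n \<le> N" "\<omega> \<in> space M" for n \<omega>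
    using sch that by (simp add: theta_scheme_def Let_def)
  have Y0: "Y 0 \<omega> = fdiag (\<lambda>_. 1) x" if "\<omega> \<in> space M" for \<omega>
    using sch that by (simp add: theta_scheme_def Let_def orth_proj_inner)
  \<comment> \<open>The noise is read off as the left-hand side of the recursion. The recursion then
    holds at every point of the space, and only the series representation of \<open>W n\<close> is a
    mean-square statement.\<close>
  define W where "W = (\<lambda>n \<omega>. Y (Suc n) \<omega> - Y n \<omega> +
    dt *\<^sub>R discrete_op e lam (span (f ` {..<d})) (\<theta> *\<^sub>R Y (Suc n) \<omega> + (1 - \<theta>) *\<^sub>R Y n \<omega>))"
  define c where "c = (\<lambda>n m. theta_ratio \<theta> (mu m * dt) ^ (N - Suc n) / (1 + \<theta> * (mu m * dt)))"
  have Ws: "sums_L2 M (\<lambda>i \<omega>. (B i (real (Suc n) * dt) \<omega> - B i (real n * dt) \<omega>) *\<^sub>R fdiag (\<lambda>_. 1) (R (e i))) (W n)"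
    if "n < N" for n
    using sch that unfolding theta_scheme_def Let_def orth_proj_inner W_def dt_def by blast
  have c1: "\<bar>c n m\<bar> \<le> 1" if m: "m < d" for n m
  proof -
    have z: "0 \<le> mu m * dt" using mu_pos[OF m] dt0 by simp
    then have g: "1 \<le> 1 + \<theta> * (mu m * dt)" using \<theta> by simp
    have "\<bar>theta_ratio \<theta> (mu m * dt)\<bar> ^ (N - Suc n) \<le> 1" by (rule power_le_one[OF abs_ge_zero theta_ratio_le_1[OF \<theta> z]])
    then have "\<bar>theta_ratio \<theta> (mu m * dt)\<bar> ^ (N - Suc n) / (1 + \<theta> * (mu m * dt)) \<le> 1"
      using g by (subst divide_le_eq_1_pos) linarith+
    then show ?thesis using g by (simp add: c_def abs_divide power_abs)
  qed
  \<comment> \<open>Reversing the order of the steps replaces \<open>N - Suc n\<close> by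
    \<open>n\<close>, the form in which \<open>TD_horizon\<close> sums the series.\<close>
  have ker: "(\<Sum>n<N. dt * (c n j * c n k)) = (\<Sum>n<N. dt *
     (theta_ratio \<theta> (mu j * dt) ^ n / (1 + \<theta> * (mu j * dt)) * (theta_ratio \<theta> (mu k * dt) ^ n / (1 + \<theta> * (mu k * dt)))))" for j k
    unfolding c_def
    using sum.nat_diff_reindex[of "\<lambda>n. dt * (theta_ratio \<theta> (mu j * dt) ^ n / (1 + \<theta> * (mu j * dt)) *
      (theta_ratio \<theta> (mu k * dt) ^ n / (1 + \<theta> * (mu k * dt))))" N] .
  have gl: "gauss_limit M (\<lambda>\<omega>. \<Sum>n<N. fdiag (c n) (W n \<omega>))
      (kernel_form {..<d} (\<lambda>j k. (R (f j) \<bullet> R (f k)) * (\<Sum>n<N. dt * (c n j * c n k))) f)"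
    by (rule scheme_gauss_limit[OF M BM dt0 eq_refl[OF NT] Ws c1])
  have "Y N \<omega> = fdiag (\<lambda>m. theta_ratio \<theta> (mu m * dt) ^ N) x + (\<Sum>n<N. fdiag (c n) (W n \<omega>))" if \<omega>: "\<omega> \<in> space M" for \<omega>
    unfolding c_def
    by (rule theta_recursion[OF \<theta> dt0, of N "\<lambda>n. Y n \<omega>" x "\<lambda>n. W n \<omega>"]) (simp_all only: U \<omega> Y0 W_def)
  then show ?thesis using gl unfolding ker by (intro exI[of _ "\<lambda>\<omega>. \<Sum>n<N. fdiag (c n) (W n \<omega>)"]) blast
qed

text \<open>The means differ by the propagator error applied to \<open>x\<close>, the covariances by
  \<open>covariance_error\<close>. The number of modes is sent to infinity with the discretization
  fixed, which removes \<open>trunc_err\<close>.\<close>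

lemma weak_error:
  fixes M :: "'w measure"
  assumes M: "prob_space M" and BM: "cylindrical_wiener M T F B" and L: "0 < L"
    and lip: "\<And>x y. \<bar>\<phi> x - \<phi> y\<bar> \<le> L * norm (x - y)"
    and cmp: "\<And>m m' Z Z' C C' \<epsilon>. gauss_limit M Z C \<Longrightarrow> gauss_limit M Z' C' \<Longrightarrow>
      (\<And>K b. bform K b \<Longrightarrow> \<bar>C b - C' b\<bar> \<le> K * \<epsilon>) \<Longrightarrow>
      \<bar>(\<integral>\<omega>. \<phi> (m + Z \<omega>) \<partial>M) - (\<integral>\<omega>. \<phi> (m' + Z' \<omega>) \<partial>M)\<bar> \<le> L * (norm (m - m') + \<epsilon>)"
    and \<theta>: "1/2 < \<theta>" "\<theta> \<le> 1" and T: "1 \<le> T" and N: "1 \<le> N" and dt: "T / real N \<le> 1"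
    and C\<theta>: "0 < C\<theta>" "\<And>z. 0 < z \<Longrightarrow> \<bar>exp (- (real N * z)) - theta_ratio \<theta> z ^ N\<bar> \<le> C\<theta> / real N"
    and st: "has_stoch_integral M e B T \<Phi> Z" and \<Phi>: "\<forall>s\<in>{0..T}. \<forall>v. \<Phi> s v = expA (T - s) (R v)"
    and sch: "theta_scheme M e lam B R (span (f ` {..<d})) \<theta> T x N Y"
  defines "CE \<equiv> 16 * \<kappa> + 2 + C\<theta>"
  shows "\<bar>(\<integral>\<omega>. \<phi> (Y N \<omega>) \<partial>M) - (\<integral>\<omega>. \<phi> (expA T x + Z \<omega>) \<partial>M)\<bar>
    \<le> L * (CE * norm x + (8 * (Cz \<kappa> * trA) + 2 * (cq * trA) + 2 * (CE * trK))) * (\<eta> + (T / real N) powr \<gamma>)"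
proof -
  define \<delta> where "\<delta> = T / real N"
  define C0 where "C0 = 8 * (Cz \<kappa> * trA) + 2 * (cq * trA) + 2 * (CE * trK)"
  define g where "g = \<eta> + \<delta> powr \<gamma>"
  define \<rho> where "\<rho> = (\<lambda>m. theta_ratio \<theta> (mu m * \<delta>) ^ N)"
  define G where "G = kernel_form {..<d} (\<lambda>j k. (R (f j) \<bullet> R (f k)) * (\<Sum>n<N. \<delta> *
     (theta_ratio \<theta> (mu j * \<delta>) ^ n / (1 + \<theta> * (mu j * \<delta>)) * (theta_ratio \<theta> (mu k * \<delta>) ^ n / (1 + \<theta> * (mu k * \<delta>)))))) f"
  have \<delta>0: "0 < \<delta>" using T N by (simp add: \<delta>_def)
  have T0: "0 \<le> T" using T by simp
  have CE0: "0 \<le> CE" using C\<theta>(1) \<kappa> by (simp add: CE_def)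
  have "\<exists>Z'. gauss_limit M Z' G \<and> (\<forall>\<omega>\<in>space M. Y N \<omega> = fdiag \<rho> x + Z' \<omega>)"
    unfolding G_def \<rho>_def \<delta>_def by (rule scheme_decomposition[OF M BM T N \<theta> sch])
  then obtain Z' where gl': "gauss_limit M Z' G" and Y: "\<forall>\<omega>\<in>space M. Y N \<omega> = fdiag \<rho> x + Z' \<omega>"
    by (elim exE conjE) (rule that)
  have E: "norm (expA T v - fdiag \<rho> v) \<le> CE * (\<eta> + \<delta> powr \<gamma>) * norm v" for v
    unfolding CE_def \<rho>_def \<delta>_def by (rule propagator_error[OF \<theta> T N dt C\<theta>])
  have \<rho>1: "\<bar>\<rho> m\<bar> \<le> 1" if m: "m < d" for m
  proof -
    have "0 \<le> mu m * \<delta>" using mu_pos[OF m] \<delta>0 by simp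
    then show ?thesis unfolding \<rho>_def power_abs by (intro power_le_one abs_ge_zero theta_ratio_le_1[OF \<theta>])
  qed
  \<comment> \<open>\<open>(2 * \<theta> - 1) * \<delta>\<close> is the parameter of
    \<open>TD\<close>; it is positive because \<open>\<theta> > 1/2\<close> and at most the time
    step because \<open>\<theta> \<le> 1\<close>.\<close>
  have \<delta>\<theta>: "0 < (2 * \<theta> - 1) * \<delta>" "(2 * \<theta> - 1) * \<delta> \<le> \<delta>" using \<theta> \<delta>0 by (auto intro: mult_left_le_one_le)
  let ?P = "\<lambda>n \<omega>. \<Sum>i<n. (Z \<omega> \<bullet> e i) *\<^sub>R e i"
  have bound: "\<bar>(\<integral>\<omega>. \<phi> (expA T x + ?P n \<omega>) \<partial>M) - (\<integral>\<omega>. \<phi> (fdiag \<rho> x + Z' \<omega>) \<partial>M)\<bar>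
      \<le> L * (CE * g * norm x + (C0 * g + 2 * trunc_err n))" for n
  proof -
    have "\<bar>(\<integral>\<omega>. \<phi> (expA T x + ?P n \<omega>) \<partial>M) - (\<integral>\<omega>. \<phi> (fdiag \<rho> x + Z' \<omega>) \<partial>M)\<bar>
      \<le> L * (norm (expA T x - fdiag \<rho> x) + (C0 * g + 2 * trunc_err n))"
    proof (rule cmp[OF exact_gauss_limit(2)[OF M BM T0 st \<Phi>, of n] gl'])
      fix K and b :: "'h \<Rightarrow> 'h \<Rightarrow> real" assume b: "bform K b"
      show "\<bar>kernel_form {..<n} (\<lambda>j k. (R (e j) \<bullet> R (e k)) * ((1 - exp (- ((lam j + lam k) * T))) / (lam j + lam k))) e b - G b\<bar>
        \<le> K * (C0 * g + 2 * trunc_err n)"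
        using covariance_error[OF b \<delta>\<theta> T0 \<rho>1 E CE0, of n]
        unfolding TN_horizon[OF bformD(1)[OF b] T0] \<rho>_def TD_horizon[OF bformD(1)[OF b] \<theta> \<delta>0]
        unfolding G_def C0_def g_def by simp
    qed
    also have "\<dots> \<le> L * (CE * g * norm x + (C0 * g + 2 * trunc_err n))"
      using E[of x] L unfolding g_def by (intro mult_left_mono add_right_mono) auto
    finally show ?thesis .
  qed
  have Zi: "integrable M Z" by (rule exact_gauss_limit(1)[OF M BM T0 st \<Phi>])
  have "\<bar>(\<integral>\<omega>. \<phi> (expA T x + Z \<omega>) \<partial>M) - (\<integral>\<omega>. \<phi> (fdiag \<rho> x + Z' \<omega>) \<partial>M)\<bar> \<le> L * (CE * g * norm x + (C0 * g + 2 * 0))"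
  proof (rule LIMSEQ_le)
    show "(\<lambda>n. \<bar>(\<integral>\<omega>. \<phi> (expA T x + ?P n \<omega>) \<partial>M) - (\<integral>\<omega>. \<phi> (fdiag \<rho> x + Z' \<omega>) \<partial>M)\<bar>) \<longlonglongrightarrow>
        \<bar>(\<integral>\<omega>. \<phi> (expA T x + Z \<omega>) \<partial>M) - (\<integral>\<omega>. \<phi> (fdiag \<rho> x + Z' \<omega>) \<partial>M)\<bar>"
      by (rule tendsto_rabs[OF tendsto_diff[OF expectation_truncation[OF M lip Zi] tendsto_const]])
    show "(\<lambda>n. L * (CE * g * norm x + (C0 * g + 2 * trunc_err n))) \<longlonglongrightarrow> L * (CE * g * norm x + (C0 * g + 2 * 0))"
      by (intro tendsto_intros trunc_err_lim)
  qed (use bound in blast)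
  moreover have "(\<integral>\<omega>. \<phi> (Y N \<omega>) \<partial>M) = (\<integral>\<omega>. \<phi> (fdiag \<rho> x + Z' \<omega>) \<partial>M)"
    by (rule Bochner_Integration.integral_cong[OF refl]) (simp add: Y)
  ultimately have "\<bar>(\<integral>\<omega>. \<phi> (Y N \<omega>) \<partial>M) - (\<integral>\<omega>. \<phi> (expA T x + Z \<omega>) \<partial>M)\<bar> \<le> L * (CE * g * norm x + C0 * g)"
    by (simp add: abs_minus_commute)
  also have "\<dots> = L * (CE * norm x + C0) * g" by (simp add: algebra_simps)
  finally show ?thesis unfolding g_def C0_def \<delta>_def .
qed

end

text \<open>For \<open>h \<le> 1\<close> powers decrease with the exponent. For \<open>h > 1\<close>
  the cap leaves only 1 to be bounded: by \<open>h powr (2 * \<gamma>)\<close> if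
  \<open>\<gamma> \<ge> 0\<close>, and by \<open>\<delta> powr \<gamma>\<close> if
  \<open>\<gamma>\<close> is negative.\<close>

lemma rate_at_endpoint:
  fixes h \<delta> \<gamma> \<gamma>' :: real
  assumes "0 < h" "0 < \<delta>" "\<delta> \<le> 1" "0 < \<gamma>'" "\<gamma> < \<gamma>'"
  shows "min 1 (h powr (2 * \<gamma>')) + \<delta> powr \<gamma>' \<le> 2 * (h powr (2 * \<gamma>) + \<delta> powr \<gamma>)"
proof -
  have \<delta>: "\<delta> powr \<gamma>' \<le> \<delta> powr \<gamma>" using assms by (intro powr_mono') auto
  have "min 1 (h powr (2 * \<gamma>')) \<le> h powr (2 * \<gamma>) + \<delta> powr \<gamma>"
  proof (cases "h \<le> 1")
    case True
    then have "h powr (2 * \<gamma>') \<le> h powr (2 * \<gamma>)" using assms by (intro powr_mono') auto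
    then show ?thesis using powr_ge_zero[of \<delta> \<gamma>] by linarith
  next
    case False
    show ?thesis
    proof (cases "0 \<le> \<gamma>")
      case True
      then have "1 \<le> h powr (2 * \<gamma>)" using False by (intro ge_one_powr_ge_zero) auto
      then show ?thesis using powr_ge_zero[of \<delta> \<gamma>] by linarith
    next
      case False
      then have "\<delta> powr 0 \<le> \<delta> powr \<gamma>" using assms by (intro powr_mono') auto
      then have "1 \<le> \<delta> powr \<gamma>" using assms by simp
      then show ?thesis using powr_ge_zero[of h "2 * \<gamma>"] by linarith
    qed
  qed
  from add_mono[OF this \<delta>] show ?thesis by (rule order_trans) simp
qed

theorem theorem3p1:
  fixes D :: "'h::{real_inner, banach, second_countable_topology} set"
    and A Q R :: "'h \<Rightarrow> 'h"
    and e :: "nat \<Rightarrow> 'h" and lam :: "nat \<Rightarrow> real"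
    and S :: "real \<Rightarrow> 'h \<Rightarrow> 'h"
    and M :: "'w measure" and F :: "real \<Rightarrow> 'w measure"
    and b :: "nat \<Rightarrow> real \<Rightarrow> 'w \<Rightarrow> real"
    and V :: "real \<Rightarrow> 'h set" and r \<kappa>\<^sub>0 :: real
    and \<phi> :: "'h \<Rightarrow> real" and \<alpha> \<beta> T \<theta> :: real and x :: 'h
    and X :: "real \<Rightarrow> 'w \<Rightarrow> 'h"
    and Xh :: "real \<Rightarrow> nat \<Rightarrow> nat \<Rightarrow> 'w \<Rightarrow> 'h"
  assumes A: "self_adjoint_op D A" "nonneg_op D A" "compactly_embedded D A"
    and basis: "orthonormal_basis e"
    and eigen: "\<And>n. e n \<in> D \<and> A (e n) = lam n *\<^sub>R e n"
    and lam: "0 < lam 0" "mono lam" "filterlim lam at_top sequentially"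
    and semigroup: "generates D (\<lambda>v. - A v) S"
    and Q: "nonneg_sym_bounded Q" "is_sqrt_op R Q"
    and M: "prob_space M" "normal_filtration M T F"
    and W: "cylindrical_wiener M T F b"
    and V: "\<And>h. 0 < h \<Longrightarrow> finite_dim_subspace (V h) \<and> V h \<subseteq> pow_dom e lam (1/2)"
    and r: "2 \<le> r" and \<kappa>\<^sub>0: "0 < \<kappa>\<^sub>0"
    and approx1: "\<And>h s v. \<lbrakk>0 < h; 1 \<le> s; s \<le> r; v \<in> pow_dom e lam (s/2)\<rbrakk> \<Longrightarrow>
        norm (orth_proj (energy_inner e lam) (V h) v - v)
          \<le> \<kappa>\<^sub>0 * h powr s * norm (pow_op e lam (s/2) v)"
    and approx2: "\<And>h s w. \<lbrakk>0 < h; 1 \<le> s; s \<le> r - 1; w \<in> pow_dom e lam (s/2)\<rbrakk> \<Longrightarrow>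
        norm (pow_op e lam (1/2) (orth_proj (energy_inner e lam) (V h) w - w))
          \<le> \<kappa>\<^sub>0 * h powr (s - 1) * norm (pow_op e lam (s/2) w)"
    and \<phi>: "C2b \<phi>"
    and \<alpha>\<beta>: "0 < \<alpha>" "0 \<le> \<beta>" "\<beta> \<le> \<alpha>" "0 < 1 - \<alpha> + \<beta>"
    and trace: "summable (\<lambda>n. lam n powr (- \<alpha>))"
    and AQ: "range Q \<subseteq> pow_dom e lam \<beta>" "bounded_linear (\<lambda>v. pow_op e lam \<beta> (Q v))"
    and T: "1 \<le> T"
    and X: "\<And>t. t \<in> {0..T} \<Longrightarrow>
        has_stoch_integral M e b t (\<lambda>s v. S (t - s) (R v)) (\<lambda>\<omega>. X t \<omega> - S t x)"
    and \<theta>: "1/2 < \<theta>" "\<theta> \<le> 1"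
    and Xh: "\<And>h N. \<lbrakk>0 < h; 1 \<le> N\<rbrakk> \<Longrightarrow>
        theta_scheme M e lam b R (V h) \<theta> T x N (Xh h N)"
  shows "\<exists>C>0. \<forall>h>0. \<forall>N\<ge>1. T / real N \<le> 1 \<longrightarrow>
    (\<forall>\<gamma><1 - \<alpha> + \<beta>.
       \<bar>(\<integral>\<omega>. \<phi> (Xh h N N \<omega>) \<partial>M) - (\<integral>\<omega>. \<phi> (X T \<omega>) \<partial>M)\<bar>
         \<le> C * (h powr (2 * \<gamma>) + (T / real N) powr \<gamma>))"
proof -
  interpret spectral_basis e lam using basis lam by unfold_locales auto
  have R: "bounded_linear R" "\<And>u v. R u \<bullet> v = u \<bullet> R v" "\<And>v. R (R v) = Q v"
    using Q(2) by (auto simp: is_sqrt_op_def nonneg_sym_bounded_def)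
  obtain cq where cq: "0 \<le> cq" "\<And>n. norm (R (R (e n))) \<le> cq * lam n powr - \<beta>"
    using covariance_decay[OF R AQ] by blast
  interpret noise e lam R cq \<alpha> \<beta>
    by (rule noise.intro[OF spectral_basis_axioms], rule noise_axioms.intro)
      (use R(1,2) cq trace \<alpha>\<beta> lam(3) in auto)
  obtain L where L: "0 < L" and lip: "\<forall>x y. \<bar>\<phi> x - \<phi> y\<bar> \<le> L * norm (x - y)"
    and cmp: "\<forall>m m' Z Z' C C' \<epsilon>. gauss_limit M Z C \<longrightarrow> gauss_limit M Z' C' \<longrightarrow>
      (\<forall>K b. bform K b \<longrightarrow> \<bar>C b - C' b\<bar> \<le> K * \<epsilon>) \<longrightarrow>
      \<bar>(\<integral>\<omega>. \<phi> (m + Z \<omega>) \<partial>M) - (\<integral>\<omega>. \<phi> (m' + Z' \<omega>) \<partial>M)\<bar> \<le> L * (norm (m - m') + \<epsilon>)"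
    using gauss_limit_comparison[OF M(1) \<phi>] by (elim exE conjE) (rule that)
  obtain C\<theta> where C\<theta>: "0 < C\<theta>" "\<forall>N\<ge>1. \<forall>z>0. \<bar>exp (- (real N * z)) - theta_ratio \<theta> z ^ N\<bar> \<le> C\<theta> / real N"
    using theta_ratio_power_error[OF \<theta>] by (elim exE conjE) (rule that)
  define CE where "CE = 16 * \<kappa>\<^sub>0 + 2 + C\<theta>"
  \<comment> \<open>Built from \<open>x\<close>, \<open>\<theta>\<close>, the Lipschitz and
    comparison constant of \<open>\<phi>\<close> and spectral data; neither \<open>h\<close> nor
    \<open>N\<close> nor the exponent occurs in it.\<close>
  define C1 where "C1 = L * (CE * norm x + (8 * (Cz \<kappa>\<^sub>0 * trA) + 2 * (cq * trA) + 2 * (CE * trK)))"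
  have CE0: "0 \<le> CE" using \<kappa>\<^sub>0 C\<theta>(1) by (simp add: CE_def)
  have C10: "0 \<le> C1" unfolding C1_def
    using L CE0 cq(1) Cz_nonneg[OF less_imp_le[OF \<kappa>\<^sub>0]] trA_nonneg trK_nonneg by simp
  have SexpA: "S t v = expA t v" if "0 \<le> t" for t v
    by (rule semigroup_eq_expA[OF semigroup A(1) eigen lam(3) that])
  have T0: "T \<in> {0..T}" using T by simp
  have main: "\<bar>(\<integral>\<omega>. \<phi> (Xh h N N \<omega>) \<partial>M) - (\<integral>\<omega>. \<phi> (X T \<omega>) \<partial>M)\<bar>
      \<le> C1 * (min 1 (h powr (2 * (1 - \<alpha> + \<beta>))) + (T / real N) powr (1 - \<alpha> + \<beta>))"
    if h: "0 < h" and N: "1 \<le> N" and dt: "T / real N \<le> 1" for h N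
  proof -
    have "\<exists>d f mu. galerkin e lam d f mu \<kappa>\<^sub>0 h \<and> V h = span (f ` {..<d})"
    proof (rule galerkin_exists[OF _ _ \<kappa>\<^sub>0 h])
      show "finite_dim_subspace (V h)" "V h \<subseteq> pow_dom e lam (1/2)" using V[OF h] by auto
      show "norm (orth_proj (energy_inner e lam) (V h) v - v) \<le> \<kappa>\<^sub>0 * h powr 1 * norm (pow_op e lam (1/2) v)"
        if "v \<in> pow_dom e lam (1/2)" for v using approx1[OF h, of 1 v] that r by simp
      show "norm (orth_proj (energy_inner e lam) (V h) v - v) \<le> \<kappa>\<^sub>0 * h powr 2 * norm (pow_op e lam 1 v)"
        if "v \<in> pow_dom e lam 1" for v using approx1[OF h, of 2 v] that r by simp
    qed
    then obtain d f mu where gal: "galerkin e lam d f mu \<kappa>\<^sub>0 h" and Vh: "V h = span (f ` {..<d})" by blast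
    interpret G: galerkin_noise e lam d f mu \<kappa>\<^sub>0 h R cq \<alpha> \<beta>
      by (intro galerkin_noise.intro gal noise_axioms)
    have st: "has_stoch_integral M e b T (\<lambda>s v. S (T - s) (R v)) (\<lambda>\<omega>. X T \<omega> - S T x)" by (rule X[OF T0])
    have \<Phi>: "\<forall>s\<in>{0..T}. \<forall>v. S (T - s) (R v) = expA (T - s) (R v)" using SexpA by simp
    have sch: "theta_scheme M e lam b R (span (f ` {..<d})) \<theta> T x N (Xh h N)"
      using Xh[OF h N] unfolding Vh .
    have XT: "expA T x + (X T \<omega> - S T x) = X T \<omega>" for \<omega> using SexpA[of T x] T by simp
    show ?thesis
      using G.weak_error[OF M(1) W L lip[rule_format] cmp[rule_format] \<theta> T N dt C\<theta>(1) C\<theta>(2)[rule_format, OF N] st \<Phi> sch]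
      unfolding XT C1_def CE_def G.\<eta>_def .
  qed
  show ?thesis
  \<comment> \<open>The factor 2 is that of \<open>rate_at_endpoint\<close>; the additional 1 makes
    the constant strictly positive.\<close>
  proof (intro exI[of _ "2 * C1 + 1"] conjI allI impI)
    show "0 < 2 * C1 + 1" using C10 by simp
    fix h N \<gamma>' assume h: "(0::real) < h" and N: "1 \<le> N" and dt: "T / real N \<le> 1" and \<gamma>': "\<gamma>' < 1 - \<alpha> + \<beta>"
    have dt0: "0 < T / real N" using T N by simp
    let ?r = "h powr (2 * \<gamma>') + (T / real N) powr \<gamma>'"
    have "\<bar>(\<integral>\<omega>. \<phi> (Xh h N N \<omega>) \<partial>M) - (\<integral>\<omega>. \<phi> (X T \<omega>) \<partial>M)\<bar> \<le> C1 * (2 * ?r)"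
      by (rule order_trans[OF main[OF h N dt] mult_left_mono[OF rate_at_endpoint[OF h dt0 dt \<alpha>\<beta>(4) \<gamma>'] C10]])
    also have "\<dots> \<le> (2 * C1 + 1) * ?r" by (simp add: algebra_simps)
    finally show "\<bar>(\<integral>\<omega>. \<phi> (Xh h N N \<omega>) \<partial>M) - (\<integral>\<omega>. \<phi> (X T \<omega>) \<partial>M)\<bar> \<le> (2 * C1 + 1) * ?r" .
  qed
qed

end
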